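(* Let $\Lambda=T_A(M)$ be a finite dimensional hereditary tensor algebra over a field $k$, where $A$ is a finite dimensional semisimple $k$-algebra and $M$ a finite dimensional $A$-bimodule. Then there is an algebra isomorphism $T_\Lambda(\mho)\cong T_A(M\oplus DM)$ under which $\bar c\in\mho$ is sent to $$c=\rho-\ell\in(M\otimes_ADM)\oplus(DM\otimes_AM).$$ Thus the preprojective algebra $\Pi$ of $\Lambda$ is isomorphic to $T_A(M\oplus DM)/\langle c\rangle$.
   Context: $D=\operatorname{Hom}_k(-,k)$, and $k$ acts centrally on all bimodules. Fix a symmetrising element $\sigma\in DA$, i.e. a linear form with $\sigma(ab)=\sigma(ba)$ and such that $\sigma(a\,\cdot)=0$ implies $a=0$. For a finite dimensional right (resp. left) $A$-module $X$ and $\xi\in DX$, let $\overrightarrow{\xi}\colon X\to A$ be the unique right $A$-linear map (resp. $\overleftarrow{\xi}\colon X\to A$ the unique left $A$-linear map) with $\sigma\circ\overrightarrow{\xi}=\xi$ (resp. $\sigma\circ\overleftarrow{\xi}=\xi$). $\Omega$ is the kernel of the multiplication $\Lambda\otimes_A\Lambda\to\Lambda$, generated as a bimodule by the elements $d\lambda:=1\otimes\lambda-\lambda\otimes1$. Set $\mho:=D(D\Lambda\otimes_\Lambda\Omega\otimes_\Lambda D\Lambda)$ and let $\bar c\in\mho$ be the functional $$\bar c\colon\ \theta\otimes d\lambda\otimes\phi\mapsto\theta(\overleftarrow{\phi}(\lambda))-\phi(\overrightarrow{\theta}(\lambda)).$$ There is a bimodule homomorphism $\Lambda\otimes_A\Lambda\to\mho$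 with $1\otimes1\mapsto\bar c$; $\Pi_1$ is its cokernel, and the preprojective algebra of $\Lambda$ is the tensor algebra $\Pi:=T_\Lambda(\Pi_1)$, which equals $T_\Lambda(\mho)/\langle\bar c\rangle$. The element $\rho=\sum m_i\otimes\mu_i\in M\otimes_ADM$ corresponds to the identity of $M_A$, i.e. $m=\sum m_i\overrightarrow{\mu_i}(m)$ for all $m\in M$; the element $\ell=\sum\nu_j\otimes n_j\in DM\otimes_AM$ corresponds to the identity of ${}_AM$, i.e. $m=\sum\overleftarrow{\nu_j}(m)n_j$ for all $m\in M$. *)

theory Defs
  imports "HOL-Algebra.Module" "HOL-Algebra.QuotRing"
begin

section \<open>Algebras and bimodules\<close>

text \<open>Not necessarily commutative unital algebras; the library locale \<^locale>\<open>algebra\<close> is for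
  commutative ones.\<close>

locale k_algebra = module k R + ring R for k (structure) and R (structure) +
  assumes smult_mult_left:
      "\<lbrakk>c \<in> carrier k; x \<in> carrier R; y \<in> carrier R\<rbrakk> \<Longrightarrow>
        (c \<odot>\<^bsub>R\<^esub> x) \<otimes>\<^bsub>R\<^esub> y = c \<odot>\<^bsub>R\<^esub> (x \<otimes>\<^bsub>R\<^esub> y)"
    and smult_mult_right:
      "\<lbrakk>c \<in> carrier k; x \<in> carrier R; y \<in> carrier R\<rbrakk> \<Longrightarrow>
        x \<otimes>\<^bsub>R\<^esub> (c \<odot>\<^bsub>R\<^esub> y) = c \<odot>\<^bsub>R\<^esub> (x \<otimes>\<^bsub>R\<^esub> y)"

text \<open>As for \<^type>\<open>module\<close>, the multiplicative fields of the record are irrelevant.\<close>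

record ('k, 'r, 's, 'x) bimodule = "('k, 'x) module" +
  lact :: "'r \<Rightarrow> 'x \<Rightarrow> 'x"
  ract :: "'x \<Rightarrow> 's \<Rightarrow> 'x"

text \<open>\<open>R\<close>-\<open>S\<close>-bimodules on which \<open>k\<close> acts centrally.\<close>

locale bimodule =
  left: k_algebra k R + right: k_algebra k S + module k X
  for k (structure) and R (structure) and S (structure) and X (structure) +
  assumes lact_closed: "\<lbrakk>r \<in> carrier R; x \<in> carrier X\<rbrakk> \<Longrightarrow> lact X r x \<in> carrier X"
    and ract_closed: "\<lbrakk>x \<in> carrier X; s \<in> carrier S\<rbrakk> \<Longrightarrow> ract X x s \<in> carrier X"
    and lact_add_left: "\<lbrakk>r \<in> carrier R; r' \<in> carrier R; x \<in> carrier X\<rbrakk> \<Longrightarrow>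
          lact X (r \<oplus>\<^bsub>R\<^esub> r') x = lact X r x \<oplus>\<^bsub>X\<^esub> lact X r' x"
    and lact_add_right: "\<lbrakk>r \<in> carrier R; x \<in> carrier X; y \<in> carrier X\<rbrakk> \<Longrightarrow>
          lact X r (x \<oplus>\<^bsub>X\<^esub> y) = lact X r x \<oplus>\<^bsub>X\<^esub> lact X r y"
    and ract_add_left: "\<lbrakk>x \<in> carrier X; y \<in> carrier X; s \<in> carrier S\<rbrakk> \<Longrightarrow>
          ract X (x \<oplus>\<^bsub>X\<^esub> y) s = ract X x s \<oplus>\<^bsub>X\<^esub> ract X y s"
    and ract_add_right: "\<lbrakk>x \<in> carrier X; s \<in> carrier S; s' \<in> carrier S\<rbrakk> \<Longrightarrow>
          ract X x (s \<oplus>\<^bsub>S\<^esub> s') = ract X x s \<oplus>\<^bsub>X\<^esub> ract X x s'"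
    and lact_mult: "\<lbrakk>r \<in> carrier R; r' \<in> carrier R; x \<in> carrier X\<rbrakk> \<Longrightarrow>
          lact X (r \<otimes>\<^bsub>R\<^esub> r') x = lact X r (lact X r' x)"
    and ract_mult: "\<lbrakk>x \<in> carrier X; s \<in> carrier S; s' \<in> carrier S\<rbrakk> \<Longrightarrow>
          ract X x (s \<otimes>\<^bsub>S\<^esub> s') = ract X (ract X x s) s'"
    and lact_one: "x \<in> carrier X \<Longrightarrow> lact X \<one>\<^bsub>R\<^esub> x = x"
    and ract_one: "x \<in> carrier X \<Longrightarrow> ract X x \<one>\<^bsub>S\<^esub> = x"
    and lact_ract: "\<lbrakk>r \<in> carrier R; x \<in> carrier X; s \<in> carrier S\<rbrakk> \<Longrightarrow>
          ract X (lact X r x) s = lact X r (ract X x s)"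
    and lact_scalar: "\<lbrakk>c \<in> carrier k; x \<in> carrier X\<rbrakk> \<Longrightarrow> lact X (c \<odot>\<^bsub>R\<^esub> \<one>\<^bsub>R\<^esub>) x = c \<odot>\<^bsub>X\<^esub> x"
    and ract_scalar: "\<lbrakk>c \<in> carrier k; x \<in> carrier X\<rbrakk> \<Longrightarrow> ract X x (c \<odot>\<^bsub>S\<^esub> \<one>\<^bsub>S\<^esub>) = c \<odot>\<^bsub>X\<^esub> x"

text \<open>The algebra \<open>R\<close> as a bimodule, with left and right actions restricted along the algebra
  homomorphisms \<open>f\<close> and \<open>g\<close> into \<open>R\<close>.\<close>

definition alg_bimodule ::
  "('k, 'r, 'u) module_scheme \<Rightarrow> ('p \<Rightarrow> 'r) \<Rightarrow> ('q \<Rightarrow> 'r) \<Rightarrow> ('k, 'p, 'q, 'r) bimodule"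
  where "alg_bimodule R f g =
    \<lparr>carrier = carrier R, mult = mult R, one = one R, zero = zero R, add = add R,
     smult = smult R, lact = (\<lambda>p x. f p \<otimes>\<^bsub>R\<^esub> x), ract = (\<lambda>x q. x \<otimes>\<^bsub>R\<^esub> g q)\<rparr>"

definition bimodule_dsum ::
  "('k, 'r, 's, 'x, 'u) bimodule_scheme \<Rightarrow> ('k, 'r, 's, 'y, 'v) bimodule_scheme \<Rightarrow>
   ('k, 'r, 's, 'x \<times> 'y) bimodule"
  where "bimodule_dsum X Y =
    \<lparr>carrier = carrier X \<times> carrier Y, mult = undefined, one = undefined,
     zero = (\<zero>\<^bsub>X\<^esub>, \<zero>\<^bsub>Y\<^esub>),
     add = (\<lambda>(x, y) (x', y'). (x \<oplus>\<^bsub>X\<^esub> x', y \<oplus>\<^bsub>Y\<^esub> y')),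
     smult = (\<lambda>c (x, y). (c \<odot>\<^bsub>X\<^esub> x, c \<odot>\<^bsub>Y\<^esub> y)),
     lact = (\<lambda>r (x, y). (lact X r x, lact Y r y)),
     ract = (\<lambda>(x, y) s. (ract X x s, ract Y y s))\<rparr>"

definition gen_submodule ::
  "('k, 'w) ring_scheme \<Rightarrow> ('k, 'x, 'u) module_scheme \<Rightarrow> 'x set \<Rightarrow> 'x set"
  where "gen_submodule k V G = \<Inter>{N. submodule N k V \<and> G \<subseteq> N}"

definition fin_dim :: "('k, 'w) ring_scheme \<Rightarrow> ('k, 'x, 'u) module_scheme \<Rightarrow> bool"
  where "fin_dim k V \<longleftrightarrow>
    (\<exists>B. finite B \<and> B \<subseteq> carrier V \<and> gen_submodule k V B = carrier V)"

text \<open>Isomorphisms of \<open>k\<close>-algebras.\<close>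

definition alg_iso ::
  "('k, 'w) ring_scheme \<Rightarrow> ('k, 'r, 'u) module_scheme \<Rightarrow> ('k, 's, 'v) module_scheme \<Rightarrow> ('r \<Rightarrow> 's) set"
  where "alg_iso k R S =
    {h \<in> ring_iso R S. \<forall>c \<in> carrier k. \<forall>x \<in> carrier R. h (c \<odot>\<^bsub>R\<^esub> x) = c \<odot>\<^bsub>S\<^esub> h x}"


section \<open>Semisimple and hereditary rings\<close>

definition left_ideal :: "'r set \<Rightarrow> ('r, 'u) ring_scheme \<Rightarrow> bool"
  where "left_ideal I R \<longleftrightarrow>
    additive_subgroup I R \<and> (\<forall>a \<in> carrier R. \<forall>x \<in> I. a \<otimes>\<^bsub>R\<^esub> x \<in> I)"

definition right_ideal :: "'r set \<Rightarrow> ('r, 'u) ring_scheme \<Rightarrow> bool"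
  where "right_ideal I R \<longleftrightarrow>
    additive_subgroup I R \<and> (\<forall>a \<in> carrier R. \<forall>x \<in> I. x \<otimes>\<^bsub>R\<^esub> a \<in> I)"

text \<open>Every submodule of the regular module is a direct summand. The condition is left-right
  symmetric; both sides are required here.\<close>

definition semisimple_ring :: "('r, 'u) ring_scheme \<Rightarrow> bool"
  where "semisimple_ring R \<longleftrightarrow>
    (\<forall>I. left_ideal I R \<longrightarrow>
      (\<exists>J. left_ideal J R \<and> I \<inter> J = {\<zero>\<^bsub>R\<^esub>} \<and> I <+>\<^bsub>R\<^esub> J = carrier R)) \<and>
    (\<forall>I. right_ideal I R \<longrightarrow>
      (\<exists>J. right_ideal J R \<and> I \<inter> J = {\<zero>\<^bsub>R\<^esub>} \<and> I <+>\<^bsub>R\<^esub> J = carrier R))"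

text \<open>A one-sided ideal \<open>I\<close> is projective iff the canonical epimorphism onto it from the free
  module with basis \<open>I\<close> splits; \<open>s y x\<close> is the \<open>x\<close>-coordinate of the image of \<open>y\<close> under the
  splitting. Only the values of \<open>s\<close> on \<open>I\<close> matter.\<close>

definition projective_left_ideal :: "'r set \<Rightarrow> ('r, 'u) ring_scheme \<Rightarrow> bool"
  where "projective_left_ideal I R \<longleftrightarrow>
    (\<exists>s. (\<forall>y \<in> I. s y \<in> I \<rightarrow> carrier R \<and> finite {x \<in> I. s y x \<noteq> \<zero>\<^bsub>R\<^esub>}) \<and>
         (\<forall>y \<in> I. \<forall>y' \<in> I. \<forall>x \<in> I. s (y \<oplus>\<^bsub>R\<^esub> y') x = s y x \<oplus>\<^bsub>R\<^esub> s y' x) \<and>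
         (\<forall>y \<in> I. \<forall>a \<in> carrier R. \<forall>x \<in> I. s (a \<otimes>\<^bsub>R\<^esub> y) x = a \<otimes>\<^bsub>R\<^esub> s y x) \<and>
         (\<forall>y \<in> I. (\<Oplus>\<^bsub>R\<^esub>x \<in> {x \<in> I. s y x \<noteq> \<zero>\<^bsub>R\<^esub>}. s y x \<otimes>\<^bsub>R\<^esub> x) = y))"

definition projective_right_ideal :: "'r set \<Rightarrow> ('r, 'u) ring_scheme \<Rightarrow> bool"
  where "projective_right_ideal I R \<longleftrightarrow>
    (\<exists>s. (\<forall>y \<in> I. s y \<in> I \<rightarrow> carrier R \<and> finite {x \<in> I. s y x \<noteq> \<zero>\<^bsub>R\<^esub>}) \<and>
         (\<forall>y \<in> I. \<forall>y' \<in> I. \<forall>x \<in> I. s (y \<oplus>\<^bsub>R\<^esub> y') x = s y x \<oplus>\<^bsub>R\<^esub> s y' x) \<and>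
         (\<forall>y \<in> I. \<forall>a \<in> carrier R. \<forall>x \<in> I. s (y \<otimes>\<^bsub>R\<^esub> a) x = s y x \<otimes>\<^bsub>R\<^esub> a) \<and>
         (\<forall>y \<in> I. (\<Oplus>\<^bsub>R\<^esub>x \<in> {x \<in> I. s y x \<noteq> \<zero>\<^bsub>R\<^esub>}. x \<otimes>\<^bsub>R\<^esub> s y x) = y))"

definition hereditary_ring :: "('r, 'u) ring_scheme \<Rightarrow> bool"
  where "hereditary_ring R \<longleftrightarrow>
    (\<forall>I. left_ideal I R \<longrightarrow> projective_left_ideal I R) \<and>
    (\<forall>I. right_ideal I R \<longrightarrow> projective_right_ideal I R)"


section \<open>Duality\<close>

text \<open>Linear forms are extensional functions on the carrier.\<close>

definition functionals :: "('k, 'w) ring_scheme \<Rightarrow> ('k, 'x, 'u) module_scheme \<Rightarrow> ('x \<Rightarrow> 'k) set"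
  where "functionals k X =
    {f \<in> carrier X \<rightarrow>\<^sub>E carrier k.
      (\<forall>x \<in> carrier X. \<forall>y \<in> carrier X. f (x \<oplus>\<^bsub>X\<^esub> y) = f x \<oplus>\<^bsub>k\<^esub> f y) \<and>
      (\<forall>c \<in> carrier k. \<forall>x \<in> carrier X. f (c \<odot>\<^bsub>X\<^esub> x) = c \<otimes>\<^bsub>k\<^esub> f x)}"

text \<open>\<open>DX\<close> for an \<open>R\<close>-\<open>S\<close>-bimodule \<open>X\<close> is an \<open>S\<close>-\<open>R\<close>-bimodule by \<open>(s f r)(x) = f (r x s)\<close>.\<close>

definition dual ::
  "('k, 'w) ring_scheme \<Rightarrow> ('k, 'r, 's, 'x, 'u) bimodule_scheme \<Rightarrow> ('k, 's, 'r, 'x \<Rightarrow> 'k) bimodule"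
  where "dual k X =
    \<lparr>carrier = functionals k X, mult = undefined, one = undefined,
     zero = (\<lambda>x \<in> carrier X. \<zero>\<^bsub>k\<^esub>),
     add = (\<lambda>f g. \<lambda>x \<in> carrier X. f x \<oplus>\<^bsub>k\<^esub> g x),
     smult = (\<lambda>c f. \<lambda>x \<in> carrier X. c \<otimes>\<^bsub>k\<^esub> f x),
     lact = (\<lambda>s f. \<lambda>x \<in> carrier X. f (ract X x s)),
     ract = (\<lambda>f r. \<lambda>x \<in> carrier X. f (lact X r x))\<rparr>"

definition symmetrising ::
  "('k, 'w) ring_scheme \<Rightarrow> ('k, 'a, 'u) module_scheme \<Rightarrow> ('a \<Rightarrow> 'k) \<Rightarrow> bool"
  where "symmetrising k A \<sigma> \<longleftrightarrow>
    \<sigma> \<in> functionals k A \<and>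
    (\<forall>a \<in> carrier A. \<forall>b \<in> carrier A. \<sigma> (a \<otimes>\<^bsub>A\<^esub> b) = \<sigma> (b \<otimes>\<^bsub>A\<^esub> a)) \<and>
    (\<forall>a \<in> carrier A. (\<forall>b \<in> carrier A. \<sigma> (a \<otimes>\<^bsub>A\<^esub> b) = \<zero>\<^bsub>k\<^esub>) \<longrightarrow> a = \<zero>\<^bsub>A\<^esub>)"

text \<open>\<open>rvec A \<sigma> X \<xi>\<close> is the right \<open>A\<close>-linear and \<open>lvec A \<sigma> X \<xi>\<close> the left \<open>A\<close>-linear map
  \<open>X \<rightarrow> A\<close> whose composition with \<open>\<sigma>\<close> is \<open>\<xi>\<close>.\<close>

definition rvec ::
  "('a, 'v) ring_scheme \<Rightarrow> ('a \<Rightarrow> 'k) \<Rightarrow> ('k, 'r, 'a, 'x, 'u) bimodule_scheme \<Rightarrow> ('x \<Rightarrow> 'k) \<Rightarrow> 'x \<Rightarrow> 'a"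
  where "rvec A \<sigma> X \<xi> =
    (THE f. f \<in> carrier X \<rightarrow>\<^sub>E carrier A \<and>
      (\<forall>x \<in> carrier X. \<forall>y \<in> carrier X. f (x \<oplus>\<^bsub>X\<^esub> y) = f x \<oplus>\<^bsub>A\<^esub> f y) \<and>
      (\<forall>x \<in> carrier X. \<forall>a \<in> carrier A. f (ract X x a) = f x \<otimes>\<^bsub>A\<^esub> a) \<and>
      (\<forall>x \<in> carrier X. \<sigma> (f x) = \<xi> x))"

definition lvec ::
  "('a, 'v) ring_scheme \<Rightarrow> ('a \<Rightarrow> 'k) \<Rightarrow> ('k, 'a, 's, 'x, 'u) bimodule_scheme \<Rightarrow> ('x \<Rightarrow> 'k) \<Rightarrow> 'x \<Rightarrow> 'a"
  where "lvec A \<sigma> X \<xi> =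
    (THE f. f \<in> carrier X \<rightarrow>\<^sub>E carrier A \<and>
      (\<forall>x \<in> carrier X. \<forall>y \<in> carrier X. f (x \<oplus>\<^bsub>X\<^esub> y) = f x \<oplus>\<^bsub>A\<^esub> f y) \<and>
      (\<forall>x \<in> carrier X. \<forall>a \<in> carrier A. f (lact X a x) = a \<otimes>\<^bsub>A\<^esub> f x) \<and>
      (\<forall>x \<in> carrier X. \<sigma> (f x) = \<xi> x))"


section \<open>Quotients and modules given by generators and relations\<close>

text \<open>Operations on cosets follow the library's \<^const>\<open>rcoset_mult\<close>.\<close>

definition quot_module ::
  "('k, 'x, 'u) module_scheme \<Rightarrow> 'x set \<Rightarrow> ('k, 'x set) module"
  where "quot_module V N =
    \<lparr>carrier = a_rcosets\<^bsub>V\<^esub> N, mult = undefined, one = undefined, zero = N, add = set_add V,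
     smult = (\<lambda>c U. \<Union>u \<in> U. N +>\<^bsub>V\<^esub> (c \<odot>\<^bsub>V\<^esub> u))\<rparr>"

definition quot_bimodule ::
  "('k, 'r, 's, 'x, 'u) bimodule_scheme \<Rightarrow> 'x set \<Rightarrow> ('k, 'r, 's, 'x set) bimodule"
  where "quot_bimodule X N =
    \<lparr>carrier = a_rcosets\<^bsub>X\<^esub> N, mult = undefined, one = undefined, zero = N, add = set_add X,
     smult = (\<lambda>c U. \<Union>u \<in> U. N +>\<^bsub>X\<^esub> (c \<odot>\<^bsub>X\<^esub> u)),
     lact = (\<lambda>r U. \<Union>u \<in> U. N +>\<^bsub>X\<^esub> (lact X r u)),
     ract = (\<lambda>U s. \<Union>u \<in> U. N +>\<^bsub>X\<^esub> (ract X u s))\<rparr>"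

text \<open>\<^term>\<open>R Quot I\<close> with its \<open>k\<close>-action.\<close>

definition quot_alg :: "('k, 'r, 'u) module_scheme \<Rightarrow> 'r set \<Rightarrow> ('k, 'r set) module"
  where "quot_alg R I =
    \<lparr>carrier = carrier (R Quot I), mult = mult (R Quot I), one = one (R Quot I),
     zero = zero (R Quot I), add = add (R Quot I),
     smult = (\<lambda>c U. \<Union>u \<in> U. I +>\<^bsub>R\<^esub> (c \<odot>\<^bsub>R\<^esub> u))\<rparr>"

definition free_module :: "('k, 'w) ring_scheme \<Rightarrow> 's set \<Rightarrow> ('k, 's \<Rightarrow> 'k) module"
  where "free_module k S =
    \<lparr>carrier = {f \<in> S \<rightarrow>\<^sub>E carrier k. finite {s \<in> S. f s \<noteq> \<zero>\<^bsub>k\<^esub>}},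
     mult = undefined, one = undefined,
     zero = (\<lambda>s \<in> S. \<zero>\<^bsub>k\<^esub>),
     add = (\<lambda>f g. \<lambda>s \<in> S. f s \<oplus>\<^bsub>k\<^esub> g s),
     smult = (\<lambda>c f. \<lambda>s \<in> S. c \<otimes>\<^bsub>k\<^esub> f s)\<rparr>"

definition delta :: "('k, 'w) ring_scheme \<Rightarrow> 's set \<Rightarrow> 's \<Rightarrow> ('s \<Rightarrow> 'k)"
  where "delta k S s = (\<lambda>t \<in> S. if t = s then \<one>\<^bsub>k\<^esub> else \<zero>\<^bsub>k\<^esub>)"

text \<open>The relations \<open>s + t - u\<close>, \<open>c s - t\<close> and \<open>s - t\<close> between generators.\<close>

definition rel_add :: "('k, 'w) ring_scheme \<Rightarrow> 's set \<Rightarrow> 's \<Rightarrow> 's \<Rightarrow> 's \<Rightarrow> ('s \<Rightarrow> 'k)"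
  where "rel_add k S s t u =
    (delta k S s \<oplus>\<^bsub>free_module k S\<^esub> delta k S t) \<ominus>\<^bsub>free_module k S\<^esub> delta k S u"

definition rel_smult :: "('k, 'w) ring_scheme \<Rightarrow> 's set \<Rightarrow> 'k \<Rightarrow> 's \<Rightarrow> 's \<Rightarrow> ('s \<Rightarrow> 'k)"
  where "rel_smult k S c s t =
    (c \<odot>\<^bsub>free_module k S\<^esub> delta k S s) \<ominus>\<^bsub>free_module k S\<^esub> delta k S t"

definition rel_eq :: "('k, 'w) ring_scheme \<Rightarrow> 's set \<Rightarrow> 's \<Rightarrow> 's \<Rightarrow> ('s \<Rightarrow> 'k)"
  where "rel_eq k S s t = delta k S s \<ominus>\<^bsub>free_module k S\<^esub> delta k S t"

definition pres_module ::
  "('k, 'w) ring_scheme \<Rightarrow> 's set \<Rightarrow> ('s \<Rightarrow> 'k) set \<Rightarrow> ('k, ('s \<Rightarrow> 'k) set) module"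
  where "pres_module k S G = quot_module (free_module k S) (gen_submodule k (free_module k S) G)"

definition pres_class ::
  "('k, 'w) ring_scheme \<Rightarrow> 's set \<Rightarrow> ('s \<Rightarrow> 'k) set \<Rightarrow> 's \<Rightarrow> ('s \<Rightarrow> 'k) set"
  where "pres_class k S G s =
    gen_submodule k (free_module k S) G +>\<^bsub>free_module k S\<^esub> delta k S s"

text \<open>The linear map out of a presented module that sends the class of \<open>s\<close> to \<open>g s\<close>, for \<open>g\<close>
  compatible with the relations.\<close>

definition pres_lift ::
  "('k, 'w) ring_scheme \<Rightarrow> 's set \<Rightarrow> ('k, 'y, 'u) module_scheme \<Rightarrow> ('s \<Rightarrow> 'y) \<Rightarrow> ('s \<Rightarrow> 'k) set \<Rightarrow> 'y"
  where "pres_lift k S Y g U =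
    the_elem ((\<lambda>f. \<Oplus>\<^bsub>Y\<^esub>s \<in> {s \<in> S. f s \<noteq> \<zero>\<^bsub>k\<^esub>}. f s \<odot>\<^bsub>Y\<^esub> g s) ` U)"


section \<open>Tensor products\<close>

definition tensor_rels ::
  "('k, 'w) ring_scheme \<Rightarrow> ('k, 'r, 's, 'x, 'u) bimodule_scheme \<Rightarrow> ('s, 'z) ring_scheme \<Rightarrow>
   ('k, 's, 't, 'y, 'v) bimodule_scheme \<Rightarrow> ('x \<times> 'y \<Rightarrow> 'k) set"
  where "tensor_rels k X S Y = (let P = carrier X \<times> carrier Y in
    {rel_add k P (x, y) (x', y) (x \<oplus>\<^bsub>X\<^esub> x', y) | x x' y.
        x \<in> carrier X \<and> x' \<in> carrier X \<and> y \<in> carrier Y} \<union>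
    {rel_add k P (x, y) (x, y') (x, y \<oplus>\<^bsub>Y\<^esub> y') | x y y'.
        x \<in> carrier X \<and> y \<in> carrier Y \<and> y' \<in> carrier Y} \<union>
    {rel_smult k P c (x, y) (c \<odot>\<^bsub>X\<^esub> x, y) | c x y.
        c \<in> carrier k \<and> x \<in> carrier X \<and> y \<in> carrier Y} \<union>
    {rel_smult k P c (x, y) (x, c \<odot>\<^bsub>Y\<^esub> y) | c x y.
        c \<in> carrier k \<and> x \<in> carrier X \<and> y \<in> carrier Y} \<union>
    {rel_eq k P (ract X x s, y) (x, lact Y s y) | x s y.
        x \<in> carrier X \<and> s \<in> carrier S \<and> y \<in> carrier Y})"

definition pure_tensor ::
  "('k, 'w) ring_scheme \<Rightarrow> ('k, 'r, 's, 'x, 'u) bimodule_scheme \<Rightarrow> ('s, 'z) ring_scheme \<Rightarrow>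
   ('k, 's, 't, 'y, 'v) bimodule_scheme \<Rightarrow> 'x \<Rightarrow> 'y \<Rightarrow> ('x \<times> 'y \<Rightarrow> 'k) set"
  where "pure_tensor k X S Y x y =
    pres_class k (carrier X \<times> carrier Y) (tensor_rels k X S Y) (x, y)"

definition tensor_lift ::
  "('k, 'w) ring_scheme \<Rightarrow> ('k, 'r, 's, 'x, 'u) bimodule_scheme \<Rightarrow>
   ('k, 's, 't, 'y, 'v) bimodule_scheme \<Rightarrow> ('k, 'q, 'p) module_scheme \<Rightarrow>
   ('x \<Rightarrow> 'y \<Rightarrow> 'q) \<Rightarrow> ('x \<times> 'y \<Rightarrow> 'k) set \<Rightarrow> 'q"
  where "tensor_lift k X Y Z \<beta> = pres_lift k (carrier X \<times> carrier Y) Z (\<lambda>(x, y). \<beta> x y)"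

text \<open>\<open>tensor k X S Y\<close> is \<open>X \<otimes>\<^sub>S Y\<close>, an \<open>R\<close>-\<open>T\<close>-bimodule for an \<open>R\<close>-\<open>S\<close>-bimodule \<open>X\<close> and an
  \<open>S\<close>-\<open>T\<close>-bimodule \<open>Y\<close>.\<close>

definition tensor ::
  "('k, 'w) ring_scheme \<Rightarrow> ('k, 'r, 's, 'x, 'u) bimodule_scheme \<Rightarrow> ('s, 'z) ring_scheme \<Rightarrow>
   ('k, 's, 't, 'y, 'v) bimodule_scheme \<Rightarrow> ('k, 'r, 't, ('x \<times> 'y \<Rightarrow> 'k) set) bimodule"
  where "tensor k X S Y =
    (let V = pres_module k (carrier X \<times> carrier Y) (tensor_rels k X S Y) in
      \<lparr>carrier = carrier V, mult = undefined, one = undefined, zero = zero V, add = add V,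
       smult = smult V,
       lact = (\<lambda>r. tensor_lift k X Y V (\<lambda>x y. pure_tensor k X S Y (lact X r x) y)),
       ract = (\<lambda>U t. tensor_lift k X Y V (\<lambda>x y. pure_tensor k X S Y x (ract Y y t)) U)\<rparr>)"


section \<open>Tensor algebras\<close>

text \<open>The degree \<open>n\<close> part of the tensor algebra of an \<open>R\<close>-bimodule \<open>X\<close> is realised as
  \<open>R \<otimes>\<^sub>R X \<otimes>\<^sub>R \<dots> \<otimes>\<^sub>R X\<close> with \<open>n\<close> factors \<open>X\<close>, that is, as \<open>R\<close> for \<open>n = 0\<close> and as the \<open>n\<close>-fold
  tensor power of \<open>X\<close> for \<open>n > 0\<close>. The pair \<open>(r, [x\<^sub>1, \<dots>, x\<^sub>n])\<close> stands for
  \<open>r \<otimes> x\<^sub>1 \<otimes> \<dots> \<otimes> x\<^sub>n\<close>. All relations are homogeneous in the length of the list, so the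
  module presented by all these words is the direct sum of the degree \<open>n\<close> parts.\<close>

definition words ::
  "('r, 'z) ring_scheme \<Rightarrow> ('k, 'r, 'r, 'x, 'u) bimodule_scheme \<Rightarrow> ('r \<times> 'x list) set"
  where "words R X = carrier R \<times> lists (carrier X)"

definition word_rels ::
  "('k, 'w) ring_scheme \<Rightarrow> ('k, 'r, 'z) module_scheme \<Rightarrow> ('k, 'r, 'r, 'x, 'u) bimodule_scheme \<Rightarrow>
   ('r \<times> 'x list \<Rightarrow> 'k) set"
  where "word_rels k R X = (let P = words R X; L = lists (carrier X) in
    {rel_add k P (r, u) (r', u) (r \<oplus>\<^bsub>R\<^esub> r', u) | r r' u.
        r \<in> carrier R \<and> r' \<in> carrier R \<and> u \<in> L} \<union>
    {rel_smult k P c (r, u) (c \<odot>\<^bsub>R\<^esub> r, u) | c r u.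
        c \<in> carrier k \<and> r \<in> carrier R \<and> u \<in> L} \<union>
    {rel_add k P (r, u @ [x] @ v) (r, u @ [y] @ v) (r, u @ [x \<oplus>\<^bsub>X\<^esub> y] @ v) | r u x y v.
        r \<in> carrier R \<and> u \<in> L \<and> x \<in> carrier X \<and> y \<in> carrier X \<and> v \<in> L} \<union>
    {rel_smult k P c (r, u @ [x] @ v) (r, u @ [c \<odot>\<^bsub>X\<^esub> x] @ v) | c r u x v.
        c \<in> carrier k \<and> r \<in> carrier R \<and> u \<in> L \<and> x \<in> carrier X \<and> v \<in> L} \<union>
    {rel_eq k P (r \<otimes>\<^bsub>R\<^esub> s, [x] @ v) (r, [lact X s x] @ v) | r s x v.
        r \<in> carrier R \<and> s \<in> carrier R \<and> x \<in> carrier X \<and> v \<in> L} \<union>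
    {rel_eq k P (r, u @ [ract X x s, y] @ v) (r, u @ [x, lact X s y] @ v) | r u x s y v.
        r \<in> carrier R \<and> u \<in> L \<and> x \<in> carrier X \<and> s \<in> carrier R \<and> y \<in> carrier X \<and> v \<in> L})"

definition word_mult ::
  "('r, 'z) ring_scheme \<Rightarrow> ('k, 'r, 'r, 'x, 'u) bimodule_scheme \<Rightarrow>
   'r \<times> 'x list \<Rightarrow> 'r \<times> 'x list \<Rightarrow> 'r \<times> 'x list"
  where "word_mult R X = (\<lambda>(r, u) (s, v).
    if u = [] then (r \<otimes>\<^bsub>R\<^esub> s, v) else (r, butlast u @ [ract X (last u) s] @ v))"

definition word_class ::
  "('k, 'w) ring_scheme \<Rightarrow> ('k, 'r, 'z) module_scheme \<Rightarrow> ('k, 'r, 'r, 'x, 'u) bimodule_scheme \<Rightarrow>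
   'r \<times> 'x list \<Rightarrow> ('r \<times> 'x list \<Rightarrow> 'k) set"
  where "word_class k R X = pres_class k (words R X) (word_rels k R X)"

definition tensor_alg ::
  "('k, 'w) ring_scheme \<Rightarrow> ('k, 'r, 'z) module_scheme \<Rightarrow> ('k, 'r, 'r, 'x, 'u) bimodule_scheme \<Rightarrow>
   ('k, ('r \<times> 'x list \<Rightarrow> 'k) set) module"
  where "tensor_alg k R X = (let V = pres_module k (words R X) (word_rels k R X) in
    \<lparr>carrier = carrier V,
     mult = (\<lambda>U W. pres_lift k (words R X) V
       (\<lambda>w. pres_lift k (words R X) V (\<lambda>w'. word_class k R X (word_mult R X w w')) W) U),
     one = word_class k R X (\<one>\<^bsub>R\<^esub>, []),
     zero = zero V, add = add V, smult = smult V\<rparr>)"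

definition tensor_alg_in0 ::
  "('k, 'w) ring_scheme \<Rightarrow> ('k, 'r, 'z) module_scheme \<Rightarrow> ('k, 'r, 'r, 'x, 'u) bimodule_scheme \<Rightarrow>
   'r \<Rightarrow> ('r \<times> 'x list \<Rightarrow> 'k) set"
  where "tensor_alg_in0 k R X r = word_class k R X (r, [])"

definition tensor_alg_in1 ::
  "('k, 'w) ring_scheme \<Rightarrow> ('k, 'r, 'z) module_scheme \<Rightarrow> ('k, 'r, 'r, 'x, 'u) bimodule_scheme \<Rightarrow>
   'x \<Rightarrow> ('r \<times> 'x list \<Rightarrow> 'k) set"
  where "tensor_alg_in1 k R X x = word_class k R X (\<one>\<^bsub>R\<^esub>, [x])"


section \<open>The preprojective algebra\<close>

text \<open>Below, \<open>\<Lambda>\<close> is an algebra containing \<open>A\<close> through the homomorphism \<open>i : A \<rightarrow> \<Lambda>\<close>.\<close>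

definition Lam_A_Lam ::
  "('k, 'w) ring_scheme \<Rightarrow> ('k, 'a, 'u) module_scheme \<Rightarrow> ('k, 'l, 'v) module_scheme \<Rightarrow> ('a \<Rightarrow> 'l) \<Rightarrow>
   ('k, 'l, 'l, ('l \<times> 'l \<Rightarrow> 'k) set) bimodule"
  where "Lam_A_Lam k A \<Lambda> i = tensor k (alg_bimodule \<Lambda> id i) A (alg_bimodule \<Lambda> i id)"

definition Omega ::
  "('k, 'w) ring_scheme \<Rightarrow> ('k, 'a, 'u) module_scheme \<Rightarrow> ('k, 'l, 'v) module_scheme \<Rightarrow> ('a \<Rightarrow> 'l) \<Rightarrow>
   ('k, 'l, 'l, ('l \<times> 'l \<Rightarrow> 'k) set) bimodule"
  where "Omega k A \<Lambda> i = (Lam_A_Lam k A \<Lambda> i)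
    \<lparr>carrier := {U \<in> carrier (Lam_A_Lam k A \<Lambda> i).
       tensor_lift k (alg_bimodule \<Lambda> id i) (alg_bimodule \<Lambda> i id) \<Lambda> (\<lambda>x y. x \<otimes>\<^bsub>\<Lambda>\<^esub> y) U = \<zero>\<^bsub>\<Lambda>\<^esub>}\<rparr>"

definition diff ::
  "('k, 'w) ring_scheme \<Rightarrow> ('k, 'a, 'u) module_scheme \<Rightarrow> ('k, 'l, 'v) module_scheme \<Rightarrow> ('a \<Rightarrow> 'l) \<Rightarrow>
   'l \<Rightarrow> ('l \<times> 'l \<Rightarrow> 'k) set"
  where "diff k A \<Lambda> i x =
    pure_tensor k (alg_bimodule \<Lambda> id i) A (alg_bimodule \<Lambda> i id) \<one>\<^bsub>\<Lambda>\<^esub> x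
    \<ominus>\<^bsub>Lam_A_Lam k A \<Lambda> i\<^esub>
    pure_tensor k (alg_bimodule \<Lambda> id i) A (alg_bimodule \<Lambda> i id) x \<one>\<^bsub>\<Lambda>\<^esub>"

definition DLam ::
  "('k, 'w) ring_scheme \<Rightarrow> ('k, 'l, 'v) module_scheme \<Rightarrow> ('k, 'l, 'l, 'l \<Rightarrow> 'k) bimodule"
  where "DLam k \<Lambda> = dual k (alg_bimodule \<Lambda> id id)"

definition mho ::
  "('k, 'w) ring_scheme \<Rightarrow> ('k, 'a, 'u) module_scheme \<Rightarrow> ('k, 'l, 'v) module_scheme \<Rightarrow> ('a \<Rightarrow> 'l) \<Rightarrow>
   ('k, 'l, 'l,
     ((('l \<Rightarrow> 'k) \<times> ('l \<times> 'l \<Rightarrow> 'k) set \<Rightarrow> 'k) set \<times> ('l \<Rightarrow> 'k) \<Rightarrow> 'k) set \<Rightarrow> 'k) bimodule"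
  where "mho k A \<Lambda> i =
    dual k (tensor k (tensor k (DLam k \<Lambda>) \<Lambda> (Omega k A \<Lambda> i)) \<Lambda> (DLam k \<Lambda>))"

text \<open>The value of \<open>cbar\<close> on \<open>\<theta> \<otimes> dx \<otimes> \<phi>\<close> is prescribed; the \<open>\<theta> \<otimes> dx \<otimes> \<phi>\<close> span, as \<open>\<Omega>\<close> is
  generated as a bimodule by the \<open>dx\<close>. \<open>\<Lambda>\<close> is viewed as an \<open>A\<close>-bimodule to form the vectors of
  \<open>\<theta>\<close> and \<open>\<phi>\<close>.\<close>

definition cbar ::
  "('k, 'w) ring_scheme \<Rightarrow> ('k, 'a, 'u) module_scheme \<Rightarrow> ('a \<Rightarrow> 'k) \<Rightarrow> ('k, 'l, 'v) module_scheme \<Rightarrow>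
   ('a \<Rightarrow> 'l) \<Rightarrow>
   ((('l \<Rightarrow> 'k) \<times> ('l \<times> 'l \<Rightarrow> 'k) set \<Rightarrow> 'k) set \<times> ('l \<Rightarrow> 'k) \<Rightarrow> 'k) set \<Rightarrow> 'k"
  where "cbar k A \<sigma> \<Lambda> i = (THE f. f \<in> carrier (mho k A \<Lambda> i) \<and>
    (\<forall>\<theta> \<in> carrier (DLam k \<Lambda>). \<forall>x \<in> carrier \<Lambda>. \<forall>\<phi> \<in> carrier (DLam k \<Lambda>).
      f (pure_tensor k (tensor k (DLam k \<Lambda>) \<Lambda> (Omega k A \<Lambda> i)) \<Lambda> (DLam k \<Lambda>)
          (pure_tensor k (DLam k \<Lambda>) \<Lambda> (Omega k A \<Lambda> i) \<theta> (diff k A \<Lambda> i x)) \<phi>) =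
      \<theta> (i (lvec A \<sigma> (alg_bimodule \<Lambda> i i) \<phi> x)) \<ominus>\<^bsub>k\<^esub> \<phi> (i (rvec A \<sigma> (alg_bimodule \<Lambda> i i) \<theta> x))))"

text \<open>The cokernel of the bimodule homomorphism \<open>\<Lambda> \<otimes>\<^sub>A \<Lambda> \<rightarrow> \<mho>\<close> with
  \<open>x \<otimes> y \<mapsto> x \<cdot> cbar \<cdot> y\<close>.\<close>

definition Pi1 ::
  "('k, 'w) ring_scheme \<Rightarrow> ('k, 'a, 'u) module_scheme \<Rightarrow> ('a \<Rightarrow> 'k) \<Rightarrow> ('k, 'l, 'v) module_scheme \<Rightarrow>
   ('a \<Rightarrow> 'l) \<Rightarrow>
   ('k, 'l, 'l,
     (((('l \<Rightarrow> 'k) \<times> ('l \<times> 'l \<Rightarrow> 'k) set \<Rightarrow> 'k) set \<times> ('l \<Rightarrow> 'k) \<Rightarrow> 'k) set \<Rightarrow> 'k) set) bimodule"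
  where "Pi1 k A \<sigma> \<Lambda> i = quot_bimodule (mho k A \<Lambda> i)
    (tensor_lift k (alg_bimodule \<Lambda> id i) (alg_bimodule \<Lambda> i id) (mho k A \<Lambda> i)
       (\<lambda>x y. ract (mho k A \<Lambda> i) (lact (mho k A \<Lambda> i) x (cbar k A \<sigma> \<Lambda> i)) y)
     ` carrier (Lam_A_Lam k A \<Lambda> i))"

definition preproj_alg ::
  "('k, 'w) ring_scheme \<Rightarrow> ('k, 'a, 'u) module_scheme \<Rightarrow> ('a \<Rightarrow> 'k) \<Rightarrow> ('k, 'l, 'v) module_scheme \<Rightarrow>
   ('a \<Rightarrow> 'l) \<Rightarrow>
   ('k, ('l \<times>
     (((('l \<Rightarrow> 'k) \<times> ('l \<times> 'l \<Rightarrow> 'k) set \<Rightarrow> 'k) set \<times> ('l \<Rightarrow> 'k) \<Rightarrow> 'k) set \<Rightarrow> 'k) set list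
     \<Rightarrow> 'k) set) module"
  where "preproj_alg k A \<sigma> \<Lambda> i = tensor_alg k \<Lambda> (Pi1 k A \<sigma> \<Lambda> i)"


section \<open>The element \<open>c = \<rho> - \<ell>\<close>\<close>

text \<open>The sums \<open>\<Sum> m\<^sub>i \<otimes> \<mu>\<^sub>i\<close> with \<open>x = \<Sum> m\<^sub>i \<cdot> \<mu>\<^sub>i(x)\<close> and \<open>\<Sum> \<nu>\<^sub>j \<otimes> n\<^sub>j\<close> with
  \<open>x = \<Sum> \<nu>\<^sub>j(x) \<cdot> n\<^sub>j\<close> for all \<open>x\<close>; as elements of the tensor products they do not depend on the
  choice of the families.\<close>

definition rho ::
  "('k, 'w) ring_scheme \<Rightarrow> ('k, 'a, 'u) module_scheme \<Rightarrow> ('a \<Rightarrow> 'k) \<Rightarrow>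
   ('k, 'a, 'a, 'm, 'v) bimodule_scheme \<Rightarrow> ('m \<times> ('m \<Rightarrow> 'k) \<Rightarrow> 'k) set"
  where "rho k A \<sigma> M = (THE t. \<exists>(n :: nat) m \<mu>.
    (\<forall>i<n. m i \<in> carrier M \<and> \<mu> i \<in> carrier (dual k M)) \<and>
    (\<forall>x \<in> carrier M. x = (\<Oplus>\<^bsub>M\<^esub>i \<in> {..<n}. ract M (m i) (rvec A \<sigma> M (\<mu> i) x))) \<and>
    t = (\<Oplus>\<^bsub>tensor k M A (dual k M)\<^esub>i \<in> {..<n}. pure_tensor k M A (dual k M) (m i) (\<mu> i)))"

definition ell ::
  "('k, 'w) ring_scheme \<Rightarrow> ('k, 'a, 'u) module_scheme \<Rightarrow> ('a \<Rightarrow> 'k) \<Rightarrow>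
   ('k, 'a, 'a, 'm, 'v) bimodule_scheme \<Rightarrow> (('m \<Rightarrow> 'k) \<times> 'm \<Rightarrow> 'k) set"
  where "ell k A \<sigma> M = (THE t. \<exists>(p :: nat) \<nu> n.
    (\<forall>j<p. \<nu> j \<in> carrier (dual k M) \<and> n j \<in> carrier M) \<and>
    (\<forall>x \<in> carrier M. x = (\<Oplus>\<^bsub>M\<^esub>j \<in> {..<p}. lact M (lvec A \<sigma> M (\<nu> j) x) (n j))) \<and>
    t = (\<Oplus>\<^bsub>tensor k (dual k M) A M\<^esub>j \<in> {..<p}. pure_tensor k (dual k M) A M (\<nu> j) (n j)))"

definition M_DM ::
  "('k, 'w) ring_scheme \<Rightarrow> ('k, 'a, 'a, 'm, 'v) bimodule_scheme \<Rightarrow>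
   ('k, 'a, 'a, 'm \<times> ('m \<Rightarrow> 'k)) bimodule"
  where "M_DM k M = bimodule_dsum M (dual k M)"

text \<open>\<open>\<rho> - \<ell>\<close>, with \<open>M \<otimes>\<^sub>A DM\<close> and \<open>DM \<otimes>\<^sub>A M\<close> mapped to the degree two part of the tensor algebra
  of \<open>M \<oplus> DM\<close>.\<close>

definition c_elem ::
  "('k, 'w) ring_scheme \<Rightarrow> ('k, 'a, 'u) module_scheme \<Rightarrow> ('a \<Rightarrow> 'k) \<Rightarrow>
   ('k, 'a, 'a, 'm, 'v) bimodule_scheme \<Rightarrow> ('a \<times> ('m \<times> ('m \<Rightarrow> 'k)) list \<Rightarrow> 'k) set"
  where "c_elem k A \<sigma> M =
    tensor_lift k M (dual k M) (tensor_alg k A (M_DM k M))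
      (\<lambda>m \<mu>. word_class k A (M_DM k M) (\<one>\<^bsub>A\<^esub>, [(m, \<zero>\<^bsub>dual k M\<^esub>), (\<zero>\<^bsub>M\<^esub>, \<mu>)])) (rho k A \<sigma> M)
    \<ominus>\<^bsub>tensor_alg k A (M_DM k M)\<^esub>
    tensor_lift k (dual k M) M (tensor_alg k A (M_DM k M))
      (\<lambda>\<nu> n. word_class k A (M_DM k M) (\<one>\<^bsub>A\<^esub>, [(\<zero>\<^bsub>M\<^esub>, \<nu>), (n, \<zero>\<^bsub>dual k M\<^esub>)])) (ell k A \<sigma> M)"

end

theory Submission
  imports Defs
begin

text \<open>
  Let \<open>\<Lambda> = T\<^sub>A(M)\<close> and \<open>T = T\<^sub>A(M \<oplus> DM)\<close>. The theorem holds because \<open>\<mho>\<close> is isomorphic to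
  \<open>\<Lambda> \<otimes>\<^sub>A DM \<otimes>\<^sub>A \<Lambda>\<close>: an algebra homomorphism out of \<open>T\<^sub>\<Lambda>(\<mho>)\<close> then amounts to compatible maps on \<open>A\<close>,
  \<open>M\<close> and \<open>DM\<close>, just as one out of \<open>T\<close> does.

  The isomorphism comes from viewing the elements of \<open>\<mho>\<close> as derivations. As \<open>\<Omega>\<close> is spanned by the
  elements \<open>x \<sqdot> dy\<close>, a linear form on \<open>D\<Lambda> \<otimes> \<Omega> \<otimes> D\<Lambda>\<close> is the same as a trilinear \<open>G(\<theta>, x, \<phi>)\<close> that
  vanishes for \<open>x \<in> A\<close> and satisfies \<open>G(\<theta>, x y, \<phi>) = G(\<theta>, x, y \<phi>) + G(\<theta> x, y, \<phi>)\<close> (\<open>Mho_lift\<close>,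
  \<open>Mho_eqI\<close>). A derivation of a tensor algebra that vanishes on \<open>A\<close> is determined by its values on \<open>M\<close>, and these can be any
  bimodule map (\<open>tensor_alg_derivation\<close>). So every \<open>\<mu> \<in> DM\<close> defines an element \<open>muhat \<mu>\<close> of \<open>\<mho>\<close> by
  \<open>\<theta> \<otimes> dm \<otimes> \<phi> \<mapsto> \<mu>(a m b)\<close>, where \<open>a, b \<in> A\<close> represent the restrictions of \<open>\<theta>\<close> and \<open>\<phi>\<close> to \<open>A\<close> through \<open>\<sigma>\<close>.
  Writing \<open>rv \<theta>\<close> and \<open>lv \<theta>\<close> for the right and left linear maps \<open>\<Lambda> \<rightarrow> A\<close> that belong to \<open>\<theta> \<in> D\<Lambda>\<close>, the element
  \<open>x \<sqdot> muhat \<mu> \<sqdot> y\<close> sends \<open>\<theta> \<otimes> dm \<otimes> \<phi>\<close> to \<open>\<mu>(lv \<theta> y \<sqdot> m \<sqdot> rv \<phi> x)\<close> (\<open>muhat_act\<close>).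

  Since \<open>A\<close> is semisimple and \<open>\<Lambda>\<close> is finite dimensional, \<open>\<Lambda>\<close> has dual bases as a right and as a left
  \<open>A\<close>-module: \<open>x = \<Sum> \<lambda>\<^sub>p \<sqdot> rv \<theta>\<^sub>p x\<close> and \<open>x = \<Sum> lv \<phi>\<^sub>q x \<sqdot> \<lambda>'\<^sub>q\<close> (\<open>bimodule_dual_bases\<close>). They
  also expand linear forms, and the formula for \<open>x \<sqdot> muhat \<mu> \<sqdot> y\<close> turns this into
  \<open>f = \<Sum> \<lambda>\<^sub>p \<sqdot> muhat \<mu>\<^sub>p\<^sub>q \<sqdot> \<lambda>'\<^sub>q\<close> for every \<open>f \<in> \<mho>\<close>, with \<open>\<mu>\<^sub>p\<^sub>q(m) = f(\<phi>\<^sub>q \<otimes> dm \<otimes> \<theta>\<^sub>p)\<close>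
  (\<open>Mho_expand\<close>). Therefore the homomorphism from \<open>T\<close> to \<open>T\<^sub>\<Lambda>(\<mho>)\<close> given by \<open>\<mu> \<mapsto> muhat \<mu>\<close> is inverted by
  the one given by \<open>f \<mapsto> \<Sum> \<lambda>\<^sub>p \<mu>\<^sub>p\<^sub>q \<lambda>'\<^sub>q\<close> (\<open>to_mho_alg_inverse\<close>). With dual bases of \<open>M\<close>
  instead, the same computation yields \<open>cbar = \<Sum> m\<^sub>i \<sqdot> muhat \<mu>\<^sub>i - \<Sum> muhat \<nu>\<^sub>j \<sqdot> n\<^sub>j\<close>
  (\<open>cbar_dual_bases\<close>), which says that \<open>c\<close> is mapped to \<open>cbar\<close>.

  Finally, the image of \<open>\<Lambda> \<otimes>\<^sub>A \<Lambda>\<close> in \<open>\<mho>\<close> is the subbimodule generated by \<open>cbar\<close>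
  (\<open>cbar_map_image\<close>), and the tensor algebra of the quotient by a subbimodule with one generator is the
  quotient of the tensor algebra by the ideal with the same generator (\<open>tensor_alg_quotient_iso\<close>).
\<close>


section \<open>Linear maps\<close>

definition linear_maps ::
  "('k, 'w) ring_scheme \<Rightarrow> ('k, 'x, 'u) module_scheme \<Rightarrow> ('k, 'y, 'v) module_scheme \<Rightarrow> ('x \<Rightarrow> 'y) set"
  where "linear_maps k X Y = {f \<in> carrier X \<rightarrow> carrier Y.
    (\<forall>x \<in> carrier X. \<forall>y \<in> carrier X. f (x \<oplus>\<^bsub>X\<^esub> y) = f x \<oplus>\<^bsub>Y\<^esub> f y) \<and>
    (\<forall>c \<in> carrier k. \<forall>x \<in> carrier X. f (c \<odot>\<^bsub>X\<^esub> x) = c \<odot>\<^bsub>Y\<^esub> f x)}"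

lemma linear_mapsI:
  assumes "\<And>x. x \<in> carrier X \<Longrightarrow> f x \<in> carrier Y"
    and "\<And>x y. \<lbrakk>x \<in> carrier X; y \<in> carrier X\<rbrakk> \<Longrightarrow> f (x \<oplus>\<^bsub>X\<^esub> y) = f x \<oplus>\<^bsub>Y\<^esub> f y"
    and "\<And>c x. \<lbrakk>c \<in> carrier k; x \<in> carrier X\<rbrakk> \<Longrightarrow> f (c \<odot>\<^bsub>X\<^esub> x) = c \<odot>\<^bsub>Y\<^esub> f x"
  shows "f \<in> linear_maps k X Y"
  using assms unfolding linear_maps_def by auto

lemma linear_mapsD:
  assumes "f \<in> linear_maps k X Y"
  shows linear_maps_closed: "x \<in> carrier X \<Longrightarrow> f x \<in> carrier Y"
    and linear_maps_add: "\<lbrakk>x \<in> carrier X; y \<in> carrier X\<rbrakk> \<Longrightarrow> f (x \<oplus>\<^bsub>X\<^esub> y) = f x \<oplus>\<^bsub>Y\<^esub> f y"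
    and linear_maps_smult: "\<lbrakk>c \<in> carrier k; x \<in> carrier X\<rbrakk> \<Longrightarrow> f (c \<odot>\<^bsub>X\<^esub> x) = c \<odot>\<^bsub>Y\<^esub> f x"
  using assms unfolding linear_maps_def by auto

lemma linear_maps_zero:
  assumes "module k X" "module k Y" "f \<in> linear_maps k X Y"
  shows "f \<zero>\<^bsub>X\<^esub> = \<zero>\<^bsub>Y\<^esub>"
proof -
  interpret X: module k X by fact
  interpret Y: module k Y by fact
  have "f (\<zero>\<^bsub>k\<^esub> \<odot>\<^bsub>X\<^esub> \<zero>\<^bsub>X\<^esub>) = \<zero>\<^bsub>k\<^esub> \<odot>\<^bsub>Y\<^esub> f \<zero>\<^bsub>X\<^esub>"
    by (rule linear_maps_smult[OF assms(3)]) auto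
  then show ?thesis using linear_maps_closed[OF assms(3), of "\<zero>\<^bsub>X\<^esub>"] by simp
qed

lemma linear_maps_minus:
  assumes "module k X" "module k Y" "f \<in> linear_maps k X Y" "x \<in> carrier X"
  shows "f (\<ominus>\<^bsub>X\<^esub> x) = \<ominus>\<^bsub>Y\<^esub> f x"
proof -
  interpret X: module k X by fact
  interpret Y: module k Y by fact
  have "f (\<ominus>\<^bsub>X\<^esub> x) \<oplus>\<^bsub>Y\<^esub> f x = f (\<ominus>\<^bsub>X\<^esub> x \<oplus>\<^bsub>X\<^esub> x)"
    using linear_maps_add[OF assms(3)] assms(4) by simp
  also have "\<dots> = \<zero>\<^bsub>Y\<^esub>" using X.M.l_neg[OF assms(4)] linear_maps_zero[OF assms(1-3)] by simp
  finally show ?thesis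
    using Y.M.minus_equality linear_maps_closed[OF assms(3)] assms(4) by (metis X.M.a_inv_closed)
qed

lemma linear_maps_diff:
  assumes "module k X" "module k Y" "f \<in> linear_maps k X Y" "x \<in> carrier X" "y \<in> carrier X"
  shows "f (x \<ominus>\<^bsub>X\<^esub> y) = f x \<ominus>\<^bsub>Y\<^esub> f y"
proof -
  interpret X: module k X by fact
  show ?thesis
    unfolding a_minus_def using assms linear_maps_add[OF assms(3)] linear_maps_minus[OF assms(1-3)]
    by simp
qed

lemma linear_maps_finsum:
  assumes "module k X" "module k Y" "f \<in> linear_maps k X Y" "finite I" "g \<in> I \<rightarrow> carrier X"
  shows "f (\<Oplus>\<^bsub>X\<^esub>i \<in> I. g i) = (\<Oplus>\<^bsub>Y\<^esub>i \<in> I. f (g i))"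
proof -
  interpret X: module k X by fact
  interpret Y: module k Y by fact
  note fc = linear_maps_closed[OF assms(3)]
  show ?thesis using assms(4,5)
  proof (induction I rule: finite_induct)
    case empty
    then show ?case using linear_maps_zero[OF assms(1-3)] by simp
  next
    case (insert i I)
    then have "g i \<in> carrier X" "g \<in> I \<rightarrow> carrier X" "(\<lambda>i. f (g i)) \<in> I \<rightarrow> carrier Y"
      "f (g i) \<in> carrier Y" "(\<Oplus>\<^bsub>X\<^esub>i \<in> I. g i) \<in> carrier X"
      using fc by (auto simp: Pi_def)
    then show ?case using insert linear_maps_add[OF assms(3)]
      by (simp add: X.M.finsum_insert Y.M.finsum_insert)
  qed
qed

lemma linear_maps_compose:
  assumes "f \<in> linear_maps k X Y" "g \<in> linear_maps k Y Z"
  shows "(\<lambda>x. g (f x)) \<in> linear_maps k X Z"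
  using assms unfolding linear_maps_def by (auto simp: Pi_def)

lemma (in abelian_monoid) finsum_swap:
  assumes "finite I" "finite J" "\<And>p q. \<lbrakk>p \<in> I; q \<in> J\<rbrakk> \<Longrightarrow> f p q \<in> carrier G"
  shows "(\<Oplus>p \<in> I. \<Oplus>q \<in> J. f p q) = (\<Oplus>q \<in> J. \<Oplus>p \<in> I. f p q)"
  using assms(1,3)
proof (induction I rule: finite_induct)
  case empty
  then show ?case using assms(2) by simp
next
  case (insert a I)
  have c: "(\<Oplus>q \<in> J. f p q) \<in> carrier G" if "p \<in> insert a I" for p
    using insert.prems that by (intro finsum_closed) auto
  have c': "(\<Oplus>p \<in> I. f p q) \<in> carrier G" if "q \<in> J" for q
    using insert.prems that by (intro finsum_closed) auto
  have "(\<Oplus>p \<in> insert a I. \<Oplus>q \<in> J. f p q) = (\<Oplus>q \<in> J. f a q) \<oplus> (\<Oplus>p \<in> I. \<Oplus>q \<in> J. f p q)"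
    using insert.hyps c by (intro finsum_insert) auto
  also have "\<dots> = (\<Oplus>q \<in> J. f a q) \<oplus> (\<Oplus>q \<in> J. \<Oplus>p \<in> I. f p q)"
    using insert.IH insert.prems by simp
  also have "\<dots> = (\<Oplus>q \<in> J. f a q \<oplus> (\<Oplus>p \<in> I. f p q))"
    using insert.prems c' by (intro finsum_addf[symmetric]) auto
  also have "\<dots> = (\<Oplus>q \<in> J. \<Oplus>p \<in> insert a I. f p q)"
    using insert by (intro finsum_cong'[OF refl] finsum_insert[symmetric]) (auto intro!: finsum_closed)
  finally show ?case .
qed

text \<open>Linear forms are linear maps into this module, so one notion of linear map serves for both.\<close>

definition scalars :: "('k, 'w) ring_scheme \<Rightarrow> ('k, 'k) module"
  where "scalars k = \<lparr>carrier = carrier k, mult = mult k, one = one k, zero = zero k, add = add k,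
    smult = mult k\<rparr>"

lemma scalars_simps [simp]:
  "carrier (scalars k) = carrier k" "mult (scalars k) = mult k" "one (scalars k) = one k"
  "zero (scalars k) = zero k" "add (scalars k) = add k" "smult (scalars k) = mult k"
  by (simp_all add: scalars_def)

lemma a_inv_cong:
  assumes "carrier X = carrier Y" "add X = add Y" "zero X = zero Y"
  shows "a_inv X = a_inv Y"
  using assms by (auto simp: fun_eq_iff a_inv_def m_inv_def)

lemma a_minus_cong:
  assumes "carrier X = carrier Y" "add X = add Y" "zero X = zero Y"
  shows "a_minus X = a_minus Y"
  using a_inv_cong[OF assms] assms by (auto simp: fun_eq_iff a_minus_def)

lemma scalars_minus [simp]: "a_inv (scalars k) = a_inv k" "a_minus (scalars k) = a_minus k"
  by (rule a_inv_cong a_minus_cong; simp)+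

lemma finsum_cong_struct:
  assumes "carrier X = carrier Y" "add X = add Y" "zero X = zero Y"
  shows "finsum X f I = finsum Y f I"
  using assms by (simp add: finsum_def finprod_def)

lemma abelian_group_cong:
  fixes X :: "('x, 'u) ring_scheme" and Y :: "('x, 'v) ring_scheme"
  assumes "abelian_group X"
    and "carrier Y = carrier X" "add Y = add X" "zero Y = zero X"
  shows "abelian_group Y"
proof -
  interpret X: abelian_group X by fact
  show ?thesis
    by (rule abelian_groupI; unfold assms(2-4))
      (auto simp: X.a_ac intro!: bexI[of _ "\<ominus>\<^bsub>X\<^esub> _"] X.l_neg)
qed

lemma module_cong:
  fixes X :: "('k, 'x, 'u) module_scheme" and Y :: "('k, 'x, 'v) module_scheme"
  assumes "module k X"
    and "carrier Y = carrier X" "add Y = add X" "zero Y = zero X" "smult Y = smult X"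
  shows "module k Y"
proof -
  interpret X: module k X by fact
  have "abelian_group Y" by (rule abelian_group_cong[OF X.M.abelian_group_axioms assms(2-4)])
  from X.R.cring_axioms this show ?thesis
    by (rule moduleI; unfold assms(2-5))
      (auto simp: X.smult_l_distr X.smult_r_distr X.smult_assoc1)
qed

lemma module_scalars:
  assumes "cring k" shows "module k (scalars k)"
proof -
  interpret cring k by fact
  have "abelian_group (scalars k)" by (rule abelian_group_cong[OF abelian_group_axioms]) simp_all
  then show ?thesis
    by (intro moduleI) (auto simp: assms l_distr r_distr m_assoc)
qed

lemma functionals_iff:
  "f \<in> functionals k X \<longleftrightarrow> f \<in> linear_maps k X (scalars k) \<and> f \<in> extensional (carrier X)"
  unfolding functionals_def linear_maps_def by (auto simp: PiE_def)

lemma functionals_linear: "f \<in> functionals k X \<Longrightarrow> f \<in> linear_maps k X (scalars k)"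
  by (simp add: functionals_iff)

lemma restrict_functional:
  assumes "module k X" "f \<in> linear_maps k X (scalars k)"
  shows "restrict f (carrier X) \<in> functionals k X"
proof -
  interpret X: module k X by fact
  show ?thesis using assms(2) unfolding functionals_iff by (auto simp: linear_maps_def)
qed

lemma functionals_eqI:
  assumes "f \<in> functionals k X" "g \<in> functionals k X" "\<And>x. x \<in> carrier X \<Longrightarrow> f x = g x"
  shows "f = g"
  using assms by (auto simp: functionals_iff intro: extensionalityI)


section \<open>Presented modules\<close>

subsection \<open>Generated submodules and quotients\<close>

lemma gen_submodule_submodule:
  assumes "module k V" "G \<subseteq> carrier V"
  shows "submodule (gen_submodule k V G) k V"
proof -
  interpret V: module k V by fact
  have ne: "carrier V \<in> {N. submodule N k V \<and> G \<subseteq> N}"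
    using V.carrier_is_submodule assms(2) by auto
  show ?thesis unfolding gen_submodule_def
  proof (rule V.submoduleI)
    show "\<Inter> {N. submodule N k V \<and> G \<subseteq> N} \<subseteq> carrier V" using ne by blast
  next
    have "\<And>N. submodule N k V \<Longrightarrow> \<zero>\<^bsub>V\<^esub> \<in> N"
      using subgroup.one_closed[OF submodule.axioms(1)] by fastforce
    then show "\<zero>\<^bsub>V\<^esub> \<in> \<Inter> {N. submodule N k V \<and> G \<subseteq> N}" by blast
  qed (auto dest: V.submoduleE(3-5))
qed

lemma gen_submodule_incl: "G \<subseteq> gen_submodule k V G"
  unfolding gen_submodule_def by blast

lemma gen_submodule_minimal: "\<lbrakk>submodule N k V; G \<subseteq> N\<rbrakk> \<Longrightarrow> gen_submodule k V G \<subseteq> N"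
  unfolding gen_submodule_def by blast

lemma submodule_abelian_subgroup:
  assumes "module k V" "submodule N k V"
  shows "abelian_subgroup N V"
proof -
  interpret V: module k V by fact
  show ?thesis
    by (rule abelian_subgroupI3[OF additive_subgroupI[OF submodule.axioms(1)[OF assms(2)]]
          V.M.abelian_group_axioms])
qed

text \<open>Operations on cosets are defined as unions over all representatives; this is why they may be
  computed from a single one.\<close>

lemma coset_UN:
  assumes "abelian_subgroup N V" "v \<in> carrier V"
    and "\<And>u. u \<in> carrier V \<Longrightarrow> f u \<in> carrier V"
    and "\<And>u v. \<lbrakk>u \<in> carrier V; v \<in> carrier V\<rbrakk> \<Longrightarrow> f (u \<oplus>\<^bsub>V\<^esub> v) = f u \<oplus>\<^bsub>V\<^esub> f v"
    and "\<And>u. u \<in> N \<Longrightarrow> f u \<in> N"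
  shows "(\<Union>u \<in> N +>\<^bsub>V\<^esub> v. N +>\<^bsub>V\<^esub> f u) = N +>\<^bsub>V\<^esub> f v"
proof -
  interpret N: abelian_subgroup N V by fact
  have "N +>\<^bsub>V\<^esub> f u = N +>\<^bsub>V\<^esub> f v" if u: "u \<in> N +>\<^bsub>V\<^esub> v" for u
  proof -
    obtain n where n: "n \<in> N" "u = n \<oplus>\<^bsub>V\<^esub> v" using u by (auto simp: a_r_coset_def')
    then have "f u = f n \<oplus>\<^bsub>V\<^esub> f v" using assms(2,4) N.a_Hcarr by blast
    then have "f u \<in> N +>\<^bsub>V\<^esub> f v" using assms(5) n by (auto simp: a_r_coset_def')
    then show ?thesis using N.a_repr_independence' assms(2,3) by blast
  qed
  moreover have "v \<in> N +>\<^bsub>V\<^esub> v" using N.a_rcos_self assms(2) by blast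
  ultimately show ?thesis by blast
qed

lemma coset_eq_iff:
  assumes "abelian_subgroup N V" "u \<in> carrier V" "v \<in> carrier V"
  shows "N +>\<^bsub>V\<^esub> u = N +>\<^bsub>V\<^esub> v \<longleftrightarrow> u \<ominus>\<^bsub>V\<^esub> v \<in> N"
proof -
  interpret N: abelian_subgroup N V by fact
  show ?thesis
    using N.a_rcos_module[of v u] N.a_repr_independence'[of u v] N.a_rcos_self[of u] assms(2,3)
    by (auto simp: a_minus_def)
qed

lemma rcosets_iff: "U \<in> a_rcosets\<^bsub>V\<^esub> N \<longleftrightarrow> (\<exists>v \<in> carrier V. U = N +>\<^bsub>V\<^esub> v)"
  by (auto simp: A_RCOSETS_def')

lemma quot_module_simps:
  "carrier (quot_module V N) = a_rcosets\<^bsub>V\<^esub> N" "zero (quot_module V N) = N"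
  "add (quot_module V N) = set_add V"
  by (simp_all add: quot_module_def)

lemma quot_smult:
  assumes "module k V" "submodule N k V" "c \<in> carrier k" "v \<in> carrier V"
  shows "(\<Union>u \<in> N +>\<^bsub>V\<^esub> v. N +>\<^bsub>V\<^esub> (c \<odot>\<^bsub>V\<^esub> u)) = N +>\<^bsub>V\<^esub> (c \<odot>\<^bsub>V\<^esub> v)"
proof -
  interpret V: module k V by fact
  show ?thesis
    by (rule coset_UN[OF submodule_abelian_subgroup[OF assms(1,2)]])
      (use assms V.submoduleE(4)[OF assms(2)] in \<open>auto simp: V.smult_r_distr\<close>)
qed

lemma quot_module_module:
  assumes "module k V" "submodule N k V"
  shows "module k (quot_module V N)"
    and "(\<lambda>v. N +>\<^bsub>V\<^esub> v) \<in> linear_maps k V (quot_module V N)"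
proof -
  interpret V: module k V by fact
  interpret N: abelian_subgroup N V by (rule submodule_abelian_subgroup[OF assms])
  let ?Q = "quot_module V N"
  have sm: "c \<odot>\<^bsub>?Q\<^esub> (N +>\<^bsub>V\<^esub> v) = N +>\<^bsub>V\<^esub> (c \<odot>\<^bsub>V\<^esub> v)" if "c \<in> carrier k" "v \<in> carrier V" for c v
    using quot_smult[OF assms that] by (simp add: quot_module_def)
  have ad: "(N +>\<^bsub>V\<^esub> u) \<oplus>\<^bsub>?Q\<^esub> (N +>\<^bsub>V\<^esub> v) = N +>\<^bsub>V\<^esub> (u \<oplus>\<^bsub>V\<^esub> v)"
    if "u \<in> carrier V" "v \<in> carrier V" for u v
    using N.a_rcos_sum that by (simp add: quot_module_def)
  have z: "\<zero>\<^bsub>?Q\<^esub> = N +>\<^bsub>V\<^esub> \<zero>\<^bsub>V\<^esub>" by (simp add: quot_module_def N.a_subset)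
  have ag: "abelian_group ?Q"
  proof (rule abelian_groupI)
    fix x assume "x \<in> carrier ?Q"
    then obtain v where v: "v \<in> carrier V" "x = N +>\<^bsub>V\<^esub> v" by (auto simp: quot_module_simps rcosets_iff)
    then have "(N +>\<^bsub>V\<^esub> (\<ominus>\<^bsub>V\<^esub> v)) \<oplus>\<^bsub>?Q\<^esub> x = \<zero>\<^bsub>?Q\<^esub>" by (simp add: ad z V.M.l_neg del: V.M.a_coset_add_zero)
    then show "\<exists>y \<in> carrier ?Q. y \<oplus>\<^bsub>?Q\<^esub> x = \<zero>\<^bsub>?Q\<^esub>"
      using v by (intro bexI[of _ "N +>\<^bsub>V\<^esub> (\<ominus>\<^bsub>V\<^esub> v)"]) (auto simp: quot_module_simps rcosets_iff)
  qed (auto simp: quot_module_simps(1) rcosets_iff ad z V.M.a_ac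
      simp del: V.M.a_coset_add_zero)
  show "module k ?Q"
    by (rule moduleI[OF V.R.cring_axioms ag])
      (auto simp: quot_module_simps(1) rcosets_iff ad sm V.smult_l_distr V.smult_r_distr V.smult_assoc1)
  show "(\<lambda>v. N +>\<^bsub>V\<^esub> v) \<in> linear_maps k V ?Q"
    by (rule linear_mapsI) (auto simp: quot_module_simps(1) rcosets_iff ad sm)
qed

lemma kernel_submodule:
  assumes "module k X" "module k Y" "f \<in> linear_maps k X Y"
  shows "submodule {x \<in> carrier X. f x = \<zero>\<^bsub>Y\<^esub>} k X"
proof -
  interpret X: module k X by fact
  interpret Y: module k Y by fact
  show ?thesis
    by (rule X.submoduleI)
      (auto simp: linear_maps_zero[OF assms] linear_maps_minus[OF assms] linear_mapsD[OF assms(3)])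
qed


subsection \<open>Free modules\<close>

lemma free_module_simps:
  "carrier (free_module k S) = {f \<in> S \<rightarrow>\<^sub>E carrier k. finite {s \<in> S. f s \<noteq> \<zero>\<^bsub>k\<^esub>}}"
  "zero (free_module k S) = (\<lambda>s \<in> S. \<zero>\<^bsub>k\<^esub>)"
  "add (free_module k S) = (\<lambda>f g. \<lambda>s \<in> S. f s \<oplus>\<^bsub>k\<^esub> g s)"
  "smult (free_module k S) = (\<lambda>c f. \<lambda>s \<in> S. c \<otimes>\<^bsub>k\<^esub> f s)"
  by (simp_all add: free_module_def)

lemma free_module_module:
  assumes "cring k" shows "module k (free_module k S)"
proof -
  interpret cring k by fact
  let ?F = "free_module k S"
  have fin: "finite {s \<in> S. h s \<noteq> \<zero>\<^bsub>k\<^esub>}"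
    if "finite {s \<in> S. f s \<noteq> \<zero>\<^bsub>k\<^esub>}" "finite {s \<in> S. g s \<noteq> \<zero>\<^bsub>k\<^esub>}"
      "\<And>s. \<lbrakk>s \<in> S; f s = \<zero>\<^bsub>k\<^esub>; g s = \<zero>\<^bsub>k\<^esub>\<rbrakk> \<Longrightarrow> h s = \<zero>\<^bsub>k\<^esub>" for f g h
    by (rule finite_subset[OF _ finite_UnI[OF that(1,2)]]) (use that(3) in auto)
  have "abelian_group ?F"
  proof (rule abelian_groupI)
    fix f g assume f: "f \<in> carrier ?F" and g: "g \<in> carrier ?F"
    show "f \<oplus>\<^bsub>?F\<^esub> g \<in> carrier ?F"
      using f g fin[of f g "f \<oplus>\<^bsub>?F\<^esub> g"] by (auto simp: free_module_simps PiE_def Pi_def)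
    show "f \<oplus>\<^bsub>?F\<^esub> g = g \<oplus>\<^bsub>?F\<^esub> f"
      using f g by (auto simp: free_module_simps PiE_def Pi_def a_comm intro!: restrict_ext)
  next
    show "\<zero>\<^bsub>?F\<^esub> \<in> carrier ?F" by (auto simp: free_module_simps)
  next
    fix f g h assume "f \<in> carrier ?F" "g \<in> carrier ?F" "h \<in> carrier ?F"
    then show "f \<oplus>\<^bsub>?F\<^esub> g \<oplus>\<^bsub>?F\<^esub> h = f \<oplus>\<^bsub>?F\<^esub> (g \<oplus>\<^bsub>?F\<^esub> h)"
      by (auto simp: free_module_simps PiE_def Pi_def a_assoc intro!: restrict_ext)
  next
    fix f assume f: "f \<in> carrier ?F"
    then show "\<zero>\<^bsub>?F\<^esub> \<oplus>\<^bsub>?F\<^esub> f = f"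
      by (auto simp: free_module_simps PiE_def Pi_def intro!: extensionalityI[of _ S])
    let ?g = "\<lambda>s \<in> S. \<ominus>\<^bsub>k\<^esub> f s"
    have "?g \<in> carrier ?F"
      using f fin[of f f ?g] by (auto simp: free_module_simps PiE_def Pi_def)
    moreover have "?g \<oplus>\<^bsub>?F\<^esub> f = \<zero>\<^bsub>?F\<^esub>"
      using f by (auto simp: free_module_simps PiE_def Pi_def l_neg intro!: restrict_ext)
    ultimately show "\<exists>g \<in> carrier ?F. g \<oplus>\<^bsub>?F\<^esub> f = \<zero>\<^bsub>?F\<^esub>" by blast
  qed
  then show ?thesis
  proof (rule moduleI[OF assms])
    fix c f assume c: "c \<in> carrier k" and f: "f \<in> carrier ?F"
    show "c \<odot>\<^bsub>?F\<^esub> f \<in> carrier ?F"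
      using c f fin[of f f "c \<odot>\<^bsub>?F\<^esub> f"] by (auto simp: free_module_simps PiE_def Pi_def)
  qed (auto simp: free_module_simps PiE_def Pi_def l_distr r_distr m_assoc
      intro!: restrict_ext extensionalityI[of _ S])
qed

lemma delta_closed: "cring k \<Longrightarrow> delta k S s \<in> carrier (free_module k S)"
proof -
  assume "cring k"
  then interpret cring k .
  have "{t \<in> S. delta k S s t \<noteq> \<zero>\<^bsub>k\<^esub>} \<subseteq> {s}" by (auto simp: delta_def)
  then show ?thesis by (auto simp: free_module_simps delta_def intro: finite_subset)
qed

lemma free_module_induct [consumes 2, case_names zero delta add smult]:
  assumes "cring k" "f \<in> carrier (free_module k S)"
    and "Q \<zero>\<^bsub>free_module k S\<^esub>"
    and "\<And>s. s \<in> S \<Longrightarrow> Q (delta k S s)"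
    and "\<And>f g. \<lbrakk>f \<in> carrier (free_module k S); g \<in> carrier (free_module k S); Q f; Q g\<rbrakk> \<Longrightarrow>
           Q (f \<oplus>\<^bsub>free_module k S\<^esub> g)"
    and "\<And>c f. \<lbrakk>c \<in> carrier k; f \<in> carrier (free_module k S); Q f\<rbrakk> \<Longrightarrow> Q (c \<odot>\<^bsub>free_module k S\<^esub> f)"
  shows "Q f"
proof -
  interpret cring k by fact
  interpret F: module k "free_module k S" by (rule free_module_module) fact
  have "\<forall>f \<in> carrier (free_module k S). {s \<in> S. f s \<noteq> \<zero>\<^bsub>k\<^esub>} \<subseteq> B \<longrightarrow> Q f" if "finite B" for B
    using that
  proof (induction B rule: finite_induct)
    case empty
    show ?case
    proof (intro ballI impI)
      fix f assume "f \<in> carrier (free_module k S)" "{s \<in> S. f s \<noteq> \<zero>\<^bsub>k\<^esub>} \<subseteq> {}"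
      then have "f = \<zero>\<^bsub>free_module k S\<^esub>"
        by (auto simp: free_module_simps PiE_def intro!: extensionalityI[of _ S])
      then show "Q f" using assms(3) by simp
    qed
  next
    case (insert s B)
    show ?case
    proof (intro ballI impI)
      fix f assume f: "f \<in> carrier (free_module k S)" "{s \<in> S. f s \<noteq> \<zero>\<^bsub>k\<^esub>} \<subseteq> insert s B"
      let ?g = "\<lambda>t \<in> S. if t = s then \<zero>\<^bsub>k\<^esub> else f t"
      have "{t \<in> S. ?g t \<noteq> \<zero>\<^bsub>k\<^esub>} \<subseteq> {t \<in> S. f t \<noteq> \<zero>\<^bsub>k\<^esub>}" by auto
      moreover have "finite {t \<in> S. f t \<noteq> \<zero>\<^bsub>k\<^esub>}" using f(1) by (simp add: free_module_simps)
      ultimately have "finite {t \<in> S. ?g t \<noteq> \<zero>\<^bsub>k\<^esub>}" by (rule finite_subset)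
      then have g: "?g \<in> carrier (free_module k S)"
        using f(1) by (auto simp: free_module_simps PiE_def Pi_def)
      have "{t \<in> S. ?g t \<noteq> \<zero>\<^bsub>k\<^esub>} \<subseteq> B" using f(2) by auto
      then have Qg: "Q ?g" using insert.IH g by blast
      show "Q f"
      proof (cases "s \<in> S")
        case False
        then have "?g = f" using f(1)
          by (auto simp: free_module_simps PiE_def intro!: extensionalityI[of _ S])
        then show ?thesis using Qg by simp
      next
        case True
        then have fs: "f s \<in> carrier k" using f(1) by (auto simp: free_module_simps)
        have "f = f s \<odot>\<^bsub>free_module k S\<^esub> delta k S s \<oplus>\<^bsub>free_module k S\<^esub> ?g"
          using f(1) fs by (auto simp: free_module_simps PiE_def Pi_def delta_def
              intro!: extensionalityI[of _ S])
        moreover have "Q (f s \<odot>\<^bsub>free_module k S\<^esub> delta k S s \<oplus>\<^bsub>free_module k S\<^esub> ?g)"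
          by (intro assms(4)[OF True] assms(5,6) fs g Qg delta_closed[OF assms(1)] F.smult_closed)
        ultimately show ?thesis by simp
      qed
    qed
  qed
  moreover have "finite {s \<in> S. f s \<noteq> \<zero>\<^bsub>k\<^esub>}" using assms(2) by (simp add: free_module_simps)
  ultimately show ?thesis using assms(2) by blast
qed

text \<open>The linear extension of \<open>g\<close> to the free module; \<^const>\<open>pres_lift\<close> is the map that it induces on
  the quotient.\<close>

definition free_lift ::
  "('k, 'w) ring_scheme \<Rightarrow> 's set \<Rightarrow> ('k, 'y, 'u) module_scheme \<Rightarrow> ('s \<Rightarrow> 'y) \<Rightarrow> ('s \<Rightarrow> 'k) \<Rightarrow> 'y"
  where "free_lift k S Y g f = (\<Oplus>\<^bsub>Y\<^esub>s \<in> {s \<in> S. f s \<noteq> \<zero>\<^bsub>k\<^esub>}. f s \<odot>\<^bsub>Y\<^esub> g s)"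

lemma free_lift_superset:
  assumes "module k Y" "g \<in> S \<rightarrow> carrier Y" "f \<in> carrier (free_module k S)"
    and "finite B" "{s \<in> S. f s \<noteq> \<zero>\<^bsub>k\<^esub>} \<subseteq> B" "B \<subseteq> S"
  shows "free_lift k S Y g f = (\<Oplus>\<^bsub>Y\<^esub>s \<in> B. f s \<odot>\<^bsub>Y\<^esub> g s)"
proof -
  interpret Y: module k Y by fact
  show ?thesis unfolding free_lift_def
    by (rule Y.M.add.finprod_mono_neutral_cong_left)
      (use assms(2-6) in \<open>auto simp: free_module_simps PiE_def Pi_def subset_iff\<close>)
qed

lemma free_lift_linear:
  assumes "module k Y" "g \<in> S \<rightarrow> carrier Y"
  shows "free_lift k S Y g \<in> linear_maps k (free_module k S) Y"
proof -
  interpret Y: module k Y by fact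
  interpret F: module k "free_module k S" by (rule free_module_module) (rule Y.R.cring_axioms)
  have gc: "g s \<in> carrier Y" if "s \<in> S" for s using assms(2) that by blast
  have fc: "f s \<in> carrier k" if "f \<in> carrier (free_module k S)" "s \<in> S" for f s
    using that by (auto simp: free_module_simps)
  have fin: "finite {s \<in> S. f s \<noteq> \<zero>\<^bsub>k\<^esub>}" if "f \<in> carrier (free_module k S)" for f
    using that by (auto simp: free_module_simps)
  show ?thesis
  proof (rule linear_mapsI)
    fix f assume "f \<in> carrier (free_module k S)"
    then show "free_lift k S Y g f \<in> carrier Y"
      unfolding free_lift_def using gc fc by (intro Y.M.finsum_closed) auto
  next
    fix f f' assume f: "f \<in> carrier (free_module k S)" and f': "f' \<in> carrier (free_module k S)"
    let ?h = "f \<oplus>\<^bsub>free_module k S\<^esub> f'"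
    let ?B = "{s \<in> S. f s \<noteq> \<zero>\<^bsub>k\<^esub>} \<union> {s \<in> S. f' s \<noteq> \<zero>\<^bsub>k\<^esub>}"
    have B: "finite ?B" "?B \<subseteq> S" using fin f f' by auto
    have "free_lift k S Y g ?h = (\<Oplus>\<^bsub>Y\<^esub>s \<in> ?B. ?h s \<odot>\<^bsub>Y\<^esub> g s)"
      by (rule free_lift_superset[OF assms F.M.a_closed[OF f f'] B(1) _ B(2)])
        (auto simp: free_module_simps)
    also have "\<dots> = (\<Oplus>\<^bsub>Y\<^esub>s \<in> ?B. f s \<odot>\<^bsub>Y\<^esub> g s \<oplus>\<^bsub>Y\<^esub> f' s \<odot>\<^bsub>Y\<^esub> g s)"
      using B(2) gc fc[OF f] fc[OF f']
      by (intro Y.M.finsum_cong') (auto simp: free_module_simps Y.smult_l_distr)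
    also have "\<dots> = (\<Oplus>\<^bsub>Y\<^esub>s \<in> ?B. f s \<odot>\<^bsub>Y\<^esub> g s) \<oplus>\<^bsub>Y\<^esub> (\<Oplus>\<^bsub>Y\<^esub>s \<in> ?B. f' s \<odot>\<^bsub>Y\<^esub> g s)"
      using B(2) gc fc[OF f] fc[OF f'] by (intro Y.M.finsum_addf) auto
    also have "(\<Oplus>\<^bsub>Y\<^esub>s \<in> ?B. f s \<odot>\<^bsub>Y\<^esub> g s) = free_lift k S Y g f"
      by (rule free_lift_superset[OF assms f B(1) _ B(2), symmetric]) auto
    also have "(\<Oplus>\<^bsub>Y\<^esub>s \<in> ?B. f' s \<odot>\<^bsub>Y\<^esub> g s) = free_lift k S Y g f'"
      by (rule free_lift_superset[OF assms f' B(1) _ B(2), symmetric]) auto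
    finally show "free_lift k S Y g ?h = free_lift k S Y g f \<oplus>\<^bsub>Y\<^esub> free_lift k S Y g f'" .
  next
    fix c f assume c: "c \<in> carrier k" and f: "f \<in> carrier (free_module k S)"
    let ?h = "c \<odot>\<^bsub>free_module k S\<^esub> f"
    let ?B = "{s \<in> S. f s \<noteq> \<zero>\<^bsub>k\<^esub>}"
    have "free_lift k S Y g ?h = (\<Oplus>\<^bsub>Y\<^esub>s \<in> ?B. ?h s \<odot>\<^bsub>Y\<^esub> g s)"
      by (rule free_lift_superset[OF assms F.smult_closed[OF c f] fin[OF f]])
        (use c in \<open>auto simp: free_module_simps\<close>)
    also have "\<dots> = (\<Oplus>\<^bsub>Y\<^esub>s \<in> ?B. c \<odot>\<^bsub>Y\<^esub> (f s \<odot>\<^bsub>Y\<^esub> g s))"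
      using gc fc[OF f] c
      by (intro Y.M.finsum_cong') (auto simp: free_module_simps Y.smult_assoc1)
    also have "\<dots> = c \<odot>\<^bsub>Y\<^esub> free_lift k S Y g f" unfolding free_lift_def
      using gc fc[OF f] by (intro Y.finsum_smult_ldistr[symmetric] fin f c) auto
    finally show "free_lift k S Y g ?h = c \<odot>\<^bsub>Y\<^esub> free_lift k S Y g f" .
  qed
qed

lemma free_lift_delta:
  assumes "module k Y" "g \<in> S \<rightarrow> carrier Y" "s \<in> S"
  shows "free_lift k S Y g (delta k S s) = g s"
proof -
  interpret Y: module k Y by fact
  have "free_lift k S Y g (delta k S s) = (\<Oplus>\<^bsub>Y\<^esub>t \<in> {s}. delta k S s t \<odot>\<^bsub>Y\<^esub> g t)"
    by (rule free_lift_superset[OF assms(1,2) delta_closed[OF Y.R.cring_axioms]])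
      (use assms(3) in \<open>auto simp: delta_def\<close>)
  moreover have "g s \<in> carrier Y" using assms(2,3) by blast
  ultimately show ?thesis
    using assms(3) Y.M.finsum_insert[of "{}" s "\<lambda>t. delta k S s t \<odot>\<^bsub>Y\<^esub> g t"]
    by (simp add: delta_def)
qed


subsection \<open>Presentations\<close>

lemma rel_closed:
  assumes "cring k"
  shows "rel_add k S s t u \<in> carrier (free_module k S)"
    and "c \<in> carrier k \<Longrightarrow> rel_smult k S c s t \<in> carrier (free_module k S)"
    and "rel_eq k S s t \<in> carrier (free_module k S)"
proof -
  interpret F: module k "free_module k S" by (rule free_module_module) fact
  show "rel_add k S s t u \<in> carrier (free_module k S)"
    "c \<in> carrier k \<Longrightarrow> rel_smult k S c s t \<in> carrier (free_module k S)"
    "rel_eq k S s t \<in> carrier (free_module k S)"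
    by (auto simp: rel_add_def rel_smult_def rel_eq_def delta_closed[OF assms])
qed

lemma linear_rel:
  assumes "module k Y" "f \<in> linear_maps k (free_module k S) Y"
  shows "f (rel_add k S s t u) = \<zero>\<^bsub>Y\<^esub> \<longleftrightarrow> f (delta k S s) \<oplus>\<^bsub>Y\<^esub> f (delta k S t) = f (delta k S u)"
    and "c \<in> carrier k \<Longrightarrow>
      f (rel_smult k S c s t) = \<zero>\<^bsub>Y\<^esub> \<longleftrightarrow> c \<odot>\<^bsub>Y\<^esub> f (delta k S s) = f (delta k S t)"
    and "f (rel_eq k S s t) = \<zero>\<^bsub>Y\<^esub> \<longleftrightarrow> f (delta k S s) = f (delta k S t)"
proof -
  interpret Y: module k Y by fact
  have F: "module k (free_module k S)" by (rule free_module_module) (rule Y.R.cring_axioms)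
  interpret F: module k "free_module k S" by (rule F)
  note d = delta_closed[OF Y.R.cring_axioms, of S]
  note l = linear_mapsD[OF assms(2)] linear_maps_diff[OF F assms]
  have z: "x \<ominus>\<^bsub>Y\<^esub> y = \<zero>\<^bsub>Y\<^esub> \<longleftrightarrow> x = y" if "x \<in> carrier Y" "y \<in> carrier Y" for x y
    using that by (simp add: a_minus_def Y.M.add.inv_solve_right')
  show "f (rel_add k S s t u) = \<zero>\<^bsub>Y\<^esub> \<longleftrightarrow> f (delta k S s) \<oplus>\<^bsub>Y\<^esub> f (delta k S t) = f (delta k S u)"
    by (simp add: rel_add_def l d z)
  show "c \<in> carrier k \<Longrightarrow>
      f (rel_smult k S c s t) = \<zero>\<^bsub>Y\<^esub> \<longleftrightarrow> c \<odot>\<^bsub>Y\<^esub> f (delta k S s) = f (delta k S t)"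
    by (simp add: rel_smult_def l d z)
  show "f (rel_eq k S s t) = \<zero>\<^bsub>Y\<^esub> \<longleftrightarrow> f (delta k S s) = f (delta k S t)"
    by (simp add: rel_eq_def l d z)
qed

lemma free_lift_rel:
  assumes "module k Y" "g \<in> S \<rightarrow> carrier Y" "s \<in> S" "t \<in> S"
  shows "\<lbrakk>u \<in> S; g s \<oplus>\<^bsub>Y\<^esub> g t = g u\<rbrakk> \<Longrightarrow> free_lift k S Y g (rel_add k S s t u) = \<zero>\<^bsub>Y\<^esub>"
    and "\<lbrakk>c \<in> carrier k; c \<odot>\<^bsub>Y\<^esub> g s = g t\<rbrakk> \<Longrightarrow> free_lift k S Y g (rel_smult k S c s t) = \<zero>\<^bsub>Y\<^esub>"
    and "g s = g t \<Longrightarrow> free_lift k S Y g (rel_eq k S s t) = \<zero>\<^bsub>Y\<^esub>"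
  using linear_rel[OF assms(1) free_lift_linear[OF assms(1,2)]] free_lift_delta[OF assms(1,2)]
    assms(3,4) by auto

context
  fixes k :: "('k, 'w) ring_scheme" and S :: "'s set" and G :: "('s \<Rightarrow> 'k) set"
  assumes k: "cring k" and G: "G \<subseteq> carrier (free_module k S)"
begin

interpretation F: module k "free_module k S" by (rule free_module_module) (rule k)

lemma gen_sub: "submodule (gen_submodule k (free_module k S) G) k (free_module k S)"
  by (rule gen_submodule_submodule[OF F.module_axioms G])

lemma pres_module_module: "module k (pres_module k S G)"
  unfolding pres_module_def by (rule quot_module_module(1)[OF F.module_axioms gen_sub])

lemma pres_proj_linear:
  "(\<lambda>f. gen_submodule k (free_module k S) G +>\<^bsub>free_module k S\<^esub> f)
     \<in> linear_maps k (free_module k S) (pres_module k S G)"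
  unfolding pres_module_def by (rule quot_module_module(2)[OF F.module_axioms gen_sub])

lemma pres_class_closed: "pres_class k S G s \<in> carrier (pres_module k S G)"
  unfolding pres_class_def by (rule linear_maps_closed[OF pres_proj_linear delta_closed[OF k]])

lemma pres_proj_rel: "w \<in> G \<Longrightarrow>
    gen_submodule k (free_module k S) G +>\<^bsub>free_module k S\<^esub> w = \<zero>\<^bsub>pres_module k S G\<^esub>"
  using abelian_subgroup.a_rcos_const[OF submodule_abelian_subgroup[OF F.module_axioms gen_sub]]
    gen_submodule_incl[of G] by (auto simp: pres_module_def quot_module_simps)

lemma pres_class_add: "rel_add k S s t u \<in> G \<Longrightarrow>
    pres_class k S G s \<oplus>\<^bsub>pres_module k S G\<^esub> pres_class k S G t = pres_class k S G u"
  unfolding pres_class_def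
  by (rule linear_rel(1)[OF pres_module_module pres_proj_linear, THEN iffD1, rotated -1, OF pres_proj_rel])

lemma pres_class_smult: "\<lbrakk>rel_smult k S c s t \<in> G; c \<in> carrier k\<rbrakk> \<Longrightarrow>
    c \<odot>\<^bsub>pres_module k S G\<^esub> pres_class k S G s = pres_class k S G t"
  unfolding pres_class_def
  by (rule linear_rel(2)[OF pres_module_module pres_proj_linear, THEN iffD1, rotated -1, OF pres_proj_rel])

lemma pres_class_eq: "rel_eq k S s t \<in> G \<Longrightarrow> pres_class k S G s = pres_class k S G t"
  unfolding pres_class_def
  by (rule linear_rel(3)[OF pres_module_module pres_proj_linear, THEN iffD1, rotated -1, OF pres_proj_rel])

lemma pres_carrier_iff: "U \<in> carrier (pres_module k S G) \<longleftrightarrow>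
    (\<exists>f \<in> carrier (free_module k S). U = gen_submodule k (free_module k S) G +>\<^bsub>free_module k S\<^esub> f)"
  by (simp add: pres_module_def quot_module_simps rcosets_iff)

lemma pres_module_induct [consumes 1, case_names gen add smult]:
  assumes U: "U \<in> carrier (pres_module k S G)"
    and cl: "\<And>s. s \<in> S \<Longrightarrow> Q (pres_class k S G s)"
    and ad: "\<And>U W. \<lbrakk>U \<in> carrier (pres_module k S G); W \<in> carrier (pres_module k S G); Q U; Q W\<rbrakk> \<Longrightarrow>
           Q (U \<oplus>\<^bsub>pres_module k S G\<^esub> W)"
    and sm: "\<And>c U. \<lbrakk>c \<in> carrier k; U \<in> carrier (pres_module k S G); Q U\<rbrakk> \<Longrightarrow>
           Q (c \<odot>\<^bsub>pres_module k S G\<^esub> U)"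
    and S: "S \<noteq> {}"
  shows "Q U"
proof -
  interpret P: module k "pres_module k S G" by (rule pres_module_module)
  obtain f where f: "f \<in> carrier (free_module k S)"
    "U = gen_submodule k (free_module k S) G +>\<^bsub>free_module k S\<^esub> f"
    using U pres_carrier_iff by blast
  obtain s where "s \<in> S" using S by blast
  then have Q0: "Q \<zero>\<^bsub>pres_module k S G\<^esub>"
    using sm[OF F.R.zero_closed pres_class_closed cl] pres_class_closed by simp
  have "Q (gen_submodule k (free_module k S) G +>\<^bsub>free_module k S\<^esub> f)"
    using k f(1)
  proof (induction f rule: free_module_induct)
    case zero
    then show ?case using linear_maps_zero[OF F.module_axioms pres_module_module pres_proj_linear] Q0
      by simp
  next
    case (delta s)
    then show ?case using cl by (simp add: pres_class_def)
  next
    case (add f g)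
    then show ?case using ad linear_mapsD[OF pres_proj_linear] by simp
  next
    case (smult c f)
    then show ?case using sm linear_mapsD[OF pres_proj_linear] by simp
  qed
  then show ?thesis using f(2) by simp
qed

context
  fixes Y :: "('k, 'y, 'v) module_scheme" and g :: "'s \<Rightarrow> 'y"
  assumes Y: "module k Y" and g: "g \<in> S \<rightarrow> carrier Y"
    and kill: "\<And>w. w \<in> G \<Longrightarrow> free_lift k S Y g w = \<zero>\<^bsub>Y\<^esub>"
begin

text \<open>The linear extension of \<open>g\<close> kills the relations, hence the submodule that they generate, and is
  therefore constant on cosets. So the image of a coset is a singleton, whose element
  \<^const>\<open>pres_lift\<close> picks.\<close>

lemma pres_lift_coset:
  assumes f: "f \<in> carrier (free_module k S)"
  shows "pres_lift k S Y g (gen_submodule k (free_module k S) G +>\<^bsub>free_module k S\<^esub> f) =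
    free_lift k S Y g f"
proof -
  interpret Y: module k Y by (rule Y)
  let ?N = "gen_submodule k (free_module k S) G"
  interpret N: abelian_subgroup ?N "free_module k S"
    by (rule submodule_abelian_subgroup[OF F.module_axioms gen_sub])
  note lin = free_lift_linear[OF Y g]
  have "?N \<subseteq> {f \<in> carrier (free_module k S). free_lift k S Y g f = \<zero>\<^bsub>Y\<^esub>}"
    by (rule gen_submodule_minimal[OF kernel_submodule[OF F.module_axioms Y lin]])
      (use G kill in auto)
  then have kill_N: "n \<in> carrier (free_module k S)" "free_lift k S Y g n = \<zero>\<^bsub>Y\<^esub>" if "n \<in> ?N" for n
    using that by blast+
  have "free_lift k S Y g u = free_lift k S Y g f" if u: "u \<in> ?N +>\<^bsub>free_module k S\<^esub> f" for u
  proof -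
    obtain n where n: "n \<in> ?N" "u = n \<oplus>\<^bsub>free_module k S\<^esub> f" using u by (auto simp: a_r_coset_def')
    then show ?thesis
      using kill_N[OF n(1)] f linear_maps_add[OF lin] linear_maps_closed[OF lin] by simp
  qed
  moreover have "f \<in> ?N +>\<^bsub>free_module k S\<^esub> f" using N.a_rcos_self f by blast
  ultimately have "free_lift k S Y g ` (?N +>\<^bsub>free_module k S\<^esub> f) = {free_lift k S Y g f}" by blast
  then show ?thesis by (simp add: pres_lift_def free_lift_def[abs_def])
qed

lemma pres_lift_linear: "pres_lift k S Y g \<in> linear_maps k (pres_module k S G) Y"
proof -
  note lin = linear_mapsD[OF free_lift_linear[OF Y g]]
  note pro = linear_mapsD(2,3)[OF pres_proj_linear, symmetric]
  show ?thesis
    by (rule linear_mapsI) (auto simp: pres_carrier_iff pres_lift_coset lin pro)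
qed

lemma pres_lift_class: "s \<in> S \<Longrightarrow> pres_lift k S Y g (pres_class k S G s) = g s"
  unfolding pres_class_def
  by (simp add: pres_lift_coset delta_closed[OF k] free_lift_delta[OF Y g])

end

end

lemmas presented_induct = pres_module_induct[consumes 3, case_names gen add smult nonempty]

section \<open>Bimodules\<close>

subsection \<open>Linearity of the actions\<close>

context bimodule
begin

lemma lact_smult_left:
  "\<lbrakk>c \<in> carrier k; r \<in> carrier R; x \<in> carrier X\<rbrakk> \<Longrightarrow> lact X (c \<odot>\<^bsub>R\<^esub> r) x = c \<odot>\<^bsub>X\<^esub> lact X r x"
  using lact_mult[of "c \<odot>\<^bsub>R\<^esub> \<one>\<^bsub>R\<^esub>" r x] left.smult_mult_left[of c "\<one>\<^bsub>R\<^esub>" r] lact_scalar lact_closed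
  by simp

lemma lact_smult_right:
  "\<lbrakk>c \<in> carrier k; r \<in> carrier R; x \<in> carrier X\<rbrakk> \<Longrightarrow> lact X r (c \<odot>\<^bsub>X\<^esub> x) = c \<odot>\<^bsub>X\<^esub> lact X r x"
  using lact_mult[of r "c \<odot>\<^bsub>R\<^esub> \<one>\<^bsub>R\<^esub>" x] left.smult_mult_right[of c r "\<one>\<^bsub>R\<^esub>"] lact_scalar
    lact_smult_left
  by simp

lemma ract_smult_left:
  "\<lbrakk>c \<in> carrier k; s \<in> carrier S; x \<in> carrier X\<rbrakk> \<Longrightarrow> ract X (c \<odot>\<^bsub>X\<^esub> x) s = c \<odot>\<^bsub>X\<^esub> ract X x s"
  using ract_mult[of x "c \<odot>\<^bsub>S\<^esub> \<one>\<^bsub>S\<^esub>" s] ract_mult[of x s "c \<odot>\<^bsub>S\<^esub> \<one>\<^bsub>S\<^esub>"]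
    right.smult_mult_left[of c "\<one>\<^bsub>S\<^esub>" s] right.smult_mult_right[of c s "\<one>\<^bsub>S\<^esub>"] ract_scalar ract_closed
  by simp

lemma ract_smult_right:
  "\<lbrakk>c \<in> carrier k; s \<in> carrier S; x \<in> carrier X\<rbrakk> \<Longrightarrow> ract X x (c \<odot>\<^bsub>S\<^esub> s) = c \<odot>\<^bsub>X\<^esub> ract X x s"
  using ract_mult[of x s "c \<odot>\<^bsub>S\<^esub> \<one>\<^bsub>S\<^esub>"] right.smult_mult_right[of c s "\<one>\<^bsub>S\<^esub>"] ract_scalar ract_closed
  by simp

lemma lact_linear: "r \<in> carrier R \<Longrightarrow> lact X r \<in> linear_maps k X X"
  by (rule linear_mapsI) (auto simp: lact_closed lact_add_right lact_smult_right)

lemma ract_linear: "s \<in> carrier S \<Longrightarrow> (\<lambda>x. ract X x s) \<in> linear_maps k X X"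
  by (rule linear_mapsI) (auto simp: ract_closed ract_add_left ract_smult_left)

lemma lact_linear_left: "x \<in> carrier X \<Longrightarrow> (\<lambda>r. lact X r x) \<in> linear_maps k R X"
  by (rule linear_mapsI) (auto simp: lact_closed lact_add_left lact_smult_left)

lemma ract_linear_right: "x \<in> carrier X \<Longrightarrow> ract X x \<in> linear_maps k S X"
  by (rule linear_mapsI) (auto simp: ract_closed ract_add_right ract_smult_right)

lemmas lact_zero = linear_maps_zero[OF module_axioms module_axioms lact_linear]
lemmas ract_zero = linear_maps_zero[OF module_axioms module_axioms ract_linear]

end


subsection \<open>Algebra homomorphisms\<close>

definition alg_hom ::
  "('k, 'w) ring_scheme \<Rightarrow> ('k, 'r, 'u) module_scheme \<Rightarrow> ('k, 's, 'v) module_scheme \<Rightarrow> ('r \<Rightarrow> 's) set"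
  where "alg_hom k R S = {h \<in> ring_hom R S. h \<in> linear_maps k R S}"

lemma alg_homI:
  assumes "h \<in> linear_maps k R S"
    and "\<And>x y. \<lbrakk>x \<in> carrier R; y \<in> carrier R\<rbrakk> \<Longrightarrow> h (x \<otimes>\<^bsub>R\<^esub> y) = h x \<otimes>\<^bsub>S\<^esub> h y"
    and "h \<one>\<^bsub>R\<^esub> = \<one>\<^bsub>S\<^esub>"
  shows "h \<in> alg_hom k R S"
  using assms unfolding alg_hom_def linear_maps_def ring_hom_def by auto

lemma alg_homD:
  assumes "h \<in> alg_hom k R S"
  shows alg_hom_linear: "h \<in> linear_maps k R S"
    and alg_hom_closed: "x \<in> carrier R \<Longrightarrow> h x \<in> carrier S"
    and alg_hom_add: "\<lbrakk>x \<in> carrier R; y \<in> carrier R\<rbrakk> \<Longrightarrow> h (x \<oplus>\<^bsub>R\<^esub> y) = h x \<oplus>\<^bsub>S\<^esub> h y"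
    and alg_hom_smult: "\<lbrakk>c \<in> carrier k; x \<in> carrier R\<rbrakk> \<Longrightarrow> h (c \<odot>\<^bsub>R\<^esub> x) = c \<odot>\<^bsub>S\<^esub> h x"
    and alg_hom_mult: "\<lbrakk>x \<in> carrier R; y \<in> carrier R\<rbrakk> \<Longrightarrow> h (x \<otimes>\<^bsub>R\<^esub> y) = h x \<otimes>\<^bsub>S\<^esub> h y"
    and alg_hom_one: "h \<one>\<^bsub>R\<^esub> = \<one>\<^bsub>S\<^esub>"
  using assms unfolding alg_hom_def linear_maps_def ring_hom_def by auto

lemma alg_hom_compose:
  "\<lbrakk>f \<in> alg_hom k R S; g \<in> alg_hom k S T\<rbrakk> \<Longrightarrow> (\<lambda>x. g (f x)) \<in> alg_hom k R T"
  by (rule alg_homI) (auto simp: alg_homD linear_maps_compose[OF alg_hom_linear alg_hom_linear])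

lemma id_alg_hom: "(\<lambda>x. x) \<in> alg_hom k R R"
  by (auto intro!: alg_homI linear_mapsI)

lemma id_alg_hom': "id \<in> alg_hom k R R"
  by (auto intro!: alg_homI linear_mapsI)

lemma alg_iso_iff:
  "h \<in> alg_iso k R S \<longleftrightarrow> h \<in> alg_hom k R S \<and> bij_betw h (carrier R) (carrier S)"
  unfolding alg_iso_def alg_hom_def ring_iso_def linear_maps_def ring_hom_def by auto


subsection \<open>Constructions of bimodules\<close>

lemma alg_bimodule_simps:
  "carrier (alg_bimodule R f g) = carrier R" "zero (alg_bimodule R f g) = zero R"
  "add (alg_bimodule R f g) = add R" "smult (alg_bimodule R f g) = smult R"
  "lact (alg_bimodule R f g) = (\<lambda>p x. f p \<otimes>\<^bsub>R\<^esub> x)" "ract (alg_bimodule R f g) = (\<lambda>x q. x \<otimes>\<^bsub>R\<^esub> g q)"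
  by (simp_all add: alg_bimodule_def)

lemma alg_bimodule_bimodule:
  assumes "k_algebra k P" "k_algebra k Q" "k_algebra k R" "f \<in> alg_hom k P R" "g \<in> alg_hom k Q R"
  shows "bimodule k P Q (alg_bimodule R f g)"
proof -
  interpret P: k_algebra k P by fact
  interpret Q: k_algebra k Q by fact
  interpret R: k_algebra k R by fact
  have m: "module k (alg_bimodule R f g)"
    by (rule module_cong[OF R.module_axioms]) (simp_all add: alg_bimodule_simps)
  show ?thesis
    by (intro bimodule.intro bimodule_axioms.intro assms(1,2) m; unfold alg_bimodule_simps)
      (simp_all add: alg_homD[OF assms(4)] alg_homD[OF assms(5)] R.l_distr R.r_distr R.m_assoc
        R.smult_mult_left R.smult_mult_right)
qed

lemma scalars_k_algebra: "cring k \<Longrightarrow> k_algebra k (scalars k)"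
proof -
  assume k: "cring k"
  then interpret cring k .
  have "ring (scalars k)"
    by (rule ringI)
      (auto intro!: monoidI simp: abelian_group_cong[OF abelian_group_axioms] m_assoc l_distr r_distr)
  then show ?thesis
    by (intro k_algebra.intro k_algebra_axioms.intro module_scalars k)
      (auto simp: m_assoc m_lcomm)
qed

text \<open>With one action restricted to \<open>k\<close>, a bimodule can be tensored over \<open>k\<close> and still carries the other
  action.\<close>

definition forget_right ::
  "('k, 'r, 's, 'x, 'u) bimodule_scheme \<Rightarrow> ('k, 'r, 'k, 'x) bimodule"
  where "forget_right X = \<lparr>carrier = carrier X, mult = undefined, one = undefined, zero = zero X,
    add = add X, smult = smult X, lact = lact X, ract = (\<lambda>x c. c \<odot>\<^bsub>X\<^esub> x)\<rparr>"

definition forget_left ::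
  "('k, 'r, 's, 'x, 'u) bimodule_scheme \<Rightarrow> ('k, 'k, 's, 'x) bimodule"
  where "forget_left X = \<lparr>carrier = carrier X, mult = undefined, one = undefined, zero = zero X,
    add = add X, smult = smult X, lact = smult X, ract = ract X\<rparr>"

lemma forget_simps [simp]:
  "carrier (forget_right X) = carrier X" "zero (forget_right X) = zero X"
  "add (forget_right X) = add X" "smult (forget_right X) = smult X"
  "lact (forget_right X) = lact X" "ract (forget_right X) = (\<lambda>x c. c \<odot>\<^bsub>X\<^esub> x)"
  "carrier (forget_left X) = carrier X" "zero (forget_left X) = zero X"
  "add (forget_left X) = add X" "smult (forget_left X) = smult X"
  "lact (forget_left X) = smult X" "ract (forget_left X) = ract X"
  by (simp_all add: forget_right_def forget_left_def)

lemma forget_bimodule: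
  assumes "bimodule k R S X"
  shows "bimodule k R (scalars k) (forget_right X)" "bimodule k (scalars k) S (forget_left X)"
proof -
  interpret bimodule k R S X by fact
  have r: "module k (forget_right X)" and l: "module k (forget_left X)"
    by (rule module_cong[OF module_axioms]; simp)+
  note k = scalars_k_algebra[OF left.R.cring_axioms]
  have comm: "c \<odot>\<^bsub>X\<^esub> (d \<odot>\<^bsub>X\<^esub> x) = d \<odot>\<^bsub>X\<^esub> (c \<odot>\<^bsub>X\<^esub> x)"
    if "c \<in> carrier k" "d \<in> carrier k" "x \<in> carrier X" for c d x
    using that smult_assoc1[of c d x] smult_assoc1[of d c x] by (simp add: left.R.m_comm)
  show "bimodule k R (scalars k) (forget_right X)"
    by (intro bimodule.intro bimodule_axioms.intro left.k_algebra_axioms k r)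
      (simp_all add: lact_closed lact_add_left lact_add_right smult_l_distr smult_r_distr lact_mult
        lact_one lact_scalar lact_smult_right smult_assoc1 comm)
  show "bimodule k (scalars k) S (forget_left X)"
    by (intro bimodule.intro bimodule_axioms.intro right.k_algebra_axioms k l)
      (simp_all add: ract_closed ract_add_left ract_add_right smult_l_distr smult_r_distr ract_mult
        ract_one ract_scalar ract_smult_left smult_assoc1)
qed

lemma dual_simps:
  "carrier (dual k X) = functionals k X" "zero (dual k X) = (\<lambda>x \<in> carrier X. \<zero>\<^bsub>k\<^esub>)"
  "add (dual k X) = (\<lambda>f g. \<lambda>x \<in> carrier X. f x \<oplus>\<^bsub>k\<^esub> g x)"
  "smult (dual k X) = (\<lambda>c f. \<lambda>x \<in> carrier X. c \<otimes>\<^bsub>k\<^esub> f x)"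
  "lact (dual k X) = (\<lambda>s f. \<lambda>x \<in> carrier X. f (ract X x s))"
  "ract (dual k X) = (\<lambda>f r. \<lambda>x \<in> carrier X. f (lact X r x))"
  by (simp_all add: dual_def)

lemma dual_module:
  assumes "module k X" shows "module k (dual k X)"
proof -
  interpret X: module k X by fact
  interpret K: module k "scalars k" by (rule module_scalars) (rule X.R.cring_axioms)
  have c: "f x \<in> carrier k" if "f \<in> functionals k X" "x \<in> carrier X" for f x
    using that by (auto simp: functionals_def)
  have eq: "(\<lambda>x \<in> carrier X. g x) = f"
    if "f \<in> functionals k X" "\<And>x. x \<in> carrier X \<Longrightarrow> g x = f x" for f g
    using that by (auto simp: functionals_def PiE_def intro!: extensionalityI[of _ "carrier X"])
  have ad: "(\<lambda>x \<in> carrier X. f x \<oplus>\<^bsub>k\<^esub> g x) \<in> functionals k X"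
    if "f \<in> functionals k X" "g \<in> functionals k X" for f g
    by (rule restrict_functional[OF assms])
      (use that in \<open>auto intro!: linear_mapsI
        simp: functionals_def X.R.a_ac X.R.r_distr Pi_def PiE_def\<close>)
  have "abelian_group (dual k X)"
  proof (rule abelian_groupI; unfold dual_simps)
    show "(\<lambda>x \<in> carrier X. \<zero>\<^bsub>k\<^esub>) \<in> functionals k X"
      by (rule restrict_functional[OF assms]) (auto intro!: linear_mapsI)
  next
    fix f assume f: "f \<in> functionals k X"
    have "(\<lambda>x \<in> carrier X. \<ominus>\<^bsub>k\<^esub> f x) \<in> functionals k X"
      by (rule restrict_functional[OF assms])
        (use f in \<open>auto intro!: linear_mapsI
          simp: functionals_def X.R.minus_add X.R.r_minus Pi_def PiE_def\<close>)
    moreover have "(\<lambda>x \<in> carrier X. (\<lambda>x \<in> carrier X. \<ominus>\<^bsub>k\<^esub> f x) x \<oplus>\<^bsub>k\<^esub> f x) = (\<lambda>x \<in> carrier X. \<zero>\<^bsub>k\<^esub>)"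
      using c[OF f] by (auto intro!: restrict_ext simp: X.R.l_neg)
    ultimately show "\<exists>g \<in> functionals k X. (\<lambda>x \<in> carrier X. g x \<oplus>\<^bsub>k\<^esub> f x) = (\<lambda>x \<in> carrier X. \<zero>\<^bsub>k\<^esub>)"
      by blast
  qed (auto intro!: restrict_ext eq simp: ad c X.R.a_ac)
  then show ?thesis
  proof (rule moduleI[OF X.R.cring_axioms]; unfold dual_simps)
    fix a f assume "a \<in> carrier k" "f \<in> functionals k X"
    then show "(\<lambda>x \<in> carrier X. a \<otimes>\<^bsub>k\<^esub> f x) \<in> functionals k X"
      by (intro restrict_functional[OF assms])
        (auto intro!: linear_mapsI simp: functionals_def X.R.r_distr X.R.m_lcomm Pi_def PiE_def)
  qed (auto intro!: restrict_ext eq simp: c X.R.l_distr X.R.r_distr X.R.m_assoc)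
qed

lemma functionals_eval_simps:
  assumes "f \<in> functionals k X"
  shows "x \<in> carrier X \<Longrightarrow> f x \<in> carrier k"
    and "\<lbrakk>x \<in> carrier X; y \<in> carrier X\<rbrakk> \<Longrightarrow> f (x \<oplus>\<^bsub>X\<^esub> y) = f x \<oplus>\<^bsub>k\<^esub> f y"
    and "\<lbrakk>c \<in> carrier k; x \<in> carrier X\<rbrakk> \<Longrightarrow> f (c \<odot>\<^bsub>X\<^esub> x) = c \<otimes>\<^bsub>k\<^esub> f x"
  using assms by (auto simp: functionals_def)

lemma dual_bimodule:
  assumes "bimodule k R S X" shows "bimodule k S R (dual k X)"
proof -
  interpret bimodule k R S X by fact
  have eq: "(\<lambda>x \<in> carrier X. g x) = f"
    if "f \<in> functionals k X" "\<And>x. x \<in> carrier X \<Longrightarrow> g x = f x" for f g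
    using that by (auto simp: functionals_def PiE_def intro!: extensionalityI[of _ "carrier X"])
  show ?thesis
  proof (intro bimodule.intro bimodule_axioms.intro left.k_algebra_axioms right.k_algebra_axioms
      dual_module module_axioms; unfold dual_simps)
    fix s f assume "s \<in> carrier S" "f \<in> functionals k X"
    then show "(\<lambda>x \<in> carrier X. f (ract X x s)) \<in> functionals k X"
      by (intro restrict_functional[OF module_axioms] linear_mapsI)
        (auto simp: functionals_eval_simps ract_closed ract_add_left ract_smult_left)
  next
    fix r f assume "r \<in> carrier R" "f \<in> functionals k X"
    then show "(\<lambda>x \<in> carrier X. f (lact X r x)) \<in> functionals k X"
      by (intro restrict_functional[OF module_axioms] linear_mapsI)
        (auto simp: functionals_eval_simps lact_closed lact_add_right lact_smult_right)
  qed (auto intro!: restrict_ext eq simp: functionals_eval_simps lact_closed ract_closed lact_ract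
      lact_mult ract_mult lact_one ract_one lact_add_left ract_add_right
      lact_smult_left ract_smult_right)
qed

lemma dsum_simps:
  "carrier (bimodule_dsum X Y) = carrier X \<times> carrier Y"
  "zero (bimodule_dsum X Y) = (\<zero>\<^bsub>X\<^esub>, \<zero>\<^bsub>Y\<^esub>)"
  "add (bimodule_dsum X Y) (x, y) (x', y') = (x \<oplus>\<^bsub>X\<^esub> x', y \<oplus>\<^bsub>Y\<^esub> y')"
  "smult (bimodule_dsum X Y) c (x, y) = (c \<odot>\<^bsub>X\<^esub> x, c \<odot>\<^bsub>Y\<^esub> y)"
  "lact (bimodule_dsum X Y) r (x, y) = (lact X r x, lact Y r y)"
  "ract (bimodule_dsum X Y) (x, y) s = (ract X x s, ract Y y s)"
  by (simp_all add: bimodule_dsum_def)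

lemma dsum_module:
  fixes X :: "('k, 'r, 's, 'x, 'u) bimodule_scheme" and Y :: "('k, 'r, 's, 'y, 'v) bimodule_scheme"
  assumes "module k X" "module k Y" shows "module k (bimodule_dsum X Y)"
proof -
  interpret X: module k X by fact
  interpret Y: module k Y by fact
  have "abelian_group (bimodule_dsum X Y)"
  proof (rule abelian_groupI)
    fix z assume "z \<in> carrier (bimodule_dsum X Y)"
    then obtain x y where z: "z = (x, y)" "x \<in> carrier X" "y \<in> carrier Y"
      by (auto simp: dsum_simps)
    then show "\<exists>w \<in> carrier (bimodule_dsum X Y). w \<oplus>\<^bsub>bimodule_dsum X Y\<^esub> z = \<zero>\<^bsub>bimodule_dsum X Y\<^esub>"
      by (intro bexI[of _ "(\<ominus>\<^bsub>X\<^esub> x, \<ominus>\<^bsub>Y\<^esub> y)"]) (auto simp: dsum_simps X.M.l_neg Y.M.l_neg)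
  qed (auto simp: dsum_simps X.M.a_ac Y.M.a_ac)
  then show ?thesis
    by (rule moduleI[OF X.R.cring_axioms])
      (auto simp: dsum_simps X.smult_l_distr X.smult_r_distr X.smult_assoc1
        Y.smult_l_distr Y.smult_r_distr Y.smult_assoc1)
qed

lemma dsum_bimodule:
  assumes "bimodule k R S X" "bimodule k R S Y" shows "bimodule k R S (bimodule_dsum X Y)"
proof -
  interpret X: bimodule k R S X by fact
  interpret Y: bimodule k R S Y by fact
  show ?thesis
    by (intro bimodule.intro bimodule_axioms.intro X.left.k_algebra_axioms X.right.k_algebra_axioms
        dsum_module X.module_axioms Y.module_axioms)
      (auto simp: dsum_simps X.lact_closed X.ract_closed X.lact_add_left X.lact_add_right
        X.ract_add_left X.ract_add_right X.lact_mult X.ract_mult X.lact_one X.ract_one X.lact_ract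
        X.lact_scalar X.ract_scalar
        Y.lact_closed Y.ract_closed Y.lact_add_left Y.lact_add_right
        Y.ract_add_left Y.ract_add_right Y.lact_mult Y.ract_mult Y.lact_one Y.ract_one Y.lact_ract
        Y.lact_scalar Y.ract_scalar)
qed

definition sub_bimodule ::
  "'x set \<Rightarrow> ('k, 'w) ring_scheme \<Rightarrow> ('k, 'r, 'z) module_scheme \<Rightarrow> ('k, 's, 'y) module_scheme \<Rightarrow>
   ('k, 'r, 's, 'x, 'u) bimodule_scheme \<Rightarrow> bool"
  where "sub_bimodule N k R S X \<longleftrightarrow> submodule N k X \<and>
    (\<forall>r \<in> carrier R. \<forall>x \<in> N. lact X r x \<in> N) \<and> (\<forall>s \<in> carrier S. \<forall>x \<in> N. ract X x s \<in> N)"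

lemma sub_bimodule_bimodule:
  assumes "bimodule k R S X" "sub_bimodule N k R S X"
  shows "bimodule k R S (X\<lparr>carrier := N\<rparr>)"
proof -
  interpret bimodule k R S X by fact
  have N: "submodule N k X" "\<And>r x. \<lbrakk>r \<in> carrier R; x \<in> N\<rbrakk> \<Longrightarrow> lact X r x \<in> N"
    "\<And>x s. \<lbrakk>s \<in> carrier S; x \<in> N\<rbrakk> \<Longrightarrow> ract X x s \<in> N"
    using assms(2) by (auto simp: sub_bimodule_def)
  have sub: "x \<in> carrier X" if "x \<in> N" for x using submoduleE(1)[OF N(1)] that by blast
  show ?thesis
    by (intro bimodule.intro bimodule_axioms.intro left.k_algebra_axioms right.k_algebra_axioms
        submodule.submodule_is_module[OF N(1) module_axioms])
      (auto simp: N sub lact_add_left lact_add_right ract_add_left ract_add_right lact_mult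
        ract_mult lact_one ract_one lact_ract lact_scalar ract_scalar)
qed

lemma quot_bimodule_bimodule:
  assumes "bimodule k R S X" "sub_bimodule N k R S X"
  shows "bimodule k R S (quot_bimodule X N)"
    and "(\<lambda>x. N +>\<^bsub>X\<^esub> x) \<in> linear_maps k X (quot_bimodule X N)"
    and "\<lbrakk>r \<in> carrier R; x \<in> carrier X\<rbrakk> \<Longrightarrow>
      lact (quot_bimodule X N) r (N +>\<^bsub>X\<^esub> x) = N +>\<^bsub>X\<^esub> lact X r x"
    and "\<lbrakk>s \<in> carrier S; x \<in> carrier X\<rbrakk> \<Longrightarrow>
      ract (quot_bimodule X N) (N +>\<^bsub>X\<^esub> x) s = N +>\<^bsub>X\<^esub> ract X x s"
    and "U \<in> carrier (quot_bimodule X N) \<longleftrightarrow> (\<exists>x \<in> carrier X. U = N +>\<^bsub>X\<^esub> x)"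
proof -
  interpret bimodule k R S X by fact
  have N: "submodule N k X" "\<And>r x. \<lbrakk>r \<in> carrier R; x \<in> N\<rbrakk> \<Longrightarrow> lact X r x \<in> N"
    "\<And>x s. \<lbrakk>s \<in> carrier S; x \<in> N\<rbrakk> \<Longrightarrow> ract X x s \<in> N"
    using assms(2) by (auto simp: sub_bimodule_def)
  let ?Q = "quot_bimodule X N"
  note Nag = submodule_abelian_subgroup[OF module_axioms N(1)]
  note q = quot_module_module[OF module_axioms N(1)]
  have m: "module k ?Q"
    by (rule module_cong[OF q(1)]) (simp_all add: quot_module_def quot_bimodule_def)
  have c: "U \<in> carrier ?Q \<longleftrightarrow> (\<exists>x \<in> carrier X. U = N +>\<^bsub>X\<^esub> x)" for U
    by (simp add: quot_bimodule_def rcosets_iff)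
  then show "U \<in> carrier ?Q \<longleftrightarrow> (\<exists>x \<in> carrier X. U = N +>\<^bsub>X\<^esub> x)" .
  have lin: "(\<lambda>x. N +>\<^bsub>X\<^esub> x) \<in> linear_maps k X ?Q"
    using q(2) by (simp add: linear_maps_def quot_module_def quot_bimodule_def)
  then show "(\<lambda>x. N +>\<^bsub>X\<^esub> x) \<in> linear_maps k X ?Q" .
  have la: "lact ?Q r (N +>\<^bsub>X\<^esub> x) = N +>\<^bsub>X\<^esub> lact X r x" if "r \<in> carrier R" "x \<in> carrier X" for r x
    using coset_UN[OF Nag that(2), of "lact X r"] that(1) N(2) lact_closed lact_add_right
    by (simp add: quot_bimodule_def)
  have ra: "ract ?Q (N +>\<^bsub>X\<^esub> x) s = N +>\<^bsub>X\<^esub> ract X x s" if "s \<in> carrier S" "x \<in> carrier X" for s x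
    using coset_UN[OF Nag that(2), of "\<lambda>x. ract X x s"] that(1) N(3) ract_closed ract_add_left
    by (simp add: quot_bimodule_def)
  show "lact ?Q r (N +>\<^bsub>X\<^esub> x) = N +>\<^bsub>X\<^esub> lact X r x" if "r \<in> carrier R" "x \<in> carrier X"
    by (rule la[OF that])
  show "ract ?Q (N +>\<^bsub>X\<^esub> x) s = N +>\<^bsub>X\<^esub> ract X x s" if "s \<in> carrier S" "x \<in> carrier X"
    by (rule ra[OF that])
  note l = linear_mapsD(2,3)[OF lin, symmetric]
  show "bimodule k R S ?Q"
    by (intro bimodule.intro bimodule_axioms.intro left.k_algebra_axioms right.k_algebra_axioms m)
      (auto simp: c la ra l lact_closed ract_closed lact_add_left lact_add_right ract_add_left
        ract_add_right lact_mult ract_mult lact_one ract_one lact_ract lact_scalar ract_scalar)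
qed

section \<open>Tensor products\<close>

definition balanced ::
  "('k, 'w) ring_scheme \<Rightarrow> ('k, 'r, 's, 'x, 'u) bimodule_scheme \<Rightarrow> ('s, 'z) ring_scheme \<Rightarrow>
   ('k, 's, 't, 'y, 'v) bimodule_scheme \<Rightarrow> ('k, 'q, 'p) module_scheme \<Rightarrow> ('x \<Rightarrow> 'y \<Rightarrow> 'q) set"
  where "balanced k X S Y Z = {\<beta>.
    (\<forall>y \<in> carrier Y. (\<lambda>x. \<beta> x y) \<in> linear_maps k X Z) \<and>
    (\<forall>x \<in> carrier X. \<beta> x \<in> linear_maps k Y Z) \<and>
    (\<forall>x \<in> carrier X. \<forall>s \<in> carrier S. \<forall>y \<in> carrier Y. \<beta> (ract X x s) y = \<beta> x (lact Y s y))}"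

lemma balancedI:
  assumes "\<And>y. y \<in> carrier Y \<Longrightarrow> (\<lambda>x. \<beta> x y) \<in> linear_maps k X Z"
    and "\<And>x. x \<in> carrier X \<Longrightarrow> \<beta> x \<in> linear_maps k Y Z"
    and "\<And>x s y. \<lbrakk>x \<in> carrier X; s \<in> carrier S; y \<in> carrier Y\<rbrakk> \<Longrightarrow> \<beta> (ract X x s) y = \<beta> x (lact Y s y)"
  shows "\<beta> \<in> balanced k X S Y Z"
  using assms by (auto simp: balanced_def)

lemma tensor_simps:
  "carrier (tensor k X S Y) = carrier (pres_module k (carrier X \<times> carrier Y) (tensor_rels k X S Y))"
  "zero (tensor k X S Y) = zero (pres_module k (carrier X \<times> carrier Y) (tensor_rels k X S Y))"
  "add (tensor k X S Y) = add (pres_module k (carrier X \<times> carrier Y) (tensor_rels k X S Y))"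
  "smult (tensor k X S Y) = smult (pres_module k (carrier X \<times> carrier Y) (tensor_rels k X S Y))"
  by (simp_all add: tensor_def Let_def)

lemma pres_lift_cong:
  assumes "carrier Y = carrier Z" "add Y = add Z" "zero Y = zero Z" "smult Y = smult Z"
  shows "pres_lift k S Y g = pres_lift k S Z g"
  unfolding pres_lift_def finsum_cong_struct[OF assms(1-3)] assms(4) ..

lemma tensor_rels_closed:
  assumes "cring k"
  shows "tensor_rels k X S Y \<subseteq> carrier (free_module k (carrier X \<times> carrier Y))"
  using rel_closed[OF assms] by (auto simp: tensor_rels_def Let_def)

lemma tensor_module:
  assumes "cring k" shows "module k (tensor k X S Y)"
  by (rule module_cong[OF pres_module_module[OF assms tensor_rels_closed[OF assms]]])
    (simp_all add: tensor_simps)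

lemma pure_tensor_closed:
  assumes "cring k" shows "pure_tensor k X S Y x y \<in> carrier (tensor k X S Y)"
  using pres_class_closed[OF assms tensor_rels_closed[OF assms]]
  by (simp add: pure_tensor_def tensor_simps)

context
  fixes k :: "('k, 'w) ring_scheme" and R :: "('k, 'r, 'u1) module_scheme"
    and S :: "('k, 's, 'u2) module_scheme" and T :: "('k, 't, 'u3) module_scheme"
    and X :: "('k, 'r, 's, 'x, 'u4) bimodule_scheme" and Y :: "('k, 's, 't, 'y, 'u5) bimodule_scheme"
  assumes X: "bimodule k R S X" and Y: "bimodule k S T Y"
begin

interpretation X: bimodule k R S X by (rule X)
interpretation Y: bimodule k S T Y by (rule Y)

lemmas ground_cring = X.left.R.cring_axioms

lemma tensor_induct [consumes 1, case_names pure add smult]: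
  assumes "U \<in> carrier (tensor k X S Y)"
    and "\<And>x y. \<lbrakk>x \<in> carrier X; y \<in> carrier Y\<rbrakk> \<Longrightarrow> Q (pure_tensor k X S Y x y)"
    and "\<And>U W. \<lbrakk>U \<in> carrier (tensor k X S Y); W \<in> carrier (tensor k X S Y); Q U; Q W\<rbrakk> \<Longrightarrow>
           Q (U \<oplus>\<^bsub>tensor k X S Y\<^esub> W)"
    and "\<And>c U. \<lbrakk>c \<in> carrier k; U \<in> carrier (tensor k X S Y); Q U\<rbrakk> \<Longrightarrow> Q (c \<odot>\<^bsub>tensor k X S Y\<^esub> U)"
  shows "Q U"
proof -
  have ne: "carrier X \<times> carrier Y \<noteq> {}" using X.zero_closed Y.zero_closed by auto
  show ?thesis
    by (rule pres_module_induct[OF ground_cring tensor_rels_closed[OF ground_cring] _ _ _ _ ne])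
      (use assms in \<open>auto simp: tensor_simps pure_tensor_def\<close>)
qed

lemma linear_maps_tensor_eqI:
  assumes "f \<in> linear_maps k (tensor k X S Y) Z" "g \<in> linear_maps k (tensor k X S Y) Z"
    and "\<And>x y. \<lbrakk>x \<in> carrier X; y \<in> carrier Y\<rbrakk> \<Longrightarrow>
      f (pure_tensor k X S Y x y) = g (pure_tensor k X S Y x y)"
    and "U \<in> carrier (tensor k X S Y)"
  shows "f U = g U"
  using assms(4)
  by (induction U rule: tensor_induct)
    (auto simp: assms(3) linear_mapsD[OF assms(1)] linear_mapsD[OF assms(2)])

lemma pure_tensor_rules:
  assumes x: "x \<in> carrier X" and y: "y \<in> carrier Y"
  shows "x' \<in> carrier X \<Longrightarrow> pure_tensor k X S Y (x \<oplus>\<^bsub>X\<^esub> x') y =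
      pure_tensor k X S Y x y \<oplus>\<^bsub>tensor k X S Y\<^esub> pure_tensor k X S Y x' y"
    and "y' \<in> carrier Y \<Longrightarrow> pure_tensor k X S Y x (y \<oplus>\<^bsub>Y\<^esub> y') =
      pure_tensor k X S Y x y \<oplus>\<^bsub>tensor k X S Y\<^esub> pure_tensor k X S Y x y'"
    and "c \<in> carrier k \<Longrightarrow> pure_tensor k X S Y (c \<odot>\<^bsub>X\<^esub> x) y = c \<odot>\<^bsub>tensor k X S Y\<^esub> pure_tensor k X S Y x y"
    and "c \<in> carrier k \<Longrightarrow> pure_tensor k X S Y x (c \<odot>\<^bsub>Y\<^esub> y) = c \<odot>\<^bsub>tensor k X S Y\<^esub> pure_tensor k X S Y x y"
    and "s \<in> carrier S \<Longrightarrow> pure_tensor k X S Y (ract X x s) y = pure_tensor k X S Y x (lact Y s y)"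
proof -
  note r = tensor_rels_closed[OF ground_cring]
  note a = pres_class_add[OF ground_cring r, symmetric] and sm = pres_class_smult[OF ground_cring r, symmetric]
    and e = pres_class_eq[OF ground_cring r]
  note rel = tensor_rels_def[of k X S Y, unfolded Let_def]
  show "x' \<in> carrier X \<Longrightarrow> pure_tensor k X S Y (x \<oplus>\<^bsub>X\<^esub> x') y =
      pure_tensor k X S Y x y \<oplus>\<^bsub>tensor k X S Y\<^esub> pure_tensor k X S Y x' y"
    unfolding pure_tensor_def tensor_simps by (rule a; unfold rel) (use x y in blast)
  show "y' \<in> carrier Y \<Longrightarrow> pure_tensor k X S Y x (y \<oplus>\<^bsub>Y\<^esub> y') =
      pure_tensor k X S Y x y \<oplus>\<^bsub>tensor k X S Y\<^esub> pure_tensor k X S Y x y'"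
    unfolding pure_tensor_def tensor_simps by (rule a; unfold rel) (use x y in blast)
  show "c \<in> carrier k \<Longrightarrow> pure_tensor k X S Y (c \<odot>\<^bsub>X\<^esub> x) y = c \<odot>\<^bsub>tensor k X S Y\<^esub> pure_tensor k X S Y x y"
    unfolding pure_tensor_def tensor_simps by (rule sm, unfold rel, (use x y in blast)+)
  show "c \<in> carrier k \<Longrightarrow> pure_tensor k X S Y x (c \<odot>\<^bsub>Y\<^esub> y) = c \<odot>\<^bsub>tensor k X S Y\<^esub> pure_tensor k X S Y x y"
    unfolding pure_tensor_def tensor_simps by (rule sm, unfold rel, (use x y in blast)+)
  show "s \<in> carrier S \<Longrightarrow> pure_tensor k X S Y (ract X x s) y = pure_tensor k X S Y x (lact Y s y)"
    unfolding pure_tensor_def tensor_simps by (rule e; unfold rel) (use x y in blast)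
qed

lemma pure_tensor_linear:
  shows pure_tensor_linear_left:
      "y \<in> carrier Y \<Longrightarrow> (\<lambda>x. pure_tensor k X S Y x y) \<in> linear_maps k X (tensor k X S Y)"
    and pure_tensor_linear_right:
      "x \<in> carrier X \<Longrightarrow> pure_tensor k X S Y x \<in> linear_maps k Y (tensor k X S Y)"
  by (auto intro!: linear_mapsI simp: pure_tensor_closed[OF ground_cring] pure_tensor_rules)

text \<open>The relations between pure tensors say precisely that a map on pairs is balanced.\<close>

lemma tensor_lift:
  assumes Z: "module k Z" and b: "\<beta> \<in> balanced k X S Y Z"
  shows tensor_lift_linear: "tensor_lift k X Y Z \<beta> \<in> linear_maps k (tensor k X S Y) Z"
    and tensor_lift_pure: "\<lbrakk>x \<in> carrier X; y \<in> carrier Y\<rbrakk> \<Longrightarrow>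
      tensor_lift k X Y Z \<beta> (pure_tensor k X S Y x y) = \<beta> x y"
proof -
  interpret Z: module k Z by fact
  let ?g = "\<lambda>(x, y). \<beta> x y"
  have g1: "(\<lambda>x. \<beta> x y) \<in> linear_maps k X Z" if "y \<in> carrier Y" for y
    using b that by (auto simp: balanced_def)
  have g2: "\<beta> x \<in> linear_maps k Y Z" if "x \<in> carrier X" for x
    using b that by (auto simp: balanced_def)
  have g3: "\<beta> (ract X x s) y = \<beta> x (lact Y s y)"
    if "x \<in> carrier X" "s \<in> carrier S" "y \<in> carrier Y" for x s y
    using b that by (auto simp: balanced_def)
  have g: "?g \<in> carrier X \<times> carrier Y \<rightarrow> carrier Z"
    using linear_maps_closed[OF g2] by auto
  have kill: "free_lift k (carrier X \<times> carrier Y) Z ?g w = \<zero>\<^bsub>Z\<^esub>" if "w \<in> tensor_rels k X S Y" for w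
    using that unfolding tensor_rels_def Let_def
    by (elim UnE CollectE exE conjE; hypsubst)
      (rule free_lift_rel[OF Z g];
        simp add: linear_mapsD[OF g1] linear_mapsD[OF g2] g3 X.ract_closed Y.lact_closed)+
  have T: "linear_maps k (tensor k X S Y) Z =
      linear_maps k (pres_module k (carrier X \<times> carrier Y) (tensor_rels k X S Y)) Z"
    by (simp add: linear_maps_def tensor_simps)
  show "tensor_lift k X Y Z \<beta> \<in> linear_maps k (tensor k X S Y) Z"
    unfolding tensor_lift_def T
    by (rule pres_lift_linear[OF ground_cring tensor_rels_closed[OF ground_cring] Z g kill])
  show "\<lbrakk>x \<in> carrier X; y \<in> carrier Y\<rbrakk> \<Longrightarrow> tensor_lift k X Y Z \<beta> (pure_tensor k X S Y x y) = \<beta> x y"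
    unfolding tensor_lift_def pure_tensor_def
    by (subst pres_lift_class[OF ground_cring tensor_rels_closed[OF ground_cring] Z g kill]) auto
qed

text \<open>A map out of an iterated tensor product is built one factor at a time; this gives its linearity in
  the factors that are still to come.\<close>

lemma tensor_parameter_linear:
  assumes P: "module k P" and Z: "module k Z"
    and F: "\<And>p. p \<in> carrier P \<Longrightarrow> F p \<in> linear_maps k (tensor k X S Y) Z"
    and pure: "\<And>x y. \<lbrakk>x \<in> carrier X; y \<in> carrier Y\<rbrakk> \<Longrightarrow>
      (\<lambda>p. F p (pure_tensor k X S Y x y)) \<in> linear_maps k P Z"
    and U: "U \<in> carrier (tensor k X S Y)"
  shows "(\<lambda>p. F p U) \<in> linear_maps k P Z"
  using U
proof (induction U rule: tensor_induct)
  case (pure x y)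
  then show ?case by (rule assms(4))
next
  case (add U W)
  interpret P: module k P by (rule P)
  interpret Z: module k Z by (rule Z)
  show ?case
    by (rule linear_mapsI)
      (simp_all add: linear_mapsD[OF F] linear_mapsD[OF add(3)] linear_mapsD[OF add(4)] add(1,2)
        Z.M.a_ac Z.smult_r_distr)
next
  case (smult c U)
  interpret P: module k P by (rule P)
  interpret Z: module k Z by (rule Z)
  have "c \<odot>\<^bsub>Z\<^esub> (e \<odot>\<^bsub>Z\<^esub> z) = e \<odot>\<^bsub>Z\<^esub> (c \<odot>\<^bsub>Z\<^esub> z)" if "e \<in> carrier k" "z \<in> carrier Z" for e z
    using that smult(1) Z.smult_assoc1[of c e z] Z.smult_assoc1[of e c z]
    by (simp add: X.left.R.m_comm)
  then show ?case
    by (intro linear_mapsI)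
      (simp_all add: linear_mapsD[OF F] linear_mapsD[OF smult(3)] smult(1,2) Z.smult_r_distr)
qed

lemma tensor_lact:
  assumes r: "r \<in> carrier R"
  shows tensor_lact_linear: "lact (tensor k X S Y) r \<in> linear_maps k (tensor k X S Y) (tensor k X S Y)"
    and tensor_lact_pure: "\<lbrakk>x \<in> carrier X; y \<in> carrier Y\<rbrakk> \<Longrightarrow>
      lact (tensor k X S Y) r (pure_tensor k X S Y x y) = pure_tensor k X S Y (lact X r x) y"
proof -
  let ?b = "\<lambda>x y. pure_tensor k X S Y (lact X r x) y"
  have b: "?b \<in> balanced k X S Y (tensor k X S Y)"
    using r by (auto intro!: balancedI pure_tensor_linear_right
        linear_maps_compose[OF X.lact_linear pure_tensor_linear_left]
        simp: X.lact_closed X.lact_ract[symmetric] pure_tensor_rules)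
  have eq: "lact (tensor k X S Y) r = tensor_lift k X Y (tensor k X S Y) ?b"
    unfolding tensor_lift_def
    by (subst pres_lift_cong[of "tensor k X S Y" "pres_module k (carrier X \<times> carrier Y) (tensor_rels k X S Y)"])
      (simp_all add: tensor_simps, simp add: tensor_def Let_def tensor_lift_def)
  show "lact (tensor k X S Y) r \<in> linear_maps k (tensor k X S Y) (tensor k X S Y)"
    unfolding eq by (rule tensor_lift_linear[OF tensor_module[OF ground_cring] b])
  show "\<lbrakk>x \<in> carrier X; y \<in> carrier Y\<rbrakk> \<Longrightarrow>
      lact (tensor k X S Y) r (pure_tensor k X S Y x y) = pure_tensor k X S Y (lact X r x) y"
    unfolding eq by (rule tensor_lift_pure[OF tensor_module[OF ground_cring] b])
qed

lemma tensor_ract: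
  assumes t: "t \<in> carrier T"
  shows tensor_ract_linear:
      "(\<lambda>U. ract (tensor k X S Y) U t) \<in> linear_maps k (tensor k X S Y) (tensor k X S Y)"
    and tensor_ract_pure: "\<lbrakk>x \<in> carrier X; y \<in> carrier Y\<rbrakk> \<Longrightarrow>
      ract (tensor k X S Y) (pure_tensor k X S Y x y) t = pure_tensor k X S Y x (ract Y y t)"
proof -
  let ?b = "\<lambda>x y. pure_tensor k X S Y x (ract Y y t)"
  have b: "?b \<in> balanced k X S Y (tensor k X S Y)"
    using t by (auto intro!: balancedI pure_tensor_linear_left
        linear_maps_compose[OF Y.ract_linear pure_tensor_linear_right]
        simp: Y.ract_closed Y.lact_ract pure_tensor_rules)
  have eq: "(\<lambda>U. ract (tensor k X S Y) U t) = tensor_lift k X Y (tensor k X S Y) ?b"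
    unfolding tensor_lift_def
    by (subst pres_lift_cong[of "tensor k X S Y" "pres_module k (carrier X \<times> carrier Y) (tensor_rels k X S Y)"])
      (simp_all add: tensor_simps, simp add: tensor_def Let_def tensor_lift_def)
  show "(\<lambda>U. ract (tensor k X S Y) U t) \<in> linear_maps k (tensor k X S Y) (tensor k X S Y)"
    unfolding eq by (rule tensor_lift_linear[OF tensor_module[OF ground_cring] b])
  show "\<lbrakk>x \<in> carrier X; y \<in> carrier Y\<rbrakk> \<Longrightarrow>
      ract (tensor k X S Y) (pure_tensor k X S Y x y) t = pure_tensor k X S Y x (ract Y y t)"
    using fun_cong[OF eq] tensor_lift_pure[OF tensor_module[OF ground_cring] b] by simp
qed

lemma tensor_bimodule: "bimodule k R T (tensor k X S Y)"
proof -
  note c = linear_mapsD[OF tensor_lact_linear] linear_mapsD[OF tensor_ract_linear]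
  interpret M: module k "tensor k X S Y" by (rule tensor_module[OF ground_cring])
  note s = tensor_lact_pure tensor_ract_pure pure_tensor_rules X.lact_closed Y.ract_closed
    pure_tensor_closed[OF ground_cring]
  have ex: "(a \<oplus>\<^bsub>tensor k X S Y\<^esub> b) \<oplus>\<^bsub>tensor k X S Y\<^esub> (a' \<oplus>\<^bsub>tensor k X S Y\<^esub> b') =
      (a \<oplus>\<^bsub>tensor k X S Y\<^esub> a') \<oplus>\<^bsub>tensor k X S Y\<^esub> (b \<oplus>\<^bsub>tensor k X S Y\<^esub> b')"
    if "a \<in> carrier (tensor k X S Y)" "b \<in> carrier (tensor k X S Y)"
      "a' \<in> carrier (tensor k X S Y)" "b' \<in> carrier (tensor k X S Y)" for a b a' b'
    using that by (simp add: M.M.a_ac)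
  have sc: "c \<odot>\<^bsub>tensor k X S Y\<^esub> (d \<odot>\<^bsub>tensor k X S Y\<^esub> U) = d \<odot>\<^bsub>tensor k X S Y\<^esub> (c \<odot>\<^bsub>tensor k X S Y\<^esub> U)"
    if "c \<in> carrier k" "d \<in> carrier k" "U \<in> carrier (tensor k X S Y)" for c d U
    using that M.smult_assoc1[of c d U] M.smult_assoc1[of d c U] by (simp add: X.left.R.m_comm)
  show ?thesis
  proof (intro bimodule.intro bimodule_axioms.intro X.left.k_algebra_axioms
      Y.right.k_algebra_axioms M.module_axioms)
    fix r r' U assume r: "r \<in> carrier R" "r' \<in> carrier R" and U: "U \<in> carrier (tensor k X S Y)"
    show "lact (tensor k X S Y) (r \<oplus>\<^bsub>R\<^esub> r') U =
        lact (tensor k X S Y) r U \<oplus>\<^bsub>tensor k X S Y\<^esub> lact (tensor k X S Y) r' U"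
      using U by (induction U rule: tensor_induct) (simp_all add: r c s X.lact_add_left ex M.smult_r_distr)
    show "lact (tensor k X S Y) (r \<otimes>\<^bsub>R\<^esub> r') U = lact (tensor k X S Y) r (lact (tensor k X S Y) r' U)"
      using U by (induction U rule: tensor_induct) (simp_all add: r c s X.lact_mult)
  next
    fix U t t' assume t: "t \<in> carrier T" "t' \<in> carrier T" and U: "U \<in> carrier (tensor k X S Y)"
    show "ract (tensor k X S Y) U (t \<oplus>\<^bsub>T\<^esub> t') =
        ract (tensor k X S Y) U t \<oplus>\<^bsub>tensor k X S Y\<^esub> ract (tensor k X S Y) U t'"
      using U by (induction U rule: tensor_induct) (simp_all add: t c s Y.ract_add_right ex M.smult_r_distr)
    show "ract (tensor k X S Y) U (t \<otimes>\<^bsub>T\<^esub> t') = ract (tensor k X S Y) (ract (tensor k X S Y) U t) t'"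
      using U by (induction U rule: tensor_induct) (simp_all add: t c s Y.ract_mult)
  next
    fix U assume U: "U \<in> carrier (tensor k X S Y)"
    show "lact (tensor k X S Y) \<one>\<^bsub>R\<^esub> U = U"
      using U by (induction U rule: tensor_induct) (simp_all add: c s X.lact_one)
    show "ract (tensor k X S Y) U \<one>\<^bsub>T\<^esub> = U"
      using U by (induction U rule: tensor_induct) (simp_all add: c s Y.ract_one)
  next
    fix r U t assume r: "r \<in> carrier R" and t: "t \<in> carrier T" and U: "U \<in> carrier (tensor k X S Y)"
    show "ract (tensor k X S Y) (lact (tensor k X S Y) r U) t =
        lact (tensor k X S Y) r (ract (tensor k X S Y) U t)"
      using U by (induction U rule: tensor_induct) (simp_all add: r t c s)
  next
    fix a U assume a: "a \<in> carrier k" and U: "U \<in> carrier (tensor k X S Y)"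
    show "lact (tensor k X S Y) (a \<odot>\<^bsub>R\<^esub> \<one>\<^bsub>R\<^esub>) U = a \<odot>\<^bsub>tensor k X S Y\<^esub> U"
      using U by (induction U rule: tensor_induct)
        (simp_all add: a c s X.lact_scalar M.smult_r_distr sc)
    show "ract (tensor k X S Y) U (a \<odot>\<^bsub>T\<^esub> \<one>\<^bsub>T\<^esub>) = a \<odot>\<^bsub>tensor k X S Y\<^esub> U"
      using U by (induction U rule: tensor_induct)
        (simp_all add: a c s Y.ract_scalar M.smult_r_distr sc)
  qed (auto simp: c)
qed

end

section \<open>Tensor algebras\<close>

subsection \<open>Algebras presented by a monoid of generators\<close>

lemma free_lift_fun_linear:
  assumes Y: "module k Y" and f: "f \<in> carrier (free_module k S)"
    and g: "\<And>s. s \<in> S \<Longrightarrow> g s \<in> linear_maps k Z Y"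
  shows "(\<lambda>z. free_lift k S Y (\<lambda>s. g s z) f) \<in> linear_maps k Z Y"
proof -
  interpret Y: module k Y by fact
  have fin: "finite {s \<in> S. f s \<noteq> \<zero>\<^bsub>k\<^esub>}" and fc: "\<And>s. s \<in> S \<Longrightarrow> f s \<in> carrier k"
    using f by (auto simp: free_module_simps)
  note gl = linear_mapsD[OF g]
  show ?thesis
  proof (rule linear_mapsI; unfold free_lift_def)
    fix z assume "z \<in> carrier Z"
    then show "(\<Oplus>\<^bsub>Y\<^esub>s \<in> {s \<in> S. f s \<noteq> \<zero>\<^bsub>k\<^esub>}. f s \<odot>\<^bsub>Y\<^esub> g s z) \<in> carrier Y"
      using fc gl by (intro Y.M.finsum_closed) auto
  next
    fix z z' assume z: "z \<in> carrier Z" "z' \<in> carrier Z"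
    have "(\<Oplus>\<^bsub>Y\<^esub>s \<in> {s \<in> S. f s \<noteq> \<zero>\<^bsub>k\<^esub>}. f s \<odot>\<^bsub>Y\<^esub> g s (z \<oplus>\<^bsub>Z\<^esub> z')) =
        (\<Oplus>\<^bsub>Y\<^esub>s \<in> {s \<in> S. f s \<noteq> \<zero>\<^bsub>k\<^esub>}. f s \<odot>\<^bsub>Y\<^esub> g s z \<oplus>\<^bsub>Y\<^esub> f s \<odot>\<^bsub>Y\<^esub> g s z')"
      using z fc gl by (intro Y.M.finsum_cong') (auto simp: Y.smult_r_distr)
    also have "\<dots> = (\<Oplus>\<^bsub>Y\<^esub>s \<in> {s \<in> S. f s \<noteq> \<zero>\<^bsub>k\<^esub>}. f s \<odot>\<^bsub>Y\<^esub> g s z) \<oplus>\<^bsub>Y\<^esub>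
        (\<Oplus>\<^bsub>Y\<^esub>s \<in> {s \<in> S. f s \<noteq> \<zero>\<^bsub>k\<^esub>}. f s \<odot>\<^bsub>Y\<^esub> g s z')"
      using z fc gl by (intro Y.M.finsum_addf) auto
    finally show "(\<Oplus>\<^bsub>Y\<^esub>s \<in> {s \<in> S. f s \<noteq> \<zero>\<^bsub>k\<^esub>}. f s \<odot>\<^bsub>Y\<^esub> g s (z \<oplus>\<^bsub>Z\<^esub> z')) = \<dots>" .
  next
    fix c z assume c: "c \<in> carrier k" and z: "z \<in> carrier Z"
    have "c \<odot>\<^bsub>Y\<^esub> (f s \<odot>\<^bsub>Y\<^esub> g s z) = f s \<odot>\<^bsub>Y\<^esub> (c \<odot>\<^bsub>Y\<^esub> g s z)" if "s \<in> S" for s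
      using c z fc[OF that] gl(1)[OF that z] Y.smult_assoc1[of c "f s" "g s z"]
        Y.smult_assoc1[of "f s" c "g s z"] by (simp add: Y.R.m_comm)
    then have "(\<Oplus>\<^bsub>Y\<^esub>s \<in> {s \<in> S. f s \<noteq> \<zero>\<^bsub>k\<^esub>}. f s \<odot>\<^bsub>Y\<^esub> g s (c \<odot>\<^bsub>Z\<^esub> z)) =
        (\<Oplus>\<^bsub>Y\<^esub>s \<in> {s \<in> S. f s \<noteq> \<zero>\<^bsub>k\<^esub>}. c \<odot>\<^bsub>Y\<^esub> (f s \<odot>\<^bsub>Y\<^esub> g s z))"
      using c z fc gl by (intro Y.M.finsum_cong') auto
    also have "\<dots> = c \<odot>\<^bsub>Y\<^esub> (\<Oplus>\<^bsub>Y\<^esub>s \<in> {s \<in> S. f s \<noteq> \<zero>\<^bsub>k\<^esub>}. f s \<odot>\<^bsub>Y\<^esub> g s z)"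
      using c z fc gl by (intro Y.finsum_smult_ldistr[symmetric] fin) auto
    finally show "(\<Oplus>\<^bsub>Y\<^esub>s \<in> {s \<in> S. f s \<noteq> \<zero>\<^bsub>k\<^esub>}. f s \<odot>\<^bsub>Y\<^esub> g s (c \<odot>\<^bsub>Z\<^esub> z)) = \<dots>" .
  qed
qed

text \<open>Words form a monoid under \<^const>\<open>word_mult\<close>, and \<^const>\<open>tensor_alg\<close> is the monoid algebra modulo
  relations; \<open>pres_alg\<close> is such a quotient for an arbitrary monoid.\<close>

definition pres_alg ::
  "('k, 'w) ring_scheme \<Rightarrow> 's set \<Rightarrow> ('s \<Rightarrow> 'k) set \<Rightarrow> ('s \<Rightarrow> 's \<Rightarrow> 's) \<Rightarrow> 's \<Rightarrow> ('k, ('s \<Rightarrow> 'k) set) module"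
  where "pres_alg k S G m e = (let V = pres_module k S G in
    \<lparr>carrier = carrier V,
     mult = (\<lambda>U W. pres_lift k S V (\<lambda>w. pres_lift k S V (\<lambda>w'. pres_class k S G (m w w')) W) U),
     one = pres_class k S G e, zero = zero V, add = add V, smult = smult V\<rparr>)"

context
  fixes k :: "('k, 'w) ring_scheme" and S :: "'s set" and G :: "('s \<Rightarrow> 'k) set"
    and m :: "'s \<Rightarrow> 's \<Rightarrow> 's" and e :: 's
  assumes k: "cring k" and G: "G \<subseteq> carrier (free_module k S)"
    and m_closed: "\<And>s t. \<lbrakk>s \<in> S; t \<in> S\<rbrakk> \<Longrightarrow> m s t \<in> S" and e_closed: "e \<in> S"
    and m_assoc: "\<And>s t u. \<lbrakk>s \<in> S; t \<in> S; u \<in> S\<rbrakk> \<Longrightarrow> m (m s t) u = m s (m t u)"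
    and m_unit: "\<And>s. s \<in> S \<Longrightarrow> m e s = s" "\<And>s. s \<in> S \<Longrightarrow> m s e = s"
    and kill_right: "\<And>s w. \<lbrakk>s \<in> S; w \<in> G\<rbrakk> \<Longrightarrow>
      free_lift k S (pres_module k S G) (\<lambda>t. pres_class k S G (m s t)) w = \<zero>\<^bsub>pres_module k S G\<^esub>"
    and kill_left: "\<And>t w. \<lbrakk>t \<in> S; w \<in> G\<rbrakk> \<Longrightarrow>
      free_lift k S (pres_module k S G) (\<lambda>s. pres_class k S G (m s t)) w = \<zero>\<^bsub>pres_module k S G\<^esub>"
begin

lemma pres_alg_simps:
  "carrier (pres_alg k S G m e) = carrier (pres_module k S G)"
  "zero (pres_alg k S G m e) = zero (pres_module k S G)"
  "add (pres_alg k S G m e) = add (pres_module k S G)"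
  "smult (pres_alg k S G m e) = smult (pres_module k S G)"
  "one (pres_alg k S G m e) = pres_class k S G e"
  by (simp_all add: pres_alg_def Let_def)

interpretation V: module k "pres_module k S G" by (rule pres_module_module[OF k G])

text \<open>The product is lifted in one argument at a time. That the lift in the second argument respects the
  relations in the first is an equation between linear maps, so it may be checked on generators.\<close>

lemma pres_alg_mult:
  shows pres_alg_mult_class: "\<lbrakk>s \<in> S; t \<in> S\<rbrakk> \<Longrightarrow>
      mult (pres_alg k S G m e) (pres_class k S G s) (pres_class k S G t) = pres_class k S G (m s t)"
    and pres_alg_mult_linear_left: "W \<in> carrier (pres_module k S G) \<Longrightarrow>
      (\<lambda>U. mult (pres_alg k S G m e) U W) \<in> linear_maps k (pres_module k S G) (pres_module k S G)"
    and pres_alg_mult_linear_right: "U \<in> carrier (pres_module k S G) \<Longrightarrow>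
      mult (pres_alg k S G m e) U \<in> linear_maps k (pres_module k S G) (pres_module k S G)"
proof -
  let ?V = "pres_module k S G" and ?c = "pres_class k S G"
  define L where "L s = pres_lift k S ?V (\<lambda>t. ?c (m s t))" for s
  have cl: "(\<lambda>t. ?c (m s t)) \<in> S \<rightarrow> carrier ?V" for s
    using pres_class_closed[OF k G] by auto
  have L: "L s \<in> linear_maps k ?V ?V" if "s \<in> S" for s
    unfolding L_def by (rule pres_lift_linear[OF k G V.module_axioms cl kill_right[OF that]])
  have Lc: "L s (?c t) = ?c (m s t)" if "s \<in> S" "t \<in> S" for s t
    unfolding L_def
    by (rule pres_lift_class[OF k G V.module_axioms cl kill_right[OF that(1)] that(2)])
  have kill: "free_lift k S ?V (\<lambda>s. L s W) w = \<zero>\<^bsub>?V\<^esub>" if W: "W \<in> carrier ?V" and w: "w \<in> G" for W w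
    using k G W
  proof (induction W rule: presented_induct)
    case (gen t)
    have "w s \<in> carrier k" if "s \<in> S" for s using w G that by (auto simp: free_module_simps)
    then have "free_lift k S ?V (\<lambda>s. L s (?c t)) w = free_lift k S ?V (\<lambda>s. ?c (m s t)) w"
      unfolding free_lift_def using Lc gen pres_class_closed[OF k G]
      by (intro V.M.finsum_cong') auto
    then show ?case using kill_left gen w by simp
  next
    case (add U W)
    have "w \<in> carrier (free_module k S)" using w G by blast
    from linear_maps_add[OF free_lift_fun_linear[OF V.module_axioms this L] add(1,2)] add
    show ?case by simp
  next
    case (smult c U)
    have "w \<in> carrier (free_module k S)" using w G by blast
    from linear_maps_smult[OF free_lift_fun_linear[OF V.module_axioms this L] smult(1,2)] smult
    show ?case by simp
  qed (use e_closed in blast)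
  have mu: "mult (pres_alg k S G m e) U W = pres_lift k S ?V (\<lambda>s. L s W) U" for U W
    by (simp add: pres_alg_def Let_def L_def)
  have LW: "(\<lambda>s. L s W) \<in> S \<rightarrow> carrier ?V" if "W \<in> carrier ?V" for W
    using linear_maps_closed[OF L] that by auto
  have lin: "(\<lambda>U. mult (pres_alg k S G m e) U W) \<in> linear_maps k ?V ?V" if "W \<in> carrier ?V" for W
    unfolding mu using pres_lift_linear[OF k G V.module_axioms LW[OF that] kill[OF that]] .
  then show "(\<lambda>U. mult (pres_alg k S G m e) U W) \<in> linear_maps k ?V ?V" if "W \<in> carrier ?V"
    using that .
  have mc: "mult (pres_alg k S G m e) (?c s) W = L s W" if "s \<in> S" "W \<in> carrier ?V" for s W
    unfolding mu by (rule pres_lift_class[OF k G V.module_axioms LW[OF that(2)] kill[OF that(2)] that(1)])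
  show "mult (pres_alg k S G m e) (?c s) (?c t) = ?c (m s t)" if "s \<in> S" "t \<in> S"
    using mc[OF that(1)] Lc that pres_class_closed[OF k G] by simp
  show "mult (pres_alg k S G m e) U \<in> linear_maps k ?V ?V" if U: "U \<in> carrier ?V"
    using k G U
  proof (induction U rule: presented_induct)
    case (gen s)
    then show ?case using L[of s] by (auto simp: linear_maps_def mc)
  next
    case (add U W)
    have "mult (pres_alg k S G m e) (U \<oplus>\<^bsub>?V\<^esub> W) Z =
        mult (pres_alg k S G m e) U Z \<oplus>\<^bsub>?V\<^esub> mult (pres_alg k S G m e) W Z" if "Z \<in> carrier ?V" for Z
      by (rule linear_maps_add[OF lin[OF that] add(1,2)])
    then show ?case
      using linear_mapsD[OF add(3)] linear_mapsD[OF add(4)]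
      by (intro linear_mapsI) (simp_all add: V.M.a_ac V.smult_r_distr)
  next
    case (smult c U)
    have "mult (pres_alg k S G m e) (c \<odot>\<^bsub>?V\<^esub> U) Z =
        c \<odot>\<^bsub>?V\<^esub> mult (pres_alg k S G m e) U Z" if "Z \<in> carrier ?V" for Z
      by (rule linear_maps_smult[OF lin[OF that] smult(1,2)])
    moreover have "c \<odot>\<^bsub>?V\<^esub> (d \<odot>\<^bsub>?V\<^esub> Z) = d \<odot>\<^bsub>?V\<^esub> (c \<odot>\<^bsub>?V\<^esub> Z)"
      if "d \<in> carrier k" "Z \<in> carrier ?V" for d Z
      using that smult(1) V.smult_assoc1[of c d Z] V.smult_assoc1[of d c Z] by (simp add: V.R.m_comm)
    ultimately show ?case
      using linear_mapsD[OF smult(3)] smult(1)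
      by (intro linear_mapsI) (simp_all add: V.smult_r_distr)
  qed (use e_closed in blast)
qed

lemma pres_alg_k_algebra: "k_algebra k (pres_alg k S G m e)"
proof -
  let ?V = "pres_module k S G" and ?c = "pres_class k S G" and ?A = "pres_alg k S G m e"
  note l = linear_mapsD[OF pres_alg_mult_linear_left] linear_mapsD[OF pres_alg_mult_linear_right]
  note cl = pres_class_closed[OF k G]
  have ne: "S \<noteq> {}" using e_closed by blast
  have assoc: "mult ?A (mult ?A U W) Z = mult ?A U (mult ?A W Z)"
    if "U \<in> carrier ?V" "W \<in> carrier ?V" "Z \<in> carrier ?V" for U W Z
    using k G that(1)
  proof (induction U rule: presented_induct)
    case (gen s)
    note s = gen
    show ?case using k G that(2)
    proof (induction W rule: presented_induct)
      case (gen t)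
      note t = gen
      show ?case using k G that(3)
      proof (induction Z rule: presented_induct)
        case (gen u)
        then show ?case using s t by (simp add: pres_alg_mult_class m_closed m_assoc)
      qed (simp_all add: cl l ne s t)
    qed (simp_all add: cl l ne s that(3))
  qed (simp_all add: l ne that(2,3))
  have unit: "mult ?A (?c e) U = U \<and> mult ?A U (?c e) = U" if "U \<in> carrier ?V" for U
    using k G that
    by (induction U rule: presented_induct)
      (simp_all add: cl l ne e_closed pres_alg_mult_class m_unit)
  have ag: "abelian_group ?A"
    by (rule abelian_group_cong[OF V.M.abelian_group_axioms]) (simp_all add: pres_alg_simps)
  have "ring ?A"
    by (rule ringI[OF ag]; (rule monoidI)?; unfold pres_alg_simps)
      (simp_all add: l cl assoc unit)
  moreover have "module k ?A"
    by (rule module_cong[OF V.module_axioms]) (simp_all add: pres_alg_simps)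
  moreover have "k_algebra_axioms k ?A"
    by (rule k_algebra_axioms.intro; unfold pres_alg_simps) (simp_all add: l)
  ultimately show ?thesis by (simp add: k_algebra_def)
qed

end


subsection \<open>The tensor algebra of a bimodule\<close>

lemma word_rels_closed:
  assumes "cring k" shows "word_rels k R X \<subseteq> carrier (free_module k (words R X))"
  using rel_closed[OF assms] by (auto simp: word_rels_def Let_def)

lemma word_mult_simps:
  "word_mult R X (r, []) (s, v) = (r \<otimes>\<^bsub>R\<^esub> s, v)"
  "word_mult R X (r, u @ [x]) (s, v) = (r, u @ ract X x s # v)"
  "word_mult R X (r, [x]) (s, v) = (r, ract X x s # v)"
  "word_mult R X (r, u @ x # u' @ [y]) (s, v) = (r, u @ x # u' @ ract X y s # v)"
  "word_mult R X (r, u @ x # z # u' @ [y]) (s, v) = (r, u @ x # z # u' @ ract X y s # v)"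
  "word_mult R X (r, u @ [x, y]) (s, v) = (r, u @ x # ract X y s # v)"
  "word_mult R X (r, x # u' @ [y]) (s, v) = (r, x # u' @ ract X y s # v)"
  by (simp_all add: word_mult_def butlast_append)

lemma tensor_alg_pres_alg:
  "tensor_alg k R X = pres_alg k (words R X) (word_rels k R X) (word_mult R X) (\<one>\<^bsub>R\<^esub>, [])"
  by (simp add: tensor_alg_def pres_alg_def word_class_def Let_def)

context
  fixes k :: "('k, 'w) ring_scheme" and R :: "('k, 'r, 'u1) module_scheme"
    and X :: "('k, 'r, 'r, 'x, 'u2) bimodule_scheme"
  assumes X: "bimodule k R R X"
begin

interpretation X: bimodule k R R X by (rule X)

abbreviation (input) WV where "WV \<equiv> pres_module k (words R X) (word_rels k R X)"
abbreviation (input) wc where "wc \<equiv> word_class k R X"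

lemma ground_cring': "cring k" by (rule X.left.R.cring_axioms)

lemma tensor_alg_simps:
  "carrier (tensor_alg k R X) = carrier WV" "zero (tensor_alg k R X) = zero WV"
  "add (tensor_alg k R X) = add WV" "smult (tensor_alg k R X) = smult WV"
  "one (tensor_alg k R X) = wc (\<one>\<^bsub>R\<^esub>, [])"
  by (simp_all add: tensor_alg_def Let_def)

lemma word_class_closed: "wc w \<in> carrier WV"
  unfolding word_class_def by (rule pres_class_closed[OF ground_cring' word_rels_closed[OF ground_cring']])

lemma word_class_rules:
  assumes r: "r \<in> carrier R" and u: "set u \<subseteq> carrier X" and v: "set v \<subseteq> carrier X"
  shows "r' \<in> carrier R \<Longrightarrow> wc (r, u) \<oplus>\<^bsub>WV\<^esub> wc (r', u) = wc (r \<oplus>\<^bsub>R\<^esub> r', u)"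
    and "c \<in> carrier k \<Longrightarrow> c \<odot>\<^bsub>WV\<^esub> wc (r, u) = wc (c \<odot>\<^bsub>R\<^esub> r, u)"
    and "\<lbrakk>x \<in> carrier X; y \<in> carrier X\<rbrakk> \<Longrightarrow>
      wc (r, u @ x # v) \<oplus>\<^bsub>WV\<^esub> wc (r, u @ y # v) = wc (r, u @ (x \<oplus>\<^bsub>X\<^esub> y) # v)"
    and "\<lbrakk>c \<in> carrier k; x \<in> carrier X\<rbrakk> \<Longrightarrow>
      c \<odot>\<^bsub>WV\<^esub> wc (r, u @ x # v) = wc (r, u @ (c \<odot>\<^bsub>X\<^esub> x) # v)"
    and "\<lbrakk>s \<in> carrier R; x \<in> carrier X\<rbrakk> \<Longrightarrow> wc (r \<otimes>\<^bsub>R\<^esub> s, x # v) = wc (r, lact X s x # v)"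
    and "\<lbrakk>s \<in> carrier R; x \<in> carrier X; y \<in> carrier X\<rbrakk> \<Longrightarrow>
      wc (r, u @ ract X x s # y # v) = wc (r, u @ x # lact X s y # v)"
proof -
  note g = word_rels_closed[OF ground_cring']
  note a = pres_class_add[OF ground_cring' g] and sm = pres_class_smult[OF ground_cring' g]
    and e = pres_class_eq[OF ground_cring' g]
  note rel = word_rels_def[of k R X, unfolded Let_def]
  have uv: "u \<in> lists (carrier X)" "v \<in> lists (carrier X)" using u v by auto
  show "r' \<in> carrier R \<Longrightarrow> wc (r, u) \<oplus>\<^bsub>WV\<^esub> wc (r', u) = wc (r \<oplus>\<^bsub>R\<^esub> r', u)"
    unfolding word_class_def by (rule a, unfold rel, (rule UnI1)+, use r uv in blast)
  show "c \<in> carrier k \<Longrightarrow> c \<odot>\<^bsub>WV\<^esub> wc (r, u) = wc (c \<odot>\<^bsub>R\<^esub> r, u)"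
    unfolding word_class_def
    by (rule sm, unfold rel, rule UnI1, rule UnI1, rule UnI1, rule UnI1, rule UnI2,
        (use r uv in blast)+)
  show "wc (r, u @ x # v) \<oplus>\<^bsub>WV\<^esub> wc (r, u @ y # v) = wc (r, u @ (x \<oplus>\<^bsub>X\<^esub> y) # v)"
    if "x \<in> carrier X" "y \<in> carrier X"
  proof -
    have "rel_add k (words R X) (r, u @ [x] @ v) (r, u @ [y] @ v) (r, u @ [x \<oplus>\<^bsub>X\<^esub> y] @ v)
        \<in> word_rels k R X"
      unfolding rel by (rule UnI1, rule UnI1, rule UnI1, rule UnI2) (use r uv that in blast)
    from a[OF this] show ?thesis by (simp add: word_class_def)
  qed
  show "c \<odot>\<^bsub>WV\<^esub> wc (r, u @ x # v) = wc (r, u @ (c \<odot>\<^bsub>X\<^esub> x) # v)" if "c \<in> carrier k" "x \<in> carrier X"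
  proof -
    have "rel_smult k (words R X) c (r, u @ [x] @ v) (r, u @ [c \<odot>\<^bsub>X\<^esub> x] @ v) \<in> word_rels k R X"
      unfolding rel by (rule UnI1, rule UnI1, rule UnI2) (use r uv that in blast)
    from sm[OF this that(1)] show ?thesis by (simp add: word_class_def)
  qed
  show "wc (r \<otimes>\<^bsub>R\<^esub> s, x # v) = wc (r, lact X s x # v)" if "s \<in> carrier R" "x \<in> carrier X"
  proof -
    have "rel_eq k (words R X) (r \<otimes>\<^bsub>R\<^esub> s, [x] @ v) (r, [lact X s x] @ v) \<in> word_rels k R X"
      unfolding rel by (rule UnI1, rule UnI2) (use r uv that in blast)
    from e[OF this] show ?thesis by (simp add: word_class_def)
  qed
  show "wc (r, u @ ract X x s # y # v) = wc (r, u @ x # lact X s y # v)"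
    if "s \<in> carrier R" "x \<in> carrier X" "y \<in> carrier X"
  proof -
    have "rel_eq k (words R X) (r, u @ [ract X x s, y] @ v) (r, u @ [x, lact X s y] @ v)
        \<in> word_rels k R X"
      unfolding rel by (rule UnI2) (use r uv that in blast)
    from e[OF this] show ?thesis by (simp add: word_class_def)
  qed
qed

lemmas word_class_coeff = word_class_rules(1,2)[where v = "[]"] word_class_rules(5)[where u = "[]"]

lemma in_words_iff: "(r, u) \<in> words R X \<longleftrightarrow> r \<in> carrier R \<and> set u \<subseteq> carrier X"
  by (auto simp: words_def)

text \<open>The conditions on \<open>g\<close> correspond to the six families in \<^const>\<open>word_rels\<close>.\<close>

lemma word_rels_killI:
  assumes Y: "module k Y" and g: "g \<in> words R X \<rightarrow> carrier Y"
    and add: "\<And>r r' u. \<lbrakk>r \<in> carrier R; r' \<in> carrier R; set u \<subseteq> carrier X\<rbrakk> \<Longrightarrow>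
      g (r, u) \<oplus>\<^bsub>Y\<^esub> g (r', u) = g (r \<oplus>\<^bsub>R\<^esub> r', u)"
    and smult: "\<And>c r u. \<lbrakk>c \<in> carrier k; r \<in> carrier R; set u \<subseteq> carrier X\<rbrakk> \<Longrightarrow>
      c \<odot>\<^bsub>Y\<^esub> g (r, u) = g (c \<odot>\<^bsub>R\<^esub> r, u)"
    and add': "\<And>r u x y v. \<lbrakk>r \<in> carrier R; set u \<subseteq> carrier X; x \<in> carrier X; y \<in> carrier X;
      set v \<subseteq> carrier X\<rbrakk> \<Longrightarrow> g (r, u @ x # v) \<oplus>\<^bsub>Y\<^esub> g (r, u @ y # v) = g (r, u @ (x \<oplus>\<^bsub>X\<^esub> y) # v)"
    and smult': "\<And>c r u x v. \<lbrakk>c \<in> carrier k; r \<in> carrier R; set u \<subseteq> carrier X; x \<in> carrier X;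
      set v \<subseteq> carrier X\<rbrakk> \<Longrightarrow> c \<odot>\<^bsub>Y\<^esub> g (r, u @ x # v) = g (r, u @ (c \<odot>\<^bsub>X\<^esub> x) # v)"
    and left: "\<And>r s x v. \<lbrakk>r \<in> carrier R; s \<in> carrier R; x \<in> carrier X; set v \<subseteq> carrier X\<rbrakk> \<Longrightarrow>
      g (r \<otimes>\<^bsub>R\<^esub> s, x # v) = g (r, lact X s x # v)"
    and mid: "\<And>r u x s y v. \<lbrakk>r \<in> carrier R; set u \<subseteq> carrier X; x \<in> carrier X; s \<in> carrier R;
      y \<in> carrier X; set v \<subseteq> carrier X\<rbrakk> \<Longrightarrow>
      g (r, u @ ract X x s # y # v) = g (r, u @ x # lact X s y # v)"
    and w: "w \<in> word_rels k R X"
  shows "free_lift k (words R X) Y g w = \<zero>\<^bsub>Y\<^esub>"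
proof -
  note fl = free_lift_rel[OF Y g]
  note cl = X.left.smult_closed X.lact_closed X.ract_closed
  from w show ?thesis unfolding word_rels_def Let_def
  proof (elim UnE CollectE exE conjE)
    fix r r' u assume a: "r \<in> carrier R" "r' \<in> carrier R" "u \<in> lists (carrier X)"
      "w = rel_add k (words R X) (r, u) (r', u) (r \<oplus>\<^bsub>R\<^esub> r', u)"
    show ?thesis unfolding a(4) by (rule fl) (use a(1-3) in \<open>auto simp: in_words_iff intro!: add\<close>)
  next
    fix c r u assume a: "c \<in> carrier k" "r \<in> carrier R" "u \<in> lists (carrier X)"
      "w = rel_smult k (words R X) c (r, u) (c \<odot>\<^bsub>R\<^esub> r, u)"
    show ?thesis unfolding a(4) by (rule fl) (use a(1-3) in \<open>auto simp: in_words_iff intro!: smult\<close>)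
  next
    fix r u x y v assume a: "r \<in> carrier R" "u \<in> lists (carrier X)" "x \<in> carrier X" "y \<in> carrier X"
      "v \<in> lists (carrier X)"
      "w = rel_add k (words R X) (r, u @ [x] @ v) (r, u @ [y] @ v) (r, u @ [x \<oplus>\<^bsub>X\<^esub> y] @ v)"
    show ?thesis unfolding a(6)
      by (rule fl) (use a(1-5) in \<open>auto simp: in_words_iff intro!: add'\<close>)
  next
    fix c r u x v assume a: "c \<in> carrier k" "r \<in> carrier R" "u \<in> lists (carrier X)" "x \<in> carrier X"
      "v \<in> lists (carrier X)"
      "w = rel_smult k (words R X) c (r, u @ [x] @ v) (r, u @ [c \<odot>\<^bsub>X\<^esub> x] @ v)"
    show ?thesis unfolding a(6)
      by (rule fl) (use a(1-5) in \<open>auto simp: in_words_iff intro!: smult'\<close>)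
  next
    fix r s x v assume a: "r \<in> carrier R" "s \<in> carrier R" "x \<in> carrier X" "v \<in> lists (carrier X)"
      "w = rel_eq k (words R X) (r \<otimes>\<^bsub>R\<^esub> s, [x] @ v) (r, [lact X s x] @ v)"
    show ?thesis unfolding a(5)
      by (rule fl) (use a(1-4) in \<open>auto simp: in_words_iff cl intro!: left\<close>)
  next
    fix r u x s y v assume a: "r \<in> carrier R" "u \<in> lists (carrier X)" "x \<in> carrier X"
      "s \<in> carrier R" "y \<in> carrier X" "v \<in> lists (carrier X)"
      "w = rel_eq k (words R X) (r, u @ [ract X x s, y] @ v) (r, u @ [x, lact X s y] @ v)"
    show ?thesis unfolding a(7)
      by (rule fl) (use a(1-6) in \<open>auto simp: in_words_iff cl intro!: mid\<close>)
  qed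
qed

lemma word_mult_closed:
  "\<lbrakk>w \<in> words R X; w' \<in> words R X\<rbrakk> \<Longrightarrow> word_mult R X w w' \<in> words R X"
proof -
  assume w: "w \<in> words R X" "w' \<in> words R X"
  obtain r u s v where e: "w = (r, u)" "w' = (s, v)" by (cases w; cases w')
  show ?thesis using w unfolding e
    by (cases u rule: rev_cases) (auto simp: in_words_iff word_mult_simps X.ract_closed)
qed

lemma word_mult_assoc:
  assumes "w \<in> words R X" "w' \<in> words R X" "w'' \<in> words R X"
  shows "word_mult R X (word_mult R X w w') w'' = word_mult R X w (word_mult R X w' w'')"
proof -
  obtain r u s v t z where e: "w = (r, u)" "w' = (s, v)" "w'' = (t, z)" by (cases w; cases w'; cases w'')
  show ?thesis using assms unfolding e
    by (cases u rule: rev_cases; cases v rule: rev_cases)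
      (auto simp: in_words_iff word_mult_simps X.left.m_assoc X.ract_mult)
qed

lemma word_mult_unit:
  assumes "w \<in> words R X"
  shows "word_mult R X (\<one>\<^bsub>R\<^esub>, []) w = w" "word_mult R X w (\<one>\<^bsub>R\<^esub>, []) = w"
proof -
  obtain r u where e: "w = (r, u)" by (cases w)
  show "word_mult R X (\<one>\<^bsub>R\<^esub>, []) w = w" "word_mult R X w (\<one>\<^bsub>R\<^esub>, []) = w"
    using assms unfolding e
    by (auto simp: in_words_iff word_mult_simps, cases u rule: rev_cases)
      (auto simp: word_mult_simps X.ract_one)
qed

text \<open>In a product of words only the last letter of the left word changes: it absorbs the coefficient of
  the right word. A relation for that coefficient becomes a relation at this letter, or for the
  coefficient of the left word if that has no letters.\<close>

lemma word_mult_kill_right: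
  assumes w: "w \<in> words R X" and g: "g \<in> word_rels k R X"
  shows "free_lift k (words R X) WV (\<lambda>w'. wc (word_mult R X w w')) g = \<zero>\<^bsub>WV\<^esub>"
proof -
  obtain r u where e: "w = (r, u)" by (cases w)
  have r: "r \<in> carrier R" and u: "set u \<subseteq> carrier X" using w unfolding e in_words_iff by auto
  note rules = word_class_rules
  have V: "module k WV" by (rule pres_module_module[OF ground_cring' word_rels_closed[OF ground_cring']])
  show ?thesis
  proof (cases u rule: rev_cases)
    case Nil
    show ?thesis unfolding e Nil
    proof (rule word_rels_killI[OF V _ _ _ _ _ _ _ g], goal_cases)
      case 1 show ?case by (simp add: word_class_closed)
    next
      case 2 then show ?case by (simp add: word_mult_simps r word_class_coeff X.left.r_distr)
    next
      case 3 then show ?case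
        by (simp add: word_mult_simps r word_class_coeff X.left.smult_mult_right)
    next
      case 4 then show ?case by (simp add: word_mult_simps r rules(3))
    next
      case 5 then show ?case by (simp add: word_mult_simps r rules(4))
    next
      case 6 then show ?case
        by (simp add: word_mult_simps r word_class_coeff X.left.m_assoc[symmetric])
    next
      case 7 then show ?case by (simp add: word_mult_simps r rules(6))
    qed
  next
    case (snoc u0 z)
    have z: "z \<in> carrier X" "set u0 \<subseteq> carrier X" using u snoc by auto
    have a: "u0 @ x # v @ y = (u0 @ x # v) @ y" for x v y by simp
    show ?thesis unfolding e snoc
    proof (rule word_rels_killI[OF V _ _ _ _ _ _ _ g], goal_cases)
      case 1 show ?case by (simp add: word_class_closed)
    next
      case (2 s s' v)
      then show ?case
        using rules(3)[OF r z(2), of v "ract X z s" "ract X z s'"] z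
        by (simp add: word_mult_simps X.ract_add_right X.ract_closed)
    next
      case (3 c s v)
      then show ?case
        using rules(4)[OF r z(2), of v c "ract X z s"] z
        by (simp add: word_mult_simps X.ract_smult_right X.ract_closed)
    next
      case (4 s u' x y v)
      then show ?case
        using rules(3)[OF r, of "u0 @ ract X z s # u'" v x y] z
        by (simp add: word_mult_simps X.ract_closed)
    next
      case (5 c s u' x v)
      then show ?case
        using rules(4)[OF r, of "u0 @ ract X z s # u'" v c x] z
        by (simp add: word_mult_simps X.ract_closed)
    next
      case (6 s t x v)
      then show ?case
        using rules(6)[OF r z(2), of v t "ract X z s" x] z
        by (simp add: word_mult_simps X.ract_closed X.ract_mult)
    next
      case (7 s u' x t y v)
      then show ?case
        using rules(6)[OF r, of "u0 @ ract X z s # u'" v t x y] z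
        by (simp add: word_mult_simps X.ract_closed)
    qed
  qed
qed

lemma word_mult_kill_left:
  assumes w: "w' \<in> words R X" and g: "g \<in> word_rels k R X"
  shows "free_lift k (words R X) WV (\<lambda>w. wc (word_mult R X w w')) g = \<zero>\<^bsub>WV\<^esub>"
proof -
  obtain s v where e: "w' = (s, v)" by (cases w')
  have s: "s \<in> carrier R" and v: "set v \<subseteq> carrier X" using w unfolding e in_words_iff by auto
  note rules = word_class_rules
  have V: "module k WV" by (rule pres_module_module[OF ground_cring' word_rels_closed[OF ground_cring']])
  show ?thesis unfolding e
  proof (rule word_rels_killI[OF V _ _ _ _ _ _ _ g], goal_cases)
    case 1 show ?case by (simp add: word_class_closed)
  next
    case (2 r r' u)
    then show ?case
      by (cases u rule: rev_cases)
        (simp_all add: word_mult_simps word_class_coeff s v X.ract_closed X.left.l_distr)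
  next
    case (3 c r u)
    then show ?case
      by (cases u rule: rev_cases)
        (simp_all add: word_mult_simps word_class_coeff s v X.ract_closed X.left.smult_mult_left)
  next
    case (4 r u x y u')
    then show ?case
      by (cases u' rule: rev_cases)
        (simp_all add: word_mult_simps rules(3) s v X.ract_closed X.ract_add_left)
  next
    case (5 c r u x u')
    then show ?case
      by (cases u' rule: rev_cases)
        (simp_all add: word_mult_simps rules(4) s v X.ract_closed X.ract_smult_left)
  next
    case (6 r t x u')
    then show ?case
      by (cases u' rule: rev_cases)
        (simp_all add: word_mult_simps word_class_coeff s v X.ract_closed X.lact_closed X.lact_ract)
  next
    case (7 r u x t y u')
    then show ?case
      by (cases u' rule: rev_cases)
        (simp_all add: word_mult_simps rules(6) s v X.ract_closed X.lact_closed X.lact_ract)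
  qed
qed

lemma one_word: "(\<one>\<^bsub>R\<^esub>, []) \<in> words R X" by (simp add: in_words_iff)

lemma tensor_alg_k_algebra: "k_algebra k (tensor_alg k R X)"
  unfolding tensor_alg_pres_alg
  by (rule pres_alg_k_algebra[OF ground_cring' word_rels_closed[OF ground_cring']])
    (simp_all add: word_mult_closed one_word word_mult_assoc word_mult_unit
      word_mult_kill_right[unfolded word_class_def] word_mult_kill_left[unfolded word_class_def])

lemma tensor_alg_mult_class:
  "\<lbrakk>w \<in> words R X; w' \<in> words R X\<rbrakk> \<Longrightarrow>
    wc w \<otimes>\<^bsub>tensor_alg k R X\<^esub> wc w' = wc (word_mult R X w w')"
  unfolding tensor_alg_pres_alg word_class_def
  by (rule pres_alg_mult_class[OF ground_cring' word_rels_closed[OF ground_cring']])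
    (simp_all add: word_mult_closed one_word word_mult_assoc word_mult_unit
      word_mult_kill_right[unfolded word_class_def] word_mult_kill_left[unfolded word_class_def])

interpretation T: k_algebra k "tensor_alg k R X" by (rule tensor_alg_k_algebra)

lemma in0_alg_hom: "tensor_alg_in0 k R X \<in> alg_hom k R (tensor_alg k R X)"
  by (auto intro!: alg_homI linear_mapsI simp: tensor_alg_in0_def tensor_alg_simps(1,3,4,5)
      word_class_closed word_class_coeff tensor_alg_mult_class in_words_iff word_mult_simps)

lemma in1_linear: "tensor_alg_in1 k R X \<in> linear_maps k X (tensor_alg k R X)"
  using word_class_rules(3,4)[of "\<one>\<^bsub>R\<^esub>" "[]" "[]"]
  by (auto intro!: linear_mapsI simp: tensor_alg_in1_def tensor_alg_simps word_class_closed)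

lemma in1_lact: "\<lbrakk>r \<in> carrier R; x \<in> carrier X\<rbrakk> \<Longrightarrow> tensor_alg_in1 k R X (lact X r x) =
    tensor_alg_in0 k R X r \<otimes>\<^bsub>tensor_alg k R X\<^esub> tensor_alg_in1 k R X x"
  using word_class_rules(5)[of "\<one>\<^bsub>R\<^esub>" "[]" "[]" r x]
  by (simp add: tensor_alg_in1_def tensor_alg_in0_def tensor_alg_mult_class in_words_iff
      word_mult_simps)

lemma in1_ract: "\<lbrakk>r \<in> carrier R; x \<in> carrier X\<rbrakk> \<Longrightarrow> tensor_alg_in1 k R X (ract X x r) =
    tensor_alg_in1 k R X x \<otimes>\<^bsub>tensor_alg k R X\<^esub> tensor_alg_in0 k R X r"
  by (simp add: tensor_alg_in1_def tensor_alg_in0_def tensor_alg_mult_class in_words_iff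
      word_mult_simps)

lemma tensor_alg_induct [consumes 1, case_names in0 mult_in1 add smult]:
  assumes "U \<in> carrier (tensor_alg k R X)"
    and in0: "\<And>r. r \<in> carrier R \<Longrightarrow> Q (tensor_alg_in0 k R X r)"
    and in1: "\<And>U x. \<lbrakk>U \<in> carrier (tensor_alg k R X); x \<in> carrier X; Q U\<rbrakk> \<Longrightarrow>
      Q (U \<otimes>\<^bsub>tensor_alg k R X\<^esub> tensor_alg_in1 k R X x)"
    and add: "\<And>U W. \<lbrakk>U \<in> carrier (tensor_alg k R X); W \<in> carrier (tensor_alg k R X); Q U; Q W\<rbrakk> \<Longrightarrow>
      Q (U \<oplus>\<^bsub>tensor_alg k R X\<^esub> W)"
    and smult: "\<And>c U. \<lbrakk>c \<in> carrier k; U \<in> carrier (tensor_alg k R X); Q U\<rbrakk> \<Longrightarrow>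
      Q (c \<odot>\<^bsub>tensor_alg k R X\<^esub> U)"
  shows "Q U"
proof -
  have Qw: "Q (wc (r, u))" if "r \<in> carrier R" "set u \<subseteq> carrier X" for r u
    using that(2)
  proof (induction u rule: rev_induct)
    case Nil
    then show ?case using in0[OF that(1)] by (simp add: tensor_alg_in0_def)
  next
    case (snoc x u)
    have "wc (r, u @ [x]) = wc (r, u) \<otimes>\<^bsub>tensor_alg k R X\<^esub> tensor_alg_in1 k R X x"
      using snoc.prems that(1) by (cases u rule: rev_cases)
        (simp_all add: tensor_alg_in1_def tensor_alg_mult_class in_words_iff word_mult_simps X.ract_one)
    then show ?case using in1[of "wc (r, u)" x] snoc word_class_closed by (simp add: tensor_alg_simps)
  qed
  have ne: "words R X \<noteq> {}" using one_word by blast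
  show ?thesis
    by (rule pres_module_induct[OF ground_cring' word_rels_closed[OF ground_cring'] _ _ _ _ ne])
      (use assms(1) add smult Qw in \<open>auto simp: tensor_alg_simps words_def word_class_def lists_eq_set\<close>)
qed

lemma tensor_alg_hom_eqI:
  assumes B: "k_algebra k B"
    and f: "f \<in> alg_hom k (tensor_alg k R X) B" and g: "g \<in> alg_hom k (tensor_alg k R X) B"
    and "\<And>r. r \<in> carrier R \<Longrightarrow> f (tensor_alg_in0 k R X r) = g (tensor_alg_in0 k R X r)"
    and "\<And>x. x \<in> carrier X \<Longrightarrow> f (tensor_alg_in1 k R X x) = g (tensor_alg_in1 k R X x)"
    and "U \<in> carrier (tensor_alg k R X)"
  shows "f U = g U"
  using assms(6)
  by (induction U rule: tensor_alg_induct)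
    (simp_all add: assms(4,5) alg_homD[OF f] alg_homD[OF g] linear_maps_closed[OF in1_linear])

end

definition compatible_pair ::
  "('k, 'w) ring_scheme \<Rightarrow> ('k, 'r, 'z) module_scheme \<Rightarrow> ('k, 'r, 'r, 'x, 'u) bimodule_scheme \<Rightarrow>
   ('k, 'b, 'v) module_scheme \<Rightarrow> ('r \<Rightarrow> 'b) \<Rightarrow> ('x \<Rightarrow> 'b) \<Rightarrow> bool"
  where "compatible_pair k R X B f0 f1 \<longleftrightarrow> f0 \<in> alg_hom k R B \<and> f1 \<in> linear_maps k X B \<and>
    (\<forall>r \<in> carrier R. \<forall>x \<in> carrier X. f1 (lact X r x) = f0 r \<otimes>\<^bsub>B\<^esub> f1 x) \<and>
    (\<forall>r \<in> carrier R. \<forall>x \<in> carrier X. f1 (ract X x r) = f1 x \<otimes>\<^bsub>B\<^esub> f0 r)"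

text \<open>The word \<open>(r, [x\<^sub>1, \<dots>, x\<^sub>n])\<close> has to be sent to \<open>f0 r \<sqdot> f1 x\<^sub>1 \<sqdot> \<dots> \<sqdot> f1 x\<^sub>n\<close>. This respects the
  relations because \<open>f0\<close> and \<open>f1\<close> are linear and \<open>f1\<close> is compatible with both actions.\<close>

lemma tensor_alg_lift:
  assumes X: "bimodule k R R X" and B: "k_algebra k B" and c: "compatible_pair k R X B f0 f1"
  obtains F where "F \<in> alg_hom k (tensor_alg k R X) B"
    and "\<And>r. r \<in> carrier R \<Longrightarrow> F (tensor_alg_in0 k R X r) = f0 r"
    and "\<And>x. x \<in> carrier X \<Longrightarrow> F (tensor_alg_in1 k R X x) = f1 x"
proof -
  interpret X: bimodule k R R X by (rule X)
  interpret B: k_algebra k B by (rule B)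
  interpret T: k_algebra k "tensor_alg k R X" by (rule tensor_alg_k_algebra[OF X])
  have f0: "f0 \<in> alg_hom k R B" and f1: "f1 \<in> linear_maps k X B"
    and l: "\<And>r x. \<lbrakk>r \<in> carrier R; x \<in> carrier X\<rbrakk> \<Longrightarrow> f1 (lact X r x) = f0 r \<otimes>\<^bsub>B\<^esub> f1 x"
    and rr: "\<And>r x. \<lbrakk>r \<in> carrier R; x \<in> carrier X\<rbrakk> \<Longrightarrow> f1 (ract X x r) = f1 x \<otimes>\<^bsub>B\<^esub> f0 r"
    using c by (auto simp: compatible_pair_def)
  note f0D = alg_homD[OF f0] and f1D = linear_mapsD[OF f1]
  define P where "P u = foldr (\<lambda>x b. f1 x \<otimes>\<^bsub>B\<^esub> b) u \<one>\<^bsub>B\<^esub>" for u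
  have P_simps: "P [] = \<one>\<^bsub>B\<^esub>" "P (x # u) = f1 x \<otimes>\<^bsub>B\<^esub> P u" for x u by (simp_all add: P_def)
  have P_closed: "P u \<in> carrier B" if "set u \<subseteq> carrier X" for u
    using that by (induction u) (auto simp: P_simps f1D)
  have P_append: "P (u @ v) = P u \<otimes>\<^bsub>B\<^esub> P v" if "set u \<subseteq> carrier X" "set v \<subseteq> carrier X" for u v
    using that by (induction u) (auto simp: P_simps f1D P_closed B.m_assoc)
  define g where "g = (\<lambda>(r, u). f0 r \<otimes>\<^bsub>B\<^esub> P u)"
  have g: "g (r, u) = f0 r \<otimes>\<^bsub>B\<^esub> P u" for r u by (simp add: g_def)
  have gc: "g \<in> words R X \<rightarrow> carrier B" by (auto simp: words_def g f0D P_closed lists_eq_set)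
  have mm: "x \<otimes>\<^bsub>B\<^esub> (y \<otimes>\<^bsub>B\<^esub> z) = x \<otimes>\<^bsub>B\<^esub> y \<otimes>\<^bsub>B\<^esub> z" if "x \<in> carrier B" "y \<in> carrier B" "z \<in> carrier B"
    for x y z using that by (simp add: B.m_assoc)
  have kill: "free_lift k (words R X) B g w = \<zero>\<^bsub>B\<^esub>" if "w \<in> word_rels k R X" for w
    by (rule word_rels_killI[OF X B.module_axioms gc _ _ _ _ _ _ that])
      (simp_all add: g P_append P_simps P_closed f0D f1D l rr B.l_distr B.r_distr
        B.smult_mult_left B.smult_mult_right mm X.lact_closed X.ract_closed)
  let ?F = "pres_lift k (words R X) B g"
  note kc = X.left.R.cring_axioms
  note wr = word_rels_closed[OF kc]
  have Fl: "?F \<in> linear_maps k (tensor_alg k R X) B"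
    using pres_lift_linear[OF kc wr B.module_axioms gc kill]
    by (simp add: linear_maps_def tensor_alg_simps[OF X])
  have Fc: "?F (word_class k R X w) = g w" if "w \<in> words R X" for w
    unfolding word_class_def by (rule pres_lift_class[OF kc wr B.module_axioms gc kill that])
  have F0: "?F (tensor_alg_in0 k R X r) = f0 r" if "r \<in> carrier R" for r
    using Fc that by (simp add: tensor_alg_in0_def in_words_iff[OF X] g P_simps f0D)
  have F1: "?F (tensor_alg_in1 k R X x) = f1 x" if "x \<in> carrier X" for x
    using Fc that by (simp add: tensor_alg_in1_def in_words_iff[OF X] g P_simps f0D f1D)
  note FD = linear_mapsD[OF Fl]
  have gm: "g (word_mult R X w w') = g w \<otimes>\<^bsub>B\<^esub> g w'" if "w \<in> words R X" "w' \<in> words R X" for w w'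
  proof -
    obtain r u s v where e: "w = (r, u)" "w' = (s, v)" by (cases w; cases w')
    show ?thesis using that unfolding e
      by (cases u rule: rev_cases)
        (auto simp: in_words_iff[OF X] word_mult_simps g P_append P_simps P_closed f0D f1D rr mm
          X.ract_closed)
  qed
  have ne: "words R X \<noteq> {}" using one_word[OF X] by blast
  note ind = pres_module_induct[OF kc wr _ _ _ _ ne]
  note ts = tensor_alg_simps[OF X]
  have FM1: "?F (word_class k R X w \<otimes>\<^bsub>tensor_alg k R X\<^esub> W) = g w \<otimes>\<^bsub>B\<^esub> ?F W"
    if w: "w \<in> words R X" and W: "W \<in> carrier (tensor_alg k R X)" for w W
  proof -
    have wT: "word_class k R X w \<in> carrier (tensor_alg k R X)"
      using word_class_closed[OF X] by (simp add: ts)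
    have gw: "g w \<in> carrier B" using gc w by blast
    from W[unfolded ts] show ?thesis
    proof (rule ind)
      fix s assume "s \<in> words R X"
      then show "?F (word_class k R X w \<otimes>\<^bsub>tensor_alg k R X\<^esub> pres_class k (words R X) (word_rels k R X) s)
          = g w \<otimes>\<^bsub>B\<^esub> ?F (pres_class k (words R X) (word_rels k R X) s)"
        using w Fc by (simp add: word_class_def[symmetric] tensor_alg_mult_class[OF X] gm
            word_mult_closed[OF X])
    qed (simp_all add: ts(1,3,4)[symmetric] T.r_distr T.smult_mult_right wT gw FD B.r_distr
        B.smult_mult_right)
  qed
  have FM: "?F (U \<otimes>\<^bsub>tensor_alg k R X\<^esub> W) = ?F U \<otimes>\<^bsub>B\<^esub> ?F W"
    if U: "U \<in> carrier (tensor_alg k R X)" and W: "W \<in> carrier (tensor_alg k R X)" for U W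
    using U[unfolded ts]
  proof (rule ind)
    fix s assume "s \<in> words R X"
    then show "?F (pres_class k (words R X) (word_rels k R X) s \<otimes>\<^bsub>tensor_alg k R X\<^esub> W)
        = ?F (pres_class k (words R X) (word_rels k R X) s) \<otimes>\<^bsub>B\<^esub> ?F W"
      using FM1[OF _ W] Fc by (simp add: word_class_def[symmetric])
  qed (simp_all add: ts(1,3,4)[symmetric] T.l_distr T.smult_mult_left W FD B.l_distr
      B.smult_mult_left)
  have "?F \<in> alg_hom k (tensor_alg k R X) B"
    by (rule alg_homI[OF Fl FM])
      (use Fc[OF one_word[OF X]] in \<open>simp_all add: ts g P_simps f0D\<close>)
  then show thesis using F0 F1 that by blast
qed

section \<open>Duality over a symmetric algebra\<close>

subsection \<open>One-sided actions\<close>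

text \<open>Left modules will be treated as right modules over the opposite algebra.\<close>

definition opp :: "('k, 'r, 'u) module_scheme \<Rightarrow> ('k, 'r, 'u) module_scheme"
  where "opp R = R\<lparr>mult := (\<lambda>x y. y \<otimes>\<^bsub>R\<^esub> x)\<rparr>"

lemma opp_simps [simp]:
  "carrier (opp R) = carrier R" "zero (opp R) = zero R" "one (opp R) = one R"
  "add (opp R) = add R" "smult (opp R) = smult R" "mult (opp R) x y = y \<otimes>\<^bsub>R\<^esub> x"
  by (simp_all add: opp_def)

lemma opp_k_algebra: assumes "k_algebra k R" shows "k_algebra k (opp R)"
proof -
  interpret R: k_algebra k R by fact
  have "abelian_group (opp R)" by (rule abelian_group_cong[OF R.abelian_group_axioms]) simp_all
  moreover have "Group.monoid (opp R)" by (rule monoidI) (simp_all add: R.m_assoc)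
  ultimately have "ring (opp R)" by (rule ringI) (simp_all add: R.l_distr R.r_distr)
  moreover have "module k (opp R)" by (rule module_cong[OF R.module_axioms]) simp_all
  moreover have "k_algebra_axioms k (opp R)"
    by (rule k_algebra_axioms.intro) (simp_all add: R.smult_mult_left R.smult_mult_right)
  ultimately show ?thesis by (simp add: k_algebra_def)
qed

locale right_module = alg: k_algebra k A + module k X
  for k (structure) and A (structure) and X (structure) +
  fixes act
  assumes act_closed: "\<lbrakk>x \<in> carrier X; a \<in> carrier A\<rbrakk> \<Longrightarrow> act x a \<in> carrier X"
    and act_add_left: "\<lbrakk>x \<in> carrier X; y \<in> carrier X; a \<in> carrier A\<rbrakk> \<Longrightarrow>
      act (x \<oplus>\<^bsub>X\<^esub> y) a = act x a \<oplus>\<^bsub>X\<^esub> act y a"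
    and act_add_right: "\<lbrakk>x \<in> carrier X; a \<in> carrier A; b \<in> carrier A\<rbrakk> \<Longrightarrow>
      act x (a \<oplus>\<^bsub>A\<^esub> b) = act x a \<oplus>\<^bsub>X\<^esub> act x b"
    and act_mult: "\<lbrakk>x \<in> carrier X; a \<in> carrier A; b \<in> carrier A\<rbrakk> \<Longrightarrow> act x (a \<otimes>\<^bsub>A\<^esub> b) = act (act x a) b"
    and act_one: "x \<in> carrier X \<Longrightarrow> act x \<one>\<^bsub>A\<^esub> = x"
    and act_scalar: "\<lbrakk>c \<in> carrier k; x \<in> carrier X\<rbrakk> \<Longrightarrow> act x (c \<odot>\<^bsub>A\<^esub> \<one>\<^bsub>A\<^esub>) = c \<odot>\<^bsub>X\<^esub> x"

lemma bimodule_right_module: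
  assumes "bimodule k R A X" shows "right_module k A X (ract X)"
proof -
  interpret bimodule k R A X by fact
  show ?thesis
    by (intro right_module.intro right_module_axioms.intro right.k_algebra_axioms module_axioms)
      (simp_all add: ract_closed ract_add_left ract_add_right ract_mult ract_one ract_scalar)
qed

lemma bimodule_left_module:
  assumes "bimodule k A S X" shows "right_module k (opp A) X (\<lambda>x a. lact X a x)"
proof -
  interpret bimodule k A S X by fact
  show ?thesis
    by (intro right_module.intro right_module_axioms.intro opp_k_algebra left.k_algebra_axioms
        module_axioms)
      (simp_all add: lact_closed lact_add_left lact_add_right lact_mult lact_one lact_scalar)
qed

context right_module
begin

lemma act_smult_right:
  assumes "c \<in> carrier k" "x \<in> carrier X" "a \<in> carrier A"
  shows "act x (c \<odot>\<^bsub>A\<^esub> a) = c \<odot>\<^bsub>X\<^esub> act x a"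
  using act_mult[of x a "c \<odot>\<^bsub>A\<^esub> \<one>\<^bsub>A\<^esub>"] alg.smult_mult_right[of c a "\<one>\<^bsub>A\<^esub>"] act_scalar act_closed assms
  by simp

lemma act_smult_left:
  assumes "c \<in> carrier k" "x \<in> carrier X" "a \<in> carrier A"
  shows "act (c \<odot>\<^bsub>X\<^esub> x) a = c \<odot>\<^bsub>X\<^esub> act x a"
  using act_mult[of x "c \<odot>\<^bsub>A\<^esub> \<one>\<^bsub>A\<^esub>" a] alg.smult_mult_left[of c "\<one>\<^bsub>A\<^esub>" a] act_scalar
    act_smult_right assms
  by simp

lemma act_linear_left: "a \<in> carrier A \<Longrightarrow> (\<lambda>x. act x a) \<in> linear_maps k X X"
  by (rule linear_mapsI) (auto simp: act_closed act_add_left act_smult_left)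

lemma act_linear_right: "x \<in> carrier X \<Longrightarrow> act x \<in> linear_maps k A X"
  by (rule linear_mapsI) (auto simp: act_closed act_add_right act_smult_right)

end


subsection \<open>Linear forms and module maps into a symmetric algebra\<close>

text \<open>\<^const>\<open>rvec\<close> is the case of a right action on a bimodule, \<^const>\<open>lvec\<close> that of a left action,
  viewed as a right action of the opposite algebra.\<close>

definition vec ::
  "('a, 'v) ring_scheme \<Rightarrow> ('a \<Rightarrow> 'k) \<Rightarrow> ('x, 'u) ring_scheme \<Rightarrow> ('x \<Rightarrow> 'a \<Rightarrow> 'x) \<Rightarrow> ('x \<Rightarrow> 'k) \<Rightarrow> 'x \<Rightarrow> 'a"
  where "vec A \<sigma> X act \<xi> =
    (THE f. f \<in> carrier X \<rightarrow>\<^sub>E carrier A \<and>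
      (\<forall>x \<in> carrier X. \<forall>y \<in> carrier X. f (x \<oplus>\<^bsub>X\<^esub> y) = f x \<oplus>\<^bsub>A\<^esub> f y) \<and>
      (\<forall>x \<in> carrier X. \<forall>a \<in> carrier A. f (act x a) = f x \<otimes>\<^bsub>A\<^esub> a) \<and>
      (\<forall>x \<in> carrier X. \<sigma> (f x) = \<xi> x))"

lemma rvec_vec: "rvec A \<sigma> X \<xi> = vec A \<sigma> X (ract X) \<xi>"
  by (simp add: rvec_def vec_def)

lemma lvec_vec: "lvec A \<sigma> X \<xi> = vec (opp A) \<sigma> X (\<lambda>x a. lact X a x) \<xi>"
  by (simp add: lvec_def vec_def)

locale symmetric_algebra = K: field k + k_algebra k A for k (structure) and A (structure) +
  fixes \<sigma>
  assumes fin: "fin_dim k A" and symm: "symmetrising k A \<sigma>"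

lemma symmetric_algebra_opp:
  assumes "symmetric_algebra k A \<sigma>" shows "symmetric_algebra k (opp A) \<sigma>"
proof -
  interpret symmetric_algebra k A \<sigma> by fact
  have "fin_dim k (opp A)"
    using fin unfolding fin_dim_def gen_submodule_def submodule_def submodule_axioms_def by simp
  moreover have "symmetrising k (opp A) \<sigma>"
    using symm unfolding symmetrising_def by (auto simp: functionals_def)
  ultimately show ?thesis
    by (intro symmetric_algebra.intro symmetric_algebra_axioms.intro K.field_axioms
        opp_k_algebra k_algebra_axioms)
qed

context symmetric_algebra
begin

lemma sigma_linear: "\<sigma> \<in> linear_maps k A (scalars k)"
  using symm functionals_linear by (auto simp: symmetrising_def)

lemmas sigma = linear_mapsD[OF sigma_linear, unfolded scalars_simps]

lemma sigma_comm: "\<lbrakk>a \<in> carrier A; b \<in> carrier A\<rbrakk> \<Longrightarrow> \<sigma> (a \<otimes>\<^bsub>A\<^esub> b) = \<sigma> (b \<otimes>\<^bsub>A\<^esub> a)"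
  using symm by (auto simp: symmetrising_def)

lemma sigma_nondegenerate:
  assumes "a \<in> carrier A" "b \<in> carrier A" "\<And>c. c \<in> carrier A \<Longrightarrow> \<sigma> (a \<otimes>\<^bsub>A\<^esub> c) = \<sigma> (b \<otimes>\<^bsub>A\<^esub> c)"
  shows "a = b"
proof -
  note md = linear_maps_diff[OF module_axioms module_scalars[OF K.cring_axioms] sigma_linear]
  have "\<sigma> ((a \<ominus>\<^bsub>A\<^esub> b) \<otimes>\<^bsub>A\<^esub> c) = \<zero>\<^bsub>k\<^esub>" if c: "c \<in> carrier A" for c
  proof -
    have "(a \<ominus>\<^bsub>A\<^esub> b) \<otimes>\<^bsub>A\<^esub> c = a \<otimes>\<^bsub>A\<^esub> c \<ominus>\<^bsub>A\<^esub> b \<otimes>\<^bsub>A\<^esub> c"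
      using assms(1,2) c by (simp add: a_minus_def l_distr l_minus)
    then show ?thesis using assms c md[of "a \<otimes>\<^bsub>A\<^esub> c" "b \<otimes>\<^bsub>A\<^esub> c"] sigma(1)[of "b \<otimes>\<^bsub>A\<^esub> c"]
      by (simp add: K.r_neg a_minus_def)
  qed
  then have "a \<ominus>\<^bsub>A\<^esub> b = \<zero>\<^bsub>A\<^esub>" using symm assms(1,2) by (auto simp: symmetrising_def)
  then show ?thesis using assms(1,2) by (metis M.minus_equality M.minus_minus M.a_inv_closed a_minus_def)
qed

text \<open>The forms \<open>v \<mapsto> \<sigma>(a v)\<close> separate points, and in finite dimension this suffices to make all linear
  forms of this kind: the identity is built up on a generating set from operators \<open>E\<close> such that \<open>\<xi> \<circ> E\<close>
  is of this kind for every \<open>\<xi>\<close>.\<close>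

lemma sigma_operator:
  assumes "finite B" "B \<subseteq> carrier A"
  shows "\<exists>E \<in> linear_maps k A A. (\<forall>v \<in> B. E v = v) \<and>
    (\<forall>\<xi> \<in> linear_maps k A (scalars k). \<exists>a \<in> carrier A. \<forall>v \<in> carrier A. \<xi> (E v) = \<sigma> (a \<otimes>\<^bsub>A\<^esub> v))"
  using assms
proof (induction B rule: finite_induct)
  case empty
  have "(\<lambda>v. \<zero>\<^bsub>A\<^esub>) \<in> linear_maps k A A" by (rule linear_mapsI) auto
  have z: "\<xi> \<zero>\<^bsub>A\<^esub> = \<zero>\<^bsub>k\<^esub>" if "\<xi> \<in> linear_maps k A (scalars k)" for \<xi>
    using linear_maps_zero[OF module_axioms module_scalars[OF K.cring_axioms] that] by simp
  have "\<exists>a \<in> carrier A. \<forall>v \<in> carrier A. \<xi> \<zero>\<^bsub>A\<^esub> = \<sigma> (a \<otimes>\<^bsub>A\<^esub> v)"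
    if "\<xi> \<in> linear_maps k A (scalars k)" for \<xi>
    by (rule bexI[of _ "\<zero>\<^bsub>A\<^esub>"]) (simp_all add: z[OF that] z[OF sigma_linear])
  then show ?case using \<open>(\<lambda>v. \<zero>\<^bsub>A\<^esub>) \<in> linear_maps k A A\<close>
    by (intro bexI[of _ "\<lambda>v. \<zero>\<^bsub>A\<^esub>"] conjI ballI) auto
next
  case (insert b B)
  then obtain E where E: "E \<in> linear_maps k A A" "\<forall>v \<in> B. E v = v"
    "\<forall>\<xi> \<in> linear_maps k A (scalars k). \<exists>a \<in> carrier A. \<forall>v \<in> carrier A. \<xi> (E v) = \<sigma> (a \<otimes>\<^bsub>A\<^esub> v)"
    by auto
  note Ec = linear_mapsD[OF E(1)]
  have b: "b \<in> carrier A" using insert by auto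
  show ?case
  proof (cases "b \<ominus>\<^bsub>A\<^esub> E b = \<zero>\<^bsub>A\<^esub>")
    case True
    then have "E b = b"
      using b Ec(1)[OF b] by (metis M.minus_equality M.minus_minus M.a_inv_closed a_minus_def)
    then show ?thesis using E by auto
  next
    case False
    define b' where "b' = b \<ominus>\<^bsub>A\<^esub> E b"
    have b': "b' \<in> carrier A" using b Ec by (simp add: b'_def)
    obtain w0 where w0: "w0 \<in> carrier A" "\<sigma> (b' \<otimes>\<^bsub>A\<^esub> w0) \<noteq> \<zero>\<^bsub>k\<^esub>"
      using symm b' False unfolding symmetrising_def b'_def by blast
    define t where "t = \<sigma> (b' \<otimes>\<^bsub>A\<^esub> w0)"
    have t: "t \<in> Units k" using w0 b' sigma(1) K.field_Units by (auto simp: t_def)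
    define w where "w = inv\<^bsub>k\<^esub> t \<odot>\<^bsub>A\<^esub> w0"
    have w: "w \<in> carrier A" using t w0 by (simp add: w_def)
    have wb: "\<sigma> (w \<otimes>\<^bsub>A\<^esub> b') = \<one>\<^bsub>k\<^esub>"
      using t w0 b' sigma_comm[of w0 b'] sigma(3)[of "inv\<^bsub>k\<^esub> t" "w0 \<otimes>\<^bsub>A\<^esub> b'"]
      by (simp add: w_def smult_mult_left t_def)
    \<comment> \<open>\<open>F\<close> agrees with \<open>E\<close> where \<open>E\<close> is the identity, and the added term corrects the value at \<open>b\<close>.\<close>
    define F where "F v = E v \<oplus>\<^bsub>A\<^esub> \<sigma> (w \<otimes>\<^bsub>A\<^esub> (v \<ominus>\<^bsub>A\<^esub> E v)) \<odot>\<^bsub>A\<^esub> b'" for v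
    have wl: "(\<lambda>v. \<sigma> (w \<otimes>\<^bsub>A\<^esub> v)) \<in> linear_maps k A (scalars k)"
      using w by (auto intro!: linear_mapsI simp: r_distr smult_mult_right sigma)
    have dl: "(\<lambda>v. v \<ominus>\<^bsub>A\<^esub> E v) \<in> linear_maps k A A"
      using Ec by (auto intro!: linear_mapsI
          simp: a_minus_def smult_r_distr smult_r_minus M.minus_add M.a_ac)
    have gl: "(\<lambda>v. \<sigma> (w \<otimes>\<^bsub>A\<^esub> (v \<ominus>\<^bsub>A\<^esub> E v))) \<in> linear_maps k A (scalars k)"
      by (rule linear_maps_compose[OF dl wl])
    note g = linear_mapsD[OF gl, unfolded scalars_simps]
    have Fl: "F \<in> linear_maps k A A"
      using Ec g b' by (auto intro!: linear_mapsI
          simp: F_def smult_l_distr smult_r_distr smult_assoc1 M.a_ac)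
    have "F v = v" if "v \<in> B" for v
      using E(2) that b' insert.prems w sigma(1)
        linear_maps_zero[OF module_axioms module_scalars[OF K.cring_axioms] wl]
      by (auto simp: F_def a_minus_def M.r_neg subset_iff)
    moreover have "F b = b"
      using wb b b' Ec(1)[OF b] by (simp add: F_def b'_def[symmetric])
        (simp add: b'_def a_minus_def M.a_ac M.r_neg M.a_comm[of "E b"])
    moreover have "\<exists>a \<in> carrier A. \<forall>v \<in> carrier A. \<xi> (F v) = \<sigma> (a \<otimes>\<^bsub>A\<^esub> v)"
      if xi: "\<xi> \<in> linear_maps k A (scalars k)" for \<xi>
    proof -
      note x = linear_mapsD[OF xi, unfolded scalars_simps]
      obtain a where a: "a \<in> carrier A" "\<forall>v \<in> carrier A. \<xi> (E v) = \<sigma> (a \<otimes>\<^bsub>A\<^esub> v)" using E(3) xi by blast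
      obtain a' where a': "a' \<in> carrier A" "\<forall>v \<in> carrier A. \<sigma> (w \<otimes>\<^bsub>A\<^esub> E v) = \<sigma> (a' \<otimes>\<^bsub>A\<^esub> v)"
        using E(3)[rule_format, OF wl] by auto
      have xb: "\<xi> b' \<in> carrier k" using x b' by blast
      have "\<xi> (F v) = \<sigma> ((a \<oplus>\<^bsub>A\<^esub> \<xi> b' \<odot>\<^bsub>A\<^esub> (w \<ominus>\<^bsub>A\<^esub> a')) \<otimes>\<^bsub>A\<^esub> v)" if v: "v \<in> carrier A" for v
      proof -
        have "\<sigma> (w \<otimes>\<^bsub>A\<^esub> (v \<ominus>\<^bsub>A\<^esub> E v)) = \<sigma> (w \<otimes>\<^bsub>A\<^esub> v) \<ominus>\<^bsub>k\<^esub> \<sigma> (a' \<otimes>\<^bsub>A\<^esub> v)"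
          using linear_maps_diff[OF module_axioms module_scalars[OF K.cring_axioms] wl v Ec(1)[OF v]]
            a'(2) v by simp
        also have "\<dots> = \<sigma> ((w \<ominus>\<^bsub>A\<^esub> a') \<otimes>\<^bsub>A\<^esub> v)"
          using linear_maps_diff[OF module_axioms module_scalars[OF K.cring_axioms] sigma_linear,
              of "w \<otimes>\<^bsub>A\<^esub> v" "a' \<otimes>\<^bsub>A\<^esub> v"] w a'(1) v
          by (simp add: a_minus_def l_distr l_minus)
        finally have s: "\<sigma> (w \<otimes>\<^bsub>A\<^esub> (v \<ominus>\<^bsub>A\<^esub> E v)) = \<sigma> ((w \<ominus>\<^bsub>A\<^esub> a') \<otimes>\<^bsub>A\<^esub> v)" .
        have "\<xi> (F v) = \<xi> (E v) \<oplus>\<^bsub>k\<^esub> \<sigma> ((w \<ominus>\<^bsub>A\<^esub> a') \<otimes>\<^bsub>A\<^esub> v) \<otimes>\<^bsub>k\<^esub> \<xi> b'"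
          unfolding F_def s using x v Ec b' w a' sigma by simp
        also have "\<dots> = \<sigma> (a \<otimes>\<^bsub>A\<^esub> v) \<oplus>\<^bsub>k\<^esub> \<xi> b' \<otimes>\<^bsub>k\<^esub> \<sigma> ((w \<ominus>\<^bsub>A\<^esub> a') \<otimes>\<^bsub>A\<^esub> v)"
          using a v xb w a' sigma(1) by (simp add: K.m_comm)
        also have "\<dots> = \<sigma> ((a \<oplus>\<^bsub>A\<^esub> \<xi> b' \<odot>\<^bsub>A\<^esub> (w \<ominus>\<^bsub>A\<^esub> a')) \<otimes>\<^bsub>A\<^esub> v)"
          using a(1) a'(1) v xb w by (simp add: l_distr smult_mult_left sigma)
        finally show ?thesis .
      qed
      then show ?thesis
        using a(1) a'(1) xb w by (intro bexI[of _ "a \<oplus>\<^bsub>A\<^esub> \<xi> b' \<odot>\<^bsub>A\<^esub> (w \<ominus>\<^bsub>A\<^esub> a')"]) auto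
    qed
    ultimately show ?thesis using Fl by (intro bexI[of _ F]) auto
  qed
qed

lemma sigma_represents:
  assumes "\<xi> \<in> linear_maps k A (scalars k)"
  shows "\<exists>a \<in> carrier A. \<forall>b \<in> carrier A. \<sigma> (a \<otimes>\<^bsub>A\<^esub> b) = \<xi> b"
proof -
  obtain B where B: "finite B" "B \<subseteq> carrier A" "gen_submodule k A B = carrier A"
    using fin by (auto simp: fin_dim_def)
  obtain E where E: "E \<in> linear_maps k A A" "\<forall>v \<in> B. E v = v"
    "\<forall>\<xi> \<in> linear_maps k A (scalars k). \<exists>a \<in> carrier A. \<forall>v \<in> carrier A. \<xi> (E v) = \<sigma> (a \<otimes>\<^bsub>A\<^esub> v)"
    using sigma_operator[OF B(1,2)] by blast
  note Ec = linear_mapsD[OF E(1)]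
  have "submodule {v \<in> carrier A. E v = v} k A"
    by (rule submoduleI)
      (auto simp: Ec linear_maps_zero[OF module_axioms module_axioms E(1)]
        linear_maps_minus[OF module_axioms module_axioms E(1)])
  from gen_submodule_minimal[OF this, of B] have "carrier A \<subseteq> {v \<in> carrier A. E v = v}"
    unfolding B(3) using B(2) E(2) by blast
  then have "\<xi> (E v) = \<xi> v" if "v \<in> carrier A" for v using that by fastforce
  then show ?thesis using E(3)[rule_format, OF assms] by fastforce
qed

end

locale right_module_symm = symmetric_algebra k A \<sigma> + X: right_module k A X act
  for k (structure) and A (structure) and \<sigma> and X (structure) and act
begin

text \<open>The value at \<open>x\<close> is the element of \<open>A\<close> that represents the linear form \<open>b \<mapsto> \<xi>(x b)\<close> through \<open>\<sigma>\<close>.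
  Uniqueness of such elements yields all the properties.\<close>

lemma vec_char:
  assumes xi: "\<xi> \<in> functionals k X"
  shows "vec A \<sigma> X act \<xi> \<in> carrier X \<rightarrow>\<^sub>E carrier A \<and>
      (\<forall>x \<in> carrier X. \<forall>y \<in> carrier X. vec A \<sigma> X act \<xi> (x \<oplus>\<^bsub>X\<^esub> y) = vec A \<sigma> X act \<xi> x \<oplus>\<^bsub>A\<^esub> vec A \<sigma> X act \<xi> y) \<and>
      (\<forall>x \<in> carrier X. \<forall>a \<in> carrier A. vec A \<sigma> X act \<xi> (act x a) = vec A \<sigma> X act \<xi> x \<otimes>\<^bsub>A\<^esub> a) \<and>
      (\<forall>x \<in> carrier X. \<sigma> (vec A \<sigma> X act \<xi> x) = \<xi> x)"
proof -
  note x = functionals_eval_simps[OF xi]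
  have "\<exists>a \<in> carrier A. \<forall>b \<in> carrier A. \<sigma> (a \<otimes>\<^bsub>A\<^esub> b) = \<xi> (act x b)" if "x \<in> carrier X" for x
    by (rule sigma_represents)
      (rule linear_maps_compose[OF X.act_linear_right[OF that] functionals_linear[OF xi]])
  then obtain f where f: "\<And>x. x \<in> carrier X \<Longrightarrow> f x \<in> carrier A"
    "\<And>x b. \<lbrakk>x \<in> carrier X; b \<in> carrier A\<rbrakk> \<Longrightarrow> \<sigma> (f x \<otimes>\<^bsub>A\<^esub> b) = \<xi> (act x b)" by metis
  note s = X.act_closed X.act_add_left X.act_mult X.act_one
  have f1: "\<sigma> (f x) = \<xi> x" if "x \<in> carrier X" for x
    using f(2)[OF that, of "\<one>\<^bsub>A\<^esub>"] f(1)[OF that] that by (simp add: s)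
  have f2: "f (x \<oplus>\<^bsub>X\<^esub> y) = f x \<oplus>\<^bsub>A\<^esub> f y" if "x \<in> carrier X" "y \<in> carrier X" for x y
    by (rule sigma_nondegenerate) (use that in \<open>simp_all add: f x s l_distr sigma\<close>)
  have f3: "f (act x a) = f x \<otimes>\<^bsub>A\<^esub> a" if "x \<in> carrier X" "a \<in> carrier A" for x a
    by (rule sigma_nondegenerate) (use that in \<open>simp_all add: f x s m_assoc\<close>)
  define P where "P g \<longleftrightarrow> g \<in> carrier X \<rightarrow>\<^sub>E carrier A \<and>
      (\<forall>x \<in> carrier X. \<forall>y \<in> carrier X. g (x \<oplus>\<^bsub>X\<^esub> y) = g x \<oplus>\<^bsub>A\<^esub> g y) \<and>
      (\<forall>x \<in> carrier X. \<forall>a \<in> carrier A. g (act x a) = g x \<otimes>\<^bsub>A\<^esub> a) \<and>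
      (\<forall>x \<in> carrier X. \<sigma> (g x) = \<xi> x)" for g
  have "P (The P)"
  proof (rule theI[of P "restrict f (carrier X)"])
    show "P (restrict f (carrier X))" by (auto simp: P_def f f1 f2 f3 s)
  next
    fix g assume g: "P g"
    have "g x = f x" if "x \<in> carrier X" for x
    proof (rule sigma_nondegenerate)
      fix c assume c: "c \<in> carrier A"
      have "\<sigma> (g x \<otimes>\<^bsub>A\<^esub> c) = \<sigma> (g (act x c))" using g that c by (simp add: P_def)
      also have "\<dots> = \<xi> (act x c)" using g s(1)[OF that c] unfolding P_def by blast
      finally show "\<sigma> (g x \<otimes>\<^bsub>A\<^esub> c) = \<sigma> (f x \<otimes>\<^bsub>A\<^esub> c)" using f that c by simp
    qed (use g f that in \<open>auto simp: P_def\<close>)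
    then show "g = restrict f (carrier X)"
      using g by (auto intro!: extensionalityI[of _ "carrier X"] simp: PiE_def P_def)
  qed
  moreover have "vec A \<sigma> X act \<xi> = The P" by (simp add: vec_def P_def[abs_def])
  ultimately have "P (vec A \<sigma> X act \<xi>)" by simp
  then show ?thesis unfolding P_def .
qed

lemma vec:
  assumes "\<xi> \<in> functionals k X" "x \<in> carrier X"
  shows vec_closed: "vec A \<sigma> X act \<xi> x \<in> carrier A"
    and vec_add: "y \<in> carrier X \<Longrightarrow> vec A \<sigma> X act \<xi> (x \<oplus>\<^bsub>X\<^esub> y) = vec A \<sigma> X act \<xi> x \<oplus>\<^bsub>A\<^esub> vec A \<sigma> X act \<xi> y"
    and vec_act: "a \<in> carrier A \<Longrightarrow> vec A \<sigma> X act \<xi> (act x a) = vec A \<sigma> X act \<xi> x \<otimes>\<^bsub>A\<^esub> a"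
    and sigma_vec: "\<sigma> (vec A \<sigma> X act \<xi> x) = \<xi> x"
  using vec_char[OF assms(1)] assms(2) by auto

lemma sigma_vec_mult:
  "\<lbrakk>\<xi> \<in> functionals k X; x \<in> carrier X; a \<in> carrier A\<rbrakk> \<Longrightarrow>
    \<sigma> (vec A \<sigma> X act \<xi> x \<otimes>\<^bsub>A\<^esub> a) = \<xi> (act x a)"
  using sigma_vec[of \<xi> "act x a"] vec_act by (simp add: X.act_closed)

lemma vec_eqI:
  assumes "\<xi> \<in> functionals k X" "x \<in> carrier X" "a \<in> carrier A"
    and "\<And>b. b \<in> carrier A \<Longrightarrow> \<sigma> (a \<otimes>\<^bsub>A\<^esub> b) = \<xi> (act x b)"
  shows "vec A \<sigma> X act \<xi> x = a"
  by (rule sigma_nondegenerate) (simp_all add: assms vec_closed sigma_vec_mult)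

lemma vec_linear: "\<xi> \<in> functionals k X \<Longrightarrow> vec A \<sigma> X act \<xi> \<in> linear_maps k X A"
proof (rule linear_mapsI)
  fix c x assume a: "\<xi> \<in> functionals k X" "c \<in> carrier k" "x \<in> carrier X"
  have "vec A \<sigma> X act \<xi> (act x (c \<odot>\<^bsub>A\<^esub> \<one>\<^bsub>A\<^esub>)) = vec A \<sigma> X act \<xi> x \<otimes>\<^bsub>A\<^esub> (c \<odot>\<^bsub>A\<^esub> \<one>\<^bsub>A\<^esub>)"
    using a vec_act by simp
  then show "vec A \<sigma> X act \<xi> (c \<odot>\<^bsub>X\<^esub> x) = c \<odot>\<^bsub>A\<^esub> vec A \<sigma> X act \<xi> x"
    using a vec_closed by (simp add: X.act_scalar smult_mult_right)
qed (simp_all add: vec_closed vec_add)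

subsection \<open>Dual bases over a semisimple algebra\<close>

definition dual_basis where
  "dual_basis n x \<xi> \<longleftrightarrow> (\<forall>i < n. x i \<in> carrier X \<and> \<xi> i \<in> functionals k X) \<and>
    (\<forall>v \<in> carrier X. v = (\<Oplus>\<^bsub>X\<^esub>i \<in> {..<(n::nat)}. act (x i) (vec A \<sigma> X act (\<xi> i) v)))"

text \<open>Here the coordinates \<open>f i\<close> are only defined on the submodule \<open>V\<close>, since they are to be extended to
  larger submodules generator by generator.\<close>

definition partial_dual_basis where
  "partial_dual_basis V n x f \<longleftrightarrow> submodule V k X \<and> (\<forall>v \<in> V. \<forall>a \<in> carrier A. act v a \<in> V) \<and>
    (\<forall>i < (n::nat). x i \<in> carrier X \<and> f i \<in> V \<rightarrow> carrier A \<and>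
      (\<forall>v \<in> V. \<forall>w \<in> V. f i (v \<oplus>\<^bsub>X\<^esub> w) = f i v \<oplus>\<^bsub>A\<^esub> f i w) \<and>
      (\<forall>v \<in> V. \<forall>a \<in> carrier A. f i (act v a) = f i v \<otimes>\<^bsub>A\<^esub> a)) \<and>
    (\<forall>v \<in> V. v = (\<Oplus>\<^bsub>X\<^esub>i \<in> {..<n}. act (x i) (f i v)))"

text \<open>The \<open>a\<close> with \<open>b a \<in> V\<close> form a right ideal \<open>I\<close>. If \<open>J\<close> is a complement of \<open>I\<close>, then
  \<open>V + bA = V \<oplus> bJ\<close>, and \<open>J \<rightarrow> bJ\<close> is bijective. So the component in \<open>J \<subseteq> A\<close> is a coordinate that
  belongs to \<open>b\<close>, and the old coordinates extend by zero on \<open>bJ\<close>.\<close>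

lemma partial_dual_basis_extend:
  assumes ss: "\<And>I. right_ideal I A \<Longrightarrow>
      \<exists>J. right_ideal J A \<and> I \<inter> J = {\<zero>\<^bsub>A\<^esub>} \<and> I <+>\<^bsub>A\<^esub> J = carrier A"
    and V: "partial_dual_basis V n x f" and b: "b \<in> carrier X"
  shows "\<exists>V' n' x' f'. partial_dual_basis V' n' x' f' \<and> V \<subseteq> V' \<and> b \<in> V'"
proof -
  note d = V[unfolded partial_dual_basis_def]
  have Vs: "submodule V k X" and Va: "\<And>v a. \<lbrakk>v \<in> V; a \<in> carrier A\<rbrakk> \<Longrightarrow> act v a \<in> V"
    using d by auto
  have x: "\<And>i. i < n \<Longrightarrow> x i \<in> carrier X" and fc: "\<And>i v. \<lbrakk>i < n; v \<in> V\<rbrakk> \<Longrightarrow> f i v \<in> carrier A"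
    and fa: "\<And>i v w. \<lbrakk>i < n; v \<in> V; w \<in> V\<rbrakk> \<Longrightarrow> f i (v \<oplus>\<^bsub>X\<^esub> w) = f i v \<oplus>\<^bsub>A\<^esub> f i w"
    and fm: "\<And>i v a. \<lbrakk>i < n; v \<in> V; a \<in> carrier A\<rbrakk> \<Longrightarrow> f i (act v a) = f i v \<otimes>\<^bsub>A\<^esub> a"
    and fe: "\<And>v. v \<in> V \<Longrightarrow> (\<Oplus>\<^bsub>X\<^esub>i \<in> {..<n}. act (x i) (f i v)) = v"
    using d by (auto simp: Pi_def)
  note sub = X.submoduleE(1)[OF Vs, THEN subsetD] and Vn = X.submoduleE(3)[OF Vs]
    and Vp = X.submoduleE(5)[OF Vs] and Vk = X.submoduleE(4)[OF Vs]
  have V0: "\<zero>\<^bsub>X\<^esub> \<in> V" using subgroup.one_closed[OF submodule.axioms(1)[OF Vs]] by simp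
  note bl = X.act_linear_right[OF b]
  note ba = linear_mapsD[OF bl]
  note b0 = linear_maps_zero[OF module_axioms X.module_axioms bl]
    and bm = linear_maps_minus[OF module_axioms X.module_axioms bl]
  define I where "I = {a \<in> carrier A. act b a \<in> V}"
  have "right_ideal I A" unfolding right_ideal_def
  proof (intro conjI additive_subgroupI ballI)
    show "subgroup I (add_monoid A)"
      by (rule add.subgroupI) (auto simp: I_def ba bm Vn Vp b0 V0 intro!: exI[of _ "\<zero>\<^bsub>A\<^esub>"])
  qed (auto simp: I_def X.act_mult b Va)
  then obtain J where J: "right_ideal J A" "I \<inter> J = {\<zero>\<^bsub>A\<^esub>}" "I <+>\<^bsub>A\<^esub> J = carrier A" using ss by blast
  interpret J: additive_subgroup J A using J(1) by (simp add: right_ideal_def)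
  have Jm: "\<And>a j. \<lbrakk>a \<in> carrier A; j \<in> J\<rbrakk> \<Longrightarrow> j \<otimes>\<^bsub>A\<^esub> a \<in> J" using J(1) by (simp add: right_ideal_def)
  define V' where "V' = {v \<oplus>\<^bsub>X\<^esub> act b j | v j. v \<in> V \<and> j \<in> J}"
  have uniq: "v = v' \<and> j = j'"
    if "v \<in> V" "j \<in> J" "v' \<in> V" "j' \<in> J" "v \<oplus>\<^bsub>X\<^esub> act b j = v' \<oplus>\<^bsub>X\<^esub> act b j'" for v j v' j'
  proof -
    note c = sub[OF that(1)] sub[OF that(3)] J.a_Hcarr[OF that(2)] J.a_Hcarr[OF that(4)]
    have "act b (j \<ominus>\<^bsub>A\<^esub> j') = act b j \<ominus>\<^bsub>X\<^esub> act b j'"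
      using linear_maps_diff[OF module_axioms X.module_axioms bl] c by simp
    also have "\<dots> = v' \<ominus>\<^bsub>X\<^esub> v"
    proof -
      have "act b j = \<ominus>\<^bsub>X\<^esub> v \<oplus>\<^bsub>X\<^esub> (v' \<oplus>\<^bsub>X\<^esub> act b j')"
        using that(5) c ba(1) by (metis X.M.r_neg1)
      then show ?thesis using c ba(1) by (simp add: a_minus_def X.M.a_ac X.M.r_neg)
    qed
    finally have "j \<ominus>\<^bsub>A\<^esub> j' \<in> I" using that Vp Vn c by (simp add: I_def a_minus_def)
    moreover have "j \<ominus>\<^bsub>A\<^esub> j' \<in> J" using that by (simp add: a_minus_def)
    ultimately have "j \<ominus>\<^bsub>A\<^esub> j' = \<zero>\<^bsub>A\<^esub>" using J(2) by blast
    then have "j = j'"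
      using c by (metis M.minus_equality M.minus_minus M.a_inv_closed a_minus_def)
    then show ?thesis using that(5) c ba(1) by simp
  qed
  define p where "p u = (THE j. j \<in> J \<and> (\<exists>v \<in> V. u = v \<oplus>\<^bsub>X\<^esub> act b j))" for u
  define q where "q u = (THE v. v \<in> V \<and> (\<exists>j \<in> J. u = v \<oplus>\<^bsub>X\<^esub> act b j))" for u
  have p: "p (v \<oplus>\<^bsub>X\<^esub> act b j) = j" and q: "q (v \<oplus>\<^bsub>X\<^esub> act b j) = v" if "v \<in> V" "j \<in> J" for v j
    unfolding p_def q_def using that uniq by (blast intro!: the_equality)+
  have V'_add: "(v \<oplus>\<^bsub>X\<^esub> act b j) \<oplus>\<^bsub>X\<^esub> (v' \<oplus>\<^bsub>X\<^esub> act b j') = (v \<oplus>\<^bsub>X\<^esub> v') \<oplus>\<^bsub>X\<^esub> act b (j \<oplus>\<^bsub>A\<^esub> j')"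
    if "v \<in> V" "j \<in> J" "v' \<in> V" "j' \<in> J" for v j v' j'
    using sub[OF that(1)] sub[OF that(3)] J.a_Hcarr[OF that(2)] J.a_Hcarr[OF that(4)] ba
    by (simp add: X.M.a_ac)
  have V'_act: "act (v \<oplus>\<^bsub>X\<^esub> act b j) a = act v a \<oplus>\<^bsub>X\<^esub> act b (j \<otimes>\<^bsub>A\<^esub> a)"
    if "v \<in> V" "j \<in> J" "a \<in> carrier A" for v j a
    using sub[OF that(1)] J.a_Hcarr[OF that(2)] ba that(3) b
    by (simp add: X.act_add_left X.act_mult)
  have V'_minus: "\<ominus>\<^bsub>X\<^esub> (v \<oplus>\<^bsub>X\<^esub> act b j) = (\<ominus>\<^bsub>X\<^esub> v) \<oplus>\<^bsub>X\<^esub> act b (\<ominus>\<^bsub>A\<^esub> j)" if "v \<in> V" "j \<in> J" for v j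
    using sub[OF that(1)] J.a_Hcarr[OF that(2)] ba bm by (simp add: X.M.minus_add X.M.a_comm)
  have V'_smult: "c \<odot>\<^bsub>X\<^esub> (v \<oplus>\<^bsub>X\<^esub> act b j) = act v (c \<odot>\<^bsub>A\<^esub> \<one>\<^bsub>A\<^esub>) \<oplus>\<^bsub>X\<^esub> act b (j \<otimes>\<^bsub>A\<^esub> (c \<odot>\<^bsub>A\<^esub> \<one>\<^bsub>A\<^esub>))"
    if "v \<in> V" "j \<in> J" "c \<in> carrier k" for v j c
    using V'_act[OF that(1,2), of "c \<odot>\<^bsub>A\<^esub> \<one>\<^bsub>A\<^esub>"] that sub[OF that(1)] J.a_Hcarr[OF that(2)] ba
    by (simp add: X.act_scalar)
  have V'I: "v \<oplus>\<^bsub>X\<^esub> act b j \<in> V'" if "v \<in> V" "j \<in> J" for v j using that by (auto simp: V'_def)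
  have V'E: thesis if "u \<in> V'" "\<And>v j. \<lbrakk>v \<in> V; j \<in> J; u = v \<oplus>\<^bsub>X\<^esub> act b j\<rbrakk> \<Longrightarrow> thesis" for u thesis
    using that by (auto simp: V'_def)
  have V'sub: "V' \<subseteq> carrier X" using sub ba(1) J.a_Hcarr by (auto simp: V'_def)
  have VV': "V \<subseteq> V'"
  proof
    fix v assume v: "v \<in> V"
    then show "v \<in> V'" using V'I[OF v J.zero_closed] sub[OF v] by (simp add: b0)
  qed
  have bV': "b \<in> V'"
  proof -
    have "\<one>\<^bsub>A\<^esub> \<in> I <+>\<^bsub>A\<^esub> J" using J(3) by simp
    then obtain i j where ij: "i \<in> I" "j \<in> J" "\<one>\<^bsub>A\<^esub> = i \<oplus>\<^bsub>A\<^esub> j" by (auto simp: set_add_def')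
    then have "act b i \<oplus>\<^bsub>X\<^esub> act b j = b"
      using ba(2)[of i j] J.a_Hcarr[OF ij(2)] X.act_one[OF b, unfolded ij(3)] by (simp add: I_def)
    then show ?thesis using V'I[of "act b i" j] ij by (simp add: I_def)
  qed
  let ?x = "\<lambda>i. if i < n then x i else b" and ?f = "\<lambda>i u. if i < n then f i (q u) else p u"
  have "partial_dual_basis V' (Suc n) ?x ?f" unfolding partial_dual_basis_def
  proof (intro conjI allI impI ballI)
    show "submodule V' k X"
    proof (rule X.submoduleI[OF V'sub])
      show "\<zero>\<^bsub>X\<^esub> \<in> V'" using V0 VV' by blast
    next
      fix u assume "u \<in> V'"
      then show "\<ominus>\<^bsub>X\<^esub> u \<in> V'" by (elim V'E) (simp add: V'_minus V'I Vn)
    next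
      fix u w assume "u \<in> V'" "w \<in> V'"
      then show "u \<oplus>\<^bsub>X\<^esub> w \<in> V'" by (elim V'E) (simp add: V'_add V'I Vp)
    next
      fix c u assume "c \<in> carrier k" "u \<in> V'"
      then show "c \<odot>\<^bsub>X\<^esub> u \<in> V'" by (elim V'E) (simp add: V'_smult V'I Va Jm)
    qed
  next
    fix u a assume "u \<in> V'" "a \<in> carrier A"
    then show "act u a \<in> V'" by (elim V'E) (simp add: V'_act V'I Va Jm)
  next
    fix i assume "i < Suc n"
    then show "?x i \<in> carrier X" using x b by simp
    show "?f i \<in> V' \<rightarrow> carrier A"
      by (auto elim!: V'E simp: p q fc J.a_Hcarr)
    fix u w assume "u \<in> V'" "w \<in> V'"
    then show "?f i (u \<oplus>\<^bsub>X\<^esub> w) = ?f i u \<oplus>\<^bsub>A\<^esub> ?f i w"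
      by (elim V'E) (simp add: V'_add p q Vp fa)
  next
    fix i u a assume "i < Suc n" "u \<in> V'" "a \<in> carrier A"
    then show "?f i (act u a) = ?f i u \<otimes>\<^bsub>A\<^esub> a"
      by (elim V'E) (simp add: V'_act p q Va Jm fm)
  next
    fix u assume "u \<in> V'"
    then obtain v j where vj: "v \<in> V" "j \<in> J" "u = v \<oplus>\<^bsub>X\<^esub> act b j" by (elim V'E)
    have "(\<Oplus>\<^bsub>X\<^esub>i \<in> {..<Suc n}. act (?x i) (?f i u)) =
        act b j \<oplus>\<^bsub>X\<^esub> (\<Oplus>\<^bsub>X\<^esub>i \<in> {..<n}. act (?x i) (?f i u))"
      unfolding lessThan_Suc
      by (subst X.M.finsum_insert) (use vj b ba J.a_Hcarr x fc in \<open>auto simp: p q X.act_closed\<close>)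
    also have "(\<Oplus>\<^bsub>X\<^esub>i \<in> {..<n}. act (?x i) (?f i u)) = (\<Oplus>\<^bsub>X\<^esub>i \<in> {..<n}. act (x i) (f i v))"
      using vj x fc by (intro X.M.finsum_cong') (auto simp: q X.act_closed)
    also have "\<dots> = v" by (rule fe[OF vj(1)])
    finally show "u = (\<Oplus>\<^bsub>X\<^esub>i \<in> {..<Suc n}. act (?x i) (?f i u))"
      using vj sub[OF vj(1)] ba(1) J.a_Hcarr by (simp add: X.M.a_comm)
  qed
  then show ?thesis using VV' bV' by blast
qed

lemma dual_basis_exists:
  assumes ss: "\<And>I. right_ideal I A \<Longrightarrow>
      \<exists>J. right_ideal J A \<and> I \<inter> J = {\<zero>\<^bsub>A\<^esub>} \<and> I <+>\<^bsub>A\<^esub> J = carrier A"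
    and fd: "fin_dim k X"
  shows "\<exists>n x \<xi>. dual_basis n x \<xi>"
proof -
  obtain B where B: "finite B" "B \<subseteq> carrier X" "gen_submodule k X B = carrier X"
    using fd by (auto simp: fin_dim_def)
  have "\<exists>V n x f. partial_dual_basis V n x f \<and> B \<subseteq> V" using B(1,2)
  proof (induction B rule: finite_induct)
    case empty
    have "submodule {\<zero>\<^bsub>X\<^esub>} k X" by (rule X.submoduleI) auto
    moreover have "act \<zero>\<^bsub>X\<^esub> a = \<zero>\<^bsub>X\<^esub>" if "a \<in> carrier A" for a
      by (rule linear_maps_zero[OF X.module_axioms X.module_axioms X.act_linear_left[OF that]])
    ultimately have "partial_dual_basis {\<zero>\<^bsub>X\<^esub>} 0 (\<lambda>i. \<zero>\<^bsub>X\<^esub>) (\<lambda>i v. \<zero>\<^bsub>A\<^esub>)"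
      by (auto simp: partial_dual_basis_def)
    then show ?case by blast
  next
    case (insert b B)
    then obtain V n x f where "partial_dual_basis V n x f" "B \<subseteq> V" by auto
    then show ?case using partial_dual_basis_extend[OF ss, of V n x f b] insert.prems by blast
  qed
  then obtain V n x f where V: "partial_dual_basis V n x f" "B \<subseteq> V" by blast
  note d = V(1)[unfolded partial_dual_basis_def]
  have Vs: "submodule V k X" using d by blast
  have VX: "V = carrier X"
    using gen_submodule_minimal[OF Vs V(2)] B(3) X.submoduleE(1)[OF Vs] by blast
  have x: "\<And>i. i < n \<Longrightarrow> x i \<in> carrier X" and fc: "\<And>i v. \<lbrakk>i < n; v \<in> carrier X\<rbrakk> \<Longrightarrow> f i v \<in> carrier A"
    and fa: "\<And>i v w. \<lbrakk>i < n; v \<in> carrier X; w \<in> carrier X\<rbrakk> \<Longrightarrow> f i (v \<oplus>\<^bsub>X\<^esub> w) = f i v \<oplus>\<^bsub>A\<^esub> f i w"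
    and fm: "\<And>i v a. \<lbrakk>i < n; v \<in> carrier X; a \<in> carrier A\<rbrakk> \<Longrightarrow> f i (act v a) = f i v \<otimes>\<^bsub>A\<^esub> a"
    and fe: "\<And>v. v \<in> carrier X \<Longrightarrow> v = (\<Oplus>\<^bsub>X\<^esub>i \<in> {..<n}. act (x i) (f i v))"
    using d unfolding VX by (blast, blast, blast, blast, blast)
  define \<xi> where "\<xi> i = (\<lambda>v \<in> carrier X. \<sigma> (f i v))" for i
  have fl: "f i \<in> linear_maps k X A" if "i < n" for i
  proof (rule linear_mapsI)
    fix c v assume c: "c \<in> carrier k" and v: "v \<in> carrier X"
    then have "f i (act v (c \<odot>\<^bsub>A\<^esub> \<one>\<^bsub>A\<^esub>)) = f i v \<otimes>\<^bsub>A\<^esub> (c \<odot>\<^bsub>A\<^esub> \<one>\<^bsub>A\<^esub>)" using fm[OF that] by simp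
    then show "f i (c \<odot>\<^bsub>X\<^esub> v) = c \<odot>\<^bsub>A\<^esub> f i v"
      using c v fc[OF that] by (simp add: X.act_scalar smult_mult_right)
  qed (use fc fa that in auto)
  have xi: "\<xi> i \<in> functionals k X" if "i < n" for i
    unfolding \<xi>_def
    by (rule restrict_functional[OF X.module_axioms linear_maps_compose[OF fl[OF that] sigma_linear]])
  have "vec A \<sigma> X act (\<xi> i) v = f i v" if "i < n" "v \<in> carrier X" for i v
    by (rule vec_eqI[OF xi[OF that(1)] that(2) fc[OF that]])
      (use that in \<open>simp add: \<xi>_def X.act_closed fm\<close>)
  then have "v = (\<Oplus>\<^bsub>X\<^esub>i \<in> {..<n}. act (x i) (vec A \<sigma> X act (\<xi> i) v))" if "v \<in> carrier X" for v
    using fe[OF that] x fc that X.M.finsum_cong'[of "{..<n}" "{..<n}"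
        "\<lambda>i. act (x i) (f i v)" "\<lambda>i. act (x i) (vec A \<sigma> X act (\<xi> i) v)"]
    by (auto simp: X.act_closed)
  then have "dual_basis n x \<xi>" using x xi by (auto simp: dual_basis_def)
  then show ?thesis by blast
qed

text \<open>Apply \<open>\<phi>\<close> to the expansion of \<open>v\<close>. As \<open>\<sigma>\<close> is symmetric, the term
  \<open>\<phi>(x\<^sub>p a) = \<sigma>(vec \<phi> x\<^sub>p \<sqdot> a)\<close> with \<open>a = vec \<xi>\<^sub>p v\<close> equals \<open>\<sigma>(a \<sqdot> vec \<phi> x\<^sub>p) = \<xi>\<^sub>p(v \<sqdot> vec \<phi> x\<^sub>p)\<close>.\<close>

lemma dual_basis_form:
  assumes d: "dual_basis n x \<xi>" and phi: "\<phi> \<in> functionals k X" and v: "v \<in> carrier X"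
  shows "\<phi> v = (\<Oplus>\<^bsub>k\<^esub>i \<in> {..<n}. \<xi> i (act v (vec A \<sigma> X act \<phi> (x i))))"
proof -
  have x: "\<And>i. i < n \<Longrightarrow> x i \<in> carrier X" and xi: "\<And>i. i < n \<Longrightarrow> \<xi> i \<in> functionals k X"
    and e: "v = (\<Oplus>\<^bsub>X\<^esub>i \<in> {..<n}. act (x i) (vec A \<sigma> X act (\<xi> i) v))"
    using d v by (auto simp: dual_basis_def)
  have "\<phi> v = \<phi> (\<Oplus>\<^bsub>X\<^esub>i \<in> {..<n}. act (x i) (vec A \<sigma> X act (\<xi> i) v))" using e by simp
  also have "\<dots> = (\<Oplus>\<^bsub>scalars k\<^esub>i \<in> {..<n}. \<phi> (act (x i) (vec A \<sigma> X act (\<xi> i) v)))"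
    by (rule linear_maps_finsum[OF X.module_axioms module_scalars[OF K.cring_axioms]
          functionals_linear[OF phi]]) (use x xi v in \<open>auto simp: X.act_closed vec_closed\<close>)
  also have "\<dots> = (\<Oplus>\<^bsub>k\<^esub>i \<in> {..<n}. \<phi> (act (x i) (vec A \<sigma> X act (\<xi> i) v)))"
    by (rule finsum_cong_struct) simp_all
  also have "\<dots> = (\<Oplus>\<^bsub>k\<^esub>i \<in> {..<n}. \<xi> i (act v (vec A \<sigma> X act \<phi> (x i))))"
  proof (rule K.finsum_cong')
    fix i assume i: "i \<in> {..<n}"
    then have "\<phi> (act (x i) (vec A \<sigma> X act (\<xi> i) v)) = \<sigma> (vec A \<sigma> X act \<phi> (x i) \<otimes>\<^bsub>A\<^esub> vec A \<sigma> X act (\<xi> i) v)"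
      using x xi v phi by (simp add: sigma_vec_mult vec_closed)
    also have "\<dots> = \<sigma> (vec A \<sigma> X act (\<xi> i) v \<otimes>\<^bsub>A\<^esub> vec A \<sigma> X act \<phi> (x i))"
      using i x xi v phi by (simp add: sigma_comm vec_closed)
    also have "\<dots> = \<xi> i (act v (vec A \<sigma> X act \<phi> (x i)))"
      using i x xi v phi by (simp add: sigma_vec_mult vec_closed)
    finally show "\<phi> (act (x i) (vec A \<sigma> X act (\<xi> i) v)) = \<xi> i (act v (vec A \<sigma> X act \<phi> (x i)))" .
  qed (use x v phi in \<open>auto simp: functionals_eval_simps(1)[OF xi] X.act_closed vec_closed\<close>)
  finally show ?thesis .
qed

text \<open>The action of \<open>A\<close> on linear forms; it is the left action on the dual of a right module, and the right
  action on the dual of a left module.\<close>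

definition form_act where "form_act a \<xi> = (\<lambda>v \<in> carrier X. \<xi> (act v a))"

lemma form_act_closed:
  assumes "a \<in> carrier A" "\<xi> \<in> functionals k X"
  shows "form_act a \<xi> \<in> functionals k X"
  unfolding form_act_def
  by (rule restrict_functional[OF X.module_axioms linear_maps_compose[OF
          X.act_linear_left[OF assms(1)] functionals_linear[OF assms(2)]]])

text \<open>\<open>D\<close> stands for the dual of \<open>X\<close> as a module over \<open>k\<close>.\<close>

lemma dual_basis_expand:
  assumes d: "dual_basis n x \<xi>" and phi: "\<phi> \<in> functionals k X"
    and D: "module k D" "carrier D = functionals k X"
    and eval: "\<And>v. v \<in> carrier X \<Longrightarrow> (\<lambda>f. f v) \<in> linear_maps k D (scalars k)"
  shows "\<phi> = (\<Oplus>\<^bsub>D\<^esub>p \<in> {..<n}. form_act (vec A \<sigma> X act \<phi> (x p)) (\<xi> p))"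
proof -
  interpret D: module k D by (rule D)
  have c: "(\<lambda>p. form_act (vec A \<sigma> X act \<phi> (x p)) (\<xi> p)) \<in> {..<n} \<rightarrow> carrier D"
    using d phi by (auto simp: dual_basis_def D(2) intro!: form_act_closed vec_closed)
  show ?thesis
  proof (rule functionals_eqI[OF phi])
    show "(\<Oplus>\<^bsub>D\<^esub>p \<in> {..<n}. form_act (vec A \<sigma> X act \<phi> (x p)) (\<xi> p)) \<in> functionals k X"
      using D.M.finsum_closed[OF c] by (simp add: D(2))
    fix v assume v: "v \<in> carrier X"
    have "(\<Oplus>\<^bsub>D\<^esub>p \<in> {..<n}. form_act (vec A \<sigma> X act \<phi> (x p)) (\<xi> p)) v =
        (\<Oplus>\<^bsub>scalars k\<^esub>p \<in> {..<n}. form_act (vec A \<sigma> X act \<phi> (x p)) (\<xi> p) v)"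
      by (rule linear_maps_finsum[OF D(1) module_scalars[OF K.cring_axioms] eval[OF v] _ c]) simp
    also have "\<dots> = \<phi> v"
      using v by (simp add: dual_basis_form[OF d phi v] form_act_def finsum_cong_struct[of "scalars k" k])
    finally show "\<phi> v = (\<Oplus>\<^bsub>D\<^esub>p \<in> {..<n}. form_act (vec A \<sigma> X act \<phi> (x p)) (\<xi> p)) v" by simp
  qed
qed

text \<open>In \<open>X \<otimes>\<^sub>A D\<close>, the sum of the \<open>x\<^sub>p \<otimes> \<xi>\<^sub>p\<close> corresponds to the identity of \<open>X\<close>. Here the tensor product
  is replaced by an arbitrary balanced \<open>\<beta>\<close>: expanding each \<open>x\<^sub>p\<close> in the second dual basis and collecting
  the \<open>\<xi>\<^sub>p\<close> turns the first sum into the second.\<close>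

lemma dual_basis_sum_unique:
  assumes d: "dual_basis n x \<xi>" and d': "dual_basis n' x' \<xi>'"
    and D: "module k D" "carrier D = functionals k X"
    and eval: "\<And>v. v \<in> carrier X \<Longrightarrow> (\<lambda>f. f v) \<in> linear_maps k D (scalars k)"
    and T: "module k T"
    and left: "\<And>\<xi>. \<xi> \<in> functionals k X \<Longrightarrow> (\<lambda>x. \<beta> x \<xi>) \<in> linear_maps k X T"
    and right: "\<And>x. x \<in> carrier X \<Longrightarrow> \<beta> x \<in> linear_maps k D T"
    and bal: "\<And>x a \<xi>. \<lbrakk>x \<in> carrier X; a \<in> carrier A; \<xi> \<in> functionals k X\<rbrakk> \<Longrightarrow>
      \<beta> (act x a) \<xi> = \<beta> x (form_act a \<xi>)"
  shows "(\<Oplus>\<^bsub>T\<^esub>p \<in> {..<n}. \<beta> (x p) (\<xi> p)) = (\<Oplus>\<^bsub>T\<^esub>q \<in> {..<n'}. \<beta> (x' q) (\<xi>' q))"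
proof -
  interpret D: module k D by (rule D)
  interpret T: module k T by (rule T)
  have x: "\<And>p. p < n \<Longrightarrow> x p \<in> carrier X" "\<And>p. p < n \<Longrightarrow> \<xi> p \<in> functionals k X"
    "\<And>q. q < n' \<Longrightarrow> x' q \<in> carrier X" "\<And>q. q < n' \<Longrightarrow> \<xi>' q \<in> functionals k X"
    using d d' by (auto simp: dual_basis_def)
  let ?r = "\<lambda>q p. vec A \<sigma> X act (\<xi>' q) (x p)"
  have r: "?r q p \<in> carrier A" if "p < n" "q < n'" for p q using x that by (simp add: vec_closed)
  have bc: "\<beta> y \<zeta> \<in> carrier T" if "y \<in> carrier X" "\<zeta> \<in> functionals k X" for y \<zeta>
    using linear_maps_closed[OF left] that by blast
  have "(\<Oplus>\<^bsub>T\<^esub>p \<in> {..<n}. \<beta> (x p) (\<xi> p)) =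
      (\<Oplus>\<^bsub>T\<^esub>p \<in> {..<n}. \<Oplus>\<^bsub>T\<^esub>q \<in> {..<n'}. \<beta> (x' q) (form_act (?r q p) (\<xi> p)))"
  proof (rule T.M.finsum_cong'[OF refl])
    fix p assume "p \<in> {..<n}"
    then have p: "p < n" by simp
    have "\<beta> (x p) (\<xi> p) = \<beta> (\<Oplus>\<^bsub>X\<^esub>q \<in> {..<n'}. act (x' q) (?r q p)) (\<xi> p)"
      using d' x(1)[OF p] by (simp add: dual_basis_def)
    also have "\<dots> = (\<Oplus>\<^bsub>T\<^esub>q \<in> {..<n'}. \<beta> (act (x' q) (?r q p)) (\<xi> p))"
      by (rule linear_maps_finsum[OF X.module_axioms T left[OF x(2)[OF p]]])
        (use x r p in \<open>auto simp: X.act_closed\<close>)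
    also have "\<dots> = (\<Oplus>\<^bsub>T\<^esub>q \<in> {..<n'}. \<beta> (x' q) (form_act (?r q p) (\<xi> p)))"
      by (rule T.M.finsum_cong'[OF refl]) (use x r p in \<open>auto simp: bal form_act_closed intro!: bc\<close>)
    finally show "\<beta> (x p) (\<xi> p) = \<dots>" .
  qed (use x r in \<open>auto intro!: T.M.finsum_closed bc form_act_closed\<close>)
  also have "\<dots> = (\<Oplus>\<^bsub>T\<^esub>q \<in> {..<n'}. \<Oplus>\<^bsub>T\<^esub>p \<in> {..<n}. \<beta> (x' q) (form_act (?r q p) (\<xi> p)))"
    by (rule T.M.finsum_swap) (use x r in \<open>auto intro!: bc form_act_closed\<close>)
  also have "\<dots> = (\<Oplus>\<^bsub>T\<^esub>q \<in> {..<n'}. \<beta> (x' q) (\<xi>' q))"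
  proof (rule T.M.finsum_cong'[OF refl])
    fix q assume "q \<in> {..<n'}"
    then have q: "q < n'" by simp
    have "(\<Oplus>\<^bsub>T\<^esub>p \<in> {..<n}. \<beta> (x' q) (form_act (?r q p) (\<xi> p))) =
        \<beta> (x' q) (\<Oplus>\<^bsub>D\<^esub>p \<in> {..<n}. form_act (?r q p) (\<xi> p))"
      by (rule linear_maps_finsum[OF D(1) T right[OF x(3)[OF q]], symmetric])
        (use x r q in \<open>auto simp: D(2) form_act_closed\<close>)
    then show "(\<Oplus>\<^bsub>T\<^esub>p \<in> {..<n}. \<beta> (x' q) (form_act (?r q p) (\<xi> p))) = \<beta> (x' q) (\<xi>' q)"
      using dual_basis_expand[OF d x(4)[OF q] D eval] by simp
  qed (use x in \<open>auto intro!: bc\<close>)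
  finally show ?thesis .
qed

end

section \<open>The bimodule of double derivations\<close>

locale over_algebra = A: k_algebra k A + L: k_algebra k \<Lambda>
  for k (structure) and A (structure) and \<Lambda> (structure) +
  fixes i
  assumes i_hom: "i \<in> alg_hom k A \<Lambda>"
begin

abbreviation "LA \<equiv> alg_bimodule \<Lambda> id i"
abbreviation "AL \<equiv> alg_bimodule \<Lambda> i id"
abbreviation "LL \<equiv> Lam_A_Lam k A \<Lambda> i"
abbreviation "Om \<equiv> Omega k A \<Lambda> i"
abbreviation "DL \<equiv> DLam k \<Lambda>"
abbreviation "DO \<equiv> tensor k DL \<Lambda> Om"
abbreviation "DOD \<equiv> tensor k DO \<Lambda> DL"
abbreviation "Mho \<equiv> mho k A \<Lambda> i"
abbreviation "ot x y \<equiv> pure_tensor k LA A AL x y"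
abbreviation "d x \<equiv> diff k A \<Lambda> i x"

definition tri where "tri \<theta> \<omega> \<phi> = pure_tensor k DO \<Lambda> DL (pure_tensor k DL \<Lambda> Om \<theta> \<omega>) \<phi>"

lemmas k_cring = A.R.cring_axioms
lemmas i = alg_homD[OF i_hom]

lemma LA: "bimodule k \<Lambda> A LA" and AL: "bimodule k A \<Lambda> AL"
  by (intro alg_bimodule_bimodule L.k_algebra_axioms A.k_algebra_axioms i_hom id_alg_hom')+

lemma LL: "bimodule k \<Lambda> \<Lambda> LL"
  unfolding Lam_A_Lam_def by (rule tensor_bimodule[OF LA AL])

lemma DL: "bimodule k \<Lambda> \<Lambda> DL"
  unfolding DLam_def
  by (intro dual_bimodule alg_bimodule_bimodule L.k_algebra_axioms id_alg_hom')

lemma DL_simps: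
  "carrier DL = functionals k \<Lambda>"
  "add DL = (\<lambda>f g. \<lambda>x \<in> carrier \<Lambda>. f x \<oplus>\<^bsub>k\<^esub> g x)"
  "smult DL = (\<lambda>c f. \<lambda>x \<in> carrier \<Lambda>. c \<otimes>\<^bsub>k\<^esub> f x)"
  "lact DL s f = (\<lambda>x \<in> carrier \<Lambda>. f (x \<otimes>\<^bsub>\<Lambda>\<^esub> s))"
  "ract DL f r = (\<lambda>x \<in> carrier \<Lambda>. f (r \<otimes>\<^bsub>\<Lambda>\<^esub> x))"
proof -
  show "carrier DL = functionals k \<Lambda>"
    by (simp add: DLam_def dual_simps functionals_def alg_bimodule_simps)
qed (simp_all add: DLam_def dual_simps alg_bimodule_simps)

interpretation LL: bimodule k \<Lambda> \<Lambda> LL by (rule LL)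
interpretation DL: bimodule k \<Lambda> \<Lambda> DL by (rule DL)

lemma ot_closed: "ot x y \<in> carrier LL"
  unfolding Lam_A_Lam_def by (rule pure_tensor_closed[OF k_cring])

lemma ot_rules:
  assumes "x \<in> carrier \<Lambda>" "y \<in> carrier \<Lambda>"
  shows "x' \<in> carrier \<Lambda> \<Longrightarrow> ot (x \<oplus>\<^bsub>\<Lambda>\<^esub> x') y = ot x y \<oplus>\<^bsub>LL\<^esub> ot x' y"
    and "y' \<in> carrier \<Lambda> \<Longrightarrow> ot x (y \<oplus>\<^bsub>\<Lambda>\<^esub> y') = ot x y \<oplus>\<^bsub>LL\<^esub> ot x y'"
    and "c \<in> carrier k \<Longrightarrow> ot (c \<odot>\<^bsub>\<Lambda>\<^esub> x) y = c \<odot>\<^bsub>LL\<^esub> ot x y"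
    and "c \<in> carrier k \<Longrightarrow> ot x (c \<odot>\<^bsub>\<Lambda>\<^esub> y) = c \<odot>\<^bsub>LL\<^esub> ot x y"
    and "a \<in> carrier A \<Longrightarrow> ot (x \<otimes>\<^bsub>\<Lambda>\<^esub> i a) y = ot x (i a \<otimes>\<^bsub>\<Lambda>\<^esub> y)"
    and "r \<in> carrier \<Lambda> \<Longrightarrow> lact LL r (ot x y) = ot (r \<otimes>\<^bsub>\<Lambda>\<^esub> x) y"
    and "r \<in> carrier \<Lambda> \<Longrightarrow> ract LL (ot x y) r = ot x (y \<otimes>\<^bsub>\<Lambda>\<^esub> r)"
  using pure_tensor_rules[OF LA AL, of x y] tensor_lact_pure[OF LA AL, of r x y]
    tensor_ract_pure[OF LA AL, of r x y] assms
  by (simp_all add: Lam_A_Lam_def alg_bimodule_simps)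

lemma LL_eqI:
  assumes "f \<in> linear_maps k LL Z" "g \<in> linear_maps k LL Z"
    and "\<And>x y. \<lbrakk>x \<in> carrier \<Lambda>; y \<in> carrier \<Lambda>\<rbrakk> \<Longrightarrow> f (ot x y) = g (ot x y)" "U \<in> carrier LL"
  shows "f U = g U"
  by (rule linear_maps_tensor_eqI[OF LA AL])
    (use assms in \<open>auto simp: Lam_A_Lam_def alg_bimodule_simps\<close>)

lemma LL_parameter_linear:
  assumes "module k P" "module k Z" "\<And>p. p \<in> carrier P \<Longrightarrow> F p \<in> linear_maps k LL Z"
    and "\<And>x y. \<lbrakk>x \<in> carrier \<Lambda>; y \<in> carrier \<Lambda>\<rbrakk> \<Longrightarrow> (\<lambda>p. F p (ot x y)) \<in> linear_maps k P Z"
    and "U \<in> carrier LL"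
  shows "(\<lambda>p. F p U) \<in> linear_maps k P Z"
  by (rule tensor_parameter_linear[OF LA AL assms(1,2)])
    (use assms(3-5) in \<open>auto simp: Lam_A_Lam_def alg_bimodule_simps\<close>)

lemma LL_lift:
  assumes Z: "module k Z"
    and "\<And>y. y \<in> carrier \<Lambda> \<Longrightarrow> (\<lambda>x. \<beta> x y) \<in> linear_maps k \<Lambda> Z"
    and "\<And>x. x \<in> carrier \<Lambda> \<Longrightarrow> \<beta> x \<in> linear_maps k \<Lambda> Z"
    and "\<And>x a y. \<lbrakk>x \<in> carrier \<Lambda>; a \<in> carrier A; y \<in> carrier \<Lambda>\<rbrakk> \<Longrightarrow>
      \<beta> (x \<otimes>\<^bsub>\<Lambda>\<^esub> i a) y = \<beta> x (i a \<otimes>\<^bsub>\<Lambda>\<^esub> y)"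
  shows "tensor_lift k LA AL Z \<beta> \<in> linear_maps k LL Z"
    and "\<lbrakk>x \<in> carrier \<Lambda>; y \<in> carrier \<Lambda>\<rbrakk> \<Longrightarrow> tensor_lift k LA AL Z \<beta> (ot x y) = \<beta> x y"
proof -
  have b: "\<beta> \<in> balanced k LA A AL Z"
    using assms(2-4) by (auto intro!: balancedI simp: alg_bimodule_simps linear_maps_def)
  show "tensor_lift k LA AL Z \<beta> \<in> linear_maps k LL Z"
    unfolding Lam_A_Lam_def by (rule tensor_lift_linear[OF LA AL Z b])
  show "\<lbrakk>x \<in> carrier \<Lambda>; y \<in> carrier \<Lambda>\<rbrakk> \<Longrightarrow> tensor_lift k LA AL Z \<beta> (ot x y) = \<beta> x y"
    using tensor_lift_pure[OF LA AL Z b] by (simp add: alg_bimodule_simps)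
qed

abbreviation "mul \<equiv> tensor_lift k LA AL \<Lambda> (\<lambda>x y. x \<otimes>\<^bsub>\<Lambda>\<^esub> y)"

lemma mul:
  shows mul_linear: "mul \<in> linear_maps k LL \<Lambda>"
    and mul_ot: "\<lbrakk>x \<in> carrier \<Lambda>; y \<in> carrier \<Lambda>\<rbrakk> \<Longrightarrow> mul (ot x y) = x \<otimes>\<^bsub>\<Lambda>\<^esub> y"
  by (rule LL_lift[OF L.module_axioms]; auto intro!: linear_mapsI
      simp: L.l_distr L.r_distr L.smult_mult_left L.smult_mult_right L.m_assoc i)+

lemmas mulD = linear_mapsD[OF mul_linear]

lemma mul_lact: "\<lbrakk>r \<in> carrier \<Lambda>; U \<in> carrier LL\<rbrakk> \<Longrightarrow> mul (lact LL r U) = r \<otimes>\<^bsub>\<Lambda>\<^esub> mul U"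
  by (rule LL_eqI[OF linear_maps_compose[OF LL.lact_linear mul_linear]
        linear_maps_compose[OF mul_linear]])
    (auto intro!: linear_mapsI simp: L.r_distr L.smult_mult_right ot_rules mul_ot L.m_assoc)

lemma mul_ract: "\<lbrakk>r \<in> carrier \<Lambda>; U \<in> carrier LL\<rbrakk> \<Longrightarrow> mul (ract LL U r) = mul U \<otimes>\<^bsub>\<Lambda>\<^esub> r"
  by (rule LL_eqI[OF linear_maps_compose[OF LL.ract_linear mul_linear]
        linear_maps_compose[OF mul_linear]])
    (auto intro!: linear_mapsI simp: L.l_distr L.smult_mult_left ot_rules mul_ot L.m_assoc)

lemma Om_simps:
  "carrier Om = {U \<in> carrier LL. mul U = \<zero>\<^bsub>\<Lambda>\<^esub>}" "zero Om = zero LL" "add Om = add LL"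
  "smult Om = smult LL" "lact Om = lact LL" "ract Om = ract LL"
  by (simp_all add: Omega_def)

lemma Om: "bimodule k \<Lambda> \<Lambda> Om"
  unfolding Omega_def
  by (rule sub_bimodule_bimodule[OF LL])
    (auto simp: sub_bimodule_def mul_lact mul_ract LL.lact_closed LL.ract_closed
      intro!: kernel_submodule[OF LL.module_axioms L.module_axioms mul_linear])

interpretation Om: bimodule k \<Lambda> \<Lambda> Om by (rule Om)

lemma DO: "bimodule k \<Lambda> \<Lambda> DO" by (rule tensor_bimodule[OF DL Om])
interpretation DO: bimodule k \<Lambda> \<Lambda> DO by (rule DO)

lemma DOD: "bimodule k \<Lambda> \<Lambda> DOD" by (rule tensor_bimodule[OF DO DL])
interpretation DOD: bimodule k \<Lambda> \<Lambda> DOD by (rule DOD)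

lemma Mho: "bimodule k \<Lambda> \<Lambda> Mho"
  unfolding mho_def by (rule dual_bimodule[OF DOD])
interpretation Mho: bimodule k \<Lambda> \<Lambda> Mho by (rule Mho)

lemma d_closed: "x \<in> carrier \<Lambda> \<Longrightarrow> d x \<in> carrier Om"
  unfolding diff_def Om_simps
  by (auto simp: linear_maps_diff[OF LL.module_axioms L.module_axioms mul_linear] ot_closed mul_ot
      L.r_neg a_minus_def[of \<Lambda>])

lemma Om_LL: "\<omega> \<in> carrier Om \<Longrightarrow> \<omega> \<in> carrier LL" by (simp add: Om_simps)

lemma d_mult:
  assumes x: "x \<in> carrier \<Lambda>" and y: "y \<in> carrier \<Lambda>"
  shows "d (x \<otimes>\<^bsub>\<Lambda>\<^esub> y) = ract LL (d x) y \<oplus>\<^bsub>LL\<^esub> lact LL x (d y)"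
proof -
  have "ract LL (d x) y = ot \<one>\<^bsub>\<Lambda>\<^esub> (x \<otimes>\<^bsub>\<Lambda>\<^esub> y) \<ominus>\<^bsub>LL\<^esub> ot x y"
    unfolding diff_def
    using linear_maps_diff[OF LL.module_axioms LL.module_axioms LL.ract_linear[OF y]
        ot_closed[of "\<one>\<^bsub>\<Lambda>\<^esub>" x] ot_closed[of x "\<one>\<^bsub>\<Lambda>\<^esub>"]] x y
    by (simp add: ot_rules)
  moreover have "lact LL x (d y) = ot x y \<ominus>\<^bsub>LL\<^esub> ot (x \<otimes>\<^bsub>\<Lambda>\<^esub> y) \<one>\<^bsub>\<Lambda>\<^esub>"
    unfolding diff_def
    using linear_maps_diff[OF LL.module_axioms LL.module_axioms LL.lact_linear[OF x]
        ot_closed[of "\<one>\<^bsub>\<Lambda>\<^esub>" y] ot_closed[of y "\<one>\<^bsub>\<Lambda>\<^esub>"]] x y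
    by (simp add: ot_rules)
  ultimately show ?thesis
    by (simp add: diff_def a_minus_def ot_closed LL.a_assoc LL.r_neg1)
qed

lemma d_linear: "(\<lambda>x. d x) \<in> linear_maps k \<Lambda> Om"
  by (rule linear_mapsI; (rule d_closed)?)
    (simp_all add: diff_def Om_simps ot_rules ot_closed a_minus_def LL.a_ac LL.minus_add
      LL.smult_r_distr LL.smult_r_minus)

lemma d_scalar: "a \<in> carrier A \<Longrightarrow> d (i a) = \<zero>\<^bsub>LL\<^esub>"
  using ot_rules(5)[of "\<one>\<^bsub>\<Lambda>\<^esub>" "\<one>\<^bsub>\<Lambda>\<^esub>" a] i by (simp add: diff_def a_minus_def LL.r_neg ot_closed)

lemma tri_closed: "tri \<theta> \<omega> \<phi> \<in> carrier DOD"
  unfolding tri_def by (rule pure_tensor_closed[OF k_cring])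

lemma tri_linear:
  shows "\<lbrakk>\<omega> \<in> carrier Om; \<phi> \<in> carrier DL\<rbrakk> \<Longrightarrow> (\<lambda>\<theta>. tri \<theta> \<omega> \<phi>) \<in> linear_maps k DL DOD"
    and "\<lbrakk>\<theta> \<in> carrier DL; \<phi> \<in> carrier DL\<rbrakk> \<Longrightarrow> (\<lambda>\<omega>. tri \<theta> \<omega> \<phi>) \<in> linear_maps k Om DOD"
    and "\<lbrakk>\<theta> \<in> carrier DL; \<omega> \<in> carrier Om\<rbrakk> \<Longrightarrow> (\<lambda>\<phi>. tri \<theta> \<omega> \<phi>) \<in> linear_maps k DL DOD"
  unfolding tri_def
  by (intro linear_maps_compose[OF pure_tensor_linear_left[OF DL Om] pure_tensor_linear_left[OF DO DL]]
      linear_maps_compose[OF pure_tensor_linear_right[OF DL Om] pure_tensor_linear_left[OF DO DL]]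
      pure_tensor_linear_right[OF DO DL] pure_tensor_closed[OF k_cring] | assumption)+

lemma tri_rules:
  assumes "\<theta> \<in> carrier DL" "\<omega> \<in> carrier Om" "\<phi> \<in> carrier DL" "r \<in> carrier \<Lambda>"
  shows "tri (ract DL \<theta> r) \<omega> \<phi> = tri \<theta> (lact LL r \<omega>) \<phi>"
    and "tri \<theta> (ract LL \<omega> r) \<phi> = tri \<theta> \<omega> (lact DL r \<phi>)"
    and "lact DOD r (tri \<theta> \<omega> \<phi>) = tri (lact DL r \<theta>) \<omega> \<phi>"
    and "ract DOD (tri \<theta> \<omega> \<phi>) r = tri \<theta> \<omega> (ract DL \<phi> r)"
  unfolding tri_def
  using pure_tensor_rules(5)[OF DL Om, of \<theta> \<omega> r] tensor_ract_pure[OF DL Om, of r \<theta> \<omega>]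
    tensor_lact_pure[OF DL Om, of r \<theta> \<omega>] tensor_ract_pure[OF DO DL, of r _ \<phi>]
    tensor_lact_pure[OF DO DL, of r "pure_tensor k DL \<Lambda> Om \<theta> \<omega>" \<phi>]
    pure_tensor_rules(5)[OF DO DL pure_tensor_closed[OF k_cring, of DL \<Lambda> Om \<theta> \<omega>] assms(3,4)] assms
    pure_tensor_closed[OF k_cring, of DL \<Lambda> Om]
  by (simp_all add: Om_simps)

lemma tri_d_mult:
  assumes "\<theta> \<in> carrier DL" "x \<in> carrier \<Lambda>" "y \<in> carrier \<Lambda>" "\<phi> \<in> carrier DL"
  shows "tri \<theta> (d (x \<otimes>\<^bsub>\<Lambda>\<^esub> y)) \<phi> = tri \<theta> (d x) (lact DL y \<phi>) \<oplus>\<^bsub>DOD\<^esub> tri (ract DL \<theta> x) (d y) \<phi>"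
  using linear_maps_add[OF tri_linear(2)[OF assms(1,4)] Om.ract_closed[OF d_closed[OF assms(2)] assms(3)]
      Om.lact_closed[OF assms(2) d_closed[OF assms(3)]]]
    tri_rules[OF assms(1) d_closed[OF assms(2)] assms(4,3)]
    tri_rules[OF assms(1) d_closed[OF assms(3)] assms(4,2)]
  by (simp add: d_mult[OF assms(2,3)] Om_simps)

lemma DOD_eqI:
  assumes "f \<in> linear_maps k DOD Z" "g \<in> linear_maps k DOD Z"
    and "\<And>\<theta> \<omega> \<phi>. \<lbrakk>\<theta> \<in> carrier DL; \<omega> \<in> carrier Om; \<phi> \<in> carrier DL\<rbrakk> \<Longrightarrow> f (tri \<theta> \<omega> \<phi>) = g (tri \<theta> \<omega> \<phi>)"
    and "U \<in> carrier DOD"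
  shows "f U = g U"
proof (rule linear_maps_tensor_eqI[OF DO DL assms(1,2) _ assms(4)])
  fix W \<phi> assume W: "W \<in> carrier DO" and p: "\<phi> \<in> carrier DL"
  note l = pure_tensor_linear_left[OF DO DL p]
  show "f (pure_tensor k DO \<Lambda> DL W \<phi>) = g (pure_tensor k DO \<Lambda> DL W \<phi>)"
    by (rule linear_maps_tensor_eqI[OF DL Om linear_maps_compose[OF l assms(1)]
          linear_maps_compose[OF l assms(2)] _ W])
      (use assms(3) p in \<open>simp add: tri_def\<close>)
qed

text \<open>The elements \<open>x \<sqdot> dy\<close> span \<open>\<Omega>\<close>: for every \<open>U \<in> \<Lambda> \<otimes>\<^sub>A \<Lambda>\<close> the difference \<open>\<kappa> U\<close> of \<open>U\<close> and
  \<open>mul U \<otimes> 1\<close> is a combination of them, and \<open>\<kappa> U = U\<close> for \<open>U \<in> \<Omega>\<close>.\<close>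

lemma Om_eqI:
  assumes f: "f \<in> linear_maps k Om Z" and g: "g \<in> linear_maps k Om Z"
    and eq: "\<And>x y. \<lbrakk>x \<in> carrier \<Lambda>; y \<in> carrier \<Lambda>\<rbrakk> \<Longrightarrow> f (lact LL x (d y)) = g (lact LL x (d y))"
    and w: "\<omega> \<in> carrier Om"
  shows "f \<omega> = g \<omega>"
proof -
  define \<kappa> where "\<kappa> U = U \<ominus>\<^bsub>LL\<^esub> ot (mul U) \<one>\<^bsub>\<Lambda>\<^esub>" for U
  have Kc: "\<kappa> U \<in> carrier Om" if "U \<in> carrier LL" for U
    using that mulD linear_maps_diff[OF LL.module_axioms L.module_axioms mul_linear that ot_closed]
    by (simp add: \<kappa>_def Om_simps ot_closed mul_ot a_minus_def[of \<Lambda>] L.r_neg)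
  have K: "\<kappa> \<in> linear_maps k LL Om"
    by (rule linear_mapsI; (rule Kc)?)
      (simp_all add: \<kappa>_def Om_simps mulD ot_rules ot_closed a_minus_def LL.a_ac LL.minus_add
        LL.smult_r_distr LL.smult_r_minus)
  have Kot: "\<kappa> (ot x y) = lact LL x (d y)" if "x \<in> carrier \<Lambda>" "y \<in> carrier \<Lambda>" for x y
    using linear_maps_diff[OF LL.module_axioms LL.module_axioms LL.lact_linear[OF that(1)]
        ot_closed[of "\<one>\<^bsub>\<Lambda>\<^esub>" y] ot_closed[of y "\<one>\<^bsub>\<Lambda>\<^esub>"]] that
    by (simp add: \<kappa>_def diff_def mul_ot ot_rules)
  have "f (\<kappa> \<omega>) = g (\<kappa> \<omega>)"
    by (rule LL_eqI[OF linear_maps_compose[OF K f] linear_maps_compose[OF K g] _ Om_LL[OF w]])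
      (simp add: Kot eq)
  moreover have "ot \<zero>\<^bsub>\<Lambda>\<^esub> \<one>\<^bsub>\<Lambda>\<^esub> = \<zero>\<^bsub>LL\<^esub>"
    using ot_rules(3)[of "\<zero>\<^bsub>\<Lambda>\<^esub>" "\<one>\<^bsub>\<Lambda>\<^esub>" "\<zero>\<^bsub>k\<^esub>"] ot_closed by simp
  then have "\<kappa> \<omega> = \<omega>" using w Om_LL[OF w] by (simp add: \<kappa>_def Om_simps a_minus_def)
  ultimately show ?thesis by simp
qed

lemma Mho_simps: "carrier Mho = functionals k DOD"
  by (simp add: mho_def dual_simps)

lemma Mho_eqI:
  assumes f: "f \<in> carrier Mho" and g: "g \<in> carrier Mho"
    and eq: "\<And>\<theta> x \<phi>. \<lbrakk>\<theta> \<in> carrier DL; x \<in> carrier \<Lambda>; \<phi> \<in> carrier DL\<rbrakk> \<Longrightarrow>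
      f (tri \<theta> (d x) \<phi>) = g (tri \<theta> (d x) \<phi>)"
  shows "f = g"
proof (rule functionals_eqI[OF f[unfolded Mho_simps] g[unfolded Mho_simps]])
  note fl = functionals_linear[OF f[unfolded Mho_simps]]
    and gl = functionals_linear[OF g[unfolded Mho_simps]]
  show "f U = g U" if "U \<in> carrier DOD" for U
  proof (rule DOD_eqI[OF fl gl _ that])
    fix \<theta> \<omega> \<phi> assume a: "\<theta> \<in> carrier DL" "\<omega> \<in> carrier Om" "\<phi> \<in> carrier DL"
    show "f (tri \<theta> \<omega> \<phi>) = g (tri \<theta> \<omega> \<phi>)"
    proof (rule Om_eqI[OF linear_maps_compose[OF tri_linear(2)[OF a(1,3)] fl]
          linear_maps_compose[OF tri_linear(2)[OF a(1,3)] gl] _ a(2)])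
      fix x y assume "x \<in> carrier \<Lambda>" "y \<in> carrier \<Lambda>"
      then show "f (tri \<theta> (lact LL x (d y)) \<phi>) = g (tri \<theta> (lact LL x (d y)) \<phi>)"
        using tri_rules(1)[OF a(1) d_closed a(3), of y x, symmetric] eq a DL.ract_closed by simp
    qed
  qed
qed

text \<open>The linear form is \<open>\<theta> \<otimes> (x \<otimes> y) \<otimes> \<phi> \<mapsto> G(\<theta>x, y, \<phi>)\<close>, which is balanced over \<open>A\<close> because \<open>G\<close> vanishes
  on \<open>A\<close>. For \<open>r \<in> \<Lambda>\<close>, its values at \<open>\<theta> \<otimes> (x \<otimes> y) r \<otimes> \<phi>\<close> and at \<open>\<theta> \<otimes> (x \<otimes> y) \<otimes> r \<phi>\<close> differ by
  \<open>G(\<theta>xy, r, \<phi>)\<close>. On an element of \<open>\<Omega>\<close> these defects add up to zero, because the products \<open>xy\<close> do.\<close>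

lemma Mho_lift:
  assumes G1: "\<And>x \<phi>. \<lbrakk>x \<in> carrier \<Lambda>; \<phi> \<in> carrier DL\<rbrakk> \<Longrightarrow> (\<lambda>\<theta>. G \<theta> x \<phi>) \<in> linear_maps k DL (scalars k)"
    and G2: "\<And>\<theta> \<phi>. \<lbrakk>\<theta> \<in> carrier DL; \<phi> \<in> carrier DL\<rbrakk> \<Longrightarrow> (\<lambda>x. G \<theta> x \<phi>) \<in> linear_maps k \<Lambda> (scalars k)"
    and G3: "\<And>\<theta> x. \<lbrakk>\<theta> \<in> carrier DL; x \<in> carrier \<Lambda>\<rbrakk> \<Longrightarrow> (\<lambda>\<phi>. G \<theta> x \<phi>) \<in> linear_maps k DL (scalars k)"
    and der: "\<And>\<theta> x y \<phi>. \<lbrakk>\<theta> \<in> carrier DL; x \<in> carrier \<Lambda>; y \<in> carrier \<Lambda>; \<phi> \<in> carrier DL\<rbrakk> \<Longrightarrow>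
      G \<theta> (x \<otimes>\<^bsub>\<Lambda>\<^esub> y) \<phi> = G \<theta> x (lact DL y \<phi>) \<oplus>\<^bsub>k\<^esub> G (ract DL \<theta> x) y \<phi>"
    and sc: "\<And>\<theta> a \<phi>. \<lbrakk>\<theta> \<in> carrier DL; a \<in> carrier A; \<phi> \<in> carrier DL\<rbrakk> \<Longrightarrow> G \<theta> (i a) \<phi> = \<zero>\<^bsub>k\<^esub>"
  obtains f where "f \<in> carrier Mho"
    and "\<And>\<theta> x \<phi>. \<lbrakk>\<theta> \<in> carrier DL; x \<in> carrier \<Lambda>; \<phi> \<in> carrier DL\<rbrakk> \<Longrightarrow> f (tri \<theta> (d x) \<phi>) = G \<theta> x \<phi>"
proof -
  note K = module_scalars[OF k_cring]
  interpret K: module k "scalars k" by (rule K)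
  note Gc = linear_mapsD[OF G1, unfolded scalars_simps] linear_mapsD[OF G2, unfolded scalars_simps]
    linear_mapsD[OF G3, unfolded scalars_simps]
  let ?b = "\<lambda>\<theta> \<phi> x y. G (ract DL \<theta> x) y \<phi>"
  define g1 where "g1 \<theta> \<phi> = tensor_lift k LA AL (scalars k) (?b \<theta> \<phi>)" for \<theta> \<phi>
  have g1: "g1 \<theta> \<phi> \<in> linear_maps k LL (scalars k)"
    and g1_ot: "\<And>x y. \<lbrakk>x \<in> carrier \<Lambda>; y \<in> carrier \<Lambda>\<rbrakk> \<Longrightarrow> g1 \<theta> \<phi> (ot x y) = G (ract DL \<theta> x) y \<phi>"
    if t: "\<theta> \<in> carrier DL" and p: "\<phi> \<in> carrier DL" for \<theta> \<phi>
  proof -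
    have 1: "(\<lambda>x. ?b \<theta> \<phi> x y) \<in> linear_maps k \<Lambda> (scalars k)" if "y \<in> carrier \<Lambda>" for y
      by (rule linear_maps_compose[OF DL.ract_linear_right[OF t] G1[OF that p]])
    have 2: "?b \<theta> \<phi> x \<in> linear_maps k \<Lambda> (scalars k)" if "x \<in> carrier \<Lambda>" for x
      by (rule G2[OF DL.ract_closed[OF t that] p])
    have 3: "?b \<theta> \<phi> (x \<otimes>\<^bsub>\<Lambda>\<^esub> i a) y = ?b \<theta> \<phi> x (i a \<otimes>\<^bsub>\<Lambda>\<^esub> y)"
      if "x \<in> carrier \<Lambda>" "a \<in> carrier A" "y \<in> carrier \<Lambda>" for x a y
      using der[OF DL.ract_closed[OF t that(1)] i(2)[OF that(2)] that(3) p]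
        sc[OF DL.ract_closed[OF t that(1)] that(2) DL.lact_closed[OF that(3) p]] that i t p
        Gc(1)[of y \<phi> "ract DL \<theta> (x \<otimes>\<^bsub>\<Lambda>\<^esub> i a)"]
      by (simp add: DL.ract_mult DL.ract_closed)
    show "g1 \<theta> \<phi> \<in> linear_maps k LL (scalars k)" unfolding g1_def by (rule LL_lift(1)[OF K 1 2 3])
    show "\<And>x y. \<lbrakk>x \<in> carrier \<Lambda>; y \<in> carrier \<Lambda>\<rbrakk> \<Longrightarrow> g1 \<theta> \<phi> (ot x y) = G (ract DL \<theta> x) y \<phi>"
      unfolding g1_def by (rule LL_lift(2)[OF K 1 2 3])
  qed
  note g1D = linear_mapsD[OF g1, unfolded scalars_simps]
  have g1_theta: "(\<lambda>\<theta>. g1 \<theta> \<phi> U) \<in> linear_maps k DL (scalars k)"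
    if p: "\<phi> \<in> carrier DL" and U: "U \<in> carrier LL" for \<phi> U
    by (rule LL_parameter_linear[OF DL.module_axioms K g1[OF _ p] _ U], assumption, rule linear_mapsI)
      (simp_all add: p g1_ot DL.ract_closed DL.ract_add_left DL.ract_smult_left Gc)
  have g1_phi: "(\<lambda>\<phi>. g1 \<theta> \<phi> U) \<in> linear_maps k DL (scalars k)"
    if t: "\<theta> \<in> carrier DL" and U: "U \<in> carrier LL" for \<theta> U
    by (rule LL_parameter_linear[OF DL.module_axioms K g1[OF t] _ U], assumption, rule linear_mapsI)
      (simp_all add: t g1_ot DL.ract_closed Gc)
  have g1_Om: "g1 \<theta> \<phi> \<in> linear_maps k Om (scalars k)" if "\<theta> \<in> carrier DL" "\<phi> \<in> carrier DL" for \<theta> \<phi>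
    using g1[OF that] by (auto simp: linear_maps_def Om_simps)
  have g1_mid: "g1 (ract DL \<theta> r) \<phi> U = g1 \<theta> \<phi> (lact LL r U)"
    if t: "\<theta> \<in> carrier DL" and p: "\<phi> \<in> carrier DL" and r: "r \<in> carrier \<Lambda>" and U: "U \<in> carrier LL"
    for \<theta> \<phi> r U
    by (rule LL_eqI[OF g1 linear_maps_compose[OF LL.lact_linear g1] _ U])
      (simp_all add: t p r DL.ract_closed g1_ot ot_rules DL.ract_mult)
  have b2: "(\<lambda>\<theta> \<omega>. g1 \<theta> \<phi> \<omega>) \<in> balanced k DL \<Lambda> Om (scalars k)" if p: "\<phi> \<in> carrier DL" for \<phi>
    by (rule balancedI) (simp_all add: p Om_LL g1_theta g1_Om g1_mid Om_simps(5))
  define g2 where "g2 \<phi> = tensor_lift k DL Om (scalars k) (\<lambda>\<theta> \<omega>. g1 \<theta> \<phi> \<omega>)" for \<phi>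
  have g2: "g2 \<phi> \<in> linear_maps k DO (scalars k)" if "\<phi> \<in> carrier DL" for \<phi>
    unfolding g2_def by (rule tensor_lift_linear[OF DL Om K b2[OF that]])
  have g2_pure: "g2 \<phi> (pure_tensor k DL \<Lambda> Om \<theta> \<omega>) = g1 \<theta> \<phi> \<omega>"
    if "\<theta> \<in> carrier DL" "\<omega> \<in> carrier Om" "\<phi> \<in> carrier DL" for \<theta> \<omega> \<phi>
    unfolding g2_def by (rule tensor_lift_pure[OF DL Om K b2[OF that(3)] that(1,2)])
  note g2D = linear_mapsD[OF g2, unfolded scalars_simps]
  have g2_phi: "(\<lambda>\<phi>. g2 \<phi> W) \<in> linear_maps k DL (scalars k)" if W: "W \<in> carrier DO" for W
    by (rule tensor_parameter_linear[OF DL Om DL.module_axioms K g2 _ W], assumption,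
        rule linear_mapsI)
      (simp_all add: g2_pure linear_mapsD[OF g1_phi, unfolded scalars_simps] Om_LL)
  have g1_right: "g1 \<theta> \<phi> (ract LL U r) = g1 \<theta> (lact DL r \<phi>) U \<oplus>\<^bsub>k\<^esub> G (ract DL \<theta> (mul U)) r \<phi>"
    if t: "\<theta> \<in> carrier DL" and p: "\<phi> \<in> carrier DL" and r: "r \<in> carrier \<Lambda>" and U: "U \<in> carrier LL"
    for \<theta> \<phi> r U
  proof -
    have s: "(\<lambda>U. g1 \<theta> (lact DL r \<phi>) U \<oplus>\<^bsub>k\<^esub> G (ract DL \<theta> (mul U)) r \<phi>) \<in> linear_maps k LL (scalars k)"
      by (rule linear_mapsI)
        (simp_all add: g1D t p r DL.lact_closed DL.ract_closed mulD Gc DL.ract_add_right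
          DL.ract_smult_right A.R.a_ac A.R.r_distr)
    show ?thesis
      by (rule LL_eqI[OF linear_maps_compose[OF LL.ract_linear g1] s _ U])
        (simp_all add: t p r g1_ot ot_rules DL.lact_closed DL.ract_closed der mul_ot DL.ract_mult)
  qed
  have g2_mid: "g2 \<phi> (ract DO W r) = g2 (lact DL r \<phi>) W"
    if p: "\<phi> \<in> carrier DL" and r: "r \<in> carrier \<Lambda>" and W: "W \<in> carrier DO" for \<phi> r W
  proof (rule linear_maps_tensor_eqI[OF DL Om linear_maps_compose[OF DO.ract_linear g2] g2 _ W])
    fix \<theta> \<omega> assume t: "\<theta> \<in> carrier DL" and w: "\<omega> \<in> carrier Om"
    have "ract DL \<theta> \<zero>\<^bsub>\<Lambda>\<^esub> = \<zero>\<^bsub>DL\<^esub>"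
      by (rule linear_maps_zero[OF L.module_axioms DL.module_axioms DL.ract_linear_right[OF t]])
    then have "G (ract DL \<theta> \<zero>\<^bsub>\<Lambda>\<^esub>) r \<phi> = \<zero>\<^bsub>k\<^esub>"
      using linear_maps_zero[OF DL.module_axioms K G1[OF r p]] by simp
    then show "g2 \<phi> (ract DO (pure_tensor k DL \<Lambda> Om \<theta> \<omega>) r) =
        g2 (lact DL r \<phi>) (pure_tensor k DL \<Lambda> Om \<theta> \<omega>)"
      using t w p r g1_right[OF t p r Om_LL[OF w]] Om.ract_closed[OF w r]
      by (simp add: tensor_ract_pure[OF DL Om] g2_pure DL.lact_closed Om_simps g1D)
  qed (simp_all add: p r DL.lact_closed)
  have b3: "(\<lambda>W \<phi>. g2 \<phi> W) \<in> balanced k DO \<Lambda> DL (scalars k)"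
    by (rule balancedI) (simp_all add: g2 g2_phi g2_mid)
  define g3 where "g3 = tensor_lift k DO DL (scalars k) (\<lambda>W \<phi>. g2 \<phi> W)"
  have g3: "g3 \<in> linear_maps k DOD (scalars k)"
    unfolding g3_def by (rule tensor_lift_linear[OF DO DL K b3])
  have g3_tri: "g3 (tri \<theta> \<omega> \<phi>) = g1 \<theta> \<phi> \<omega>"
    if "\<theta> \<in> carrier DL" "\<omega> \<in> carrier Om" "\<phi> \<in> carrier DL" for \<theta> \<omega> \<phi>
    unfolding g3_def tri_def
    by (subst tensor_lift_pure[OF DO DL K b3 pure_tensor_closed[OF k_cring] that(3)])
      (rule g2_pure[OF that])
  have "G \<theta> \<one>\<^bsub>\<Lambda>\<^esub> \<phi> = \<zero>\<^bsub>k\<^esub>" if "\<theta> \<in> carrier DL" "\<phi> \<in> carrier DL" for \<theta> \<phi>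
    using sc[OF that(1) _ that(2), of "\<one>\<^bsub>A\<^esub>"] i(6) by simp
  then have "g1 \<theta> \<phi> (d x) = G \<theta> x \<phi>"
    if "\<theta> \<in> carrier DL" "x \<in> carrier \<Lambda>" "\<phi> \<in> carrier DL" for \<theta> x \<phi>
    using that linear_maps_diff[OF LL.module_axioms K g1[OF that(1,3)] ot_closed[of "\<one>\<^bsub>\<Lambda>\<^esub>" x]
        ot_closed[of x "\<one>\<^bsub>\<Lambda>\<^esub>"]]
    by (simp add: diff_def g1_ot DL.ract_one DL.ract_closed Gc a_minus_def[of k])
  then show thesis
    using that[of "restrict g3 (carrier DOD)"] restrict_functional[OF DOD.module_axioms g3]
    by (simp add: Mho_simps tri_closed g3_tri d_closed)
qed

lemma Mho_act:
  assumes "f \<in> carrier Mho" "\<theta> \<in> carrier DL" "\<omega> \<in> carrier Om" "\<phi> \<in> carrier DL" "r \<in> carrier \<Lambda>"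
  shows "lact Mho r f (tri \<theta> \<omega> \<phi>) = f (tri \<theta> \<omega> (ract DL \<phi> r))"
    and "ract Mho f r (tri \<theta> \<omega> \<phi>) = f (tri (lact DL r \<theta>) \<omega> \<phi>)"
  using assms by (simp_all add: mho_def dual_simps tri_closed tri_rules)

lemma Mho_add:
  "\<lbrakk>f \<in> carrier Mho; g \<in> carrier Mho\<rbrakk> \<Longrightarrow> (f \<oplus>\<^bsub>Mho\<^esub> g) (tri \<theta> \<omega> \<phi>) = f (tri \<theta> \<omega> \<phi>) \<oplus>\<^bsub>k\<^esub> g (tri \<theta> \<omega> \<phi>)"
  "c \<in> carrier k \<Longrightarrow> (c \<odot>\<^bsub>Mho\<^esub> f) (tri \<theta> \<omega> \<phi>) = c \<otimes>\<^bsub>k\<^esub> f (tri \<theta> \<omega> \<phi>)"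
  "\<zero>\<^bsub>Mho\<^esub> (tri \<theta> \<omega> \<phi>) = \<zero>\<^bsub>k\<^esub>"
  by (simp_all add: mho_def dual_simps tri_closed)

end

subsection \<open>The canonical element\<close>

locale symm_over_algebra = symmetric_algebra k A \<sigma> + over_algebra k A \<Lambda> i
  for k (structure) and A (structure) and \<sigma> and \<Lambda> (structure) and i
begin

abbreviation "AA \<equiv> alg_bimodule \<Lambda> i i"
abbreviation "rv \<theta> x \<equiv> rvec A \<sigma> AA \<theta> x"
abbreviation "lv \<theta> x \<equiv> lvec A \<sigma> AA \<theta> x"

lemma AA: "bimodule k A A AA"
  by (intro alg_bimodule_bimodule L.k_algebra_axioms k_algebra_axioms i_hom)

lemma right_AA: "right_module_symm k A \<sigma> AA (ract AA)"
  by (intro right_module_symm.intro symmetric_algebra_axioms bimodule_right_module[OF AA])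

lemma left_AA: "right_module_symm k (opp A) \<sigma> AA (\<lambda>x a. lact AA a x)"
  by (intro right_module_symm.intro symmetric_algebra_opp symmetric_algebra_axioms
      bimodule_left_module[OF AA])

lemma functionals_AA: "functionals k AA = functionals k \<Lambda>"
  by (simp add: functionals_def alg_bimodule_simps)

interpretation DL: bimodule k \<Lambda> \<Lambda> DL by (rule DL)

lemma rv:
  assumes "\<theta> \<in> carrier DL" "x \<in> carrier \<Lambda>"
  shows rv_closed: "rv \<theta> x \<in> carrier A"
    and rv_i: "a \<in> carrier A \<Longrightarrow> rv \<theta> (x \<otimes>\<^bsub>\<Lambda>\<^esub> i a) = rv \<theta> x \<otimes>\<^bsub>A\<^esub> a"
    and sigma_rv: "a \<in> carrier A \<Longrightarrow> \<sigma> (rv \<theta> x \<otimes>\<^bsub>A\<^esub> a) = \<theta> (x \<otimes>\<^bsub>\<Lambda>\<^esub> i a)"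
    and rv_eqI: "\<lbrakk>a \<in> carrier A; \<And>b. b \<in> carrier A \<Longrightarrow> \<sigma> (a \<otimes>\<^bsub>A\<^esub> b) = \<theta> (x \<otimes>\<^bsub>\<Lambda>\<^esub> i b)\<rbrakk> \<Longrightarrow> rv \<theta> x = a"
    and "\<theta> \<in> carrier DL \<Longrightarrow> rvec A \<sigma> AA \<theta> \<in> linear_maps k \<Lambda> A"
  using right_module_symm.vec[OF right_AA, of \<theta> x] right_module_symm.sigma_vec_mult[OF right_AA, of \<theta> x]
    right_module_symm.vec_eqI[OF right_AA, of \<theta> x a] assms
    right_module_symm.vec_linear[OF right_AA, of \<theta>]
  by (simp_all add: rvec_vec functionals_AA DL_simps alg_bimodule_simps linear_maps_def)

lemmas rv_linear = rv(5)[OF _ L.M.zero_closed]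

lemma lv:
  assumes "\<theta> \<in> carrier DL" "x \<in> carrier \<Lambda>"
  shows lv_closed: "lv \<theta> x \<in> carrier A"
    and lv_i: "a \<in> carrier A \<Longrightarrow> lv \<theta> (i a \<otimes>\<^bsub>\<Lambda>\<^esub> x) = a \<otimes>\<^bsub>A\<^esub> lv \<theta> x"
    and sigma_lv: "a \<in> carrier A \<Longrightarrow> \<sigma> (a \<otimes>\<^bsub>A\<^esub> lv \<theta> x) = \<theta> (i a \<otimes>\<^bsub>\<Lambda>\<^esub> x)"
    and lv_eqI: "\<lbrakk>a \<in> carrier A; \<And>b. b \<in> carrier A \<Longrightarrow> \<sigma> (b \<otimes>\<^bsub>A\<^esub> a) = \<theta> (i b \<otimes>\<^bsub>\<Lambda>\<^esub> x)\<rbrakk> \<Longrightarrow> lv \<theta> x = a"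
    and "\<theta> \<in> carrier DL \<Longrightarrow> lvec A \<sigma> AA \<theta> \<in> linear_maps k \<Lambda> A"
  using right_module_symm.vec[OF left_AA, of \<theta> x] right_module_symm.sigma_vec_mult[OF left_AA, of \<theta> x]
    right_module_symm.vec_eqI[OF left_AA, of \<theta> x a] assms
    right_module_symm.vec_linear[OF left_AA, of \<theta>]
  by (simp_all add: lvec_vec functionals_AA DL_simps alg_bimodule_simps linear_maps_def)

lemmas lv_linear = lv(5)[OF _ L.M.zero_closed]

lemma DL_act_form:
  assumes "\<theta> \<in> carrier DL" "x \<in> carrier \<Lambda>" "y \<in> carrier \<Lambda>"
  shows "lact DL x \<theta> y = \<theta> (y \<otimes>\<^bsub>\<Lambda>\<^esub> x)" "ract DL \<theta> x y = \<theta> (x \<otimes>\<^bsub>\<Lambda>\<^esub> y)"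
  using assms by (simp_all add: DL_simps)

lemma DL_linear_form:
  assumes "\<theta> \<in> carrier DL" "y \<in> carrier \<Lambda>"
  shows "\<theta>' \<in> carrier DL \<Longrightarrow> (\<theta> \<oplus>\<^bsub>DL\<^esub> \<theta>') y = \<theta> y \<oplus>\<^bsub>k\<^esub> \<theta>' y"
    and "c \<in> carrier k \<Longrightarrow> (c \<odot>\<^bsub>DL\<^esub> \<theta>) y = c \<otimes>\<^bsub>k\<^esub> \<theta> y"
    and "\<theta> y \<in> carrier k"
  using assms by (simp_all add: DL_simps functionals_eval_simps)

lemmas DL_form = DL_act_form DL_linear_form

lemma DL_linear: "\<theta> \<in> carrier DL \<Longrightarrow> \<theta> \<in> linear_maps k \<Lambda> (scalars k)"
  by (simp add: DL_simps functionals_linear)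

lemma vec_forms:
  assumes t: "\<theta> \<in> carrier DL" and x: "x \<in> carrier \<Lambda>"
  shows rv_ract: "y \<in> carrier \<Lambda> \<Longrightarrow> rv (ract DL \<theta> y) x = rv \<theta> (y \<otimes>\<^bsub>\<Lambda>\<^esub> x)"
    and lv_lact: "y \<in> carrier \<Lambda> \<Longrightarrow> lv (lact DL y \<theta>) x = lv \<theta> (x \<otimes>\<^bsub>\<Lambda>\<^esub> y)"
    and rv_lact_i: "a \<in> carrier A \<Longrightarrow> rv (lact DL (i a) \<theta>) x = a \<otimes>\<^bsub>A\<^esub> rv \<theta> x"
    and lv_ract_i: "a \<in> carrier A \<Longrightarrow> lv (ract DL \<theta> (i a)) x = lv \<theta> x \<otimes>\<^bsub>A\<^esub> a"
    and rv_add: "\<theta>' \<in> carrier DL \<Longrightarrow> rv (\<theta> \<oplus>\<^bsub>DL\<^esub> \<theta>') x = rv \<theta> x \<oplus>\<^bsub>A\<^esub> rv \<theta>' x"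
    and lv_add: "\<theta>' \<in> carrier DL \<Longrightarrow> lv (\<theta> \<oplus>\<^bsub>DL\<^esub> \<theta>') x = lv \<theta> x \<oplus>\<^bsub>A\<^esub> lv \<theta>' x"
    and rv_smult: "c \<in> carrier k \<Longrightarrow> rv (c \<odot>\<^bsub>DL\<^esub> \<theta>) x = c \<odot>\<^bsub>A\<^esub> rv \<theta> x"
    and lv_smult: "c \<in> carrier k \<Longrightarrow> lv (c \<odot>\<^bsub>DL\<^esub> \<theta>) x = c \<odot>\<^bsub>A\<^esub> lv \<theta> x"
proof -
  show "rv (ract DL \<theta> y) x = rv \<theta> (y \<otimes>\<^bsub>\<Lambda>\<^esub> x)" if "y \<in> carrier \<Lambda>"
    by (rule rv_eqI) (simp_all add: t x that DL.ract_closed rv_closed sigma_rv DL_form i L.m_assoc)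
  show "lv (lact DL y \<theta>) x = lv \<theta> (x \<otimes>\<^bsub>\<Lambda>\<^esub> y)" if "y \<in> carrier \<Lambda>"
    by (rule lv_eqI) (simp_all add: t x that DL.lact_closed lv_closed sigma_lv DL_form i L.m_assoc)
  show "rv (lact DL (i a) \<theta>) x = a \<otimes>\<^bsub>A\<^esub> rv \<theta> x" if "a \<in> carrier A"
  proof (rule rv_eqI)
    fix b assume b: "b \<in> carrier A"
    have "\<sigma> (a \<otimes>\<^bsub>A\<^esub> rv \<theta> x \<otimes>\<^bsub>A\<^esub> b) = \<sigma> (rv \<theta> x \<otimes>\<^bsub>A\<^esub> (b \<otimes>\<^bsub>A\<^esub> a))"
      using sigma_comm[of a "rv \<theta> x \<otimes>\<^bsub>A\<^esub> b"] that b t x by (simp add: rv_closed m_assoc)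
    then show "\<sigma> (a \<otimes>\<^bsub>A\<^esub> rv \<theta> x \<otimes>\<^bsub>A\<^esub> b) = lact DL (i a) \<theta> (x \<otimes>\<^bsub>\<Lambda>\<^esub> i b)"
      using that b t x by (simp add: sigma_rv DL_form i L.m_assoc)
  qed (simp_all add: that t x rv_closed DL.lact_closed i)
  show "lv (ract DL \<theta> (i a)) x = lv \<theta> x \<otimes>\<^bsub>A\<^esub> a" if "a \<in> carrier A"
  proof (rule lv_eqI)
    fix b assume b: "b \<in> carrier A"
    have "\<sigma> (b \<otimes>\<^bsub>A\<^esub> (lv \<theta> x \<otimes>\<^bsub>A\<^esub> a)) = \<sigma> ((a \<otimes>\<^bsub>A\<^esub> b) \<otimes>\<^bsub>A\<^esub> lv \<theta> x)"
      using sigma_comm[of "b \<otimes>\<^bsub>A\<^esub> lv \<theta> x" a] that b t x by (simp add: lv_closed m_assoc)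
    then show "\<sigma> (b \<otimes>\<^bsub>A\<^esub> (lv \<theta> x \<otimes>\<^bsub>A\<^esub> a)) = ract DL \<theta> (i a) (i b \<otimes>\<^bsub>\<Lambda>\<^esub> x)"
      using that b t x by (simp add: sigma_lv DL_form i L.m_assoc)
  qed (simp_all add: that t x lv_closed DL.ract_closed i)
  show "rv (\<theta> \<oplus>\<^bsub>DL\<^esub> \<theta>') x = rv \<theta> x \<oplus>\<^bsub>A\<^esub> rv \<theta>' x" if "\<theta>' \<in> carrier DL"
    by (rule rv_eqI) (simp_all add: t x that rv_closed sigma_rv DL_form i l_distr sigma)
  show "lv (\<theta> \<oplus>\<^bsub>DL\<^esub> \<theta>') x = lv \<theta> x \<oplus>\<^bsub>A\<^esub> lv \<theta>' x" if "\<theta>' \<in> carrier DL"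
    by (rule lv_eqI) (simp_all add: t x that lv_closed sigma_lv DL_form i r_distr sigma)
  show "rv (c \<odot>\<^bsub>DL\<^esub> \<theta>) x = c \<odot>\<^bsub>A\<^esub> rv \<theta> x" if "c \<in> carrier k"
    by (rule rv_eqI) (simp_all add: t x that rv_closed sigma_rv DL_form i smult_mult_left sigma)
  show "lv (c \<odot>\<^bsub>DL\<^esub> \<theta>) x = c \<odot>\<^bsub>A\<^esub> lv \<theta> x" if "c \<in> carrier k"
    by (rule lv_eqI) (simp_all add: t x that lv_closed sigma_lv DL_form i smult_mult_right sigma)
qed

text \<open>Both sides are equal to \<open>\<sigma>(rv \<theta> x \<sqdot> lv \<phi> y)\<close>.\<close>

lemma sigma_rv_lv:
  assumes "\<theta> \<in> carrier DL" "\<phi> \<in> carrier DL" "x \<in> carrier \<Lambda>" "y \<in> carrier \<Lambda>"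
  shows "\<theta> (x \<otimes>\<^bsub>\<Lambda>\<^esub> i (lv \<phi> y)) = \<phi> (i (rv \<theta> x) \<otimes>\<^bsub>\<Lambda>\<^esub> y)"
  using sigma_rv[of \<theta> x "lv \<phi> y"] sigma_lv[of \<phi> y "rv \<theta> x"] assms rv_closed lv_closed by simp

text \<open>In \<open>G(\<theta>, x, y \<phi>) + G(\<theta> x, y, \<phi>)\<close> the terms \<open>(y \<phi>)(rv \<theta> x)\<close> and \<open>(\<theta> x)(lv \<phi> y)\<close> cancel, because they are
  equal by \<open>sigma_rv_lv\<close>.\<close>

lemma cbar_exists: "\<exists>f \<in> carrier Mho. \<forall>\<theta> \<in> carrier DL. \<forall>x \<in> carrier \<Lambda>. \<forall>\<phi> \<in> carrier DL.
    f (tri \<theta> (d x) \<phi>) = \<theta> (i (lv \<phi> x)) \<ominus>\<^bsub>k\<^esub> \<phi> (i (rv \<theta> x))"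
proof -
  note lf = linear_mapsD[OF lv_linear] and rf = linear_mapsD[OF rv_linear]
  note th = linear_mapsD[OF DL_linear, unfolded scalars_simps]
  have dist: "(a \<oplus>\<^bsub>k\<^esub> b) \<ominus>\<^bsub>k\<^esub> (c \<oplus>\<^bsub>k\<^esub> e) = (a \<ominus>\<^bsub>k\<^esub> c) \<oplus>\<^bsub>k\<^esub> (b \<ominus>\<^bsub>k\<^esub> e)"
    if "a \<in> carrier k" "b \<in> carrier k" "c \<in> carrier k" "e \<in> carrier k" for a b c e
    using that by (simp add: a_minus_def K.minus_add K.a_ac)
  have sm: "c \<otimes>\<^bsub>k\<^esub> a \<ominus>\<^bsub>k\<^esub> c \<otimes>\<^bsub>k\<^esub> b = c \<otimes>\<^bsub>k\<^esub> (a \<ominus>\<^bsub>k\<^esub> b)"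
    if "a \<in> carrier k" "b \<in> carrier k" "c \<in> carrier k" for a b c
    using that by (simp add: a_minus_def K.r_distr K.r_minus)
  show ?thesis
  proof (rule Mho_lift[of "\<lambda>\<theta> x \<phi>. \<theta> (i (lv \<phi> x)) \<ominus>\<^bsub>k\<^esub> \<phi> (i (rv \<theta> x))"], goal_cases)
    case (1 x \<phi>)
    then show ?case
      by (intro linear_mapsI) (simp_all add: DL_form i rv_closed lv_closed vec_forms th dist sm)
  next
    case (2 \<theta> \<phi>)
    then show ?case
      by (intro linear_mapsI) (simp_all add: DL_form i rv_closed lv_closed lf rf th dist sm)
  next
    case (3 \<theta> x)
    then show ?case
      by (intro linear_mapsI) (simp_all add: DL_form i rv_closed lv_closed vec_forms th dist sm)
  next
    case (4 \<theta> x y \<phi>)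
    have c: "\<theta> (i (lv \<phi> (x \<otimes>\<^bsub>\<Lambda>\<^esub> y))) \<in> carrier k" "\<phi> (i (rv \<theta> (x \<otimes>\<^bsub>\<Lambda>\<^esub> y))) \<in> carrier k"
      "\<phi> (i (rv \<theta> x) \<otimes>\<^bsub>\<Lambda>\<^esub> y) \<in> carrier k"
      using 4 by (simp_all add: DL_form i rv_closed lv_closed)
    have "lact DL y \<phi> (i (rv \<theta> x)) = \<phi> (i (rv \<theta> x) \<otimes>\<^bsub>\<Lambda>\<^esub> y)"
      "ract DL \<theta> x (i (lv \<phi> y)) = \<phi> (i (rv \<theta> x) \<otimes>\<^bsub>\<Lambda>\<^esub> y)"
      using 4 sigma_rv_lv[of \<theta> \<phi> x y] by (simp_all add: DL_form i rv_closed lv_closed)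
    then show ?case
      using 4 c by (simp add: vec_forms a_minus_def K.a_assoc K.r_neg1)
  next
    case (5 \<theta> a \<phi>)
    have l: "lv \<phi> (i a) = a \<otimes>\<^bsub>A\<^esub> lv \<phi> \<one>\<^bsub>\<Lambda>\<^esub>" using 5 lv_i[of \<phi> "\<one>\<^bsub>\<Lambda>\<^esub>" a] i by simp
    have r: "rv \<theta> (i a) = rv \<theta> \<one>\<^bsub>\<Lambda>\<^esub> \<otimes>\<^bsub>A\<^esub> a" using 5 rv_i[of \<theta> "\<one>\<^bsub>\<Lambda>\<^esub>" a] i by simp
    have "\<theta> (i (lv \<phi> (i a))) = \<sigma> (rv \<theta> \<one>\<^bsub>\<Lambda>\<^esub> \<otimes>\<^bsub>A\<^esub> (a \<otimes>\<^bsub>A\<^esub> lv \<phi> \<one>\<^bsub>\<Lambda>\<^esub>))"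
      using 5 sigma_rv[of \<theta> "\<one>\<^bsub>\<Lambda>\<^esub>"] by (simp add: l lv_closed i)
    moreover have "\<phi> (i (rv \<theta> (i a))) = \<sigma> ((rv \<theta> \<one>\<^bsub>\<Lambda>\<^esub> \<otimes>\<^bsub>A\<^esub> a) \<otimes>\<^bsub>A\<^esub> lv \<phi> \<one>\<^bsub>\<Lambda>\<^esub>)"
      using 5 sigma_lv[of \<phi> "\<one>\<^bsub>\<Lambda>\<^esub>"] by (simp add: r rv_closed i)
    ultimately show ?case
      using 5 by (simp add: m_assoc rv_closed lv_closed a_minus_def K.r_neg sigma)
  next
    case (6 f)
    then show ?case by blast
  qed
qed

abbreviation "cb \<equiv> cbar k A \<sigma> \<Lambda> i"

lemma cbar:
  shows cbar_closed: "cb \<in> carrier Mho"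
    and cbar_tri: "\<lbrakk>\<theta> \<in> carrier DL; x \<in> carrier \<Lambda>; \<phi> \<in> carrier DL\<rbrakk> \<Longrightarrow>
      cb (tri \<theta> (d x) \<phi>) = \<theta> (i (lv \<phi> x)) \<ominus>\<^bsub>k\<^esub> \<phi> (i (rv \<theta> x))"
proof -
  define P where "P f \<longleftrightarrow> f \<in> carrier Mho \<and> (\<forall>\<theta> \<in> carrier DL. \<forall>x \<in> carrier \<Lambda>. \<forall>\<phi> \<in> carrier DL.
    f (tri \<theta> (d x) \<phi>) = \<theta> (i (lv \<phi> x)) \<ominus>\<^bsub>k\<^esub> \<phi> (i (rv \<theta> x)))" for f
  obtain f where f: "P f" using cbar_exists by (auto simp: P_def)
  have "g = f" if "P g" for g
    by (rule Mho_eqI) (use f that in \<open>auto simp: P_def\<close>)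
  with f have "P (The P)" by (rule theI)
  moreover have "cb = The P" by (simp add: cbar_def P_def[abs_def] tri_def)
  ultimately have "P cb" by simp
  then show "cb \<in> carrier Mho" "\<lbrakk>\<theta> \<in> carrier DL; x \<in> carrier \<Lambda>; \<phi> \<in> carrier DL\<rbrakk> \<Longrightarrow>
      cb (tri \<theta> (d x) \<phi>) = \<theta> (i (lv \<phi> x)) \<ominus>\<^bsub>k\<^esub> \<phi> (i (rv \<theta> x))"
    by (auto simp: P_def)
qed

text \<open>Hence \<open>x \<otimes> y \<mapsto> x \<sqdot> cbar \<sqdot> y\<close> is defined on \<open>\<Lambda> \<otimes>\<^sub>A \<Lambda>\<close>.\<close>

lemma cbar_commute:
  assumes a: "a \<in> carrier A"
  shows "lact Mho (i a) cb = ract Mho cb (i a)"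
proof -
  interpret Mho: bimodule k \<Lambda> \<Lambda> Mho by (rule Mho)
  show ?thesis
  proof (rule Mho_eqI)
    fix \<theta> x \<phi> assume b: "\<theta> \<in> carrier DL" "x \<in> carrier \<Lambda>" "\<phi> \<in> carrier DL"
    have "lact Mho (i a) cb (tri \<theta> (d x) \<phi>) = cb (tri \<theta> (d x) (ract DL \<phi> (i a)))"
      by (rule Mho_act(1)) (simp_all add: a b cbar_closed d_closed i)
    moreover have "ract Mho cb (i a) (tri \<theta> (d x) \<phi>) = cb (tri (lact DL (i a) \<theta>) (d x) \<phi>)"
      by (rule Mho_act(2)) (simp_all add: a b cbar_closed d_closed i)
    ultimately show "lact Mho (i a) cb (tri \<theta> (d x) \<phi>) = ract Mho cb (i a) (tri \<theta> (d x) \<phi>)"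
      using a b by (simp add: cbar_tri DL.ract_closed DL.lact_closed i vec_forms DL_form
          rv_closed lv_closed)
  qed (simp_all add: Mho.lact_closed Mho.ract_closed cbar_closed i a)
qed

end

subsection \<open>Derivations of a tensor algebra\<close>

text \<open>The extension of \<open>L\<close> by the ideal \<open>B\<close> with \<open>B\<^sup>2 = 0\<close>.\<close>

definition triv_ext ::
  "('k, 'l, 'u) module_scheme \<Rightarrow> ('k, 'l, 'l, 'b, 'v) bimodule_scheme \<Rightarrow> ('k, 'l \<times> 'b) module"
  where "triv_ext L B = \<lparr>carrier = carrier L \<times> carrier B,
    mult = (\<lambda>(x, b) (y, c). (x \<otimes>\<^bsub>L\<^esub> y, lact B x c \<oplus>\<^bsub>B\<^esub> ract B b y)), one = (\<one>\<^bsub>L\<^esub>, \<zero>\<^bsub>B\<^esub>),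
    zero = (\<zero>\<^bsub>L\<^esub>, \<zero>\<^bsub>B\<^esub>), add = (\<lambda>(x, b) (y, c). (x \<oplus>\<^bsub>L\<^esub> y, b \<oplus>\<^bsub>B\<^esub> c)),
    smult = (\<lambda>c (x, b). (c \<odot>\<^bsub>L\<^esub> x, c \<odot>\<^bsub>B\<^esub> b))\<rparr>"

lemma triv_ext_simps:
  "carrier (triv_ext L B) = carrier L \<times> carrier B"
  "mult (triv_ext L B) (x, b) (y, c) = (x \<otimes>\<^bsub>L\<^esub> y, lact B x c \<oplus>\<^bsub>B\<^esub> ract B b y)"
  "one (triv_ext L B) = (\<one>\<^bsub>L\<^esub>, \<zero>\<^bsub>B\<^esub>)" "zero (triv_ext L B) = (\<zero>\<^bsub>L\<^esub>, \<zero>\<^bsub>B\<^esub>)"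
  "add (triv_ext L B) (x, b) (y, c) = (x \<oplus>\<^bsub>L\<^esub> y, b \<oplus>\<^bsub>B\<^esub> c)"
  "smult (triv_ext L B) e (x, b) = (e \<odot>\<^bsub>L\<^esub> x, e \<odot>\<^bsub>B\<^esub> b)"
  by (simp_all add: triv_ext_def)

lemma triv_ext_k_algebra:
  assumes "bimodule k L L B" shows "k_algebra k (triv_ext L B)"
proof -
  interpret B: bimodule k L L B by fact
  note zero = B.lact_zero B.ract_zero
  have ag: "abelian_group (triv_ext L B)"
  proof (rule abelian_groupI)
    fix z assume "z \<in> carrier (triv_ext L B)"
    then obtain x y where z: "z = (x, y)" "x \<in> carrier L" "y \<in> carrier B"
      by (auto simp: triv_ext_simps)
    then show "\<exists>w \<in> carrier (triv_ext L B). w \<oplus>\<^bsub>triv_ext L B\<^esub> z = \<zero>\<^bsub>triv_ext L B\<^esub>"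
      by (intro bexI[of _ "(\<ominus>\<^bsub>L\<^esub> x, \<ominus>\<^bsub>B\<^esub> y)"]) (auto simp: triv_ext_simps B.left.l_neg B.l_neg)
  qed (auto simp: triv_ext_simps B.left.a_ac B.a_ac)
  have mon: "Group.monoid (triv_ext L B)"
    by (rule monoidI) (auto simp: triv_ext_simps B.lact_closed B.ract_closed B.left.m_assoc
        B.lact_mult B.ract_mult B.lact_add_right B.ract_add_left B.lact_ract B.a_assoc
        B.lact_one B.ract_one zero)
  have "ring (triv_ext L B)"
    by (rule ringI[OF ag mon]) (auto simp: triv_ext_simps B.lact_closed B.ract_closed B.left.l_distr
        B.left.r_distr B.lact_add_left B.lact_add_right B.ract_add_left B.ract_add_right B.a_ac)
  moreover have "module k (triv_ext L B)"
    by (rule moduleI[OF B.left.R.cring_axioms ag]) (auto simp: triv_ext_simps B.left.smult_l_distr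
        B.left.smult_r_distr B.left.smult_assoc1 B.smult_l_distr B.smult_r_distr B.smult_assoc1)
  moreover have "k_algebra_axioms k (triv_ext L B)"
    by (rule k_algebra_axioms.intro) (auto simp: triv_ext_simps B.left.smult_mult_left
        B.left.smult_mult_right B.lact_smult_left B.lact_smult_right B.ract_smult_left
        B.ract_smult_right B.smult_r_distr B.lact_closed B.ract_closed)
  ultimately show ?thesis by (simp add: k_algebra_def)
qed

text \<open>A linear map \<open>\<delta>\<close> is a derivation iff \<open>x \<mapsto> (x, \<delta> x)\<close> is a homomorphism to the trivial extension, and
  homomorphisms out of a tensor algebra are given by their values on generators.\<close>

lemma tensor_alg_derivation:
  fixes k :: "('k, 'w) ring_scheme" and A :: "('k, 'a, 'u) module_scheme"
    and M :: "('k, 'a, 'a, 'm, 'v) bimodule_scheme"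
  defines "L \<equiv> tensor_alg k A M" and "i \<equiv> tensor_alg_in0 k A M" and "j \<equiv> tensor_alg_in1 k A M"
  assumes M: "bimodule k A A M" and B: "bimodule k L L B"
    and D: "D \<in> linear_maps k M B"
    and D_lact: "\<And>a m. \<lbrakk>a \<in> carrier A; m \<in> carrier M\<rbrakk> \<Longrightarrow> D (lact M a m) = lact B (i a) (D m)"
    and D_ract: "\<And>a m. \<lbrakk>a \<in> carrier A; m \<in> carrier M\<rbrakk> \<Longrightarrow> D (ract M m a) = ract B (D m) (i a)"
  obtains \<delta> where "\<delta> \<in> linear_maps k L B"
    and "\<And>x y. \<lbrakk>x \<in> carrier L; y \<in> carrier L\<rbrakk> \<Longrightarrow> \<delta> (x \<otimes>\<^bsub>L\<^esub> y) = lact B x (\<delta> y) \<oplus>\<^bsub>B\<^esub> ract B (\<delta> x) y"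
    and "\<And>a. a \<in> carrier A \<Longrightarrow> \<delta> (i a) = \<zero>\<^bsub>B\<^esub>" and "\<And>m. m \<in> carrier M \<Longrightarrow> \<delta> (j m) = D m"
proof -
  interpret B: bimodule k L L B by fact
  interpret M: bimodule k A A M by fact
  let ?E = "triv_ext L B"
  have E: "k_algebra k ?E" by (rule triv_ext_k_algebra[OF B])
  have i: "i \<in> alg_hom k A L" unfolding i_def L_def by (rule in0_alg_hom[OF M])
  have j: "j \<in> linear_maps k M L" unfolding j_def L_def by (rule in1_linear[OF M])
  note iD = alg_homD[OF i] and jD = linear_mapsD[OF j] and DD = linear_mapsD[OF D]
  note zero = B.lact_zero B.ract_zero
  have f0: "(\<lambda>a. (i a, \<zero>\<^bsub>B\<^esub>)) \<in> alg_hom k A ?E"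
    by (auto intro!: alg_homI linear_mapsI simp: triv_ext_simps iD zero)
  have f1: "(\<lambda>m. (j m, D m)) \<in> linear_maps k M ?E"
    by (auto intro!: linear_mapsI simp: triv_ext_simps jD DD)
  have l0: "lact B x \<zero>\<^bsub>B\<^esub> = \<zero>\<^bsub>B\<^esub>" "ract B \<zero>\<^bsub>B\<^esub> x = \<zero>\<^bsub>B\<^esub>" if "x \<in> carrier L" for x
    using zero that by auto
  have "compatible_pair k A M ?E (\<lambda>a. (i a, \<zero>\<^bsub>B\<^esub>)) (\<lambda>m. (j m, D m))"
    using f0 f1 unfolding compatible_pair_def
    by (auto simp: triv_ext_simps in1_lact[OF M, folded i_def j_def L_def]
        in1_ract[OF M, folded i_def j_def L_def] D_lact D_ract l0 iD jD DD B.lact_closed B.ract_closed)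
  from tensor_alg_lift[OF M E this] obtain F where F: "F \<in> alg_hom k L ?E"
    "\<And>a. a \<in> carrier A \<Longrightarrow> F (i a) = (i a, \<zero>\<^bsub>B\<^esub>)" "\<And>m. m \<in> carrier M \<Longrightarrow> F (j m) = (j m, D m)"
    unfolding L_def i_def j_def by blast
  note FD = alg_homD[OF F(1)]
  have Fc: "fst (F x) \<in> carrier L \<and> snd (F x) \<in> carrier B" if "x \<in> carrier L" for x
    using FD(2)[OF that] by (auto simp: triv_ext_simps)
  have Fm: "F (x \<otimes>\<^bsub>L\<^esub> y) = (fst (F x) \<otimes>\<^bsub>L\<^esub> fst (F y),
      lact B (fst (F x)) (snd (F y)) \<oplus>\<^bsub>B\<^esub> ract B (snd (F x)) (fst (F y)))"
    if "x \<in> carrier L" "y \<in> carrier L" for x y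
    using FD(5)[OF that] by (cases "F x"; cases "F y") (simp add: triv_ext_simps)
  have Fa: "F (x \<oplus>\<^bsub>L\<^esub> y) = (fst (F x) \<oplus>\<^bsub>L\<^esub> fst (F y), snd (F x) \<oplus>\<^bsub>B\<^esub> snd (F y))"
    if "x \<in> carrier L" "y \<in> carrier L" for x y
    using FD(3)[OF that] by (cases "F x"; cases "F y") (simp add: triv_ext_simps)
  have Fs: "F (c \<odot>\<^bsub>L\<^esub> x) = (c \<odot>\<^bsub>L\<^esub> fst (F x), c \<odot>\<^bsub>B\<^esub> snd (F x))"
    if "c \<in> carrier k" "x \<in> carrier L" for c x
    using FD(4)[OF that] by (cases "F x") (simp add: triv_ext_simps)
  have F1: "F \<one>\<^bsub>L\<^esub> = (\<one>\<^bsub>L\<^esub>, \<zero>\<^bsub>B\<^esub>)" using FD(6) by (simp add: triv_ext_simps)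
  have "(\<lambda>x. fst (F x)) \<in> alg_hom k L L"
    by (rule alg_homI; (rule linear_mapsI)?) (simp_all add: Fc Fm Fa Fs F1)
  then have fst: "fst (F x) = x" if "x \<in> carrier L" for x
    using tensor_alg_hom_eqI[OF M B.left.k_algebra_axioms[unfolded L_def] _ id_alg_hom, of "\<lambda>x. fst (F x)" x]
      F(2,3) that unfolding L_def i_def j_def by simp
  show thesis
  proof (rule that[of "\<lambda>x. snd (F x)"])
    show "(\<lambda>x. snd (F x)) \<in> linear_maps k L B" by (rule linear_mapsI) (simp_all add: Fc Fa Fs)
  qed (simp_all add: Fm fst F)
qed


section \<open>The bimodule for a tensor algebra\<close>

locale tensor_setup = symmetric_algebra k A \<sigma>
  for k :: "('k, 'w) ring_scheme" (structure) and A :: "('k, 'a, 'u) module_scheme" (structure) and \<sigma> +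
  fixes M :: "('k, 'a, 'a, 'm, 'v) bimodule_scheme" (structure)
  assumes M_bimodule: "bimodule k A A M"
begin

abbreviation "Lam \<equiv> tensor_alg k A M"
abbreviation "\<iota> \<equiv> tensor_alg_in0 k A M"
abbreviation "j \<equiv> tensor_alg_in1 k A M"

sublocale symm_over_algebra k A \<sigma> "tensor_alg k A M" "tensor_alg_in0 k A M"
  by (intro symm_over_algebra.intro symmetric_algebra_axioms over_algebra.intro k_algebra_axioms
      tensor_alg_k_algebra M_bimodule over_algebra_axioms.intro in0_alg_hom)

interpretation M: bimodule k A A M by (rule M_bimodule)
interpretation DL: bimodule k Lam Lam DL by (rule DL)
interpretation DOD: bimodule k Lam Lam DOD by (rule DOD)
interpretation Mho: bimodule k Lam Lam Mho by (rule Mho)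
interpretation LL: bimodule k Lam Lam LL by (rule LL)
interpretation Om: bimodule k Lam Lam Om by (rule Om)

lemmas j = linear_mapsD[OF in1_linear[OF M_bimodule]]
lemmas j_act = in1_lact[OF M_bimodule] in1_ract[OF M_bimodule]

lemma Mho_linear: "f \<in> carrier Mho \<Longrightarrow> f \<in> linear_maps k DOD (scalars k)"
  by (simp add: Mho_simps functionals_linear)

lemma Mho_tri_linear:
  assumes "f \<in> carrier Mho"
  shows "\<lbrakk>\<omega> \<in> carrier Om; \<phi> \<in> carrier DL\<rbrakk> \<Longrightarrow> (\<lambda>\<theta>. f (tri \<theta> \<omega> \<phi>)) \<in> linear_maps k DL (scalars k)"
    and "\<lbrakk>\<theta> \<in> carrier DL; \<phi> \<in> carrier DL\<rbrakk> \<Longrightarrow> (\<lambda>\<omega>. f (tri \<theta> \<omega> \<phi>)) \<in> linear_maps k Om (scalars k)"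
    and "\<lbrakk>\<theta> \<in> carrier DL; \<omega> \<in> carrier Om\<rbrakk> \<Longrightarrow> (\<lambda>\<phi>. f (tri \<theta> \<omega> \<phi>)) \<in> linear_maps k DL (scalars k)"
  by (rule linear_maps_compose[OF _ Mho_linear[OF assms]], erule (1) tri_linear)+

text \<open>\<open>A\<close> and \<open>M\<close> generate the tensor algebra, so a derivation that vanishes on \<open>A\<close> is determined by its
  values on \<open>M\<close>.\<close>

lemma Mho_eqI_generators:
  assumes f: "f \<in> carrier Mho" and g: "g \<in> carrier Mho"
    and eq: "\<And>\<theta> m \<phi>. \<lbrakk>\<theta> \<in> carrier DL; m \<in> carrier M; \<phi> \<in> carrier DL\<rbrakk> \<Longrightarrow>
      f (tri \<theta> (d (j m)) \<phi>) = g (tri \<theta> (d (j m)) \<phi>)"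
  shows "f = g"
proof (rule Mho_eqI[OF f g])
  have "\<forall>\<theta> \<in> carrier DL. \<forall>\<phi> \<in> carrier DL. f (tri \<theta> (d x) \<phi>) = g (tri \<theta> (d x) \<phi>)"
    if "x \<in> carrier Lam" for x
    using M_bimodule that
  proof (induction x rule: tensor_alg_induct[consumes 2, case_names in0 mult_in1 add smult])
    case (in0 a)
    have "h (tri \<theta> \<zero>\<^bsub>LL\<^esub> \<phi>) = \<zero>\<^bsub>k\<^esub>" if "h \<in> carrier Mho" "\<theta> \<in> carrier DL" "\<phi> \<in> carrier DL" for h \<theta> \<phi>
      using linear_maps_zero[OF Om.module_axioms module_scalars[OF K.cring_axioms]
          Mho_tri_linear(2)[OF that]] by (simp add: Om_simps)
    from this[OF f] this[OF g] show ?case by (simp add: d_scalar in0)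
  next
    case (mult_in1 x m)
    then show ?case
      using linear_mapsD[OF Mho_linear[OF f]] linear_mapsD[OF Mho_linear[OF g]] eq
      by (simp add: tri_d_mult j tri_closed DL.lact_closed DL.ract_closed)
  next
    case (add x y)
    then show ?case
      using linear_mapsD[OF Mho_tri_linear(2)[OF f]] linear_mapsD[OF Mho_tri_linear(2)[OF g]]
        linear_mapsD[OF d_linear]
      by simp
  next
    case (smult c x)
    then show ?case
      using linear_mapsD[OF Mho_tri_linear(2)[OF f]] linear_mapsD[OF Mho_tri_linear(2)[OF g]]
        linear_mapsD[OF d_linear]
      by simp
  qed
  then show "f (tri \<theta> (d x) \<phi>) = g (tri \<theta> (d x) \<phi>)"
    if "\<theta> \<in> carrier DL" "x \<in> carrier Lam" "\<phi> \<in> carrier DL" for \<theta> x \<phi>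
    using that by blast
qed

abbreviation "DM \<equiv> dual k M"

lemma DM: "bimodule k A A DM" by (rule dual_bimodule[OF M_bimodule])
interpretation DM: bimodule k A A DM by (rule DM)

lemma DM_closed: "carrier DM = functionals k M" by (simp add: dual_simps)

definition sandwich where "sandwich a m b = ract M (lact M a m) b"

lemma sandwich_closed:
  "\<lbrakk>a \<in> carrier A; m \<in> carrier M; b \<in> carrier A\<rbrakk> \<Longrightarrow> sandwich a m b \<in> carrier M"
  by (simp add: sandwich_def M.lact_closed M.ract_closed)

lemma sandwich_linear:
  shows "\<lbrakk>m \<in> carrier M; b \<in> carrier A\<rbrakk> \<Longrightarrow> (\<lambda>a. sandwich a m b) \<in> linear_maps k A M"
    and "\<lbrakk>a \<in> carrier A; b \<in> carrier A\<rbrakk> \<Longrightarrow> (\<lambda>m. sandwich a m b) \<in> linear_maps k M M"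
    and "\<lbrakk>a \<in> carrier A; m \<in> carrier M\<rbrakk> \<Longrightarrow> (\<lambda>b. sandwich a m b) \<in> linear_maps k A M"
  unfolding sandwich_def
  by (intro linear_maps_compose[OF M.lact_linear_left M.ract_linear]
      linear_maps_compose[OF M.lact_linear M.ract_linear] M.ract_linear_right M.lact_closed
      | assumption)+

lemma one_forms:
  assumes "\<theta> \<in> carrier DL" "a \<in> carrier A"
  shows "lv \<theta> (\<iota> a) = a \<otimes>\<^bsub>A\<^esub> lv \<theta> \<one>\<^bsub>Lam\<^esub>" "rv \<theta> (\<iota> a) = rv \<theta> \<one>\<^bsub>Lam\<^esub> \<otimes>\<^bsub>A\<^esub> a"
    and "lv \<theta> \<one>\<^bsub>Lam\<^esub> = rv \<theta> \<one>\<^bsub>Lam\<^esub>"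
proof -
  show "lv \<theta> (\<iota> a) = a \<otimes>\<^bsub>A\<^esub> lv \<theta> \<one>\<^bsub>Lam\<^esub>" using assms lv_i[of \<theta> "\<one>\<^bsub>Lam\<^esub>" a] i by simp
  show "rv \<theta> (\<iota> a) = rv \<theta> \<one>\<^bsub>Lam\<^esub> \<otimes>\<^bsub>A\<^esub> a" using assms rv_i[of \<theta> "\<one>\<^bsub>Lam\<^esub>" a] i by simp
  show "lv \<theta> \<one>\<^bsub>Lam\<^esub> = rv \<theta> \<one>\<^bsub>Lam\<^esub>"
  proof (rule lv_eqI)
    fix b assume "b \<in> carrier A"
    then show "\<sigma> (b \<otimes>\<^bsub>A\<^esub> rv \<theta> \<one>\<^bsub>Lam\<^esub>) = \<theta> (\<iota> b \<otimes>\<^bsub>Lam\<^esub> \<one>\<^bsub>Lam\<^esub>)"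
      using assms sigma_rv[of \<theta> "\<one>\<^bsub>Lam\<^esub>" b] sigma_comm[of b "rv \<theta> \<one>\<^bsub>Lam\<^esub>"] by (simp add: rv_closed i)
  qed (use assms in \<open>simp_all add: rv_closed\<close>)
qed

text \<open>The required values at \<open>dm\<close> depend on \<open>m\<close> through a bimodule map from \<open>M\<close> to the bilinear forms on
  \<open>D\<Lambda> \<times> D\<Lambda>\<close>, which therefore extends to a derivation of \<open>\<Lambda>\<close>. Bilinear forms are realised as linear
  forms on \<open>D\<Lambda> \<otimes>\<^sub>k D\<Lambda>\<close>. The factors stand in the order \<open>\<phi> \<otimes> \<theta>\<close>, because then the actions \<open>\<theta> \<mapsto> \<theta> x\<close> and
  \<open>\<phi> \<mapsto> x \<phi>\<close> that occur in the derivation rule are the outer actions on the tensor product.\<close>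

lemma muhat_exists:
  assumes mu: "\<mu> \<in> carrier DM"
  shows "\<exists>f \<in> carrier Mho. \<forall>\<theta> \<in> carrier DL. \<forall>m \<in> carrier M. \<forall>\<phi> \<in> carrier DL.
    f (tri \<theta> (d (j m)) \<phi>) = \<mu> (sandwich (lv \<theta> \<one>\<^bsub>Lam\<^esub>) m (rv \<phi> \<one>\<^bsub>Lam\<^esub>))"
proof -
  note K = module_scalars[OF K.cring_axioms]
  interpret S: module k "scalars k" by (rule K)
  let ?X = "forget_right DL" and ?Y = "forget_left DL"
  let ?W = "tensor k ?X (scalars k) ?Y"
  let ?B = "dual k ?W"
  let ?p = "pure_tensor k ?X (scalars k) ?Y"
  note X = forget_bimodule(1)[OF DL] and Y = forget_bimodule(2)[OF DL]
  note W = tensor_bimodule[OF X Y]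
  interpret W: bimodule k Lam Lam ?W by (rule W)
  have B: "bimodule k Lam Lam ?B" by (rule dual_bimodule[OF W])
  interpret B: bimodule k Lam Lam ?B by (rule B)
  note mul = linear_mapsD[OF functionals_linear[OF mu[unfolded DM_closed]], unfolded scalars_simps]
  note sw = linear_mapsD[OF sandwich_linear(1)] linear_mapsD[OF sandwich_linear(2)]
    linear_mapsD[OF sandwich_linear(3)]
  have ab: "lv \<theta> \<one>\<^bsub>Lam\<^esub> \<in> carrier A" "rv \<theta> \<one>\<^bsub>Lam\<^esub> \<in> carrier A" if "\<theta> \<in> carrier DL" for \<theta>
    using that by (simp_all add: lv_closed rv_closed)
  have ab_lin: "(\<lambda>\<theta>. lv \<theta> \<one>\<^bsub>Lam\<^esub>) \<in> linear_maps k DL A" "(\<lambda>\<theta>. rv \<theta> \<one>\<^bsub>Lam\<^esub>) \<in> linear_maps k DL A"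
    by (auto intro!: linear_mapsI simp: ab vec_forms)
  note abD = linear_mapsD[OF ab_lin(1)] linear_mapsD[OF ab_lin(2)]
  let ?b = "\<lambda>m \<phi> \<theta>. \<mu> (sandwich (lv \<theta> \<one>\<^bsub>Lam\<^esub>) m (rv \<phi> \<one>\<^bsub>Lam\<^esub>))"
  have bal: "?b m \<in> balanced k ?X (scalars k) ?Y (scalars k)" if m: "m \<in> carrier M" for m
    by (rule balancedI; (rule linear_mapsI)?)
      (simp_all add: m abD sw mul sandwich_closed)
  define D where "D m = (\<lambda>U \<in> carrier ?W. tensor_lift k ?X ?Y (scalars k) (?b m) U)" for m
  have Dc: "D m \<in> carrier ?B" if "m \<in> carrier M" for m
    unfolding D_def dual_simps
    by (rule restrict_functional[OF W.module_axioms tensor_lift_linear[OF X Y K bal[OF that]]])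
  have Dp: "D m (?p \<phi> \<theta>) = ?b m \<phi> \<theta>" if "m \<in> carrier M" "\<phi> \<in> carrier DL" "\<theta> \<in> carrier DL" for m \<phi> \<theta>
    using tensor_lift_pure[OF X Y K bal[OF that(1)]] that(2,3)
    by (simp add: D_def pure_tensor_closed[OF K.cring_axioms])
  have B_eqI: "f = g" if f: "f \<in> carrier ?B" and g: "g \<in> carrier ?B"
    and eq: "\<And>\<phi> \<theta>. \<lbrakk>\<phi> \<in> carrier DL; \<theta> \<in> carrier DL\<rbrakk> \<Longrightarrow> f (?p \<phi> \<theta>) = g (?p \<phi> \<theta>)" for f g
  proof (rule functionals_eqI)
    fix U assume "U \<in> carrier ?W"
    then show "f U = g U"
      by (rule linear_maps_tensor_eqI[OF X Y functionals_linear functionals_linear, rotated -1])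
        (use f g eq in \<open>simp_all add: dual_simps\<close>)
  qed (use f g in \<open>simp_all add: dual_simps\<close>)
  note pc = pure_tensor_closed[OF K.cring_axioms, of ?X "scalars k" ?Y]
  have Bev: "(f \<oplus>\<^bsub>?B\<^esub> g) (?p \<phi> \<theta>) = f (?p \<phi> \<theta>) \<oplus>\<^bsub>k\<^esub> g (?p \<phi> \<theta>)"
    "(c \<odot>\<^bsub>?B\<^esub> f) (?p \<phi> \<theta>) = c \<otimes>\<^bsub>k\<^esub> f (?p \<phi> \<theta>)" for f g c \<phi> \<theta>
    by (simp_all add: dual_simps pc)
  have Bact: "lact ?B x f (?p \<phi> \<theta>) = f (?p \<phi> (ract DL \<theta> x))"
    "ract ?B f x (?p \<phi> \<theta>) = f (?p (lact DL x \<phi>) \<theta>)"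
    if "x \<in> carrier Lam" "\<phi> \<in> carrier DL" "\<theta> \<in> carrier DL" for x f \<phi> \<theta>
    using that tensor_lact_pure[OF X Y, of x \<phi> \<theta>] tensor_ract_pure[OF X Y, of x \<phi> \<theta>]
    by (simp_all add: dual_simps pc)
  have Dl: "D \<in> linear_maps k M ?B"
  proof (rule linear_mapsI; (rule Dc)?; (rule B_eqI)?)
  qed (simp_all add: Dc Dp Bev abD sw mul sandwich_closed)
  have sandwich_act: "sandwich a (lact M b m) c = sandwich (a \<otimes>\<^bsub>A\<^esub> b) m c"
    "sandwich a (ract M m b) c = sandwich a m (b \<otimes>\<^bsub>A\<^esub> c)"
    if "a \<in> carrier A" "b \<in> carrier A" "c \<in> carrier A" "m \<in> carrier M" for a b c m
    using that by (simp_all add: sandwich_def M.lact_mult M.ract_mult M.lact_closed M.ract_closed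
        M.lact_ract[symmetric])
  have D1: "D (lact M a m) = lact ?B (\<iota> a) (D m)" if "a \<in> carrier A" "m \<in> carrier M" for a m
    by (rule B_eqI)
      (use that in \<open>simp_all add: Dc Dp Bact i M.lact_closed B.lact_closed DL.ract_closed ab
        sandwich_act vec_forms\<close>)
  have D2: "D (ract M m a) = ract ?B (D m) (\<iota> a)" if "a \<in> carrier A" "m \<in> carrier M" for a m
    by (rule B_eqI)
      (use that in \<open>simp_all add: Dc Dp Bact i M.ract_closed B.ract_closed DL.lact_closed ab
        sandwich_act vec_forms\<close>)
  obtain \<delta> where dl: "\<delta> \<in> linear_maps k Lam ?B"
    and dm: "\<And>x y. \<lbrakk>x \<in> carrier Lam; y \<in> carrier Lam\<rbrakk> \<Longrightarrow>
      \<delta> (x \<otimes>\<^bsub>Lam\<^esub> y) = lact ?B x (\<delta> y) \<oplus>\<^bsub>?B\<^esub> ract ?B (\<delta> x) y"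
    and di: "\<And>a. a \<in> carrier A \<Longrightarrow> \<delta> (\<iota> a) = \<zero>\<^bsub>?B\<^esub>" and dj: "\<And>m. m \<in> carrier M \<Longrightarrow> \<delta> (j m) = D m"
    using tensor_alg_derivation[OF M_bimodule B Dl D1 D2] by blast
  note dD = linear_mapsD[OF dl]
  have dlin: "\<delta> x \<in> linear_maps k ?W (scalars k)" if "x \<in> carrier Lam" for x
    using dD(1)[OF that] by (simp add: dual_simps functionals_linear)
  have p1: "(\<lambda>\<theta>. ?p \<phi> \<theta>) \<in> linear_maps k DL ?W" if "\<phi> \<in> carrier DL" for \<phi>
    using pure_tensor_linear_right[OF X Y, of \<phi>] that by (simp add: linear_maps_def)
  have p2: "(\<lambda>\<phi>. ?p \<phi> \<theta>) \<in> linear_maps k DL ?W" if "\<theta> \<in> carrier DL" for \<theta>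
    using pure_tensor_linear_left[OF X Y, of \<theta>] that by (simp add: linear_maps_def)
  obtain f where f: "f \<in> carrier Mho"
    "\<And>\<theta> x \<phi>. \<lbrakk>\<theta> \<in> carrier DL; x \<in> carrier Lam; \<phi> \<in> carrier DL\<rbrakk> \<Longrightarrow> f (tri \<theta> (d x) \<phi>) = \<delta> x (?p \<phi> \<theta>)"
  proof (rule Mho_lift[of "\<lambda>\<theta> x \<phi>. \<delta> x (?p \<phi> \<theta>)"], goal_cases)
    case (1 x \<phi>)
    show ?case by (rule linear_maps_compose[OF p1[OF 1(3)] dlin[OF 1(2)]])
  next
    case (2 \<theta> \<phi>)
    show ?case
      by (rule linear_mapsI)
        (simp_all add: dD Bev linear_maps_closed[OF dlin, unfolded scalars_simps] pc)
  next
    case (3 \<theta> x)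
    show ?case by (rule linear_maps_compose[OF p2[OF 3(2)] dlin[OF 3(3)]])
  next
    case (4 \<theta> x y \<phi>)
    have "\<delta> y (?p \<phi> (ract DL \<theta> x)) \<in> carrier k" "\<delta> x (?p (lact DL y \<phi>) \<theta>) \<in> carrier k"
      using 4 linear_maps_closed[OF dlin, unfolded scalars_simps] pc by auto
    then show ?case using 4 by (simp add: dm Bev Bact K.a_comm)
  next
    case (5 \<theta> a \<phi>)
    then show ?case by (simp add: di dual_simps pc)
  next
    case (6 f)
    then show ?case by blast
  qed
  then show ?thesis by (intro bexI[of _ f]) (simp_all add: j dj Dp)
qed

definition muhat where
  "muhat \<mu> = (SOME f. f \<in> carrier Mho \<and> (\<forall>\<theta> \<in> carrier DL. \<forall>m \<in> carrier M. \<forall>\<phi> \<in> carrier DL.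
    f (tri \<theta> (d (j m)) \<phi>) = \<mu> (sandwich (lv \<theta> \<one>\<^bsub>Lam\<^esub>) m (rv \<phi> \<one>\<^bsub>Lam\<^esub>))))"

lemma muhat:
  assumes "\<mu> \<in> carrier DM"
  shows muhat_closed: "muhat \<mu> \<in> carrier Mho"
    and muhat_tri: "\<lbrakk>\<theta> \<in> carrier DL; m \<in> carrier M; \<phi> \<in> carrier DL\<rbrakk> \<Longrightarrow>
      muhat \<mu> (tri \<theta> (d (j m)) \<phi>) = \<mu> (sandwich (lv \<theta> \<one>\<^bsub>Lam\<^esub>) m (rv \<phi> \<one>\<^bsub>Lam\<^esub>))"
proof -
  have ex: "\<exists>f. f \<in> carrier Mho \<and> (\<forall>\<theta> \<in> carrier DL. \<forall>m \<in> carrier M. \<forall>\<phi> \<in> carrier DL.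
    f (tri \<theta> (d (j m)) \<phi>) = \<mu> (sandwich (lv \<theta> \<one>\<^bsub>Lam\<^esub>) m (rv \<phi> \<one>\<^bsub>Lam\<^esub>)))"
    using muhat_exists[OF assms] by blast
  show "muhat \<mu> \<in> carrier Mho" "\<lbrakk>\<theta> \<in> carrier DL; m \<in> carrier M; \<phi> \<in> carrier DL\<rbrakk> \<Longrightarrow>
      muhat \<mu> (tri \<theta> (d (j m)) \<phi>) = \<mu> (sandwich (lv \<theta> \<one>\<^bsub>Lam\<^esub>) m (rv \<phi> \<one>\<^bsub>Lam\<^esub>))"
    using someI_ex[OF ex] unfolding muhat_def by blast+
qed

lemma muhat_act:
  assumes mu: "\<mu> \<in> carrier DM" and x: "x \<in> carrier Lam" and y: "y \<in> carrier Lam"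
    and t: "\<theta> \<in> carrier DL" and m: "m \<in> carrier M" and p: "\<phi> \<in> carrier DL"
  shows "ract Mho (lact Mho x (muhat \<mu>)) y (tri \<theta> (d (j m)) \<phi>) = \<mu> (sandwich (lv \<theta> y) m (rv \<phi> x))"
  using assms
  by (simp add: Mho_act Mho.lact_closed Mho.ract_closed muhat_closed d_closed j DL.lact_closed
      DL.ract_closed muhat_tri vec_forms)

end

subsection \<open>Dual bases of bimodules\<close>

lemma dual_eval_linear:
  assumes "v \<in> carrier X" shows "(\<lambda>f. f v) \<in> linear_maps k (dual k X) (scalars k)"
  using assms by (intro linear_mapsI) (auto simp: dual_simps functionals_eval_simps)

lemma dual_finsum_eval:
  assumes X: "module k X" and "finite I" "g \<in> I \<rightarrow> functionals k X" "v \<in> carrier X"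
  shows "(\<Oplus>\<^bsub>dual k X\<^esub>p \<in> I. g p) v = (\<Oplus>\<^bsub>k\<^esub>p \<in> I. g p v)"
proof -
  interpret X: module k X by fact
  have "(\<Oplus>\<^bsub>dual k X\<^esub>p \<in> I. g p) v = (\<Oplus>\<^bsub>scalars k\<^esub>p \<in> I. g p v)"
    by (rule linear_maps_finsum[OF dual_module[OF X] module_scalars[OF X.R.cring_axioms]
          dual_eval_linear[OF assms(4)] assms(2)])
      (use assms(3) in \<open>simp add: dual_simps\<close>)
  then show ?thesis by (simp add: finsum_cong_struct[of "scalars k" k])
qed

context symmetric_algebra
begin

definition right_dual_basis where
  "right_dual_basis X n x \<xi> \<longleftrightarrow> (\<forall>p < (n::nat). x p \<in> carrier X \<and> \<xi> p \<in> functionals k X) \<and>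
    (\<forall>v \<in> carrier X. v = (\<Oplus>\<^bsub>X\<^esub>p \<in> {..<n}. ract X (x p) (rvec A \<sigma> X (\<xi> p) v)))"

definition left_dual_basis where
  "left_dual_basis X n x \<xi> \<longleftrightarrow> (\<forall>p < (n::nat). x p \<in> carrier X \<and> \<xi> p \<in> functionals k X) \<and>
    (\<forall>v \<in> carrier X. v = (\<Oplus>\<^bsub>X\<^esub>p \<in> {..<n}. lact X (lvec A \<sigma> X (\<xi> p) v) (x p)))"

lemma right_module_symm_bimodule:
  assumes "bimodule k R A X" shows "right_module_symm k A \<sigma> X (ract X)"
  by (intro right_module_symm.intro symmetric_algebra_axioms bimodule_right_module[OF assms])

lemma left_module_symm_bimodule:
  assumes "bimodule k A S X" shows "right_module_symm k (opp A) \<sigma> X (\<lambda>x a. lact X a x)"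
  by (intro right_module_symm.intro symmetric_algebra_opp symmetric_algebra_axioms
      bimodule_left_module[OF assms])

lemma dual_basis_iff:
  assumes "bimodule k A A X"
  shows "right_dual_basis X n x \<xi> \<longleftrightarrow> right_module_symm.dual_basis k A \<sigma> X (ract X) n x \<xi>"
    and "left_dual_basis X n x \<xi> \<longleftrightarrow>
      right_module_symm.dual_basis k (opp A) \<sigma> X (\<lambda>x a. lact X a x) n x \<xi>"
  by (simp_all add: right_dual_basis_def left_dual_basis_def rvec_vec lvec_vec
      right_module_symm.dual_basis_def[OF right_module_symm_bimodule[OF assms]]
      right_module_symm.dual_basis_def[OF left_module_symm_bimodule[OF assms]])

lemma bimodule_dual_bases:
  assumes X: "bimodule k A A X" and "fin_dim k X" and ss: "semisimple_ring A"
  shows "\<exists>n x \<xi>. right_dual_basis X n x \<xi>" and "\<exists>n x \<xi>. left_dual_basis X n x \<xi>"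
proof -
  have "add_monoid (opp A) = add_monoid A" by simp
  then have r: "right_ideal I (opp A) \<longleftrightarrow> left_ideal I A" for I
    by (simp add: right_ideal_def left_ideal_def additive_subgroup_def)
  have s: "I <+>\<^bsub>opp A\<^esub> J = I <+>\<^bsub>A\<^esub> J" for I J by (simp add: set_add_def')
  show "\<exists>n x \<xi>. right_dual_basis X n x \<xi>" unfolding dual_basis_iff[OF X]
    by (rule right_module_symm.dual_basis_exists[OF right_module_symm_bimodule[OF X] _ assms(2)])
      (use ss in \<open>simp add: semisimple_ring_def\<close>)
  show "\<exists>n x \<xi>. left_dual_basis X n x \<xi>" unfolding dual_basis_iff[OF X]
    by (rule right_module_symm.dual_basis_exists[OF left_module_symm_bimodule[OF X] _ assms(2)])
      (use ss in \<open>simp add: semisimple_ring_def r s\<close>)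
qed

lemma dual_basis_form_bimodule:
  assumes X: "bimodule k A A X" and phi: "\<phi> \<in> functionals k X" and v: "v \<in> carrier X"
  shows "right_dual_basis X n x \<xi> \<Longrightarrow>
      \<phi> v = (\<Oplus>\<^bsub>k\<^esub>p \<in> {..<n}. \<xi> p (ract X v (rvec A \<sigma> X \<phi> (x p))))"
    and "left_dual_basis X n x \<xi> \<Longrightarrow>
      \<phi> v = (\<Oplus>\<^bsub>k\<^esub>p \<in> {..<n}. \<xi> p (lact X (lvec A \<sigma> X \<phi> (x p)) v))"
  using right_module_symm.dual_basis_form[OF right_module_symm_bimodule[OF X] _ phi v]
    right_module_symm.dual_basis_form[OF left_module_symm_bimodule[OF X] _ phi v]
  by (simp_all add: dual_basis_iff[OF X] rvec_vec lvec_vec)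

lemma dual_basis_expand:
  assumes X: "bimodule k A A X" and phi: "\<phi> \<in> functionals k X"
  shows "right_dual_basis X n x \<xi> \<Longrightarrow>
      \<phi> = (\<Oplus>\<^bsub>dual k X\<^esub>p \<in> {..<n}. lact (dual k X) (rvec A \<sigma> X \<phi> (x p)) (\<xi> p))"
    and "left_dual_basis X n x \<xi> \<Longrightarrow>
      \<phi> = (\<Oplus>\<^bsub>dual k X\<^esub>p \<in> {..<n}. ract (dual k X) (\<xi> p) (lvec A \<sigma> X \<phi> (x p)))"
proof -
  interpret X: bimodule k A A X by fact
  note D = dual_module[OF X.module_axioms] dual_simps(1) dual_eval_linear
  show "\<phi> = (\<Oplus>\<^bsub>dual k X\<^esub>p \<in> {..<n}. lact (dual k X) (rvec A \<sigma> X \<phi> (x p)) (\<xi> p))"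
    if "right_dual_basis X n x \<xi>"
    using right_module_symm.dual_basis_expand[OF right_module_symm_bimodule[OF X]
        that[unfolded dual_basis_iff[OF X]] phi D]
    by (simp add: right_module_symm.form_act_def[OF right_module_symm_bimodule[OF X]] rvec_vec
        dual_simps(5))
  show "\<phi> = (\<Oplus>\<^bsub>dual k X\<^esub>p \<in> {..<n}. ract (dual k X) (\<xi> p) (lvec A \<sigma> X \<phi> (x p)))"
    if "left_dual_basis X n x \<xi>"
    using right_module_symm.dual_basis_expand[OF left_module_symm_bimodule[OF X]
        that[unfolded dual_basis_iff[OF X]] phi D]
    by (simp add: right_module_symm.form_act_def[OF left_module_symm_bimodule[OF X]] lvec_vec
        dual_simps(6))
qed

lemma rho_unique:
  assumes X: "bimodule k A A X" and b: "right_dual_basis X n x \<xi>" "right_dual_basis X n' x' \<xi>'"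
  defines "T \<equiv> tensor k X A (dual k X)"
  shows "(\<Oplus>\<^bsub>T\<^esub>p \<in> {..<n}. pure_tensor k X A (dual k X) (x p) (\<xi> p)) =
    (\<Oplus>\<^bsub>T\<^esub>q \<in> {..<n'}. pure_tensor k X A (dual k X) (x' q) (\<xi>' q))"
proof -
  have D: "bimodule k A A (dual k X)" by (rule dual_bimodule[OF X])
  interpret X: bimodule k A A X by fact
  note symm = right_module_symm_bimodule[OF X]
  show ?thesis
  proof (rule right_module_symm.dual_basis_sum_unique[OF symm b[unfolded dual_basis_iff[OF X]]
        dual_module[OF X.module_axioms] dual_simps(1) dual_eval_linear])
    show "module k T" unfolding T_def by (rule tensor_module[OF K.cring_axioms])
  qed (simp_all add: T_def pure_tensor_linear_left[OF X D] pure_tensor_linear_right[OF X D]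
      pure_tensor_rules(5)[OF X D] right_module_symm.form_act_def[OF symm] dual_simps(1,5)
      restrict_def)
qed

lemma ell_unique:
  assumes X: "bimodule k A A X" and b: "left_dual_basis X n x \<xi>" "left_dual_basis X n' x' \<xi>'"
  defines "T \<equiv> tensor k (dual k X) A X"
  shows "(\<Oplus>\<^bsub>T\<^esub>p \<in> {..<n}. pure_tensor k (dual k X) A X (\<xi> p) (x p)) =
    (\<Oplus>\<^bsub>T\<^esub>q \<in> {..<n'}. pure_tensor k (dual k X) A X (\<xi>' q) (x' q))"
proof -
  have D: "bimodule k A A (dual k X)" by (rule dual_bimodule[OF X])
  interpret X: bimodule k A A X by fact
  note symm = left_module_symm_bimodule[OF X]
  show ?thesis
  proof (rule right_module_symm.dual_basis_sum_unique[OF symm b[unfolded dual_basis_iff[OF X]]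
        dual_module[OF X.module_axioms] dual_simps(1) dual_eval_linear])
    show "module k T" unfolding T_def by (rule tensor_module[OF K.cring_axioms])
  qed (simp_all add: T_def pure_tensor_linear_left[OF D X] pure_tensor_linear_right[OF D X]
      pure_tensor_rules(5)[OF D X, symmetric] right_module_symm.form_act_def[OF symm] dual_simps(1,6)
      restrict_def)
qed

lemma rho_eq:
  assumes X: "bimodule k A A X" and b: "right_dual_basis X n x \<xi>"
  shows "rho k A \<sigma> X = (\<Oplus>\<^bsub>tensor k X A (dual k X)\<^esub>p \<in> {..<n}. pure_tensor k X A (dual k X) (x p) (\<xi> p))"
proof -
  have "rho k A \<sigma> X = (THE t. \<exists>n x \<xi>. right_dual_basis X n x \<xi> \<and>
      t = (\<Oplus>\<^bsub>tensor k X A (dual k X)\<^esub>p \<in> {..<n}. pure_tensor k X A (dual k X) (x p) (\<xi> p)))"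
    unfolding rho_def right_dual_basis_def dual_simps(1) by (simp only: conj_assoc)
  also have "\<dots> = (\<Oplus>\<^bsub>tensor k X A (dual k X)\<^esub>p \<in> {..<n}. pure_tensor k X A (dual k X) (x p) (\<xi> p))"
    using b rho_unique[OF X] by (intro the_equality) blast+
  finally show ?thesis .
qed

lemma ell_eq:
  assumes X: "bimodule k A A X" and b: "left_dual_basis X n x \<xi>"
  shows "ell k A \<sigma> X = (\<Oplus>\<^bsub>tensor k (dual k X) A X\<^esub>p \<in> {..<n}. pure_tensor k (dual k X) A X (\<xi> p) (x p))"
proof -
  have "ell k A \<sigma> X = (THE t. \<exists>n \<xi> x. left_dual_basis X n x \<xi> \<and>
      t = (\<Oplus>\<^bsub>tensor k (dual k X) A X\<^esub>p \<in> {..<n}. pure_tensor k (dual k X) A X (\<xi> p) (x p)))"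
    unfolding ell_def left_dual_basis_def dual_simps(1) 
    by (simp only: conj_assoc conj_commute[of "_ \<in> carrier X" "_ \<in> functionals k X"])
  also have "\<dots> = (\<Oplus>\<^bsub>tensor k (dual k X) A X\<^esub>p \<in> {..<n}. pure_tensor k (dual k X) A X (\<xi> p) (x p))"
    using b ell_unique[OF X] by (intro the_equality) blast+
  finally show ?thesis .
qed

end


subsection \<open>The canonical element in terms of dual bases\<close>

context tensor_setup
begin

interpretation M: bimodule k A A M by (rule M_bimodule)
interpretation DM: bimodule k A A DM by (rule DM)
interpretation DL: bimodule k Lam Lam DL by (rule DL)
interpretation Mho: bimodule k Lam Lam Mho by (rule Mho)
interpretation Om: bimodule k Lam Lam Om by (rule Om)
interpretation DOD: bimodule k Lam Lam DOD by (rule DOD)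

lemma muhat_linear: "muhat \<in> linear_maps k DM Mho"
  by (rule linear_mapsI; (rule Mho_eqI_generators)?)
    (simp_all add: muhat_closed muhat_tri Mho_add dual_simps(2-4)[of k M] DM.a_closed[unfolded dual_simps]
      DM.smult_closed[unfolded dual_simps] dual_simps(1)[of k M] lv_closed rv_closed sandwich_closed)

lemma muhat_bimodule:
  assumes mu: "\<mu> \<in> carrier DM" and a: "a \<in> carrier A"
  shows "muhat (lact DM a \<mu>) = lact Mho (\<iota> a) (muhat \<mu>)"
    and "muhat (ract DM \<mu> a) = ract Mho (muhat \<mu>) (\<iota> a)"
proof -
  have ia: "\<iota> a \<in> carrier Lam" using a by (rule i)
  show "muhat (lact DM a \<mu>) = lact Mho (\<iota> a) (muhat \<mu>)"
  proof (rule Mho_eqI_generators)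
    fix \<theta> m \<phi> assume b: "\<theta> \<in> carrier DL" "m \<in> carrier M" "\<phi> \<in> carrier DL"
    have "lact Mho (\<iota> a) (muhat \<mu>) (tri \<theta> (d (j m)) \<phi>) = \<mu> (sandwich (lv \<theta> \<one>\<^bsub>Lam\<^esub>) m (rv \<phi> (\<iota> a)))"
      using muhat_act[OF mu ia L.one_closed b] by (simp add: Mho.ract_one Mho.lact_closed muhat_closed mu ia)
    then show "muhat (lact DM a \<mu>) (tri \<theta> (d (j m)) \<phi>) = lact Mho (\<iota> a) (muhat \<mu>) (tri \<theta> (d (j m)) \<phi>)"
      using a b by (simp add: muhat_tri DM.lact_closed mu one_forms(2))
        (simp add: dual_simps sandwich_closed lv_closed rv_closed,
          simp add: sandwich_def M.ract_mult M.lact_closed lv_closed rv_closed)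
  qed (simp_all add: muhat_closed DM.lact_closed Mho.lact_closed mu a ia)
  show "muhat (ract DM \<mu> a) = ract Mho (muhat \<mu>) (\<iota> a)"
  proof (rule Mho_eqI_generators)
    fix \<theta> m \<phi> assume b: "\<theta> \<in> carrier DL" "m \<in> carrier M" "\<phi> \<in> carrier DL"
    have "ract Mho (muhat \<mu>) (\<iota> a) (tri \<theta> (d (j m)) \<phi>) = \<mu> (sandwich (lv \<theta> (\<iota> a)) m (rv \<phi> \<one>\<^bsub>Lam\<^esub>))"
      using muhat_act[OF mu L.one_closed ia b] by (simp add: Mho.lact_one muhat_closed mu)
    then show "muhat (ract DM \<mu> a) (tri \<theta> (d (j m)) \<phi>) = ract Mho (muhat \<mu>) (\<iota> a) (tri \<theta> (d (j m)) \<phi>)"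
      using a b by (simp add: muhat_tri DM.ract_closed mu one_forms(1))
        (simp add: dual_simps sandwich_closed lv_closed rv_closed,
          simp add: sandwich_def M.lact_mult M.lact_ract M.ract_closed M.lact_closed lv_closed rv_closed)
  qed (simp_all add: muhat_closed DM.ract_closed Mho.ract_closed mu a ia)
qed

lemma Mho_eval_linear: "U \<in> carrier DOD \<Longrightarrow> (\<lambda>f. f U) \<in> linear_maps k Mho (scalars k)"
  unfolding mho_def by (rule dual_eval_linear)

lemma Mho_finsum_eval:
  assumes "finite I" "g \<in> I \<rightarrow> carrier Mho" "U \<in> carrier DOD"
  shows "(\<Oplus>\<^bsub>Mho\<^esub>p \<in> I. g p) U = (\<Oplus>\<^bsub>k\<^esub>p \<in> I. g p U)"
  using dual_finsum_eval[OF DOD.module_axioms assms(1) _ assms(3), of g] assms(2)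
  by (simp add: mho_def dual_simps)

definition on_M where "on_M \<phi> = (\<lambda>m \<in> carrier M. \<phi> (j m))"

lemma on_M: "\<phi> \<in> carrier DL \<Longrightarrow> on_M \<phi> \<in> functionals k M"
  unfolding on_M_def
  by (rule restrict_functional[OF M.module_axioms
        linear_maps_compose[OF in1_linear[OF M_bimodule] DL_linear]])

lemma vec_on_M:
  assumes p: "\<phi> \<in> carrier DL" and m: "m \<in> carrier M"
  shows "rvec A \<sigma> M (on_M \<phi>) m = rv \<phi> (j m)" and "lvec A \<sigma> M (on_M \<phi>) m = lv \<phi> (j m)"
proof -
  show "rvec A \<sigma> M (on_M \<phi>) m = rv \<phi> (j m)"
    unfolding rvec_vec[of A \<sigma> M]
    by (rule right_module_symm.vec_eqI[OF right_module_symm_bimodule[OF M_bimodule] on_M[OF p] m])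
      (use p m in \<open>simp_all add: rv_closed j sigma_rv on_M_def M.ract_closed j_act\<close>)
  show "lvec A \<sigma> M (on_M \<phi>) m = lv \<phi> (j m)"
    unfolding lvec_vec[of A \<sigma> M]
    by (rule right_module_symm.vec_eqI[OF left_module_symm_bimodule[OF M_bimodule] on_M[OF p] m])
      (use p m in \<open>simp_all add: lv_closed j sigma_lv on_M_def M.lact_closed j_act\<close>)
qed

text \<open>At \<open>\<theta> \<otimes> dm \<otimes> \<phi>\<close> the two sums are expansions, in dual bases of \<open>M\<close>, of the restrictions of \<open>\<phi>\<close> and \<open>\<theta>\<close>
  to \<open>M\<close>, evaluated at \<open>lv \<theta> 1 \<sqdot> m\<close> and at \<open>m \<sqdot> rv \<phi> 1\<close>. By \<open>sigma_rv_lv\<close> these values are the two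
  terms that define \<^const>\<open>cbar\<close>.\<close>

lemma cbar_dual_bases:
  assumes r: "right_dual_basis M n x \<xi>" and l: "left_dual_basis M n' x' \<xi>'"
  shows "cb = (\<Oplus>\<^bsub>Mho\<^esub>p \<in> {..<n}. lact Mho (j (x p)) (muhat (\<xi> p))) \<ominus>\<^bsub>Mho\<^esub>
    (\<Oplus>\<^bsub>Mho\<^esub>q \<in> {..<n'}. ract Mho (muhat (\<xi>' q)) (j (x' q)))" (is "_ = ?R \<ominus>\<^bsub>Mho\<^esub> ?L")
proof -
  have x: "\<And>p. p < n \<Longrightarrow> x p \<in> carrier M" "\<And>p. p < n \<Longrightarrow> \<xi> p \<in> carrier DM"
    "\<And>q. q < n' \<Longrightarrow> x' q \<in> carrier M" "\<And>q. q < n' \<Longrightarrow> \<xi>' q \<in> carrier DM"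
    using r l by (auto simp: right_dual_basis_def left_dual_basis_def dual_simps)
  have Rc: "(\<lambda>p. lact Mho (j (x p)) (muhat (\<xi> p))) \<in> {..<n} \<rightarrow> carrier Mho"
    and Lc: "(\<lambda>q. ract Mho (muhat (\<xi>' q)) (j (x' q))) \<in> {..<n'} \<rightarrow> carrier Mho"
    using x by (auto simp: Mho.lact_closed Mho.ract_closed muhat_closed j)
  have c: "?R \<in> carrier Mho" "?L \<in> carrier Mho" using Rc Lc by simp_all
  show ?thesis
  proof (rule Mho_eqI_generators)
    fix \<theta> m \<phi> assume b: "\<theta> \<in> carrier DL" "m \<in> carrier M" "\<phi> \<in> carrier DL"
    let ?U = "tri \<theta> (d (j m)) \<phi>"
    have ab: "lv \<theta> \<one>\<^bsub>Lam\<^esub> \<in> carrier A" "rv \<phi> \<one>\<^bsub>Lam\<^esub> \<in> carrier A" using b by (simp_all add: lv_closed rv_closed)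
    have "?R ?U = (\<Oplus>\<^bsub>k\<^esub>p \<in> {..<n}. lact Mho (j (x p)) (muhat (\<xi> p)) ?U)"
      by (rule Mho_finsum_eval[OF _ Rc tri_closed]) simp
    also have "\<dots> = (\<Oplus>\<^bsub>k\<^esub>p \<in> {..<n}. \<xi> p (ract M (lact M (lv \<theta> \<one>\<^bsub>Lam\<^esub>) m) (rvec A \<sigma> M (on_M \<phi>) (x p))))"
    proof (rule K.finsum_cong'[OF refl])
      fix p assume "p \<in> {..<n}"
      then have p: "p < n" by simp
      show "lact Mho (j (x p)) (muhat (\<xi> p)) ?U =
          \<xi> p (ract M (lact M (lv \<theta> \<one>\<^bsub>Lam\<^esub>) m) (rvec A \<sigma> M (on_M \<phi>) (x p)))"
        using muhat_act[OF x(2)[OF p] j(1)[OF x(1)[OF p]] L.one_closed b] x p b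
        by (simp add: Mho.ract_one Mho.lact_closed muhat_closed j vec_on_M sandwich_def)
    qed (use x(1) b ab in \<open>auto intro!: functionals_eval_simps(1)[OF x(2)[unfolded DM_closed]]
        simp: vec_on_M rv_closed j M.lact_closed M.ract_closed\<close>)
    also have "\<dots> = on_M \<phi> (lact M (lv \<theta> \<one>\<^bsub>Lam\<^esub>) m)"
      using dual_basis_form_bimodule(1)[OF M_bimodule on_M[OF b(3)] _ r] b ab
      by (simp add: M.lact_closed)
    also have "\<dots> = \<phi> (\<iota> (rv \<theta> \<one>\<^bsub>Lam\<^esub>) \<otimes>\<^bsub>Lam\<^esub> j m)"
      using b ab by (simp add: on_M_def M.lact_closed j_act one_forms(3))
    also have "\<dots> = \<theta> (\<iota> (lv \<phi> (j m)))"
      using sigma_rv_lv[OF b(1,3) L.one_closed j(1)[OF b(2)]] b by (simp add: i lv_closed j)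
    finally have R: "?R ?U = \<theta> (\<iota> (lv \<phi> (j m)))" .
    have "?L ?U = (\<Oplus>\<^bsub>k\<^esub>q \<in> {..<n'}. ract Mho (muhat (\<xi>' q)) (j (x' q)) ?U)"
      by (rule Mho_finsum_eval[OF _ Lc tri_closed]) simp
    also have "\<dots> = (\<Oplus>\<^bsub>k\<^esub>q \<in> {..<n'}. \<xi>' q (lact M (lvec A \<sigma> M (on_M \<theta>) (x' q)) (ract M m (rv \<phi> \<one>\<^bsub>Lam\<^esub>))))"
    proof (rule K.finsum_cong'[OF refl])
      fix q assume "q \<in> {..<n'}"
      then have q: "q < n'" by simp
      show "ract Mho (muhat (\<xi>' q)) (j (x' q)) ?U =
          \<xi>' q (lact M (lvec A \<sigma> M (on_M \<theta>) (x' q)) (ract M m (rv \<phi> \<one>\<^bsub>Lam\<^esub>)))"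
        using muhat_act[OF x(4)[OF q] L.one_closed j(1)[OF x(3)[OF q]] b] x q b ab
        by (simp add: Mho.lact_one muhat_closed j vec_on_M sandwich_def M.lact_ract lv_closed)
    qed (use x(3) b ab in \<open>auto intro!: functionals_eval_simps(1)[OF x(4)[unfolded DM_closed]]
        simp: vec_on_M lv_closed j M.lact_closed M.ract_closed\<close>)
    also have "\<dots> = on_M \<theta> (ract M m (rv \<phi> \<one>\<^bsub>Lam\<^esub>))"
      using dual_basis_form_bimodule(2)[OF M_bimodule on_M[OF b(1)] _ l] b ab
      by (simp add: M.ract_closed)
    also have "\<dots> = \<theta> (j m \<otimes>\<^bsub>Lam\<^esub> \<iota> (lv \<phi> \<one>\<^bsub>Lam\<^esub>))"
      using b ab by (simp add: on_M_def M.ract_closed j_act one_forms(3))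
    also have "\<dots> = \<phi> (\<iota> (rv \<theta> (j m)))"
      using sigma_rv_lv[OF b(1,3) j(1)[OF b(2)] L.one_closed] b by (simp add: i rv_closed j)
    finally have L: "?L ?U = \<phi> (\<iota> (rv \<theta> (j m)))" .
    show "cb ?U = (?R \<ominus>\<^bsub>Mho\<^esub> ?L) ?U"
      using linear_maps_diff[OF Mho.module_axioms module_scalars[OF K.cring_axioms]
          Mho_eval_linear[OF tri_closed] c]
      by (simp add: R L cbar_tri b j)
  qed (simp_all add: cbar_closed c)
qed

end

section \<open>The isomorphism\<close>

lemma linear_maps_sum:
  assumes Y: "module k Y" and fin: "finite I" and g: "\<And>p. p \<in> I \<Longrightarrow> g p \<in> linear_maps k X Y"
  shows "(\<lambda>z. \<Oplus>\<^bsub>Y\<^esub>p \<in> I. g p z) \<in> linear_maps k X Y"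
proof -
  interpret Y: module k Y by fact
  note gD = linear_mapsD[OF g]
  show ?thesis
  proof (rule linear_mapsI)
    fix z z' assume z: "z \<in> carrier X" "z' \<in> carrier X"
    have "(\<Oplus>\<^bsub>Y\<^esub>p \<in> I. g p (z \<oplus>\<^bsub>X\<^esub> z')) = (\<Oplus>\<^bsub>Y\<^esub>p \<in> I. g p z \<oplus>\<^bsub>Y\<^esub> g p z')"
      using z gD by (intro Y.M.finsum_cong') auto
    then show "(\<Oplus>\<^bsub>Y\<^esub>p \<in> I. g p (z \<oplus>\<^bsub>X\<^esub> z')) = (\<Oplus>\<^bsub>Y\<^esub>p \<in> I. g p z) \<oplus>\<^bsub>Y\<^esub> (\<Oplus>\<^bsub>Y\<^esub>p \<in> I. g p z')"
      using z gD Y.M.finsum_addf[of "\<lambda>p. g p z" I "\<lambda>p. g p z'"] by (simp add: Pi_def)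
  next
    fix c z assume c: "c \<in> carrier k" and z: "z \<in> carrier X"
    have "(\<Oplus>\<^bsub>Y\<^esub>p \<in> I. g p (c \<odot>\<^bsub>X\<^esub> z)) = (\<Oplus>\<^bsub>Y\<^esub>p \<in> I. c \<odot>\<^bsub>Y\<^esub> g p z)"
      using c z gD by (intro Y.M.finsum_cong') auto
    then show "(\<Oplus>\<^bsub>Y\<^esub>p \<in> I. g p (c \<odot>\<^bsub>X\<^esub> z)) = c \<odot>\<^bsub>Y\<^esub> (\<Oplus>\<^bsub>Y\<^esub>p \<in> I. g p z)"
      using c z gD fin Y.finsum_smult_ldistr[of I c "\<lambda>p. g p z"] by (simp add: Pi_def)
  qed (use gD in \<open>auto intro!: Y.M.finsum_closed\<close>)
qed

lemma linear_maps_double_sum: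
  assumes X: "module k X" and Y: "module k Y" and f: "f \<in> linear_maps k X Y"
    and fin: "finite I" "finite J" and g: "\<And>p q. \<lbrakk>p \<in> I; q \<in> J\<rbrakk> \<Longrightarrow> g p q \<in> carrier X"
  shows "f (\<Oplus>\<^bsub>X\<^esub>p \<in> I. \<Oplus>\<^bsub>X\<^esub>q \<in> J. g p q) = (\<Oplus>\<^bsub>Y\<^esub>p \<in> I. \<Oplus>\<^bsub>Y\<^esub>q \<in> J. f (g p q))"
proof -
  interpret X: module k X by fact
  interpret Y: module k Y by fact
  have "f (\<Oplus>\<^bsub>X\<^esub>p \<in> I. \<Oplus>\<^bsub>X\<^esub>q \<in> J. g p q) = (\<Oplus>\<^bsub>Y\<^esub>p \<in> I. f (\<Oplus>\<^bsub>X\<^esub>q \<in> J. g p q))"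
    by (rule linear_maps_finsum[OF X Y f fin(1)]) (auto intro!: X.M.finsum_closed g)
  also have "\<dots> = (\<Oplus>\<^bsub>Y\<^esub>p \<in> I. \<Oplus>\<^bsub>Y\<^esub>q \<in> J. f (g p q))"
    by (rule Y.M.finsum_cong'[OF refl])
      (auto intro!: Y.M.finsum_closed linear_maps_closed[OF f] g linear_maps_finsum[OF X Y f fin(2)])
  finally show ?thesis .
qed

context tensor_setup
begin

abbreviation "MD \<equiv> M_DM k M"
abbreviation "T \<equiv> tensor_alg k A MD"
abbreviation "in0T \<equiv> tensor_alg_in0 k A MD"
abbreviation "in1T \<equiv> tensor_alg_in1 k A MD"
abbreviation "TL \<equiv> tensor_alg k Lam Mho"
abbreviation "in0L \<equiv> tensor_alg_in0 k Lam Mho"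
abbreviation "in1L \<equiv> tensor_alg_in1 k Lam Mho"

definition "jM m = in1T (m, \<zero>\<^bsub>DM\<^esub>)"
definition "jD \<mu> = in1T (\<zero>\<^bsub>M\<^esub>, \<mu>)"

lemma MD: "bimodule k A A MD"
  unfolding M_DM_def by (rule dsum_bimodule[OF M_bimodule DM])

interpretation M: bimodule k A A M by (rule M_bimodule)
interpretation DM: bimodule k A A DM by (rule DM)
interpretation MD: bimodule k A A MD by (rule MD)
interpretation DL: bimodule k Lam Lam DL by (rule DL)
interpretation Mho: bimodule k Lam Lam Mho by (rule Mho)
interpretation Om: bimodule k Lam Lam Om by (rule Om)
interpretation DOD: bimodule k Lam Lam DOD by (rule DOD)
interpretation T: k_algebra k T by (rule tensor_alg_k_algebra[OF MD])
interpretation TL: k_algebra k TL by (rule tensor_alg_k_algebra[OF Mho])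

lemmas MD_simps = dsum_simps[of M DM, folded M_DM_def]

lemmas in0T = alg_homD[OF in0_alg_hom[OF MD]]
lemmas in1T = linear_mapsD[OF in1_linear[OF MD]]
lemmas in1T_act = in1_lact[OF MD] in1_ract[OF MD]
lemmas in0L = alg_homD[OF in0_alg_hom[OF Mho]]
lemmas in1L = linear_mapsD[OF in1_linear[OF Mho]]
lemmas in1L_act = in1_lact[OF Mho] in1_ract[OF Mho]

lemma jM_linear: "jM \<in> linear_maps k M T" and jD_linear: "jD \<in> linear_maps k DM T"
proof -
  have "(\<lambda>m. (m, \<zero>\<^bsub>DM\<^esub>)) \<in> linear_maps k M MD" by (rule linear_mapsI) (simp_all add: MD_simps)
  from linear_maps_compose[OF this in1_linear[OF MD]] show "jM \<in> linear_maps k M T"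
    by (simp add: jM_def[abs_def])
  have "(\<lambda>\<mu>. (\<zero>\<^bsub>M\<^esub>, \<mu>)) \<in> linear_maps k DM MD" by (rule linear_mapsI) (simp_all add: MD_simps)
  from linear_maps_compose[OF this in1_linear[OF MD]] show "jD \<in> linear_maps k DM T"
    by (simp add: jD_def[abs_def])
qed

lemmas jM = linear_mapsD[OF jM_linear]
lemmas jD = linear_mapsD[OF jD_linear]

lemma jM_act:
  assumes "a \<in> carrier A" "m \<in> carrier M"
  shows "jM (lact M a m) = in0T a \<otimes>\<^bsub>T\<^esub> jM m" "jM (ract M m a) = jM m \<otimes>\<^bsub>T\<^esub> in0T a"
  using in1T_act[of a "(m, \<zero>\<^bsub>DM\<^esub>)"] assms
  by (simp_all add: jM_def MD_simps DM.lact_zero DM.ract_zero)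

lemma jD_act:
  assumes "a \<in> carrier A" "\<mu> \<in> carrier DM"
  shows "jD (lact DM a \<mu>) = in0T a \<otimes>\<^bsub>T\<^esub> jD \<mu>" "jD (ract DM \<mu> a) = jD \<mu> \<otimes>\<^bsub>T\<^esub> in0T a"
  using in1T_act[of a "(\<zero>\<^bsub>M\<^esub>, \<mu>)"] assms
  by (simp_all add: jD_def MD_simps M.lact_zero M.ract_zero)

lemma in1T_split: "\<lbrakk>m \<in> carrier M; \<mu> \<in> carrier DM\<rbrakk> \<Longrightarrow> in1T (m, \<mu>) = jM m \<oplus>\<^bsub>T\<^esub> jD \<mu>"
  using in1T(2)[of "(m, \<zero>\<^bsub>DM\<^esub>)" "(\<zero>\<^bsub>M\<^esub>, \<mu>)"] by (simp add: jM_def jD_def MD_simps)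

text \<open>\<open>emb\<close> is the inclusion of \<open>\<Lambda>\<close> in \<open>T = T\<^sub>A(M \<oplus> DM)\<close>, and \<open>to_mho_alg\<close> below is the homomorphism
  from \<open>T\<close> to \<open>T\<^sub>\<Lambda>(\<mho>)\<close> that is the inclusion on \<open>\<Lambda>\<close> and \<open>muhat\<close> on \<open>DM\<close>.\<close>

lemma emb_exists: "\<exists>F. F \<in> alg_hom k Lam T \<and> (\<forall>a \<in> carrier A. F (\<iota> a) = in0T a) \<and>
    (\<forall>m \<in> carrier M. F (j m) = jM m)"
proof -
  have "compatible_pair k A M T in0T jM"
    by (simp add: compatible_pair_def in0_alg_hom[OF MD] jM_linear jM_act)
  from tensor_alg_lift[OF M_bimodule T.k_algebra_axioms this] obtain F where
    "F \<in> alg_hom k Lam T" "\<And>a. a \<in> carrier A \<Longrightarrow> F (\<iota> a) = in0T a"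
    "\<And>m. m \<in> carrier M \<Longrightarrow> F (j m) = jM m" by blast
  then show ?thesis by (intro exI[of _ F]) simp
qed

definition "emb = (SOME F. F \<in> alg_hom k Lam T \<and> (\<forall>a \<in> carrier A. F (\<iota> a) = in0T a) \<and>
    (\<forall>m \<in> carrier M. F (j m) = jM m))"

lemma emb_hom: "emb \<in> alg_hom k Lam T"
  and emb_i: "a \<in> carrier A \<Longrightarrow> emb (\<iota> a) = in0T a"
  and emb_j: "m \<in> carrier M \<Longrightarrow> emb (j m) = jM m"
  using someI_ex[OF emb_exists] unfolding emb_def by blast+

lemmas emb = alg_homD[OF emb_hom]

lemma to_mho_alg_exists: "\<exists>F. F \<in> alg_hom k T TL \<and> (\<forall>x \<in> carrier Lam. F (emb x) = in0L x) \<and>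
    (\<forall>\<mu> \<in> carrier DM. F (jD \<mu>) = in1L (muhat \<mu>))"
proof -
  let ?f1 = "\<lambda>(m, \<mu>). in0L (j m) \<oplus>\<^bsub>TL\<^esub> in1L (muhat \<mu>)"
  note mh = linear_mapsD[OF muhat_linear]
  have f0: "(\<lambda>a. in0L (\<iota> a)) \<in> alg_hom k A TL"
    by (rule alg_hom_compose[OF in0_alg_hom[OF M_bimodule] in0_alg_hom[OF Mho]])
  have f1: "?f1 \<in> linear_maps k MD TL"
    by (rule linear_mapsI)
      (auto simp: MD_simps j in0L in1L mh TL.a_ac TL.smult_r_distr simp del: dual_simps)
  have "compatible_pair k A MD TL (\<lambda>a. in0L (\<iota> a)) ?f1"
    using f0 f1 unfolding compatible_pair_def
    by (auto simp: MD_simps j j_act i in0L in1L in1L_act muhat_bimodule muhat_closed TL.r_distr TL.l_distr)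
  from tensor_alg_lift[OF MD TL.k_algebra_axioms this] obtain F where
    F: "F \<in> alg_hom k T TL" "\<And>a. a \<in> carrier A \<Longrightarrow> F (in0T a) = in0L (\<iota> a)"
    "\<And>z. z \<in> carrier MD \<Longrightarrow> F (in1T z) = ?f1 z" by blast
  have FM: "F (jM m) = in0L (j m)" if "m \<in> carrier M" for m
    using F(3)[of "(m, \<zero>\<^bsub>DM\<^esub>)"] that linear_maps_zero[OF DM.module_axioms Mho.module_axioms muhat_linear]
      linear_maps_zero[OF Mho.module_axioms TL.module_axioms in1_linear[OF Mho]]
    by (simp add: jM_def MD_simps in0L j)
  have FD: "F (jD \<mu>) = in1L (muhat \<mu>)" if "\<mu> \<in> carrier DM" for \<mu>
    using F(3)[of "(\<zero>\<^bsub>M\<^esub>, \<mu>)"] that linear_maps_zero[OF M.module_axioms L.module_axioms in1_linear[OF M_bimodule]]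
      linear_maps_zero[OF L.module_axioms TL.module_axioms alg_hom_linear[OF in0_alg_hom[OF Mho]]]
    by (simp add: jD_def MD_simps in1L muhat_closed)
  have "F (emb x) = in0L x" if "x \<in> carrier Lam" for x
    by (rule tensor_alg_hom_eqI[OF M_bimodule TL.k_algebra_axioms alg_hom_compose[OF emb_hom F(1)]
          in0_alg_hom[OF Mho] _ _ that])
      (simp_all add: emb_i emb_j F(2) FM)
  then show ?thesis using F(1) FD by blast
qed

definition "to_mho_alg = (SOME F. F \<in> alg_hom k T TL \<and> (\<forall>x \<in> carrier Lam. F (emb x) = in0L x) \<and>
    (\<forall>\<mu> \<in> carrier DM. F (jD \<mu>) = in1L (muhat \<mu>)))"

lemma to_mho_alg_hom: "to_mho_alg \<in> alg_hom k T TL"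
  and to_mho_alg_emb: "x \<in> carrier Lam \<Longrightarrow> to_mho_alg (emb x) = in0L x"
  and to_mho_alg_jD: "\<mu> \<in> carrier DM \<Longrightarrow> to_mho_alg (jD \<mu>) = in1L (muhat \<mu>)"
  using someI_ex[OF to_mho_alg_exists] unfolding to_mho_alg_def by blast+

lemmas to_mho_alg = alg_homD[OF to_mho_alg_hom]

lemma word_class_pair:
  "\<lbrakk>z \<in> carrier MD; w \<in> carrier MD\<rbrakk> \<Longrightarrow> word_class k A MD (\<one>\<^bsub>A\<^esub>, [z, w]) = in1T z \<otimes>\<^bsub>T\<^esub> in1T w"
  by (simp add: tensor_alg_in1_def tensor_alg_mult_class[OF MD] in_words_iff[OF MD]
      word_mult_simps MD.ract_one)

lemma c_elem_dual_bases:
  assumes r: "right_dual_basis M n x \<xi>" and l: "left_dual_basis M n' x' \<xi>'"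
  shows "c_elem k A \<sigma> M = (\<Oplus>\<^bsub>T\<^esub>p \<in> {..<n}. jM (x p) \<otimes>\<^bsub>T\<^esub> jD (\<xi> p)) \<ominus>\<^bsub>T\<^esub>
    (\<Oplus>\<^bsub>T\<^esub>q \<in> {..<n'}. jD (\<xi>' q) \<otimes>\<^bsub>T\<^esub> jM (x' q))"
proof -
  have x: "\<And>p. p < n \<Longrightarrow> x p \<in> carrier M" "\<And>p. p < n \<Longrightarrow> \<xi> p \<in> carrier DM"
    "\<And>q. q < n' \<Longrightarrow> x' q \<in> carrier M" "\<And>q. q < n' \<Longrightarrow> \<xi>' q \<in> carrier DM"
    using r l by (auto simp: right_dual_basis_def left_dual_basis_def dual_simps)
  let ?w1 = "\<lambda>m \<mu>. word_class k A MD (\<one>\<^bsub>A\<^esub>, [(m, \<zero>\<^bsub>DM\<^esub>), (\<zero>\<^bsub>M\<^esub>, \<mu>)])"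
    and ?w2 = "\<lambda>\<nu> m. word_class k A MD (\<one>\<^bsub>A\<^esub>, [(\<zero>\<^bsub>M\<^esub>, \<nu>), (m, \<zero>\<^bsub>DM\<^esub>)])"
  have w1: "?w1 m \<mu> = jM m \<otimes>\<^bsub>T\<^esub> jD \<mu>" and w2: "?w2 \<mu> m = jD \<mu> \<otimes>\<^bsub>T\<^esub> jM m"
    if "m \<in> carrier M" "\<mu> \<in> carrier DM" for m \<mu>
    using that by (simp_all add: word_class_pair MD_simps jM_def jD_def)
  have b1: "?w1 \<in> balanced k M A DM T"
    by (rule balancedI; (rule linear_mapsI)?)
      (simp_all add: w1 jM jD T.l_distr T.r_distr T.smult_mult_left T.smult_mult_right jM_act jD_act
        M.ract_closed DM.lact_closed in0T T.m_assoc)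
  have b2: "?w2 \<in> balanced k DM A M T"
    by (rule balancedI; (rule linear_mapsI)?)
      (simp_all add: w2 jM jD T.l_distr T.r_distr T.smult_mult_left T.smult_mult_right jM_act jD_act
        M.lact_closed DM.ract_closed in0T T.m_assoc)
  note pc = pure_tensor_closed[OF K.cring_axioms]
  have "tensor_lift k M DM T ?w1 (rho k A \<sigma> M) = (\<Oplus>\<^bsub>T\<^esub>p \<in> {..<n}. jM (x p) \<otimes>\<^bsub>T\<^esub> jD (\<xi> p))"
  proof -
    have "tensor_lift k M DM T ?w1 (rho k A \<sigma> M) =
        (\<Oplus>\<^bsub>T\<^esub>p \<in> {..<n}. tensor_lift k M DM T ?w1 (pure_tensor k M A DM (x p) (\<xi> p)))"
      unfolding rho_eq[OF M_bimodule r]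
      by (rule linear_maps_finsum[OF tensor_module[OF K.cring_axioms] T.module_axioms
            tensor_lift_linear[OF M_bimodule DM T.module_axioms b1]]) (auto intro: pc)
    also have "\<dots> = (\<Oplus>\<^bsub>T\<^esub>p \<in> {..<n}. jM (x p) \<otimes>\<^bsub>T\<^esub> jD (\<xi> p))"
      by (rule T.finsum_cong'[OF refl])
        (use x in \<open>auto simp: tensor_lift_pure[OF M_bimodule DM T.module_axioms b1] w1 jM jD\<close>)
    finally show ?thesis .
  qed
  moreover have "tensor_lift k DM M T ?w2 (ell k A \<sigma> M) = (\<Oplus>\<^bsub>T\<^esub>q \<in> {..<n'}. jD (\<xi>' q) \<otimes>\<^bsub>T\<^esub> jM (x' q))"
  proof -
    have "tensor_lift k DM M T ?w2 (ell k A \<sigma> M) =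
        (\<Oplus>\<^bsub>T\<^esub>q \<in> {..<n'}. tensor_lift k DM M T ?w2 (pure_tensor k DM A M (\<xi>' q) (x' q)))"
      unfolding ell_eq[OF M_bimodule l]
      by (rule linear_maps_finsum[OF tensor_module[OF K.cring_axioms] T.module_axioms
            tensor_lift_linear[OF DM M_bimodule T.module_axioms b2]]) (auto intro: pc)
    also have "\<dots> = (\<Oplus>\<^bsub>T\<^esub>q \<in> {..<n'}. jD (\<xi>' q) \<otimes>\<^bsub>T\<^esub> jM (x' q))"
      by (rule T.finsum_cong'[OF refl])
        (use x in \<open>auto simp: tensor_lift_pure[OF DM M_bimodule T.module_axioms b2] w2 jM jD\<close>)
    finally show ?thesis .
  qed
  ultimately show ?thesis by (simp add: c_elem_def)
qed

lemma to_mho_alg_c_elem: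
  assumes r: "right_dual_basis M n x \<xi>" and l: "left_dual_basis M n' x' \<xi>'"
  shows "c_elem k A \<sigma> M \<in> carrier T" and "to_mho_alg (c_elem k A \<sigma> M) = in1L cb"
proof -
  have x: "\<And>p. p < n \<Longrightarrow> x p \<in> carrier M" "\<And>p. p < n \<Longrightarrow> \<xi> p \<in> carrier DM"
    "\<And>q. q < n' \<Longrightarrow> x' q \<in> carrier M" "\<And>q. q < n' \<Longrightarrow> \<xi>' q \<in> carrier DM"
    using r l by (auto simp: right_dual_basis_def left_dual_basis_def dual_simps)
  note c = c_elem_dual_bases[OF r l]
  let ?R = "\<Oplus>\<^bsub>T\<^esub>p \<in> {..<n}. jM (x p) \<otimes>\<^bsub>T\<^esub> jD (\<xi> p)" and ?L = "\<Oplus>\<^bsub>T\<^esub>q \<in> {..<n'}. jD (\<xi>' q) \<otimes>\<^bsub>T\<^esub> jM (x' q)"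
  have Rc: "(\<lambda>p. jM (x p) \<otimes>\<^bsub>T\<^esub> jD (\<xi> p)) \<in> {..<n} \<rightarrow> carrier T"
    and Lc: "(\<lambda>q. jD (\<xi>' q) \<otimes>\<^bsub>T\<^esub> jM (x' q)) \<in> {..<n'} \<rightarrow> carrier T"
    using x by (auto simp: jM jD)
  have RL: "?R \<in> carrier T" "?L \<in> carrier T" using Rc Lc by simp_all
  then show "c_elem k A \<sigma> M \<in> carrier T" by (simp add: c)
  have Mc: "(\<lambda>p. lact Mho (j (x p)) (muhat (\<xi> p))) \<in> {..<n} \<rightarrow> carrier Mho"
    "(\<lambda>q. ract Mho (muhat (\<xi>' q)) (j (x' q))) \<in> {..<n'} \<rightarrow> carrier Mho"
    using x by (auto simp: Mho.lact_closed Mho.ract_closed muhat_closed j)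
  have pM: "to_mho_alg (jM m) = in0L (j m)" if "m \<in> carrier M" for m
    using to_mho_alg_emb[of "j m"] that by (simp add: emb_j j)
  have "to_mho_alg ?R = (\<Oplus>\<^bsub>TL\<^esub>p \<in> {..<n}. to_mho_alg (jM (x p) \<otimes>\<^bsub>T\<^esub> jD (\<xi> p)))"
    by (rule linear_maps_finsum[OF T.module_axioms TL.module_axioms to_mho_alg(1) _ Rc]) simp
  also have "\<dots> = (\<Oplus>\<^bsub>TL\<^esub>p \<in> {..<n}. in1L (lact Mho (j (x p)) (muhat (\<xi> p))))"
    by (rule TL.finsum_cong'[OF refl])
      (use x in \<open>auto simp: to_mho_alg jM jD pM to_mho_alg_jD in1L_act in1L in0L j muhat_closed Mho.lact_closed\<close>)
  also have "\<dots> = in1L (\<Oplus>\<^bsub>Mho\<^esub>p \<in> {..<n}. lact Mho (j (x p)) (muhat (\<xi> p)))"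
    by (rule linear_maps_finsum[OF Mho.module_axioms TL.module_axioms in1_linear[OF Mho] _ Mc(1), symmetric])
      simp
  finally have R: "to_mho_alg ?R = in1L (\<Oplus>\<^bsub>Mho\<^esub>p \<in> {..<n}. lact Mho (j (x p)) (muhat (\<xi> p)))" .
  have "to_mho_alg ?L = (\<Oplus>\<^bsub>TL\<^esub>q \<in> {..<n'}. to_mho_alg (jD (\<xi>' q) \<otimes>\<^bsub>T\<^esub> jM (x' q)))"
    by (rule linear_maps_finsum[OF T.module_axioms TL.module_axioms to_mho_alg(1) _ Lc]) simp
  also have "\<dots> = (\<Oplus>\<^bsub>TL\<^esub>q \<in> {..<n'}. in1L (ract Mho (muhat (\<xi>' q)) (j (x' q))))"
    by (rule TL.finsum_cong'[OF refl])
      (use x in \<open>auto simp: to_mho_alg jM jD pM to_mho_alg_jD in1L_act in1L in0L j muhat_closed Mho.ract_closed\<close>)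
  also have "\<dots> = in1L (\<Oplus>\<^bsub>Mho\<^esub>q \<in> {..<n'}. ract Mho (muhat (\<xi>' q)) (j (x' q)))"
    by (rule linear_maps_finsum[OF Mho.module_axioms TL.module_axioms in1_linear[OF Mho] _ Mc(2), symmetric])
      simp
  finally have L: "to_mho_alg ?L = in1L (\<Oplus>\<^bsub>Mho\<^esub>q \<in> {..<n'}. ract Mho (muhat (\<xi>' q)) (j (x' q)))" .
  show "to_mho_alg (c_elem k A \<sigma> M) = in1L cb"
    using linear_maps_diff[OF T.module_axioms TL.module_axioms to_mho_alg(1) RL]
      linear_maps_diff[OF Mho.module_axioms TL.module_axioms in1_linear[OF Mho]] Mc
    by (simp add: c R L cbar_dual_bases[OF r l])
qed

text \<open>\<open>d\<close> vanishes on \<open>A\<close>, so factors from \<open>A\<close> can be moved out of its argument.\<close>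

lemma tri_d_sandwich:
  assumes t: "\<theta> \<in> carrier DL" and p: "\<phi> \<in> carrier DL" and m: "m \<in> carrier M"
    and a: "a \<in> carrier A" and b: "b \<in> carrier A"
  shows "tri \<theta> (d (j (sandwich a m b))) \<phi> = tri (ract DL \<theta> (\<iota> a)) (d (j m)) (lact DL (\<iota> b) \<phi>)"
proof -
  have z: "tri \<theta>' (d (\<iota> c)) \<phi>' = \<zero>\<^bsub>DOD\<^esub>" if "\<theta>' \<in> carrier DL" "\<phi>' \<in> carrier DL" "c \<in> carrier A" for \<theta>' \<phi>' c
    using linear_maps_zero[OF Om.module_axioms DOD.module_axioms tri_linear(2)[OF that(1,2)]] that(3)
    by (simp add: d_scalar Om_simps)
  have "j (sandwich a m b) = \<iota> a \<otimes>\<^bsub>Lam\<^esub> j m \<otimes>\<^bsub>Lam\<^esub> \<iota> b"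
    using assms by (simp add: sandwich_def j_act M.lact_closed)
  then show ?thesis
    using assms by (simp add: tri_d_mult i j z DL.lact_closed DL.ract_closed tri_closed)
qed

context
  fixes n n' :: nat and lam lam' th ph
  assumes rb: "right_dual_basis AA n lam th" and lb: "left_dual_basis AA n' lam' ph"
begin

lemma bases_closed:
  shows "p < n \<Longrightarrow> lam p \<in> carrier Lam" "p < n \<Longrightarrow> th p \<in> carrier DL"
    and "q < n' \<Longrightarrow> lam' q \<in> carrier Lam" "q < n' \<Longrightarrow> ph q \<in> carrier DL"
  using rb lb
  by (auto simp: right_dual_basis_def left_dual_basis_def functionals_AA DL_simps alg_bimodule_simps)

lemma finsum_AA: "finsum AA f I = finsum Lam f I"
  by (rule finsum_cong_struct) (simp_all add: alg_bimodule_simps)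

lemma Lam_expand:
  assumes "x \<in> carrier Lam"
  shows "(\<Oplus>\<^bsub>Lam\<^esub>p \<in> {..<n}. lam p \<otimes>\<^bsub>Lam\<^esub> \<iota> (rv (th p) x)) = x"
    and "(\<Oplus>\<^bsub>Lam\<^esub>q \<in> {..<n'}. \<iota> (lv (ph q) x) \<otimes>\<^bsub>Lam\<^esub> lam' q) = x"
  using rb lb assms
  by (auto simp: right_dual_basis_def left_dual_basis_def alg_bimodule_simps finsum_AA)

lemma finsum_DL: "finsum (dual k AA) f I = finsum DL f I"
proof (rule finsum_cong_struct)
  show "carrier (dual k AA) = carrier DL" by (simp add: dual_simps DL_simps functionals_AA)
qed (simp_all add: DLam_def dual_simps alg_bimodule_simps)

lemma DL_expand:
  assumes "\<theta> \<in> carrier DL"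
  shows "(\<Oplus>\<^bsub>DL\<^esub>p \<in> {..<n}. lact DL (\<iota> (rv \<theta> (lam p))) (th p)) = \<theta>"
    and "(\<Oplus>\<^bsub>DL\<^esub>q \<in> {..<n'}. ract DL (ph q) (\<iota> (lv \<theta> (lam' q)))) = \<theta>"
proof -
  have t: "\<theta> \<in> functionals k AA" using assms by (simp add: DL_simps functionals_AA)
  have "lact (dual k AA) a f = lact DL (\<iota> a) f" "ract (dual k AA) f a = ract DL f (\<iota> a)" for a f
    by (simp_all add: dual_simps alg_bimodule_simps DL_simps)
  then show "(\<Oplus>\<^bsub>DL\<^esub>p \<in> {..<n}. lact DL (\<iota> (rv \<theta> (lam p))) (th p)) = \<theta>"
    "(\<Oplus>\<^bsub>DL\<^esub>q \<in> {..<n'}. ract DL (ph q) (\<iota> (lv \<theta> (lam' q)))) = \<theta>"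
    using dual_basis_expand(1)[OF AA t rb] dual_basis_expand(2)[OF AA t lb] by (simp_all add: finsum_DL)
qed

text \<open>The coefficient, in \<open>DM\<close>, between \<open>lam p\<close> and \<open>lam' q\<close> in the expansion of \<open>f\<close> below.\<close>

definition coord where "coord p q f = (\<lambda>m \<in> carrier M. f (tri (ph q) (d (j m)) (th p)))"

lemma coord_linear:
  assumes p: "p < n" and q: "q < n'"
  shows "coord p q \<in> linear_maps k Mho DM"
proof -
  have c: "coord p q f \<in> functionals k M" if "f \<in> carrier Mho" for f
    unfolding coord_def
    by (rule restrict_functional[OF M.module_axioms linear_maps_compose[OF
            linear_maps_compose[OF in1_linear[OF M_bimodule] d_linear]
            Mho_tri_linear(2)[OF that bases_closed(4)[OF q] bases_closed(2)[OF p]]]])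
  show ?thesis
    by (rule linear_mapsI)
      (auto simp: c[unfolded coord_def] dual_simps coord_def Mho_add intro!: restrict_ext)
qed

lemmas coord = linear_mapsD[OF coord_linear]

text \<open>At \<open>\<theta> \<otimes> dm \<otimes> \<phi>\<close>, the summand for \<open>p\<close> and \<open>q\<close> is \<open>f(t\<^sub>q \<otimes> dm \<otimes> s\<^sub>p)\<close>, by \<open>muhat_act\<close>, where
  \<open>t\<^sub>q = ph q \<sqdot> lv \<theta> (lam' q)\<close> and \<open>s\<^sub>p = rv \<phi> (lam p) \<sqdot> th p\<close>. The sum of the \<open>t\<^sub>q\<close> is \<open>\<theta>\<close> and that of
  the \<open>s\<^sub>p\<close> is \<open>\<phi>\<close>, by \<open>DL_expand\<close>.\<close>

lemma Mho_expand:
  assumes f: "f \<in> carrier Mho"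
  shows "f = (\<Oplus>\<^bsub>Mho\<^esub>p \<in> {..<n}. \<Oplus>\<^bsub>Mho\<^esub>q \<in> {..<n'}.
    ract Mho (lact Mho (lam p) (muhat (coord p q f))) (lam' q))"
    (is "f = (\<Oplus>\<^bsub>Mho\<^esub>p \<in> {..<n}. \<Oplus>\<^bsub>Mho\<^esub>q \<in> {..<n'}. ?g p q)")
proof -
  note bc = bases_closed
  have gc: "?g p q \<in> carrier Mho" if "p < n" "q < n'" for p q
    using that f by (simp add: Mho.lact_closed Mho.ract_closed muhat_closed bc coord)
  have sc: "(\<Oplus>\<^bsub>Mho\<^esub>p \<in> {..<n}. \<Oplus>\<^bsub>Mho\<^esub>q \<in> {..<n'}. ?g p q) \<in> carrier Mho"
    using gc by (auto intro!: Mho.finsum_closed)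
  show ?thesis
  proof (rule Mho_eqI_generators[OF f sc])
    fix \<theta> m \<phi> assume b: "\<theta> \<in> carrier DL" "m \<in> carrier M" "\<phi> \<in> carrier DL"
    let ?U = "tri \<theta> (d (j m)) \<phi>"
    let ?t = "\<lambda>q. ract DL (ph q) (\<iota> (lv \<theta> (lam' q)))" and ?s = "\<lambda>p. lact DL (\<iota> (rv \<phi> (lam p))) (th p)"
    have tc: "?t q \<in> carrier DL" if "q < n'" for q
      using that b by (simp add: DL.ract_closed bc i lv_closed)
    have sc: "?s p \<in> carrier DL" if "p < n" for p
      using that b by (simp add: DL.lact_closed bc i rv_closed)
    have w: "d (j m) \<in> carrier Om" using b by (simp add: d_closed j)
    have g: "?g p q ?U = f (tri (?t q) (d (j m)) (?s p))" if "p < n" "q < n'" for p q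
    proof -
      have "?g p q ?U = coord p q f (sandwich (lv \<theta> (lam' q)) m (rv \<phi> (lam p)))"
        using that f b by (intro muhat_act) (simp_all add: bc coord)
      also have "\<dots> = f (tri (ph q) (d (j (sandwich (lv \<theta> (lam' q)) m (rv \<phi> (lam p))))) (th p))"
        using that b by (simp add: coord_def sandwich_closed lv_closed rv_closed bc)
      also have "\<dots> = f (tri (?t q) (d (j m)) (?s p))"
        using that b by (simp add: tri_d_sandwich bc lv_closed rv_closed)
      finally show ?thesis .
    qed
    have fs: "f (tri \<theta> (d (j m)) (?s p)) = (\<Oplus>\<^bsub>k\<^esub>q \<in> {..<n'}. f (tri (?t q) (d (j m)) (?s p)))"
      if p: "p < n" for p
    proof -
      have "f (tri \<theta> (d (j m)) (?s p)) = f (tri (\<Oplus>\<^bsub>DL\<^esub>q \<in> {..<n'}. ?t q) (d (j m)) (?s p))"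
        using DL_expand(2)[OF b(1)] by simp
      also have "\<dots> = (\<Oplus>\<^bsub>scalars k\<^esub>q \<in> {..<n'}. f (tri (?t q) (d (j m)) (?s p)))"
        by (rule linear_maps_finsum[OF DL.module_axioms module_scalars[OF K.cring_axioms]
              Mho_tri_linear(1)[OF f w sc[OF p]]]) (use tc in auto)
      finally show ?thesis by (simp add: finsum_cong_struct[of "scalars k" k])
    qed
    have "f ?U = f (tri \<theta> (d (j m)) (\<Oplus>\<^bsub>DL\<^esub>p \<in> {..<n}. ?s p))" using DL_expand(1)[OF b(3)] by simp
    also have "\<dots> = (\<Oplus>\<^bsub>scalars k\<^esub>p \<in> {..<n}. f (tri \<theta> (d (j m)) (?s p)))"
      by (rule linear_maps_finsum[OF DL.module_axioms module_scalars[OF K.cring_axioms]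
            Mho_tri_linear(3)[OF f b(1) w]]) (use sc in auto)
    also have "\<dots> = (\<Oplus>\<^bsub>k\<^esub>p \<in> {..<n}. f (tri \<theta> (d (j m)) (?s p)))" by (rule finsum_cong_struct) simp_all
    also have "\<dots> = (\<Oplus>\<^bsub>k\<^esub>p \<in> {..<n}. \<Oplus>\<^bsub>k\<^esub>q \<in> {..<n'}. f (tri (?t q) (d (j m)) (?s p)))"
      by (rule K.finsum_cong'[OF refl])
        (use linear_maps_closed[OF Mho_linear[OF f] tri_closed] fs in \<open>auto intro!: K.finsum_closed\<close>)
    also have "\<dots> = (\<Oplus>\<^bsub>k\<^esub>p \<in> {..<n}. \<Oplus>\<^bsub>k\<^esub>q \<in> {..<n'}. ?g p q ?U)"
      using g linear_maps_closed[OF Mho_linear[OF f] tri_closed]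
      by (intro K.finsum_cong'[OF refl] K.finsum_closed) (auto intro!: K.finsum_closed)
    also have "\<dots> = (\<Oplus>\<^bsub>scalars k\<^esub>p \<in> {..<n}. \<Oplus>\<^bsub>scalars k\<^esub>q \<in> {..<n'}. ?g p q ?U)"
      by (simp add: finsum_cong_struct[of "scalars k" k])
    also have "\<dots> = (\<Oplus>\<^bsub>Mho\<^esub>p \<in> {..<n}. \<Oplus>\<^bsub>Mho\<^esub>q \<in> {..<n'}. ?g p q) ?U"
      by (rule linear_maps_double_sum[OF Mho.module_axioms module_scalars[OF K.cring_axioms]
            Mho_eval_linear[OF tri_closed], symmetric]) (use gc in auto)
    finally show "f ?U = (\<Oplus>\<^bsub>Mho\<^esub>p \<in> {..<n}. \<Oplus>\<^bsub>Mho\<^esub>q \<in> {..<n'}. ?g p q) ?U" .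
  qed
qed

definition from_mho where
  "from_mho f = (\<Oplus>\<^bsub>T\<^esub>p \<in> {..<n}. \<Oplus>\<^bsub>T\<^esub>q \<in> {..<n'}. emb (lam p) \<otimes>\<^bsub>T\<^esub> jD (coord p q f) \<otimes>\<^bsub>T\<^esub> emb (lam' q))"

lemma from_mho_linear: "from_mho \<in> linear_maps k Mho T"
  unfolding from_mho_def
  by (rule linear_maps_sum[OF T.module_axioms]; (rule linear_maps_sum[OF T.module_axioms])?;
      (rule linear_mapsI)?)
    (simp_all add: coord jD emb bases_closed T.l_distr T.r_distr T.smult_mult_left T.smult_mult_right)

text \<open>The coefficients of \<open>x \<sqdot> muhat \<mu> \<sqdot> y\<close> are \<open>rv (th p) x \<sqdot> \<mu> \<sqdot> lv (ph q) y\<close>. After moving the factors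
  from \<open>A\<close> to \<open>lam p\<close> and \<open>lam' q\<close>, the double sum factors through the expansions of \<open>x\<close> and \<open>y\<close>.\<close>

lemma from_mho_generators:
  assumes mu: "\<mu> \<in> carrier DM" and x: "x \<in> carrier Lam" and y: "y \<in> carrier Lam"
  shows "from_mho (ract Mho (lact Mho x (muhat \<mu>)) y) = emb x \<otimes>\<^bsub>T\<^esub> jD \<mu> \<otimes>\<^bsub>T\<^esub> emb y"
proof -
  note bc = bases_closed
  let ?r = "\<lambda>p. rv (th p) x" and ?l = "\<lambda>q. lv (ph q) y"
  have rl: "?r p \<in> carrier A" "?l q \<in> carrier A" if "p < n" "q < n'" for p q
    using that x y by (simp_all add: rv_closed lv_closed bc)
  have c: "coord p q (ract Mho (lact Mho x (muhat \<mu>)) y) = lact DM (?r p) (ract DM \<mu> (?l q))"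
    if "p < n" "q < n'" for p q
    unfolding coord_def using that mu x y rl[OF that]
    by (auto intro!: restrict_ext
        simp: muhat_act bc dual_simps M.ract_closed M.lact_closed sandwich_def M.lact_ract)
  let ?a = "\<lambda>p. emb (lam p \<otimes>\<^bsub>Lam\<^esub> \<iota> (?r p))" and ?b = "\<lambda>q. emb (\<iota> (?l q) \<otimes>\<^bsub>Lam\<^esub> lam' q)"
  have ab: "?a p \<in> carrier T" "?b q \<in> carrier T" if "p < n" "q < n'" for p q
    using that rl by (simp_all add: emb bc i)
  have s: "emb (lam p) \<otimes>\<^bsub>T\<^esub> jD (coord p q (ract Mho (lact Mho x (muhat \<mu>)) y)) \<otimes>\<^bsub>T\<^esub> emb (lam' q) =
      ?a p \<otimes>\<^bsub>T\<^esub> (jD \<mu> \<otimes>\<^bsub>T\<^esub> ?b q)" if "p < n" "q < n'" for p q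
    using that rl[OF that] mu
    by (simp add: c jD_act DM.ract_closed emb bc i emb_i in0T jD T.m_assoc)
  have Ta: "(\<Oplus>\<^bsub>T\<^esub>p \<in> {..<n}. ?a p) = emb x"
    using linear_maps_finsum[OF L.module_axioms T.module_axioms emb(1), of "{..<n}" "\<lambda>p. lam p \<otimes>\<^bsub>Lam\<^esub> \<iota> (?r p)"]
      Lam_expand(1)[OF x] x by (simp add: Pi_def bc i rv_closed)
  have Tb: "(\<Oplus>\<^bsub>T\<^esub>q \<in> {..<n'}. ?b q) = emb y"
    using linear_maps_finsum[OF L.module_axioms T.module_axioms emb(1), of "{..<n'}" "\<lambda>q. \<iota> (?l q) \<otimes>\<^bsub>Lam\<^esub> lam' q"]
      Lam_expand(2)[OF y] y by (simp add: Pi_def bc i lv_closed)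
  have bT: "?b q \<in> carrier T" if "q < n'" for q using that y by (simp add: emb bc i lv_closed)
  have aT: "?a p \<in> carrier T" if "p < n" for p using that x by (simp add: emb bc i rv_closed)
  have "from_mho (ract Mho (lact Mho x (muhat \<mu>)) y) =
      (\<Oplus>\<^bsub>T\<^esub>p \<in> {..<n}. \<Oplus>\<^bsub>T\<^esub>q \<in> {..<n'}. ?a p \<otimes>\<^bsub>T\<^esub> (jD \<mu> \<otimes>\<^bsub>T\<^esub> ?b q))"
    unfolding from_mho_def
    by (intro T.finsum_cong'[OF refl]) (use s aT bT jD mu in \<open>auto intro!: T.finsum_closed\<close>)
  also have "\<dots> = (\<Oplus>\<^bsub>T\<^esub>p \<in> {..<n}. ?a p \<otimes>\<^bsub>T\<^esub> (jD \<mu> \<otimes>\<^bsub>T\<^esub> emb y))"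
    using aT bT jD mu y
    by (intro T.finsum_cong'[OF refl])
      (auto simp: T.finsum_rdistr[symmetric] Tb emb Pi_def)
  also have "\<dots> = emb x \<otimes>\<^bsub>T\<^esub> (jD \<mu> \<otimes>\<^bsub>T\<^esub> emb y)"
    using aT jD mu y by (simp add: T.finsum_ldistr[symmetric] Ta emb Pi_def)
  finally show ?thesis using mu x y by (simp add: T.m_assoc jD emb)
qed

text \<open>By \<open>Mho_expand\<close>, the bimodule is spanned by the elements in \<open>from_mho_generators\<close>, for which this is
  clear.\<close>

lemma from_mho_act:
  assumes z: "z \<in> carrier Lam" and f: "f \<in> carrier Mho"
  shows "from_mho (lact Mho z f) = emb z \<otimes>\<^bsub>T\<^esub> from_mho f" and "from_mho (ract Mho f z) = from_mho f \<otimes>\<^bsub>T\<^esub> emb z"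
proof -
  note bc = bases_closed
  let ?g = "\<lambda>p q. ract Mho (lact Mho (lam p) (muhat (coord p q f))) (lam' q)"
  let ?t = "\<lambda>p q. emb (lam p) \<otimes>\<^bsub>T\<^esub> jD (coord p q f) \<otimes>\<^bsub>T\<^esub> emb (lam' q)"
  have gc: "?g p q \<in> carrier Mho" if "p < n" "q < n'" for p q
    using that f by (simp add: Mho.lact_closed Mho.ract_closed muhat_closed bc coord)
  have tc: "?t p q \<in> carrier T" if "p < n" "q < n'" for p q
    using that f by (simp add: bc coord emb jD)
  have bg: "from_mho (lact Mho z (?g p q)) = emb z \<otimes>\<^bsub>T\<^esub> ?t p q"
    "from_mho (ract Mho (?g p q) z) = ?t p q \<otimes>\<^bsub>T\<^esub> emb z" if "p < n" "q < n'" for p q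
  proof -
    have "lact Mho z (?g p q) = ract Mho (lact Mho (z \<otimes>\<^bsub>Lam\<^esub> lam p) (muhat (coord p q f))) (lam' q)"
      using that f z
      by (simp add: Mho.lact_ract[symmetric] Mho.lact_mult Mho.lact_closed muhat_closed bc coord)
    then show "from_mho (lact Mho z (?g p q)) = emb z \<otimes>\<^bsub>T\<^esub> ?t p q"
      using that f z by (simp add: from_mho_generators bc coord emb jD T.m_assoc)
    have "ract Mho (?g p q) z = ract Mho (lact Mho (lam p) (muhat (coord p q f))) (lam' q \<otimes>\<^bsub>Lam\<^esub> z)"
      using that f z by (simp add: Mho.ract_mult Mho.lact_closed muhat_closed bc coord)
    then show "from_mho (ract Mho (?g p q) z) = ?t p q \<otimes>\<^bsub>T\<^esub> emb z"
      using that f z by (simp add: from_mho_generators bc coord emb jD T.m_assoc)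
  qed
  have "from_mho (lact Mho z f) = (\<Oplus>\<^bsub>T\<^esub>p \<in> {..<n}. \<Oplus>\<^bsub>T\<^esub>q \<in> {..<n'}. from_mho (lact Mho z (?g p q)))"
    by (subst Mho_expand[OF f], rule linear_maps_double_sum[OF Mho.module_axioms T.module_axioms
          linear_maps_compose[OF Mho.lact_linear[OF z] from_mho_linear]]) (use gc in auto)
  also have "\<dots> = (\<Oplus>\<^bsub>T\<^esub>p \<in> {..<n}. \<Oplus>\<^bsub>T\<^esub>q \<in> {..<n'}. emb z \<otimes>\<^bsub>T\<^esub> ?t p q)"
    by (intro T.finsum_cong'[OF refl]) (use bg tc emb z in \<open>auto intro!: T.finsum_closed\<close>)
  also have "\<dots> = emb z \<otimes>\<^bsub>T\<^esub> from_mho f"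
    unfolding from_mho_def
    by (rule linear_maps_double_sum[OF T.module_axioms T.module_axioms, symmetric])
      (use tc emb z in \<open>auto intro!: linear_mapsI simp: T.r_distr T.smult_mult_right\<close>)
  finally show "from_mho (lact Mho z f) = emb z \<otimes>\<^bsub>T\<^esub> from_mho f" .
  have "from_mho (ract Mho f z) = (\<Oplus>\<^bsub>T\<^esub>p \<in> {..<n}. \<Oplus>\<^bsub>T\<^esub>q \<in> {..<n'}. from_mho (ract Mho (?g p q) z))"
    by (subst Mho_expand[OF f], rule linear_maps_double_sum[OF Mho.module_axioms T.module_axioms
          linear_maps_compose[OF Mho.ract_linear[OF z] from_mho_linear]]) (use gc in auto)
  also have "\<dots> = (\<Oplus>\<^bsub>T\<^esub>p \<in> {..<n}. \<Oplus>\<^bsub>T\<^esub>q \<in> {..<n'}. ?t p q \<otimes>\<^bsub>T\<^esub> emb z)"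
    by (intro T.finsum_cong'[OF refl]) (use bg tc emb z in \<open>auto intro!: T.finsum_closed\<close>)
  also have "\<dots> = from_mho f \<otimes>\<^bsub>T\<^esub> emb z"
    unfolding from_mho_def
    by (rule linear_maps_double_sum[OF T.module_axioms T.module_axioms, symmetric])
      (use tc emb z in \<open>auto intro!: linear_mapsI simp: T.l_distr T.smult_mult_left\<close>)
  finally show "from_mho (ract Mho f z) = from_mho f \<otimes>\<^bsub>T\<^esub> emb z" .
qed

lemma to_mho_alg_from_mho:
  assumes f: "f \<in> carrier Mho" shows "to_mho_alg (from_mho f) = in1L f"
proof -
  note bc = bases_closed
  let ?g = "\<lambda>p q. ract Mho (lact Mho (lam p) (muhat (coord p q f))) (lam' q)"
  let ?t = "\<lambda>p q. emb (lam p) \<otimes>\<^bsub>T\<^esub> jD (coord p q f) \<otimes>\<^bsub>T\<^esub> emb (lam' q)"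
  have gc: "?g p q \<in> carrier Mho" if "p < n" "q < n'" for p q
    using that f by (simp add: Mho.lact_closed Mho.ract_closed muhat_closed bc coord)
  have tc: "?t p q \<in> carrier T" if "p < n" "q < n'" for p q
    using that f by (simp add: bc coord emb jD)
  have "to_mho_alg (from_mho f) = (\<Oplus>\<^bsub>TL\<^esub>p \<in> {..<n}. \<Oplus>\<^bsub>TL\<^esub>q \<in> {..<n'}. to_mho_alg (?t p q))"
    unfolding from_mho_def
    by (rule linear_maps_double_sum[OF T.module_axioms TL.module_axioms to_mho_alg(1)]) (use tc in auto)
  also have "\<dots> = (\<Oplus>\<^bsub>TL\<^esub>p \<in> {..<n}. \<Oplus>\<^bsub>TL\<^esub>q \<in> {..<n'}. in1L (?g p q))"
  proof (intro TL.finsum_cong'[OF refl])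
    fix p q assume "p \<in> {..<n}" "q \<in> {..<n'}"
    then show "to_mho_alg (?t p q) = in1L (?g p q)"
      using f by (simp add: to_mho_alg emb jD bc coord to_mho_alg_emb to_mho_alg_jD in1L_act Mho.lact_closed muhat_closed)
  qed (use gc in1L in \<open>auto intro!: TL.finsum_closed\<close>)
  also have "\<dots> = in1L (\<Oplus>\<^bsub>Mho\<^esub>p \<in> {..<n}. \<Oplus>\<^bsub>Mho\<^esub>q \<in> {..<n'}. ?g p q)"
    by (rule linear_maps_double_sum[OF Mho.module_axioms TL.module_axioms in1_linear[OF Mho], symmetric])
      (use gc in auto)
  also have "\<dots> = in1L f" using Mho_expand[OF f] by simp
  finally show ?thesis .
qed

lemma to_mho_alg_inverse:
  obtains h where "h \<in> alg_iso k TL T" and "\<And>t. t \<in> carrier T \<Longrightarrow> h (to_mho_alg t) = t"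
proof -
  have "compatible_pair k Lam Mho T emb from_mho"
    by (simp add: compatible_pair_def emb_hom from_mho_linear from_mho_act)
  from tensor_alg_lift[OF Mho T.k_algebra_axioms this] obtain h where
    h: "h \<in> alg_hom k TL T" "\<And>x. x \<in> carrier Lam \<Longrightarrow> h (in0L x) = emb x"
    "\<And>f. f \<in> carrier Mho \<Longrightarrow> h (in1L f) = from_mho f" by blast
  note hD = alg_homD[OF h(1)]
  have hj: "h (in1L (muhat \<mu>)) = jD \<mu>" if "\<mu> \<in> carrier DM" for \<mu>
    using from_mho_generators[OF that L.one_closed L.one_closed] that h(3)[OF muhat_closed[OF that]]
    by (simp add: Mho.lact_one Mho.ract_one muhat_closed emb jD)
  have to_mho_alg_in0: "to_mho_alg (in0T a) = in0L (\<iota> a)" if "a \<in> carrier A" for a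
    using to_mho_alg_emb[of "\<iota> a"] that by (simp add: emb_i i)
  have to_mho_alg_in1: "to_mho_alg (in1T z) = in0L (j (fst z)) \<oplus>\<^bsub>TL\<^esub> in1L (muhat (snd z))" if "z \<in> carrier MD" for z
    using that to_mho_alg_emb[of "j (fst z)"]
    by (auto simp: MD_simps in1T_split to_mho_alg jM jD to_mho_alg_jD emb_j j)
  have hp: "h (to_mho_alg t) = t" if "t \<in> carrier T" for t
  proof (rule tensor_alg_hom_eqI[OF MD T.k_algebra_axioms alg_hom_compose[OF to_mho_alg_hom h(1)] id_alg_hom _ _ that])
    show "h (to_mho_alg (in0T a)) = in0T a" if "a \<in> carrier A" for a
      using that by (simp add: to_mho_alg_in0 h i emb_i)
    show "h (to_mho_alg (in1T z)) = in1T z" if zc: "z \<in> carrier MD" for z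
    proof -
      obtain m \<mu> where z: "z = (m, \<mu>)" "m \<in> carrier M" "\<mu> \<in> carrier DM"
        using zc by (auto simp: MD_simps)
      have "h (to_mho_alg (in1T z)) = h (in0L (j m)) \<oplus>\<^bsub>T\<^esub> h (in1L (muhat \<mu>))"
        using z by (simp add: to_mho_alg_in1 MD_simps hD in0L in1L j muhat_closed)
      then show ?thesis using z by (simp add: h hj j emb_j in1T_split)
    qed
  qed
  have ph: "to_mho_alg (h u) = u" if "u \<in> carrier TL" for u
    by (rule tensor_alg_hom_eqI[OF Mho TL.k_algebra_axioms alg_hom_compose[OF h(1) to_mho_alg_hom] id_alg_hom _ _ that])
      (simp_all add: h to_mho_alg_emb to_mho_alg_from_mho)
  have "bij_betw h (carrier TL) (carrier T)"
    by (rule bij_betw_byWitness[where f' = to_mho_alg]) (auto simp: hp ph hD to_mho_alg)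
  then show thesis using that h(1) hp by (simp add: alg_iso_iff)
qed

end

lemma tensor_alg_mho_iso:
  assumes "semisimple_ring A" and "fin_dim k M" and "fin_dim k Lam"
  shows "c_elem k A \<sigma> M \<in> carrier T"
    and "\<exists>h \<in> alg_iso k TL T. h (in1L cb) = c_elem k A \<sigma> M"
proof -
  have fAA: "fin_dim k AA"
    using assms(3) unfolding fin_dim_def gen_submodule_def submodule_def submodule_axioms_def subgroup_def m_inv_def
    by (simp add: alg_bimodule_simps)
  obtain n lam th n' lam' ph where b: "right_dual_basis AA n lam th" "left_dual_basis AA n' lam' ph"
    using bimodule_dual_bases[OF AA fAA assms(1)] by blast
  obtain r x \<xi> r' x' \<xi>' where bM: "right_dual_basis M r x \<xi>" "left_dual_basis M r' x' \<xi>'"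
    using bimodule_dual_bases[OF M_bimodule assms(2,1)] by blast
  show c: "c_elem k A \<sigma> M \<in> carrier T" by (rule to_mho_alg_c_elem(1)[OF bM])
  obtain h where "h \<in> alg_iso k TL T" "\<And>t. t \<in> carrier T \<Longrightarrow> h (to_mho_alg t) = t"
    using to_mho_alg_inverse[OF b] by blast
  then show "\<exists>h \<in> alg_iso k TL T. h (in1L cb) = c_elem k A \<sigma> M"
    using to_mho_alg_c_elem[OF bM] by metis
qed

end

section \<open>The preprojective algebra\<close>

lemma quot_alg_simps:
  "carrier (quot_alg R I) = a_rcosets\<^bsub>R\<^esub> I" "zero (quot_alg R I) = I" "add (quot_alg R I) = set_add R"
  "mult (quot_alg R I) = rcoset_mult R I" "one (quot_alg R I) = I +>\<^bsub>R\<^esub> \<one>\<^bsub>R\<^esub>"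
  "smult (quot_alg R I) = (\<lambda>c U. \<Union>u \<in> U. I +>\<^bsub>R\<^esub> (c \<odot>\<^bsub>R\<^esub> u))"
  by (simp_all add: quot_alg_def FactRing_def)

lemma quot_alg:
  assumes R: "k_algebra k R" and I: "ideal I R"
  shows quot_alg_k_algebra: "k_algebra k (quot_alg R I)"
    and quot_alg_proj: "(+>\<^bsub>R\<^esub>) I \<in> alg_hom k R (quot_alg R I)"
    and quot_alg_carrier: "U \<in> carrier (quot_alg R I) \<longleftrightarrow> (\<exists>x \<in> carrier R. U = I +>\<^bsub>R\<^esub> x)"
    and quot_alg_eq_iff: "\<lbrakk>x \<in> carrier R; y \<in> carrier R\<rbrakk> \<Longrightarrow> I +>\<^bsub>R\<^esub> x = I +>\<^bsub>R\<^esub> y \<longleftrightarrow> x \<ominus>\<^bsub>R\<^esub> y \<in> I"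
proof -
  interpret R: k_algebra k R by fact
  interpret I: ideal I R by fact
  let ?Q = "quot_alg R I"
  have sub: "submodule I k R"
  proof (rule R.submoduleI)
    fix c x assume c: "c \<in> carrier k" and x: "x \<in> I"
    then have "c \<odot>\<^bsub>R\<^esub> x = (c \<odot>\<^bsub>R\<^esub> \<one>\<^bsub>R\<^esub>) \<otimes>\<^bsub>R\<^esub> x" by (simp add: R.smult_mult_left I.a_Hcarr)
    then show "c \<odot>\<^bsub>R\<^esub> x \<in> I" using c x by (simp add: I.I_l_closed)
  qed (use I.a_subset in auto)
  note ag = submodule_abelian_subgroup[OF R.module_axioms sub]
  have m: "module k ?Q"
    by (rule module_cong[OF quot_module_module(1)[OF R.module_axioms sub]])
      (simp_all add: quot_alg_simps quot_module_def)
  have pl: "(+>\<^bsub>R\<^esub>) I \<in> linear_maps k R ?Q"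
    using quot_module_module(2)[OF R.module_axioms sub]
    by (simp add: linear_maps_def quot_alg_simps quot_module_def)
  show c: "U \<in> carrier ?Q \<longleftrightarrow> (\<exists>x \<in> carrier R. U = I +>\<^bsub>R\<^esub> x)" for U
    by (simp add: quot_alg_simps rcosets_iff)
  have ml: "(I +>\<^bsub>R\<^esub> x) \<otimes>\<^bsub>?Q\<^esub> (I +>\<^bsub>R\<^esub> y) = I +>\<^bsub>R\<^esub> (x \<otimes>\<^bsub>R\<^esub> y)" if "x \<in> carrier R" "y \<in> carrier R" for x y
    using I.rcoset_mult_add[OF that] by (simp add: quot_alg_simps)
  show "(+>\<^bsub>R\<^esub>) I \<in> alg_hom k R ?Q"
    by (rule alg_homI[OF pl]) (simp_all add: ml quot_alg_simps(5))
  interpret q: ring "R Quot I" by (rule I.quotient_is_ring)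
  have f: "carrier ?Q = carrier (R Quot I)" "add ?Q = add (R Quot I)" "zero ?Q = zero (R Quot I)"
    "mult ?Q = mult (R Quot I)" "one ?Q = one (R Quot I)"
    by (simp_all add: quot_alg_def)
  have "ring ?Q"
    by (rule ringI[OF abelian_group_cong[OF q.abelian_group_axioms f(1-3)]]; (rule monoidI)?)
      (simp_all add: f q.m_assoc q.l_distr q.r_distr)
  moreover have "k_algebra_axioms k ?Q"
    using linear_maps_smult[OF pl, symmetric]
    by (intro k_algebra_axioms.intro) (auto simp: c ml R.smult_mult_left R.smult_mult_right)
  ultimately show "k_algebra k ?Q" using m by (simp add: k_algebra_def)
  show "I +>\<^bsub>R\<^esub> x = I +>\<^bsub>R\<^esub> y \<longleftrightarrow> x \<ominus>\<^bsub>R\<^esub> y \<in> I" if "x \<in> carrier R" "y \<in> carrier R"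
    by (rule coset_eq_iff[OF ag that])
qed

lemma alg_hom_kernel_ideal:
  assumes "k_algebra k R" "k_algebra k S" "h \<in> alg_hom k R S"
  shows "ideal {x \<in> carrier R. h x = \<zero>\<^bsub>S\<^esub>} R"
proof -
  interpret R: k_algebra k R by fact
  interpret S: k_algebra k S by fact
  interpret h: ring_hom_ring R S h
    by (rule ring_hom_ringI2[OF R.ring_axioms S.ring_axioms]) (use assms(3) in \<open>simp add: alg_hom_def\<close>)
  show ?thesis using h.kernel_is_ideal unfolding a_kernel_def' .
qed

lemma alg_iso_inverse:
  assumes R: "k_algebra k R" and h: "h \<in> alg_iso k R S"
  obtains h' where "h' \<in> alg_hom k S R" "\<And>x. x \<in> carrier R \<Longrightarrow> h' (h x) = x"
    "\<And>y. y \<in> carrier S \<Longrightarrow> h (h' y) = y"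
proof -
  interpret R: k_algebra k R by fact
  have hh: "h \<in> alg_hom k R S" and b: "bij_betw h (carrier R) (carrier S)"
    using h by (auto simp: alg_iso_iff)
  note hD = alg_homD[OF hh]
  let ?g = "inv_into (carrier R) h"
  have l: "?g (h x) = x" if "x \<in> carrier R" for x
    using b that by (simp add: bij_betw_def inv_into_f_f)
  have r: "h (?g y) = y" "?g y \<in> carrier R" if "y \<in> carrier S" for y
    using b that by (auto simp: bij_betw_def f_inv_into_f inv_into_into)
  have "?g \<in> alg_hom k S R"
  proof (rule alg_homI; (rule linear_mapsI)?)
    fix x y assume "x \<in> carrier S" "y \<in> carrier S"
    then show "?g (x \<oplus>\<^bsub>S\<^esub> y) = ?g x \<oplus>\<^bsub>R\<^esub> ?g y" "?g (x \<otimes>\<^bsub>S\<^esub> y) = ?g x \<otimes>\<^bsub>R\<^esub> ?g y"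
      using l[of "?g x \<oplus>\<^bsub>R\<^esub> ?g y"] l[of "?g x \<otimes>\<^bsub>R\<^esub> ?g y"] by (simp_all add: hD r)
  next
    fix c x assume "c \<in> carrier k" "x \<in> carrier S"
    then show "?g (c \<odot>\<^bsub>S\<^esub> x) = c \<odot>\<^bsub>R\<^esub> ?g x" using l[of "c \<odot>\<^bsub>R\<^esub> ?g x"] by (simp add: hD r)
  next
    show "?g \<one>\<^bsub>S\<^esub> = \<one>\<^bsub>R\<^esub>" using l[of "\<one>\<^bsub>R\<^esub>"] by (simp add: hD)
  qed (use r in auto)
  then show thesis using that l r by blast
qed

text \<open>A homomorphism out of \<open>T\<^sub>R(X)\<close> that kills \<open>e\<close> also kills \<open>N\<close> and factors through \<open>T\<^sub>R(X/N)\<close>;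
  conversely, \<open>N\<close> is contained in the ideal generated by \<open>e\<close>. This gives maps \<open>F\<close> from \<open>T\<^sub>R(X/N)\<close> and \<open>G\<close>
  to it whose composition \<open>F \<circ> G\<close> is the projection of \<open>T\<^sub>R(X)\<close> onto its quotient by that ideal.\<close>

lemma tensor_alg_quotient_iso:
  assumes X: "bimodule k R R X" and N: "sub_bimodule N k R R X" and e: "e \<in> N"
    and least: "\<And>N'. \<lbrakk>sub_bimodule N' k R R X; e \<in> N'\<rbrakk> \<Longrightarrow> N \<subseteq> N'"
    and B: "k_algebra k B" and h: "h \<in> alg_iso k (tensor_alg k R X) B"
  shows "\<exists>g. g \<in> alg_iso k (tensor_alg k R (quot_bimodule X N))
    (quot_alg B (Idl\<^bsub>B\<^esub> {h (tensor_alg_in1 k R X e)}))"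
proof -
  let ?P = "tensor_alg k R X" and ?in0 = "tensor_alg_in0 k R X" and ?in1 = "tensor_alg_in1 k R X"
  let ?X' = "quot_bimodule X N"
  let ?P' = "tensor_alg k R ?X'" and ?in0' = "tensor_alg_in0 k R ?X'" and ?in1' = "tensor_alg_in1 k R ?X'"
  define I where "I = Idl\<^bsub>B\<^esub> {h (?in1 e)}"
  let ?Q = "quot_alg B I"
  interpret X: bimodule k R R X by fact
  interpret B: k_algebra k B by fact
  note X' = quot_bimodule_bimodule[OF X N]
  interpret X': bimodule k R R ?X' by (rule X'(1))
  interpret P: k_algebra k ?P by (rule tensor_alg_k_algebra[OF X])
  interpret P': k_algebra k ?P' by (rule tensor_alg_k_algebra[OF X'(1)])
  note co = linear_mapsD[OF X'(2)]
  note in0 = alg_homD[OF in0_alg_hom[OF X]] and in1 = linear_mapsD[OF in1_linear[OF X]]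
  note in0' = alg_homD[OF in0_alg_hom[OF X'(1)]] and in1' = linear_mapsD[OF in1_linear[OF X'(1)]]
  have hh: "h \<in> alg_hom k ?P B" using h by (simp add: alg_iso_iff)
  note hD = alg_homD[OF hh]
  obtain h' where h': "h' \<in> alg_hom k B ?P" "\<And>x. x \<in> carrier ?P \<Longrightarrow> h' (h x) = x"
    "\<And>y. y \<in> carrier B \<Longrightarrow> h (h' y) = y"
    using alg_iso_inverse[OF P.k_algebra_axioms h] by blast
  have Nsub: "submodule N k X" using N by (simp add: sub_bimodule_def)
  have NX: "N \<subseteq> carrier X" using X.submoduleE(1)[OF Nsub] .
  have eX: "e \<in> carrier X" using NX e by blast
  have he: "h (?in1 e) \<in> carrier B" by (simp add: hD in1 eX)
  have I: "ideal I B" unfolding I_def by (rule B.genideal_ideal) (simp add: he)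
  have heI: "h (?in1 e) \<in> I" unfolding I_def by (rule B.genideal_self') (rule he)
  interpret I: ideal I B by (rule I)
  note Q = quot_alg[OF B I]
  interpret Q: k_algebra k ?Q by (rule Q(1))
  let ?pi = "(+>\<^bsub>B\<^esub>) I"
  note pi = alg_homD[OF Q(2)]
  \<comment> \<open>By minimality, \<open>N\<close> is contained in the subbimodule \<open>N'\<close> of all elements that die modulo \<open>I\<close>.\<close>
  define N' where "N' = {x \<in> carrier X. h (?in1 x) \<in> I}"
  have I_smult: "c \<odot>\<^bsub>B\<^esub> x \<in> I" if "c \<in> carrier k" "x \<in> I" for c x
    using I.I_l_closed[OF that(2), of "c \<odot>\<^bsub>B\<^esub> \<one>\<^bsub>B\<^esub>"] that I.a_Hcarr by (simp add: B.smult_mult_left)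
  have "sub_bimodule N' k R R X" unfolding sub_bimodule_def
  proof (intro conjI ballI)
    show "submodule N' k X"
      by (rule X.submoduleI)
        (auto simp: N'_def hD in1 I_smult
          linear_maps_zero[OF X.module_axioms P.module_axioms in1_linear[OF X]]
          linear_maps_zero[OF P.module_axioms B.module_axioms alg_hom_linear[OF hh]]
          linear_maps_minus[OF X.module_axioms P.module_axioms in1_linear[OF X]]
          linear_maps_minus[OF P.module_axioms B.module_axioms alg_hom_linear[OF hh]])
  next
    fix r x assume "r \<in> carrier R" "x \<in> N'"
    then show "lact X r x \<in> N'" "ract X x r \<in> N'"
      by (auto simp: N'_def X.lact_closed X.ract_closed in1_lact[OF X] in1_ract[OF X] hD in0 in1
          I.I_l_closed I.I_r_closed)
  qed
  then have NI: "h (?in1 x) \<in> I" if "x \<in> N" for x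
    using least[of N'] heI eX that by (auto simp: N'_def)
  have wd: "?pi (h (?in1 x)) = ?pi (h (?in1 y))"
    if "x \<in> carrier X" "y \<in> carrier X" "N +>\<^bsub>X\<^esub> x = N +>\<^bsub>X\<^esub> y" for x y
  proof -
    have "x \<ominus>\<^bsub>X\<^esub> y \<in> N"
      using coset_eq_iff[OF submodule_abelian_subgroup[OF X.module_axioms Nsub]] that by blast
    then have "h (?in1 (x \<ominus>\<^bsub>X\<^esub> y)) \<in> I" by (rule NI)
    then show ?thesis
      using that linear_maps_diff[OF X.module_axioms P.module_axioms in1_linear[OF X] that(1,2)]
        linear_maps_diff[OF P.module_axioms B.module_axioms alg_hom_linear[OF hh]]
      by (simp add: Q(4) hD in1)
  qed
  define f1 where "f1 U = ?pi (h (?in1 (SOME x. x \<in> carrier X \<and> U = N +>\<^bsub>X\<^esub> x)))" for U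
  have f1: "f1 (N +>\<^bsub>X\<^esub> x) = ?pi (h (?in1 x))" if "x \<in> carrier X" for x
  proof -
    have "\<exists>y. y \<in> carrier X \<and> N +>\<^bsub>X\<^esub> x = N +>\<^bsub>X\<^esub> y" using that by blast
    from someI_ex[OF this] show ?thesis
      unfolding f1_def by (intro wd[OF _ that, OF conjunct1 sym[OF conjunct2]])
  qed
  have "compatible_pair k R ?X' ?Q (\<lambda>r. ?pi (h (?in0 r))) f1"
    unfolding compatible_pair_def
  proof (intro conjI ballI)
    show "(\<lambda>r. ?pi (h (?in0 r))) \<in> alg_hom k R ?Q"
      by (rule alg_hom_compose[OF alg_hom_compose[OF in0_alg_hom[OF X] hh] Q(2)])
    show "f1 \<in> linear_maps k ?X' ?Q"
      by (rule linear_mapsI) (auto simp: X'(5) f1 co(2,3)[symmetric] pi hD in1)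
    fix r U assume "r \<in> carrier R" "U \<in> carrier ?X'"
    then show "f1 (lact ?X' r U) = ?pi (h (?in0 r)) \<otimes>\<^bsub>?Q\<^esub> f1 U"
      "f1 (ract ?X' U r) = f1 U \<otimes>\<^bsub>?Q\<^esub> ?pi (h (?in0 r))"
      by (auto simp: X'(3-5) f1 X.lact_closed X.ract_closed in1_lact[OF X] in1_ract[OF X] hD in0 in1 pi)
  qed
  from tensor_alg_lift[OF X'(1) Q(1) this] obtain F where F: "F \<in> alg_hom k ?P' ?Q"
    "\<And>r. r \<in> carrier R \<Longrightarrow> F (?in0' r) = ?pi (h (?in0 r))" "\<And>U. U \<in> carrier ?X' \<Longrightarrow> F (?in1' U) = f1 U"
    by blast
  have "compatible_pair k R X ?P' ?in0' (\<lambda>x. ?in1' (N +>\<^bsub>X\<^esub> x))"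
    unfolding compatible_pair_def
    using in0_alg_hom[OF X'(1)] linear_maps_compose[OF X'(2) in1_linear[OF X'(1)]]
    by (auto simp: X'(3,4)[symmetric] in1_lact[OF X'(1)] in1_ract[OF X'(1)] co)
  from tensor_alg_lift[OF X P'.k_algebra_axioms this] obtain G where G: "G \<in> alg_hom k ?P ?P'"
    "\<And>r. r \<in> carrier R \<Longrightarrow> G (?in0 r) = ?in0' r"
    "\<And>x. x \<in> carrier X \<Longrightarrow> G (?in1 x) = ?in1' (N +>\<^bsub>X\<^esub> x)"
    by blast
  note FD = alg_homD[OF F(1)] and GD = alg_homD[OF G(1)]
  have FG: "F (G u) = ?pi (h u)" if "u \<in> carrier ?P" for u
    by (rule tensor_alg_hom_eqI[OF X Q(1) alg_hom_compose[OF G(1) F(1)] alg_hom_compose[OF hh Q(2)] _ _ that])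
      (simp_all add: G F co f1)
  have "I \<subseteq> {b \<in> carrier B. G (h' b) = \<zero>\<^bsub>?P'\<^esub>}"
    unfolding I_def
  proof (rule B.genideal_minimal)
    show "ideal {b \<in> carrier B. G (h' b) = \<zero>\<^bsub>?P'\<^esub>} B"
      by (rule alg_hom_kernel_ideal[OF B P'.k_algebra_axioms alg_hom_compose[OF h'(1) G(1)]])
    have "N +>\<^bsub>X\<^esub> e = \<zero>\<^bsub>?X'\<^esub>"
      using abelian_subgroup.a_rcos_const[OF submodule_abelian_subgroup[OF X.module_axioms Nsub] e]
      by (simp add: quot_bimodule_def)
    then have "G (?in1 e) = \<zero>\<^bsub>?P'\<^esub>"
      using linear_maps_zero[OF X'.module_axioms P'.module_axioms in1_linear[OF X'(1)]]
      by (simp add: G eX)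
    then show "{h (?in1 e)} \<subseteq> {b \<in> carrier B. G (h' b) = \<zero>\<^bsub>?P'\<^esub>}"
      using he by (simp add: h' in1 eX)
  qed
  then have kill: "G u = \<zero>\<^bsub>?P'\<^esub>" if "u \<in> carrier ?P" "h u \<in> I" for u
    using that h'(2) by force
  have G_surj: "\<exists>u \<in> carrier ?P. U = G u" if "U \<in> carrier ?P'" for U
    using X'(1) that
  proof (induction U rule: tensor_alg_induct[consumes 2, case_names in0 mult_in1 add smult])
    case (in0 r)
    then show ?case using G(2) alg_hom_closed[OF in0_alg_hom[OF X]] by metis
  next
    case (mult_in1 U V)
    then obtain u x where "u \<in> carrier ?P" "U = G u" "x \<in> carrier X" "V = N +>\<^bsub>X\<^esub> x" using X'(5) by blast
    then show ?case
      by (intro bexI[of _ "u \<otimes>\<^bsub>?P\<^esub> ?in1 x"]) (simp_all add: GD G in1)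
  next
    case (add U V)
    then obtain u v where "u \<in> carrier ?P" "U = G u" "v \<in> carrier ?P" "V = G v" by blast
    then show ?case by (intro bexI[of _ "u \<oplus>\<^bsub>?P\<^esub> v"]) (simp_all add: GD)
  next
    case (smult c U)
    then obtain u where "u \<in> carrier ?P" "U = G u" by blast
    then show ?case using smult(1) by (intro bexI[of _ "c \<odot>\<^bsub>?P\<^esub> u"]) (simp_all add: GD)
  qed
  have "bij_betw F (carrier ?P') (carrier ?Q)" unfolding bij_betw_def
  proof
    show "inj_on F (carrier ?P')"
    proof (rule inj_onI)
      fix U V assume UV: "U \<in> carrier ?P'" "V \<in> carrier ?P'" "F U = F V"
      obtain u v where uv: "u \<in> carrier ?P" "U = G u" "v \<in> carrier ?P" "V = G v"
        using G_surj UV(1,2) by blast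
      have "?pi (h u) = ?pi (h v)" using UV(3) uv FG by simp
      then have "h u \<ominus>\<^bsub>B\<^esub> h v \<in> I" using uv by (simp add: Q(4) hD)
      then have "h (u \<ominus>\<^bsub>?P\<^esub> v) \<in> I"
        using linear_maps_diff[OF P.module_axioms B.module_axioms alg_hom_linear[OF hh] uv(1,3)] by simp
      then have "G (u \<ominus>\<^bsub>?P\<^esub> v) = \<zero>\<^bsub>?P'\<^esub>" using kill uv by simp
      then have "U \<ominus>\<^bsub>?P'\<^esub> V = \<zero>\<^bsub>?P'\<^esub>"
        using linear_maps_diff[OF P.module_axioms P'.module_axioms alg_hom_linear[OF G(1)] uv(1,3)] uv
        by simp
      then show "U = V"
        using UV(1,2) by (metis P'.minus_equality P'.minus_minus P'.a_inv_closed a_minus_def)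
    qed
    show "F ` carrier ?P' = carrier ?Q"
    proof
      show "F ` carrier ?P' \<subseteq> carrier ?Q" using FD by auto
      show "carrier ?Q \<subseteq> F ` carrier ?P'"
      proof
        fix W assume "W \<in> carrier ?Q"
        then obtain b where b: "b \<in> carrier B" "W = ?pi b" using Q(3) by blast
        then have "W = F (G (h' b))" using FG alg_hom_closed[OF h'(1)] h'(3) by simp
        then show "W \<in> F ` carrier ?P'" using GD(2) alg_hom_closed[OF h'(1)] b by blast
      qed
    qed
  qed
  then show ?thesis using F(1) unfolding I_def alg_iso_iff by blast
qed

context symm_over_algebra
begin

interpretation LL: bimodule k \<Lambda> \<Lambda> LL by (rule LL)
interpretation Mho: bimodule k \<Lambda> \<Lambda> Mho by (rule Mho)

abbreviation "cbar_map \<equiv> tensor_lift k LA AL Mho (\<lambda>x y. ract Mho (lact Mho x cb) y)"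

lemma cbar_map:
  shows cbar_map_linear: "cbar_map \<in> linear_maps k LL Mho"
    and cbar_map_ot: "\<lbrakk>x \<in> carrier \<Lambda>; y \<in> carrier \<Lambda>\<rbrakk> \<Longrightarrow> cbar_map (ot x y) = ract Mho (lact Mho x cb) y"
proof -
  have m: "ract Mho (lact Mho (x \<otimes>\<^bsub>\<Lambda>\<^esub> i a) cb) y = ract Mho (lact Mho x cb) (i a \<otimes>\<^bsub>\<Lambda>\<^esub> y)"
    if "x \<in> carrier \<Lambda>" "a \<in> carrier A" "y \<in> carrier \<Lambda>" for x a y
    using that by (simp add: Mho.lact_mult Mho.ract_mult Mho.lact_closed Mho.ract_closed cbar_closed i
        cbar_commute Mho.lact_ract)
  have 1: "(\<lambda>x. ract Mho (lact Mho x cb) y) \<in> linear_maps k \<Lambda> Mho" if "y \<in> carrier \<Lambda>" for y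
    by (rule linear_maps_compose[OF Mho.lact_linear_left[OF cbar_closed] Mho.ract_linear[OF that]])
  have 2: "(\<lambda>y. ract Mho (lact Mho x cb) y) \<in> linear_maps k \<Lambda> Mho" if "x \<in> carrier \<Lambda>" for x
    by (rule Mho.ract_linear_right[OF Mho.lact_closed[OF that cbar_closed]])
  show "cbar_map \<in> linear_maps k LL Mho" by (rule LL_lift(1)[OF Mho.module_axioms 1 2 m])
  show "\<lbrakk>x \<in> carrier \<Lambda>; y \<in> carrier \<Lambda>\<rbrakk> \<Longrightarrow> cbar_map (ot x y) = ract Mho (lact Mho x cb) y"
    by (rule LL_lift(2)[OF Mho.module_axioms 1 2 m])
qed

lemma cbar_map_image:
  shows "sub_bimodule (cbar_map ` carrier LL) k \<Lambda> \<Lambda> Mho" and "cb \<in> cbar_map ` carrier LL"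
    and "\<lbrakk>sub_bimodule N k \<Lambda> \<Lambda> Mho; cb \<in> N\<rbrakk> \<Longrightarrow> cbar_map ` carrier LL \<subseteq> N"
proof -
  note c = linear_mapsD[OF cbar_map_linear]
  have l: "cbar_map (lact LL r U) = lact Mho r (cbar_map U)" if "r \<in> carrier \<Lambda>" "U \<in> carrier LL" for r U
    by (rule LL_eqI[OF linear_maps_compose[OF LL.lact_linear cbar_map_linear]
          linear_maps_compose[OF cbar_map_linear Mho.lact_linear] _ that(2)])
      (use that in \<open>simp_all add: ot_rules cbar_map_ot Mho.lact_mult Mho.lact_closed Mho.lact_ract cbar_closed\<close>)
  have r: "cbar_map (ract LL U r) = ract Mho (cbar_map U) r" if "r \<in> carrier \<Lambda>" "U \<in> carrier LL" for r U
    by (rule LL_eqI[OF linear_maps_compose[OF LL.ract_linear cbar_map_linear]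
          linear_maps_compose[OF cbar_map_linear Mho.ract_linear] _ that(2)])
      (use that in \<open>simp_all add: ot_rules cbar_map_ot Mho.ract_mult Mho.lact_closed cbar_closed\<close>)
  show "sub_bimodule (cbar_map ` carrier LL) k \<Lambda> \<Lambda> Mho" unfolding sub_bimodule_def
  proof (intro conjI ballI)
    show "submodule (cbar_map ` carrier LL) k Mho"
    proof (rule Mho.submoduleI)
      show "\<zero>\<^bsub>Mho\<^esub> \<in> cbar_map ` carrier LL"
        using linear_maps_zero[OF LL.module_axioms Mho.module_axioms cbar_map_linear]
        by (intro image_eqI[of _ cbar_map "\<zero>\<^bsub>LL\<^esub>"]) simp_all
    next
      fix f assume "f \<in> cbar_map ` carrier LL"
      then obtain U where "U \<in> carrier LL" "f = cbar_map U" by blast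
      then show "\<ominus>\<^bsub>Mho\<^esub> f \<in> cbar_map ` carrier LL"
        using linear_maps_minus[OF LL.module_axioms Mho.module_axioms cbar_map_linear, of U]
        by (intro image_eqI[of _ _ "\<ominus>\<^bsub>LL\<^esub> U"]) simp_all
    next
      fix f g assume "f \<in> cbar_map ` carrier LL" "g \<in> cbar_map ` carrier LL"
      then obtain U W where "U \<in> carrier LL" "f = cbar_map U" "W \<in> carrier LL" "g = cbar_map W" by blast
      then show "f \<oplus>\<^bsub>Mho\<^esub> g \<in> cbar_map ` carrier LL"
        by (intro image_eqI[of _ _ "U \<oplus>\<^bsub>LL\<^esub> W"]) (simp_all add: c)
    next
      fix e f assume "e \<in> carrier k" "f \<in> cbar_map ` carrier LL"
      then obtain U where "e \<in> carrier k" "U \<in> carrier LL" "f = cbar_map U" by blast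
      then show "e \<odot>\<^bsub>Mho\<^esub> f \<in> cbar_map ` carrier LL"
        by (intro image_eqI[of _ _ "e \<odot>\<^bsub>LL\<^esub> U"]) (simp_all add: c)
    qed (use c in auto)
  next
    fix x f assume x: "x \<in> carrier \<Lambda>" and "f \<in> cbar_map ` carrier LL"
    then obtain U where "U \<in> carrier LL" "f = cbar_map U" by blast
    then show "lact Mho x f \<in> cbar_map ` carrier LL" "ract Mho f x \<in> cbar_map ` carrier LL"
      using x by (auto simp: l[symmetric] r[symmetric] LL.lact_closed LL.ract_closed)
  qed
  show "cb \<in> cbar_map ` carrier LL"
    by (rule image_eqI[of _ _ "ot \<one>\<^bsub>\<Lambda>\<^esub> \<one>\<^bsub>\<Lambda>\<^esub>"])
      (simp_all add: cbar_map_ot ot_closed Mho.lact_one Mho.ract_one cbar_closed)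
  show "cbar_map ` carrier LL \<subseteq> N" if N: "sub_bimodule N k \<Lambda> \<Lambda> Mho" and cN: "cb \<in> N"
  proof -
    have Ns: "submodule N k Mho" using N by (simp add: sub_bimodule_def)
    define t where "t = cbar_map"
    note tD = linear_mapsD[OF cbar_map_linear[folded t_def, unfolded Lam_A_Lam_def]]
    have "t U \<in> N" if "U \<in> carrier LL" for U
      using LA AL that[unfolded Lam_A_Lam_def]
    proof (induction U rule: tensor_induct[consumes 3, case_names pure add smult])
      case (pure x y)
      then have xy: "x \<in> carrier \<Lambda>" "y \<in> carrier \<Lambda>" by (simp_all add: alg_bimodule_simps)
      show ?case unfolding t_def cbar_map_ot[OF xy] using N cN xy by (simp add: sub_bimodule_def)
    next
      case (add U W)
      then show ?case using Mho.submoduleE(5)[OF Ns] by (simp add: tD)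
    next
      case (smult e U)
      then show ?case using Mho.submoduleE(4)[OF Ns] by (simp add: tD)
    qed
    then show ?thesis unfolding t_def by blast
  qed
qed

lemma Pi1_eq: "Pi1 k A \<sigma> \<Lambda> i = quot_bimodule Mho (cbar_map ` carrier LL)"
  by (simp add: Pi1_def)

end

theorem theorem4p7:
  fixes k :: "'k ring"
    and A :: "('k, 'a) module"
    and M :: "('k, 'a, 'a, 'm) bimodule"
    and \<sigma> :: "'a \<Rightarrow> 'k"
  defines "\<Lambda> \<equiv> tensor_alg k A M"
    and "i \<equiv> tensor_alg_in0 k A M"
    and "T \<equiv> tensor_alg k A (M_DM k M)"
  assumes "field k"
    and "k_algebra k A" and "fin_dim k A" and "semisimple_ring A"
    and "symmetrising k A \<sigma>"
    and "bimodule k A A M" and "fin_dim k M"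
    and "fin_dim k \<Lambda>" and "hereditary_ring \<Lambda>"
  shows "(\<exists>h \<in> alg_iso k (tensor_alg k \<Lambda> (mho k A \<Lambda> i)) T.
            h (tensor_alg_in1 k \<Lambda> (mho k A \<Lambda> i) (cbar k A \<sigma> \<Lambda> i)) = c_elem k A \<sigma> M)
         \<and> (\<exists>g. g \<in> alg_iso k (preproj_alg k A \<sigma> \<Lambda> i) (quot_alg T (Idl\<^bsub>T\<^esub> {c_elem k A \<sigma> M})))"
proof -
  interpret field k by fact
  interpret tensor_setup k A \<sigma> M
    by (intro tensor_setup.intro symmetric_algebra.intro symmetric_algebra_axioms.intro
        tensor_setup_axioms.intro assms)
  obtain h where h: "h \<in> alg_iso k TL T" "h (in1L cb) = c_elem k A \<sigma> M"
    using tensor_alg_mho_iso(2)[OF assms(7,10) assms(11)[unfolded \<Lambda>_def]] unfolding T_def by blast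
  have "\<exists>g. g \<in> alg_iso k (tensor_alg k Lam (Pi1 k A \<sigma> Lam \<iota>)) (quot_alg T (Idl\<^bsub>T\<^esub> {c_elem k A \<sigma> M}))"
    using tensor_alg_quotient_iso[OF Mho cbar_map_image tensor_alg_k_algebra[OF MD] h(1)[unfolded T_def]]
    unfolding Pi1_eq h(2) T_def .
  then show ?thesis
    using h unfolding \<Lambda>_def i_def preproj_alg_def by blast
qed

end
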